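(* Let $A$ be a cocommutative Hopf algebra over a commutative field $\mathbb{K}$, $\sigma$ its Woronowicz braiding, and $M$ a commutative $A$-bimodule algebra. The multiplicative dual quantum shuffle product map $$\widetilde{\varphi_\sigma}:\bigoplus_{n\ge0}\mathrm{Reg}(A^{\otimes n},M)\to\bigoplus_{n\ge0}\bigoplus_{p+q=n}\mathrm{Reg}(A^{\otimes p}\otimes A^{\otimes q},M),$$ defined for $f\in\mathrm{Reg}(A^{\otimes n},M)$, $\underline a\in A^{\otimes p}$ and $\underline b\in A^{\otimes n-p}$ by $$\widetilde{\varphi_\sigma}(f)(\underline a\otimes\underline b)=\Big(\underset{w\in S_{p,n}}{\ast}\widetilde{T_\sigma(w)}\big(f^{(-1)^{|w|}}\big)\Big)(\underline a\otimes\underline b),$$ is a morphism of complexes, where the source is the multiplicative Hochschild complex with differential $\widetilde\delta$ and the target carries the differential corresponding to $\widetilde\rho$ under the isomorphism $\widetilde\Lambda$.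
   Context: Sweedler notation is used, extended to tensor powers of $A$ (tensor product coalgebras). A bimodule algebra: an algebra $M$ which is an $A$-bimodule such that its product and unit are $A$-bimodule morphisms, i.e. $a\cdot(\alpha\beta)=\sum(a_{(1)}\cdot\alpha)(a_{(2)}\cdot\beta)$, $a\cdot1_M=\varepsilon(a)1_M$, and likewise on the right. For a cocommutative coalgebra $C$ and commutative algebra $M$, $\mathrm{Reg}(C,M)$ is the abelian group of linear maps $C\to M$ invertible for convolution $f*g=\mu_M(f\otimes g)\Delta_C$; $f^{-1}$ is the convolution inverse, and $\ast_{w}$ denotes convolution product over $w$. Woronowicz braiding: $\sigma(a\otimes b)=\sum b_{(1)}\otimes\mathrm{ad}_{b_{(2)}}a$, where $\mathrm{ad}_a(b)=\sum\mathrm S(a_{(1)})ba_{(2)}$; $\sigma_i=\mathrm{Id}^{\otimes i-1}\otimes\sigma\otimes\mathrm{Id}^{\otimes n-i-1}$. $S_{p,n}$ is the set of permutations $w$ of $\{1,\dots,n\}$ with $w(1)<\dots<w(p)$ and $w(p+1)<\dots<w(n)$, $(-1)^{|w|}$ the sign. For a reduced decomposition $w=\nu_{i_1}\cdots\nu_{i_r}$, $\nu_i=(i,i+1)$: $T_\sigma(w)=\sigma_{i_1}\cdots\sigma_{i_r}$, and $\widetilde{T_\sigma(w)}(f)=f\circ T_\sigma(w)$. Multiplicative Hochschild differential: for $f\in\mathrm{Reg}(A^{\otimes n},M)$, $$\widetilde\delta_n(f)(a^1\otimes\cdots\otimes a^{n+1})=\sum\big(a^1_{(1)}\cdot f(a^2_{(1)}\otimes\cdots\otimes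 a^{n+1}_{(1)})\big)\prod_{i=1}^nf^{(-1)^i}(a^1_{(i+1)}\otimes\cdots\otimes a^i_{(i+1)}a^{i+1}_{(i+1)}\otimes\cdots\otimes a^{n+1}_{(i+1)})\,\big(f^{(-1)^{n+1}}(a^1_{(n+2)}\otimes\cdots\otimes a^n_{(n+2)})\cdot a^{n+1}_{(n+2)}\big).$$ Target: put $C^{p,q}(A,M)=\mathrm{Reg}(A^{\otimes p},\mathrm{Hom}_{\mathbb{K}}(A^{\otimes q},M))$, where $\mathrm{Hom}_{\mathbb{K}}(A^{\otimes q},M)$ is a convolution algebra. $\widetilde\Lambda:\mathrm{Reg}(A^{\otimes p}\otimes A^{\otimes q},M)\simeq\mathrm{Reg}(A^{\otimes q},\mathrm{Hom}_{\mathbb{K}}(A^{\otimes p},M))=C^{q,p}(A,M)$ is $\widetilde\Lambda(F)(\underline b)(\underline a)=F(\underline a\otimes\underline b)$. For $f\in C^{p,q}(A,M)$, $\widetilde\rho(f)=(\widetilde D^{(q)}_p(f),\widetilde d^{(p)}_q(f))\in C^{p+1,q}(A,M)\oplus C^{p,q+1}(A,M)$ (extended to a group homomorphism on $\bigoplus_{p+q=n}C^{p,q}(A,M)$), where for $\underline a=a^1\otimes\cdots\otimes a^{p+1}$, $\underline x\in A^{\otimes q}$: $$\begin{aligned}\widetilde D^{(q)}_p(f)(\underline a)(\underline x)=\sum\;&a^1_{(1)}\cdot f^{(-1)^q}(a^2_{(1)}\otimes\cdots\otimes a^{p+1}_{(1)})(\mathrm{ad}_{a^1_{(2)}}\underline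 x_{(1)})\\&\prod_{i=1}^pf^{(-1)^{q+i}}(a^1_{(i+2)}\otimes\cdots\otimes a^i_{(i+1)}a^{i+1}_{(i+1)}\otimes\cdots\otimes a^{p+1}_{(i+1)})(\underline x_{(i+1)})\\&f^{(-1)^{q+p+1}}(a^1_{(p+3)}\otimes a^2_{(p+2)}\otimes\cdots\otimes a^p_{(p+2)})(\underline x_{(p+2)})\cdot a^{p+1}_{(p+2)}\end{aligned}$$ (in each factor the Sweedler index of $a^1$ is one more than that of the other $a^j$ because $a^1$ is used twice in the first factor), with $\mathrm{ad}_{a}\underline x=\sum\mathrm{ad}_{a_{(1)}}x^1\otimes\cdots\otimes\mathrm{ad}_{a_{(q)}}x^q$; and for $\underline a\in A^{\otimes p}$, $\underline x=x^1\otimes\cdots\otimes x^{q+1}$: $$\begin{aligned}\widetilde d^{(p)}_q(f)(\underline a)(\underline x)=\sum\;&x^1_{(1)}\cdot f(\underline a_{(1)})(x^2_{(1)}\otimes\cdots\otimes x^{q+1}_{(1)})\\&\prod_{i=1}^qf^{(-1)^i}(\underline a_{(i+1)})(x^1_{(i+1)}\otimes\cdots\otimes x^i_{(i+1)}x^{i+1}_{(i+1)}\otimes\cdots\otimes x^{q+1}_{(i+1)})\\&f^{(-1)^{q+1}}(\underline a_{(q+2)})(x^1_{(q+2)}\otimes\cdots\otimes x^q_{(q+2)})\cdot\mathrm{ad}_{\underline a_{(q+3)}}x^{q+1}_{(q+2)},\end{aligned}$$ with $\mathrm{ad}_{\underline a}x=\mathrm{ad}_{a^1\cdots a^p}x$.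 *)

theory Defs
  imports
    Complex_Main
    "HOL-Algebra.FiniteProduct"
    "HOL-Algebra.Product_Groups"
    "HOL-Combinatorics.Permutations"
    "HOL-Library.Function_Algebras"
begin

section \<open>Tensor powers of a vector space\<close>

definition fscale :: "('k \<Rightarrow> 'w \<Rightarrow> 'w) \<Rightarrow> 'k \<Rightarrow> ('x \<Rightarrow> 'w) \<Rightarrow> 'x \<Rightarrow> 'w"
  where "fscale s c f = (\<lambda>x. s c (f x))"

definition multilinear ::
    "('k::field \<Rightarrow> 'v::ab_group_add \<Rightarrow> 'v) \<Rightarrow> ('k \<Rightarrow> 'w::ab_group_add \<Rightarrow> 'w) \<Rightarrow> nat \<Rightarrow> ('v list \<Rightarrow> 'w) \<Rightarrow> bool"
  where "multilinear sV sW n g \<longleftrightarrow>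
    (\<forall>xs i. length xs = n \<longrightarrow> i < n \<longrightarrow> Vector_Spaces.linear sV sW (\<lambda>x. g (xs[i := x])))"

text \<open>
  The pure tensor \<open>x\<^sub>1 \<otimes> \<dots> \<otimes> x\<^sub>n\<close> is the evaluation functional \<open>\<phi> \<mapsto> \<phi>(x\<^sub>1,\<dots>,x\<^sub>n)\<close> on multilinear
  forms, and \<open>V\<^sup>\<otimes>\<^sup>n\<close> is the span of the pure tensors of length \<open>n\<close>.  A form \<open>\<phi>\<close> is a family of
  \<open>n\<close>-linear forms, one for each \<open>n\<close>.  Over a field this is the tensor power: see
  \<open>multilinear_tensor\<close> and \<open>tensor_universal\<close> below.
\<close>

type_synonym ('v, 'k) tens = "('v list \<Rightarrow> 'k) \<Rightarrow> 'k"

definition tensor :: "('k::field \<Rightarrow> 'v::ab_group_add \<Rightarrow> 'v) \<Rightarrow> 'v list \<Rightarrow> ('v, 'k) tens"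
  where "tensor s xs = (\<lambda>\<phi>. if \<forall>n. multilinear s (*) n \<phi> then \<phi> xs else 0)"

definition tensor_power :: "('k::field \<Rightarrow> 'v::ab_group_add \<Rightarrow> 'v) \<Rightarrow> nat \<Rightarrow> ('v, 'k) tens set"
  where "tensor_power s n = Modules.module.span (fscale (*)) {tensor s xs |xs. length xs = n}"

text \<open>
  Linear maps from \<open>V\<^sup>\<otimes>\<^sup>n\<close> to a subspace \<open>W\<close> of \<open>'w\<close>; outside \<open>V\<^sup>\<otimes>\<^sup>n\<close> they take the value \<open>0\<close>, so that
  equality of maps is equality in HOL.
\<close>

definition linear_maps ::
    "('k::field \<Rightarrow> 'v::ab_group_add \<Rightarrow> 'v) \<Rightarrow> ('k \<Rightarrow> 'w::ab_group_add \<Rightarrow> 'w) \<Rightarrow> nat \<Rightarrow> 'w set \<Rightarrow> (('v, 'k) tens \<Rightarrow> 'w) set"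
  where "linear_maps sV sW n W = {f.
    (\<forall>t\<in>tensor_power sV n. f t \<in> W) \<and>
    (\<forall>t\<in>tensor_power sV n. \<forall>u\<in>tensor_power sV n. f (t + u) = f t + f u) \<and>
    (\<forall>c. \<forall>t\<in>tensor_power sV n. f (fscale (*) c t) = sW c (f t)) \<and>
    (\<forall>t. t \<notin> tensor_power sV n \<longrightarrow> f t = 0)}"

text \<open>The linear map on \<open>V\<^sup>\<otimes>\<^sup>n\<close> induced by an \<open>n\<close>-linear map \<open>g\<close>.\<close>

definition lift ::
    "('k::field \<Rightarrow> 'v::ab_group_add \<Rightarrow> 'v) \<Rightarrow> ('k \<Rightarrow> 'w::ab_group_add \<Rightarrow> 'w) \<Rightarrow> nat \<Rightarrow> ('v list \<Rightarrow> 'w) \<Rightarrow> ('v, 'k) tens \<Rightarrow> 'w"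
  where "lift sV sW n g = (THE h. h \<in> linear_maps sV sW n UNIV \<and> (\<forall>xs. length xs = n \<longrightarrow> h (tensor sV xs) = g xs))"

text \<open>The concatenation product \<open>V\<^sup>\<otimes>\<^sup>m \<times> V\<^sup>\<otimes>\<^sup>n \<rightarrow> V\<^sup>\<otimes>\<^sup>(\<^sup>m\<^sup>+\<^sup>n\<^sup>)\<close>.\<close>

definition tprod ::
    "('k::field \<Rightarrow> 'v::ab_group_add \<Rightarrow> 'v) \<Rightarrow> nat \<Rightarrow> nat \<Rightarrow> ('v, 'k) tens \<Rightarrow> ('v, 'k) tens \<Rightarrow> ('v, 'k) tens"
  where "tprod s m n t u =
    lift s (fscale (*)) m (\<lambda>xs. lift s (fscale (*)) n (\<lambda>ys. tensor s (xs @ ys)) u) t"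

lemma vector_space_mult: "vector_space ((*) :: 'k::field \<Rightarrow> 'k \<Rightarrow> 'k)"
  by unfold_locales (auto simp: algebra_simps)

lemma vector_space_fscale: "vector_space s \<Longrightarrow> vector_space (fscale s)"
  unfolding vector_space_def by (auto simp: fscale_def fun_eq_iff)

lemma linearI:
  assumes "vector_space s1" "vector_space s2"
    and "\<And>x y. f (x + y) = f x + f y" "\<And>c x. f (s1 c x) = s2 c (f x)"
  shows "Vector_Spaces.linear s1 s2 f"
  using assms by (simp add: Vector_Spaces.linear_def module_hom_def module_hom_axioms_def module_iff_vector_space)

lemma multilinear_tensor:
  assumes "vector_space sV"
  shows "multilinear sV (fscale (*)) n (tensor sV)"
  unfolding multilinear_def
proof (intro allI impI)
  fix xs :: "'b list" and i assume l: "length xs = n" "i < n"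
  have "\<phi> (xs[i := x + y]) = \<phi> (xs[i := x]) + \<phi> (xs[i := y])" "\<phi> (xs[i := sV c x]) = c * \<phi> (xs[i := x])"
    if "\<forall>n. multilinear sV (*) n \<phi>" for \<phi> x y c
  proof -
    from that l have "Vector_Spaces.linear sV (*) (\<lambda>x. \<phi> (xs[i := x]))"
      by (auto simp: multilinear_def)
    then interpret Vector_Spaces.linear sV "(*)" "\<lambda>x. \<phi> (xs[i := x])" .
    show "\<phi> (xs[i := x + y]) = \<phi> (xs[i := x]) + \<phi> (xs[i := y])" by (rule add)
    show "\<phi> (xs[i := sV c x]) = c * \<phi> (xs[i := x])" by (rule scale)
  qed
  then show "Vector_Spaces.linear sV (fscale (*)) (\<lambda>x. tensor sV (xs[i := x]))"
    by (intro linearI assms vector_space_fscale[OF vector_space_mult])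
      (auto simp: tensor_def fscale_def fun_eq_iff)
qed

lemma separating_functional:
  assumes "vector_space s" "w \<noteq> 0"
  obtains l where "Vector_Spaces.linear s (*) l" "l w \<noteq> (0 :: 'k::field)"
proof -
  interpret vector_space s by fact
  interpret vp: vector_space_pair s "(*) :: 'k \<Rightarrow> 'k \<Rightarrow> 'k"
    using assms(1) vector_space_mult by (simp add: vector_space_pair_def)
  have "independent {w}" using assms(2) by (simp add: dependent_single)
  from vp.linear_independent_extend[OF this, of "\<lambda>_. 1"] obtain l
    where "Vector_Spaces.linear s (*) l" "l w = 1" by auto
  then show thesis using that by simp
qed

lemma tensor_universal:
  fixes sV :: "'k::field \<Rightarrow> 'v::ab_group_add \<Rightarrow> 'v" and sW :: "'k \<Rightarrow> 'w::ab_group_add \<Rightarrow> 'w"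
  assumes V: "vector_space sV" and W: "vector_space sW" and g: "multilinear sV sW n g"
  shows "\<exists>!h. h \<in> linear_maps sV sW n UNIV \<and> (\<forall>xs. length xs = n \<longrightarrow> h (tensor sV xs) = g xs)"
proof -
  let ?s = "fscale (*) :: 'k \<Rightarrow> ('v, 'k) tens \<Rightarrow> ('v, 'k) tens"
  let ?P = "{tensor sV xs |xs. length xs = n}"
  interpret V: vector_space sV by fact
  interpret W: vector_space sW by fact
  interpret T: vector_space ?s by (rule vector_space_fscale[OF vector_space_mult])
  let ?rel = "\<lambda>t w. \<forall>l. Vector_Spaces.linear sW (*) l \<longrightarrow> l w = t (\<lambda>xs. if length xs = n then l (g xs) else 0)"
  have form: "multilinear sV (*) m (\<lambda>xs. if length xs = n then l (g xs) else 0)"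
    if l: "Vector_Spaces.linear sW (*) l" for l m
  proof (cases "m = n")
    case True
    have "Vector_Spaces.linear sV (*) (l \<circ> (\<lambda>x. g (xs[i := x])))" if "length xs = n" "i < n" for xs i
      using that g l by (auto simp: multilinear_def intro: Vector_Spaces.linear_compose)
    then show ?thesis using True by (auto simp: multilinear_def o_def)
  next
    case False
    then show ?thesis
      by (auto simp: multilinear_def intro!: linearI V vector_space_mult)
  qed
  have pure: "?rel (tensor sV xs) (g xs)" if "length xs = n" for xs
    using that form by (auto simp: tensor_def)
  have rel0: "?rel 0 0"
    by (auto simp: Vector_Spaces.linear_def module_hom.zero)
  have reladd: "?rel (t + u) (w + w')" if "?rel t w" "?rel u w'" for t u w w'
    using that by (auto simp: Vector_Spaces.linear_def module_hom.add)
  have relsc: "?rel (?s c t) (sW c w)" if "?rel t w" for t w c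
    using that by (auto simp: Vector_Spaces.linear_def module_hom.scale fscale_def)
  have ex: "\<exists>w. ?rel t w" if "t \<in> T.span ?P" for t
    using that
  proof (induction rule: T.span_induct_alt)
    case base
    show ?case using rel0 by blast
  next
    case (step c x y)
    then obtain w xs where y: "?rel y w" and x: "x = tensor sV xs" "length xs = n" by auto
    have "?rel (?s c x) (sW c (g xs))"
      unfolding x(1) by (rule relsc[OF pure[OF x(2)]])
    from reladd[OF this y] have "?rel (?s c x + y) (sW c (g xs) + w)" .
    then show ?case by blast
  qed
  have uniq: "w = w'" if "?rel t w" "?rel t w'" for t w w'
  proof (rule ccontr)
    assume "w \<noteq> w'"
    then have "w - w' \<noteq> 0" by simp
    from separating_functional[OF W this] obtain l
      where l: "Vector_Spaces.linear sW (*) l" "l (w - w') \<noteq> 0" by blast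
    have "module_hom sW (*) l" using l(1) by (simp add: Vector_Spaces.linear_def)
    then have "l w \<noteq> l w'" using l(2) module_hom.diff[of sW "(*)" l w w'] by auto
    with that l(1) show False by simp
  qed
  have TP: "tensor_power sV n = T.span ?P" by (simp add: tensor_power_def)
  define h where "h t = (if t \<in> tensor_power sV n then THE w. ?rel t w else 0)" for t
  have h: "h t = w" if "t \<in> tensor_power sV n" "?rel t w" for t w
    using that uniq[OF _ that(2)] unfolding h_def by (auto intro: the_equality)
  have hr: "?rel t (h t)" if t: "t \<in> tensor_power sV n" for t
  proof -
    from ex[OF t[unfolded TP]] obtain w where w: "?rel t w" by (rule exE)
    with h[OF t w] show ?thesis by simp
  qed
  have hl: "h \<in> linear_maps sV sW n UNIV"
    unfolding linear_maps_def
  proof (intro CollectI conjI ballI allI impI)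
    fix t u assume tu: "t \<in> tensor_power sV n" "u \<in> tensor_power sV n"
    show "h (t + u) = h t + h u"
      by (rule h[OF _ reladd[OF hr[OF tu(1)] hr[OF tu(2)]]]) (use tu T.span_add[of t ?P u] in \<open>simp only: TP\<close>)
  next
    fix c t assume t: "t \<in> tensor_power sV n"
    show "h (?s c t) = sW c (h t)"
      by (rule h[OF _ relsc[OF hr[OF t]]]) (use t T.span_scale[of t ?P c] in \<open>simp only: TP\<close>)
  qed (auto simp: h_def)
  have hp: "h (tensor sV xs) = g xs" if "length xs = n" for xs
    using that by (intro h pure) (auto simp: TP intro: T.span_base)
  show ?thesis
  proof (rule ex1I[of _ h])
    show "h \<in> linear_maps sV sW n UNIV \<and> (\<forall>xs. length xs = n \<longrightarrow> h (tensor sV xs) = g xs)"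
      using hl hp by simp
  next
    fix k assume k: "k \<in> linear_maps sV sW n UNIV \<and> (\<forall>xs. length xs = n \<longrightarrow> k (tensor sV xs) = g xs)"
    have lin: "f (?s c x + y) = sW c (f x) + f y"
      if "f \<in> linear_maps sV sW n UNIV" "x \<in> T.span ?P" "y \<in> T.span ?P" for f c x y
      using that by (auto simp: linear_maps_def TP T.span_scale)
    have "t \<in> T.span ?P \<and> k t = h t" if "t \<in> T.span ?P" for t
      using that
    proof (induction rule: T.span_induct_alt)
      case base
      have "f 0 = 0" if "f \<in> linear_maps sV sW n UNIV" for f
      proof -
        have "f (?s 0 0) = sW 0 (f 0)"
          using that T.span_zero[of ?P] TP unfolding linear_maps_def by blast
        then show ?thesis by (simp only: T.scale_zero_left W.scale_zero_left)
      qed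
      from this[OF conjunct1[OF k]] this[OF hl] show ?case using T.span_zero[of ?P] by metis
    next
      case (step c x y)
      then obtain xs where xs: "x = tensor sV xs" "length xs = n" by blast
      have x: "x \<in> T.span ?P" using step(1) by (rule T.span_base)
      have y: "y \<in> T.span ?P" "k y = h y" using step(2) by blast+
      have "k x = h x" using k hp[OF xs(2)] xs by simp
      then have "k (?s c x + y) = h (?s c x + y)"
        unfolding lin[OF conjunct1[OF k] x y(1)] lin[OF hl x y(1)] y(2) by (rule arg_cong)
      then show ?case using T.span_add[OF T.span_scale[OF x] y(1)] by (rule conjI[rotated])
    qed
    then have "k t = h t" if "t \<in> tensor_power sV n" for t
      using that TP by blast
    moreover have "k t = h t" if "t \<notin> tensor_power sV n" for t
      using that k hl unfolding linear_maps_def by simp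
    ultimately show "k = h" by blast
  qed
qed

lemma lift_tensor:
  assumes "vector_space sV" "vector_space sW" "multilinear sV sW n g" "length xs = n"
  shows "lift sV sW n g (tensor sV xs) = g xs"
  using theI'[OF tensor_universal[OF assms(1-3)]] assms(4) unfolding lift_def by blast


section \<open>Cocommutative Hopf algebras\<close>

text \<open>
  The sort of \<open>'a\<close> is that of unital rings without the requirement \<open>0 \<noteq> 1\<close>.
\<close>

locale k_algebra = vector_space scale
  for scale :: "'k::field \<Rightarrow> 'a::{ring,monoid_mult} \<Rightarrow> 'a" +
  assumes scale_mult_left: "scale c x * y = scale c (x * y)"
    and scale_mult_right: "x * scale c y = scale c (x * y)"

locale coalgebra = vector_space scale
  for scale :: "'k::field \<Rightarrow> 'a::ab_group_add \<Rightarrow> 'a" +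
  fixes comult :: "'a \<Rightarrow> ('a, 'k) tens"
    and counit :: "'a \<Rightarrow> 'k"
  assumes comult_closed: "comult a \<in> tensor_power scale 2"
    and comult_linear: "Vector_Spaces.linear scale (fscale (*)) comult"
    and counit_linear: "Vector_Spaces.linear scale (*) counit"
    and coassoc:
      "lift scale (fscale (*)) 2 (\<lambda>xs. tprod scale 2 1 (comult (xs ! 0)) (tensor scale [xs ! 1])) (comult a) =
       lift scale (fscale (*)) 2 (\<lambda>xs. tprod scale 1 2 (tensor scale [xs ! 0]) (comult (xs ! 1))) (comult a)"
    and counit_left: "lift scale scale 2 (\<lambda>xs. scale (counit (xs ! 0)) (xs ! 1)) (comult a) = a"
    and counit_right: "lift scale scale 2 (\<lambda>xs. scale (counit (xs ! 1)) (xs ! 0)) (comult a) = a"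
begin

text \<open>
  \<open>comult_pow k a\<close> is \<open>\<Sum> a\<^sub>(\<^sub>1\<^sub>) \<otimes> \<dots> \<otimes> a\<^sub>(\<^sub>k\<^sub>)\<close>; it is \<open>\<epsilon>(a)\<close> for \<open>k = 0\<close>, and \<open>a\<close> for \<open>k = 1\<close> by the counit axiom.
\<close>

primrec comult_pow :: "nat \<Rightarrow> 'a \<Rightarrow> ('a, 'k) tens"
  where
    "comult_pow 0 a = fscale (*) (counit a) (tensor scale [])"
  | "comult_pow (Suc k) a =
       lift scale (fscale (*)) 2 (\<lambda>xs. tprod scale 1 k (tensor scale [xs ! 0]) (comult_pow k (xs ! 1))) (comult a)"

text \<open>
  Sweedler notation: \<open>sweedler s [(k\<^sub>1, a\<^sup>1), \<dots>, (k\<^sub>m, a\<^sup>m)] g\<close> is the sum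
  \<open>\<Sum> g [[a\<^sup>1\<^sub>(\<^sub>1\<^sub>), \<dots>, a\<^sup>1\<^sub>(\<^sub>k\<^sub>1\<^sub>)], \<dots>, [a\<^sup>m\<^sub>(\<^sub>1\<^sub>), \<dots>, a\<^sup>m\<^sub>(\<^sub>k\<^sub>m\<^sub>)]]\<close> for \<open>g\<close> linear in each entry, with values in a space
  with scalar multiplication \<open>s\<close>.
\<close>

primrec sweedler ::
    "('k \<Rightarrow> 'w::ab_group_add \<Rightarrow> 'w) \<Rightarrow> (nat \<times> 'a) list \<Rightarrow> ('a list list \<Rightarrow> 'w) \<Rightarrow> 'w"
  where
    "sweedler s [] g = g []"
  | "sweedler s (x # xs) g =
       lift scale s (fst x) (\<lambda>c. sweedler s xs (\<lambda>cs. g (c # cs))) (comult_pow (fst x) (snd x))"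

text \<open>\<open>leg i\<close> selects \<open>[a\<^sup>1\<^sub>(\<^sub>i\<^sub>), \<dots>, a\<^sup>m\<^sub>(\<^sub>i\<^sub>)]\<close>; like Sweedler indices, \<open>i\<close> starts at \<open>1\<close>.\<close>

definition leg :: "nat \<Rightarrow> 'b list list \<Rightarrow> 'b list"
  where "leg i cs = map (\<lambda>c. c ! (i - 1)) cs"

text \<open>
  The linear maps from the tensor product coalgebra \<open>A\<^sup>\<otimes>\<^sup>n\<close> to an algebra \<open>W\<close>, with the convolution product.
  The algebra \<open>W\<close> is given by its scalar multiplication and its multiplicative monoid, its addition being
  that of the type.
\<close>

definition conv_monoid ::
    "nat \<Rightarrow> ('k \<Rightarrow> 'w::ab_group_add \<Rightarrow> 'w) \<Rightarrow> 'w monoid \<Rightarrow> (('a, 'k) tens \<Rightarrow> 'w) monoid"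
  where "conv_monoid n s W = \<lparr>
    carrier = linear_maps scale s n (carrier W),
    monoid.mult = (\<lambda>f g. lift scale s n (\<lambda>as. sweedler s (map (Pair 2) as)
      (\<lambda>\<alpha>. f (tensor scale (leg 1 \<alpha>)) \<otimes>\<^bsub>W\<^esub> g (tensor scale (leg 2 \<alpha>))))),
    one = lift scale s n (\<lambda>as. s (prod_list (map counit as)) \<one>\<^bsub>W\<^esub>)\<rparr>"

end

locale bialgebra = k_algebra scale + coalgebra scale comult counit
  for scale :: "'k::field \<Rightarrow> 'a::{ring,monoid_mult} \<Rightarrow> 'a" and comult counit +
  assumes comult_mult: "comult (a * b) =
      lift scale (fscale (*)) 2 (\<lambda>xs. lift scale (fscale (*)) 2 (\<lambda>ys. tensor scale (map2 (*) xs ys)) (comult b)) (comult a)"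
    and comult_one: "comult 1 = tensor scale [1, 1]"
    and counit_mult: "counit (a * b) = counit a * counit b"
    and counit_one: "counit 1 = 1"

locale cocommutative_hopf_algebra = bialgebra scale comult counit
  for scale :: "'k::field \<Rightarrow> 'a::{ring,monoid_mult} \<Rightarrow> 'a" and comult counit +
  fixes antipode :: "'a \<Rightarrow> 'a"
  assumes antipode_linear: "Vector_Spaces.linear scale scale antipode"
    and antipode_left: "sweedler scale [(2, a)] (\<lambda>c. antipode (c ! 0 ! 0) * (c ! 0 ! 1)) = scale (counit a) 1"
    and antipode_right: "sweedler scale [(2, a)] (\<lambda>c. (c ! 0 ! 0) * antipode (c ! 0 ! 1)) = scale (counit a) 1"
    and cocommutative: "lift scale (fscale (*)) 2 (\<lambda>xs. tensor scale [xs ! 1, xs ! 0]) (comult a) = comult a"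
begin

definition ad :: "'a \<Rightarrow> 'a \<Rightarrow> 'a"
  where "ad a b = sweedler scale [(2, a)] (\<lambda>c. antipode (c ! 0 ! 0) * b * (c ! 0 ! 1))"

text \<open>\<open>ad_tensor a [x\<^sup>1,\<dots>,x\<^sup>q] = \<Sum> ad\<^bsub>a(1)\<^esub> x\<^sup>1 \<otimes> \<dots> \<otimes> ad\<^bsub>a(q)\<^esub> x\<^sup>q\<close>, which is \<open>\<epsilon>(a)\<close> if \<open>q = 0\<close>.\<close>

definition ad_tensor :: "'a \<Rightarrow> 'a list \<Rightarrow> ('a, 'k) tens"
  where "ad_tensor a xs = sweedler (fscale (*)) [(length xs, a)] (\<lambda>c. tensor scale (map2 ad (c ! 0) xs))"

text \<open>The Woronowicz braiding \<open>\<sigma>\<close>, the operators \<open>\<sigma>\<^sub>i\<close> on \<open>A\<^sup>\<otimes>\<^sup>n\<close> for \<open>1 \<le> i < n\<close>, and their lifts \<open>T\<^sub>\<sigma>(w)\<close>.\<close>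

definition braiding :: "('a, 'k) tens \<Rightarrow> ('a, 'k) tens"
  where "braiding = lift scale (fscale (*)) 2 (\<lambda>xs.
    sweedler (fscale (*)) [(2, xs ! 1)] (\<lambda>c. tensor scale [c ! 0 ! 0, ad (c ! 0 ! 1) (xs ! 0)]))"

definition braid :: "nat \<Rightarrow> nat \<Rightarrow> ('a, 'k) tens \<Rightarrow> ('a, 'k) tens"
  where "braid n i = lift scale (fscale (*)) n (\<lambda>xs.
    tprod scale (i - 1) (n - i + 1) (tensor scale (take (i - 1) xs))
      (tprod scale 2 (n - i - 1) (braiding (tensor scale [xs ! (i - 1), xs ! i]))
        (tensor scale (drop (i + 1) xs))))"

definition word_perm :: "nat list \<Rightarrow> nat \<Rightarrow> nat"
  where "word_perm is = foldr (\<lambda>i w. transpose i (Suc i) \<circ> w) is id"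

definition reduced_decomposition :: "nat \<Rightarrow> (nat \<Rightarrow> nat) \<Rightarrow> nat list \<Rightarrow> bool"
  where "reduced_decomposition n w is \<longleftrightarrow>
    set is \<subseteq> {1..<n} \<and> word_perm is = w \<and>
    (\<forall>js. set js \<subseteq> {1..<n} \<and> word_perm js = w \<longrightarrow> length is \<le> length js)"

definition T\<^sub>\<sigma> :: "nat \<Rightarrow> (nat \<Rightarrow> nat) \<Rightarrow> ('a, 'k) tens \<Rightarrow> ('a, 'k) tens"
  where "T\<^sub>\<sigma> n w = foldr (\<lambda>i t. braid n i \<circ> t) (SOME is. reduced_decomposition n w is) id"

end

definition shuffle_perms :: "nat \<Rightarrow> nat \<Rightarrow> (nat \<Rightarrow> nat) set"
  where "shuffle_perms p n =
    {w. w permutes {1..n} \<and> strict_mono_on {1..p} w \<and> strict_mono_on {p+1..n} w}"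

definition contract :: "nat \<Rightarrow> 'a::times list \<Rightarrow> 'a list"
  \<comment> \<open>\<open>[a\<^sup>1, \<dots>, a\<^sup>n\<^sup>+\<^sup>1] \<mapsto> [a\<^sup>1, \<dots>, a\<^sup>i a\<^sup>i\<^sup>+\<^sup>1, \<dots>, a\<^sup>n\<^sup>+\<^sup>1]\<close>\<close>
  where "contract i xs = take (i - 1) xs @ [xs ! (i - 1) * xs ! i] @ drop (i + 1) xs"


section \<open>Commutative bimodule algebras and their complexes\<close>

locale commutative_bimodule_algebra =
  cocommutative_hopf_algebra scaleA comult counit antipode + M: k_algebra scaleM
  for scaleA :: "'k::field \<Rightarrow> 'a::{ring,monoid_mult} \<Rightarrow> 'a"
    and comult counit antipode
    and scaleM :: "'k \<Rightarrow> 'm::{comm_ring,comm_monoid_mult} \<Rightarrow> 'm" +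
  fixes lact :: "'a \<Rightarrow> 'm \<Rightarrow> 'm" (infixr \<open>\<rightharpoonup>\<close> 75)
    and ract :: "'m \<Rightarrow> 'a \<Rightarrow> 'm" (infixl \<open>\<leftharpoonup>\<close> 75)
  assumes lact_linear_left: "Vector_Spaces.linear scaleA scaleM (\<lambda>a. a \<rightharpoonup> m)"
    and lact_linear_right: "Vector_Spaces.linear scaleM scaleM (\<lambda>m. a \<rightharpoonup> m)"
    and ract_linear_left: "Vector_Spaces.linear scaleM scaleM (\<lambda>m. m \<leftharpoonup> a)"
    and ract_linear_right: "Vector_Spaces.linear scaleA scaleM (\<lambda>a. m \<leftharpoonup> a)"
    and lact_one: "1 \<rightharpoonup> m = m"
    and lact_mult: "(a * b) \<rightharpoonup> m = a \<rightharpoonup> (b \<rightharpoonup> m)"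
    and ract_one: "m \<leftharpoonup> 1 = m"
    and ract_mult: "m \<leftharpoonup> (a * b) = (m \<leftharpoonup> a) \<leftharpoonup> b"
    and lact_ract: "(a \<rightharpoonup> m) \<leftharpoonup> b = a \<rightharpoonup> (m \<leftharpoonup> b)"
    and lact_prod: "a \<rightharpoonup> (m * m') = sweedler scaleM [(2, a)] (\<lambda>c. ((c ! 0 ! 0) \<rightharpoonup> m) * ((c ! 0 ! 1) \<rightharpoonup> m'))"
    and lact_unit: "a \<rightharpoonup> (1 :: 'm) = scaleM (counit a) 1"
    and ract_prod: "(m * m') \<leftharpoonup> a = sweedler scaleM [(2, a)] (\<lambda>c. (m \<leftharpoonup> (c ! 0 ! 0)) * (m' \<leftharpoonup> (c ! 0 ! 1)))"
    and ract_unit: "(1 :: 'm) \<leftharpoonup> a = scaleM (counit a) 1"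
begin

abbreviation tens :: "'a list \<Rightarrow> ('a, 'k) tens"
  where "tens \<equiv> tensor scaleA"

definition M_monoid :: "'m monoid"
  where "M_monoid = \<lparr>carrier = UNIV, monoid.mult = (*), one = 1\<rparr>"

definition Reg :: "nat \<Rightarrow> (('a, 'k) tens \<Rightarrow> 'm) monoid"
  where "Reg n = units_of (conv_monoid n scaleM M_monoid)"

text \<open>\<open>Reg(A\<^sup>\<otimes>\<^sup>p \<otimes> A\<^sup>\<otimes>\<^sup>q, M)\<close>, where the coalgebra \<open>A\<^sup>\<otimes>\<^sup>p \<otimes> A\<^sup>\<otimes>\<^sup>q\<close> is identified with \<open>A\<^sup>\<otimes>\<^sup>(\<^sup>p\<^sup>+\<^sup>q\<^sup>)\<close> by concatenation.\<close>

definition Reg2 :: "nat \<Rightarrow> nat \<Rightarrow> (('a, 'k) tens \<Rightarrow> 'm) monoid"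
  where "Reg2 p q = Reg (p + q)"

text \<open>\<open>C\<^sup>p\<^sup>,\<^sup>q(A, M) = Reg(A\<^sup>\<otimes>\<^sup>p, Hom(A\<^sup>\<otimes>\<^sup>q, M))\<close>\<close>

definition C :: "nat \<Rightarrow> nat \<Rightarrow> (('a, 'k) tens \<Rightarrow> ('a, 'k) tens \<Rightarrow> 'm) monoid"
  where "C p q = units_of (conv_monoid p (fscale scaleM) (conv_monoid q scaleM M_monoid))"

definition \<delta> :: "nat \<Rightarrow> (('a, 'k) tens \<Rightarrow> 'm) \<Rightarrow> ('a, 'k) tens \<Rightarrow> 'm"
  where "\<delta> n f = lift scaleA scaleM (n + 1) (\<lambda>as.
    sweedler scaleM (map (Pair (n + 2)) as) (\<lambda>\<alpha>.
      (hd (leg 1 \<alpha>) \<rightharpoonup> f (tens (tl (leg 1 \<alpha>)))) *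
      (\<Prod>i=1..n. (f [^]\<^bsub>Reg n\<^esub> ((-1) ^ i :: int)) (tens (contract i (leg (i + 1) \<alpha>)))) *
      ((f [^]\<^bsub>Reg n\<^esub> ((-1) ^ (n + 1) :: int)) (tens (butlast (leg (n + 2) \<alpha>))) \<leftharpoonup> last (leg (n + 2) \<alpha>))))"

text \<open>
  In \<open>\<D>\<close> the entry \<open>a\<^sup>1\<close> is split into \<open>p + 3\<close> legs and the others into \<open>p + 2\<close>.  Removing \<open>a\<^sup>1\<^sub>(\<^sub>1\<^sub>)\<close> from
  \<open>\<alpha>\<close> gives \<open>\<beta>\<close>, so that \<open>leg i \<beta> = [a\<^sup>1\<^sub>(\<^sub>i\<^sub>+\<^sub>1\<^sub>), a\<^sup>2\<^sub>(\<^sub>i\<^sub>), \<dots>, a\<^sup>p\<^sup>+\<^sup>1\<^sub>(\<^sub>i\<^sub>)]\<close>.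
\<close>

definition \<D> :: "nat \<Rightarrow> nat \<Rightarrow> (('a, 'k) tens \<Rightarrow> ('a, 'k) tens \<Rightarrow> 'm) \<Rightarrow> ('a, 'k) tens \<Rightarrow> ('a, 'k) tens \<Rightarrow> 'm"
  where "\<D> p q f = lift scaleA (fscale scaleM) (p + 1) (\<lambda>as. lift scaleA scaleM q (\<lambda>xs.
    sweedler scaleM ((p + 3, hd as) # map (Pair (p + 2)) (tl as)) (\<lambda>\<alpha>.
    sweedler scaleM (map (Pair (p + 2)) xs) (\<lambda>\<xi>.
      let \<beta> = tl (hd \<alpha>) # tl \<alpha> in
      (hd (hd \<alpha>) \<rightharpoonup> (f [^]\<^bsub>C p q\<^esub> ((-1) ^ q :: int))
         (tens (tl (leg 1 \<beta>))) (ad_tensor (hd (leg 1 \<beta>)) (leg 1 \<xi>))) *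
      (\<Prod>i=1..p. (f [^]\<^bsub>C p q\<^esub> ((-1) ^ (q + i) :: int))
         (tens (contract i (leg (i + 1) \<beta>))) (tens (leg (i + 1) \<xi>))) *
      ((f [^]\<^bsub>C p q\<^esub> ((-1) ^ (q + p + 1) :: int))
         (tens (butlast (leg (p + 2) \<beta>))) (tens (leg (p + 2) \<xi>)) \<leftharpoonup> last (leg (p + 2) \<beta>))))))"

definition \<d> :: "nat \<Rightarrow> nat \<Rightarrow> (('a, 'k) tens \<Rightarrow> ('a, 'k) tens \<Rightarrow> 'm) \<Rightarrow> ('a, 'k) tens \<Rightarrow> ('a, 'k) tens \<Rightarrow> 'm"
  where "\<d> p q f = lift scaleA (fscale scaleM) p (\<lambda>as. lift scaleA scaleM (q + 1) (\<lambda>xs.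
    sweedler scaleM (map (Pair (q + 3)) as) (\<lambda>\<alpha>.
    sweedler scaleM (map (Pair (q + 2)) xs) (\<lambda>\<xi>.
      (hd (leg 1 \<xi>) \<rightharpoonup> f (tens (leg 1 \<alpha>)) (tens (tl (leg 1 \<xi>)))) *
      (\<Prod>i=1..q. (f [^]\<^bsub>C p q\<^esub> ((-1) ^ i :: int))
         (tens (leg (i + 1) \<alpha>)) (tens (contract i (leg (i + 1) \<xi>)))) *
      ((f [^]\<^bsub>C p q\<^esub> ((-1) ^ (q + 1) :: int))
         (tens (leg (q + 2) \<alpha>)) (tens (butlast (leg (q + 2) \<xi>)))
         \<leftharpoonup> ad (prod_list (leg (q + 3) \<alpha>)) (last (leg (q + 2) \<xi>)))))))"

text \<open>
  A family indexed by \<open>p \<in> {..n}\<close> stands for an element of a sum over \<open>p + q = n\<close>, with \<open>q = n - p\<close>.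
\<close>

definition Tot_Reg2 :: "nat \<Rightarrow> (nat \<Rightarrow> ('a, 'k) tens \<Rightarrow> 'm) monoid"
  where "Tot_Reg2 n = product_group {..n} (\<lambda>p. Reg2 p (n - p))"

definition Tot_C :: "nat \<Rightarrow> (nat \<Rightarrow> ('a, 'k) tens \<Rightarrow> ('a, 'k) tens \<Rightarrow> 'm) monoid"
  where "Tot_C n = product_group {..n} (\<lambda>p. C p (n - p))"

text \<open>The component of \<open>\<rho>(f)\<close> in \<open>C\<^sup>p\<^sup>,\<^sup>n\<^sup>+\<^sup>1\<^sup>-\<^sup>p\<close> comes from those of \<open>f\<close> in \<open>C\<^sup>p\<^sup>-\<^sup>1\<^sup>,\<^sup>n\<^sup>+\<^sup>1\<^sup>-\<^sup>p\<close> and \<open>C\<^sup>p\<^sup>,\<^sup>n\<^sup>-\<^sup>p\<close>.\<close>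

definition \<rho> :: "nat \<Rightarrow> (nat \<Rightarrow> ('a, 'k) tens \<Rightarrow> ('a, 'k) tens \<Rightarrow> 'm)
    \<Rightarrow> nat \<Rightarrow> ('a, 'k) tens \<Rightarrow> ('a, 'k) tens \<Rightarrow> 'm"
  where "\<rho> n f = (\<lambda>p\<in>{..n+1}.
    (if p = 0 then \<one>\<^bsub>C p (n + 1 - p)\<^esub> else \<D> (p - 1) (n + 1 - p) (f (p - 1)))
      \<otimes>\<^bsub>C p (n + 1 - p)\<^esub>
    (if p = n + 1 then \<one>\<^bsub>C p (n + 1 - p)\<^esub> else \<d> p (n - p) (f p)))"

definition \<Lambda> :: "nat \<Rightarrow> nat \<Rightarrow> (('a, 'k) tens \<Rightarrow> 'm) \<Rightarrow> ('a, 'k) tens \<Rightarrow> ('a, 'k) tens \<Rightarrow> 'm"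
  where "\<Lambda> p q F = (\<lambda>b a. if b \<in> tensor_power scaleA q \<and> a \<in> tensor_power scaleA p
    then F (tprod scaleA p q a b) else 0)"

definition Tot_\<Lambda> :: "nat \<Rightarrow> (nat \<Rightarrow> ('a, 'k) tens \<Rightarrow> 'm) \<Rightarrow> nat \<Rightarrow> ('a, 'k) tens \<Rightarrow> ('a, 'k) tens \<Rightarrow> 'm"
  where "Tot_\<Lambda> n F = (\<lambda>q\<in>{..n}. \<Lambda> (n - q) q (F (n - q)))"

text \<open>The differential corresponding to \<open>\<rho>\<close> under the isomorphism \<open>\<Lambda>\<close>.\<close>

definition \<rho>_Reg2 :: "nat \<Rightarrow> (nat \<Rightarrow> ('a, 'k) tens \<Rightarrow> 'm) \<Rightarrow> nat \<Rightarrow> ('a, 'k) tens \<Rightarrow> 'm"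
  where "\<rho>_Reg2 n F = inv_into (carrier (Tot_Reg2 (n + 1))) (Tot_\<Lambda> (n + 1)) (\<rho> n (Tot_\<Lambda> n F))"

definition \<phi>\<^sub>\<sigma> :: "nat \<Rightarrow> (('a, 'k) tens \<Rightarrow> 'm) \<Rightarrow> nat \<Rightarrow> ('a, 'k) tens \<Rightarrow> 'm"
  where "\<phi>\<^sub>\<sigma> n f = (\<lambda>p\<in>{..n}.
    \<Otimes>\<^bsub>Reg n\<^esub>w\<in>shuffle_perms p n. (f [^]\<^bsub>Reg n\<^esub> sign w) \<circ> T\<^sub>\<sigma> n w)"

end


section \<open>Morphisms of complexes of abelian groups\<close>

definition cochain_complex :: "(nat \<Rightarrow> 'g monoid) \<Rightarrow> (nat \<Rightarrow> 'g \<Rightarrow> 'g) \<Rightarrow> bool"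
  where "cochain_complex G d \<longleftrightarrow>
    (\<forall>n. comm_group (G n) \<and> d n \<in> hom (G n) (G (n + 1)) \<and>
      (\<forall>x\<in>carrier (G n). d (n + 1) (d n x) = \<one>\<^bsub>G (n + 2)\<^esub>))"

definition morphism_of_complexes ::
    "(nat \<Rightarrow> 'g monoid) \<Rightarrow> (nat \<Rightarrow> 'g \<Rightarrow> 'g) \<Rightarrow> (nat \<Rightarrow> 'h monoid) \<Rightarrow> (nat \<Rightarrow> 'h \<Rightarrow> 'h) \<Rightarrow> (nat \<Rightarrow> 'g \<Rightarrow> 'h) \<Rightarrow> bool"
  where "morphism_of_complexes G d H e h \<longleftrightarrow>
    cochain_complex G d \<and> cochain_complex H e \<and>
    (\<forall>n. h n \<in> hom (G n) (H n) \<and> (\<forall>x\<in>carrier (G n). h (n + 1) (d n x) = e n (h n x)))"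

end

theory Submission
  imports Defs
begin

text \<open>
  For a cocommutative coalgebra \<open>C\<close> the coalgebra maps \<open>C \<rightarrow> A\<close> form a group under convolution, and \<open>Reg(C, M)\<close>
  is a bimodule over it.  Pulling back along \<open>g\<^sub>1 \<otimes> \<dots> \<otimes> g\<^sub>n\<close>, composed with the iterated coproduct of \<open>C\<close>, turns
  \<open>f \<in> Reg(A\<^sup>\<otimes>\<^sup>n, M)\<close> into a function of the \<open>n\<close> group elements \<open>g\<^sub>i\<close>.  Under this translation \<open>\<sigma>\<close> becomes
  \<open>(x, y) \<mapsto> (y, y\<^sup>-\<^sup>1 x y)\<close>, \<open>\<delta>\<close> becomes the usual coboundary of group cohomology, and the two parts of \<open>\<rho>\<close> become
  differentials on functions of two blocks of group elements, the second block acting on the first by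
  conjugation.  For groups the theorem says that the signed sum over all shuffles commutes with the
  coboundaries; this follows by induction along the recursion of shuffles on their first letter.  Taking
  \<open>C = A\<^sup>\<otimes>\<^sup>n\<close> and for \<open>g\<^sub>i\<close> the \<open>i\<close>-th coordinate \<open>a\<^sup>1 \<otimes> \<dots> \<otimes> a\<^sup>n \<mapsto> \<Prod>\<^sub>j\<^sub>\<noteq>\<^sub>i \<epsilon>(a\<^sup>j) a\<^sup>i\<close> recovers \<open>f\<close>, so that identities
  between elements of \<open>Reg(A\<^sup>\<otimes>\<^sup>n, M)\<close> may be checked on group elements.
\<close>

subsection \<open>Group cohomology and shuffles\<close>

text \<open>Two features of the definitions shape the translation. The formulas for
  \<open>\<D>\<close> and \<open>\<d>\<close> split some letters into one leg more than the others,
  because a leg is spent on \<open>ad\<close>. Coassociativity absorbs the extra leg into a single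
  face map, after which every differential is a convolution product of faces. A face is awkward as a
  formula, but its pullback along a tuple is a pullback of the argument along a changed tuple,
  followed for outer faces by an action, and these are convolution homomorphisms. Since the
  coordinates recover the face itself, it preserves \<open>Reg\<close>; the same argument serves the
  composites with braids. Cocommutativity enters mostly through one interchange of legs,
  \<open>SWL_medial\<close>. The other feature is the arbitrary reduced word in
  \<open>T\<^sub>\<sigma>\<close>. No braid relation is proved: a shuffle is reached from the
  unshuffled word by as many swaps as it has inversions, so a reduced word can only contain swaps
  that create an inversion, and its effect on group elements depends on the shuffle alone. The
  square-zero laws are not inputs either; they too are read off from group elements.\<close>

definition sg :: "nat \<Rightarrow> 'n::ab_group_add \<Rightarrow> 'n"
  where "sg k x = (if even k then x else - x)"

lemma sg_0 [simp]: "sg 0 x = x" and sg_Suc: "sg (Suc k) x = - sg k x"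
  and sg_zero [simp]: "sg k 0 = 0"
  and sg_add: "sg k (x + y) = sg k x + sg k y"
  and sg_minus: "sg k (- x) = - sg k x"
  and sg_sg: "sg j (sg k x) = sg (j + k) x"
  and sg_sg_same [simp]: "sg k (sg k x) = x"
  by (auto simp: sg_def)

lemma sg_diff: "sg k (x - y) = sg k x - sg k y"
  by (simp add: sg_def)

lemma sg_commute: "sg j (sg k x) = sg k (sg j x)"
  by (simp add: sg_def)

lemma additive_sg: "additive h \<Longrightarrow> h (sg k x) = sg k (h x)"
  by (simp add: sg_def additive.minus)

text \<open>The inner faces of the bar coboundary with their signs, (-1)^i for the contraction of
  letters i and i + 1; \<open>bd_sum\<close> is the closed form. The group is written additively but
  need not commute. Recursion on the head fits the recursion of \<open>Sh\<close>.\<close>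

fun bd :: "('g::group_add list \<Rightarrow> 'n::ab_group_add) \<Rightarrow> 'g list \<Rightarrow> 'n"
  where
    "bd f (x # y # l) = - f ((x + y) # l) - bd (\<lambda>l. f (x # l)) (y # l)"
  | "bd f l = 0"

definition conjg :: "'g::group_add \<Rightarrow> 'g \<Rightarrow> 'g"
  where "conjg b a = - b + a + b"

lemma conjg_add: "conjg b (x + y) = conjg b x + conjg b y"
  by (simp add: conjg_def add.assoc)

lemma conjg_conjg: "conjg c (conjg b x) = conjg (b + c) x"
proof -
  have "- (b + c) = - c + - b" by (rule minus_add)
  then show ?thesis by (simp only: conjg_def add.assoc)
qed

lemma conjg_zero [simp]: "conjg 0 x = x"
  by (simp add: conjg_def)

text \<open>The braiding, which sends (a, b) to (b, \<open>conjg b a\<close>), preserves the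
  product. The cancellation between contractions and crossings rests on this.\<close>

lemma add_conjg: "b + conjg b a = a + b"
  by (simp add: conjg_def add.assoc)

lemma bd_cong: "(\<And>k. Suc (length k) = length l \<Longrightarrow> f k = f' k) \<Longrightarrow> bd f l = bd f' l"
  by (induct f l arbitrary: f' rule: bd.induct) auto

lemma bd_add: "bd (\<lambda>l. f l + f' l) l = bd f l + bd f' l"
  by (induct f l arbitrary: f' rule: bd.induct) auto

lemma bd_hom: "additive h \<Longrightarrow> bd (\<lambda>l. h (f l)) l = h (bd f l)"
  by (induct f l rule: bd.induct) (auto simp: additive.minus additive.diff additive.zero)

lemma bd_sg: "bd (\<lambda>l. sg k (f l)) l = sg k (bd f l)"
  by (intro bd_hom additive.intro sg_add)

lemma bd_minus: "bd (\<lambda>l. - f l) l = - bd f l"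
  by (intro bd_hom additive.intro) simp

lemma bd_map:
  assumes "\<And>x y. h (x + y) = h x + h y"
  shows "bd (\<lambda>l. f (map h l)) l = bd f (map h l)"
proof (induct l arbitrary: f rule: induct_list012)
  case (3 x y zs)
  then show ?case using 3(2)[of "\<lambda>l. f (h x # l)"] by (simp add: assms)
qed auto

lemma bd_fun: "bd f l z = bd (\<lambda>l. f l z) l"
  by (induct l arbitrary: f rule: induct_list012) auto

text \<open>Mirror image of the defining recursion, for the places where the right action peels off
  the last letter.\<close>

lemma bd_snoc:
  "bd f (l @ [x, y]) = bd (\<lambda>k. f (k @ [y])) (l @ [x]) + sg (Suc (length l)) (f (l @ [x + y]))"
proof (induct l arbitrary: f)
  case Nil
  show ?case by (simp add: sg_Suc)
next
  case (Cons a l)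
  show ?case
  proof (cases l)
    case Nil
    then show ?thesis by (simp add: sg_Suc)
  next
    case (Cons b l')
    then show ?thesis
      using Cons.hyps[of "\<lambda>l. f (a # l)"] by (simp add: sg_Suc)
  qed
qed

text \<open>Expressing \<open>bd f (x # l)\<close> through the function that adds \<open>x\<close>
  to the head of \<open>l\<close> makes the head contractions of the outer and the inner sum cancel;
  what remains is the claim for \<open>\<lambda>l. f (x # l)\<close> on a shorter list.\<close>

lemma bd_bd: "bd (bd f) l = 0"
proof (induct "length l" arbitrary: f l rule: less_induct)
  case less
  show ?case
  proof (cases "length l < 2")
    case True
    then show ?thesis by (cases l; cases "tl l") auto
  next
    case False
    then obtain x y k where 1: "l = x # y # k" by (cases l; cases "tl l") auto
    \<comment> \<open>\<open>hd\<close> and \<open>tl\<close> are harmless, since the outer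
      \<open>bd\<close> only evaluates lists with one letter fewer than \<open>y # k\<close>. For
      \<open>k = []\<close> it evaluates nothing, hence the separate case.\<close>
    have eq: "bd (\<lambda>l. bd f (x # l)) (y # k)
      = - bd (\<lambda>l. f ((x + hd l) # tl l)) (y # k) - bd (bd (\<lambda>l. f (x # l))) (y # k)"
    proof -
      have "bd (\<lambda>l. bd f (x # l)) (y # k)
        = bd (\<lambda>l. - f ((x + hd l) # tl l) + - bd (\<lambda>l. f (x # l)) l) (y # k)"
      proof (cases k)
        case Nil
        then show ?thesis by simp
      next
        case (Cons z k')
        show ?thesis
        proof (rule bd_cong)
          fix m :: "'b list" assume "Suc (length m) = length (y # k)"
          with Cons obtain u m' where "m = u # m'" by (cases m) auto
          then show "bd f (x # m) = - f ((x + hd m) # tl m) + - bd (\<lambda>l. f (x # l)) m" by simp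
        qed
      qed
      then show ?thesis by (simp only: bd_add bd_minus) simp
    qed
    have "bd (bd (\<lambda>l. f (x # l))) (y # k) = 0"
      using 1 by (intro less) auto
    moreover have "bd (\<lambda>l. f ((x + hd l) # tl l)) (y # k) = bd f ((x + y) # k)"
      by (cases k) (auto simp: add.assoc)
    ultimately show ?thesis using 1 eq by simp
  qed
qed

locale bimodule_action =
  fixes la ra :: "'g::group_add \<Rightarrow> 'n::ab_group_add \<Rightarrow> 'n"
  assumes la_add: "la g (x + y) = la g x + la g y"
    and ra_add: "ra g (x + y) = ra g x + ra g y"
    and la_la: "la g (la h x) = la (g + h) x"
    and ra_ra: "ra g (ra h x) = ra (h + g) x"
    and la_ra: "la g (ra h x) = ra h (la g x)"
begin

lemma additive_la: "additive (la g)" and additive_ra: "additive (ra g)"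
  by (auto intro: additive.intro la_add ra_add)

text \<open>The inhomogeneous coboundary with coefficients in a bimodule. An n-cochain is evaluated
  on n + 1 letters, so the sign (-1)^(n+1) of the last face reads
  \<open>sg (length l)\<close>.\<close>

definition hoch :: "('g list \<Rightarrow> 'n) \<Rightarrow> 'g list \<Rightarrow> 'n"
  where "hoch f l = la (hd l) (f (tl l)) + bd f l + sg (length l) (ra (last l) (f (butlast l)))"

lemma hoch_add: "hoch (\<lambda>l. f l + f' l) l = hoch f l + hoch f' l"
  by (simp add: hoch_def la_add ra_add bd_add sg_add)

lemma hoch_cong:
  assumes "\<And>k. Suc (length k) = length l \<Longrightarrow> f k = f' k" "l \<noteq> []"
  shows "hoch f l = hoch f' l"
proof -
  have "Suc (length (tl l)) = length l" "Suc (length (butlast l)) = length l"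
    using assms(2) by (cases l; simp)+
  then show ?thesis
    using assms(1) bd_cong[of l f f'] by (simp add: hoch_def)
qed

text \<open>The faces cancel in groups: inner ones among themselves by \<open>bd_bd\<close>, the
  head contraction against the iterated left action, the last contraction (isolated by
  \<open>bd_snoc\<close>) against the iterated right action, and left against right by
  \<open>la_ra\<close>.\<close>

lemma hoch_hoch: "hoch (hoch f) (x # y # l) = 0"
proof -
  have 1: "bd (\<lambda>l. la (hd l) (f (tl l))) (x # y # l)
      = - la (x + y) (f l) - la x (bd f (y # l))"
    by (simp add: bd_hom additive_la)
  obtain m u v where m: "x # y # l = m @ [u, v]"
  proof (cases "x # y # l" rule: rev_cases)
    case (snoc k v)
    with that show ?thesis by (cases k rule: rev_cases) auto
  qed simp
  have lm: "length (x # y # l) = Suc (Suc (length m))" by (simp add: m)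
  have 2: "bd (\<lambda>l. ra (last l) (f (butlast l))) (m @ [u, v])
      = ra v (bd f (m @ [u])) + sg (Suc (length m)) (ra (u + v) (f m))"
    by (subst bd_snoc) (simp add: bd_hom additive_ra)
  have 3: "bd (hoch f) (x # y # l) = bd (\<lambda>l. la (hd l) (f (tl l))) (x # y # l)
     + sg (Suc (length m)) (bd (\<lambda>l. ra (last l) (f (butlast l))) (x # y # l))"
  proof -
    have "bd (hoch f) (x # y # l)
       = bd (\<lambda>l. la (hd l) (f (tl l)) + bd f l + sg (Suc (length m)) (ra (last l) (f (butlast l)))) (x # y # l)"
      using lm by (intro bd_cong) (auto simp: hoch_def)
    then show ?thesis by (simp only: bd_add bd_sg bd_bd) simp
  qed
  have 4: "la x (hoch f (y # l)) = la (x + y) (f l) + la x (bd f (y # l))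
     + sg (Suc (length m)) (ra v (la x (f (butlast (y # l)))))"
  proof -
    have "last (y # l) = v" using m by (metis last_ConsR last_snoc list.distinct(1) append_butlast_last_id last_append)
    then show ?thesis using lm
      by (simp add: hoch_def la_add la_la additive_sg[OF additive_la] la_ra)
  qed
  have 5: "ra v (hoch f (m @ [u])) = ra v (la (hd (m @ [u])) (f (tl (m @ [u])))) + ra v (bd f (m @ [u]))
    + sg (Suc (length m)) (ra (u + v) (f m))"
    by (simp add: hoch_def ra_add ra_ra additive_sg[OF additive_ra])
  have 6: "hd (m @ [u]) = x" using m by (cases m) auto
  have 7: "tl (m @ [u]) = butlast (y # l)"
    using m by (metis butlast_append butlast.simps(2) butlast_tl list.distinct(1) list.sel(3) append_assoc append_Cons append_Nil butlast_snoc)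
  have "hoch (hoch f) (x # y # l) = la x (hoch f (y # l)) + bd (hoch f) (x # y # l)
     + sg (length (x # y # l)) (ra v (hoch f (m @ [u])))"
  proof -
    have "last (x # y # l) = v" "butlast (x # y # l) = m @ [u]" unfolding m by (auto simp: butlast_append)
    then show ?thesis unfolding hoch_def[of "hoch f"] by simp
  qed
  also have "\<dots> = 0"
    unfolding 3 4 5 1 lm 6 7 using 2 by (simp add: m sg_add sg_Suc sg_minus sg_diff del: butlast.simps)
  finally show ?thesis .
qed

text \<open>Conjugation by a fixed element is an endomorphism, so twisting the right action by it
  keeps the laws; \<open>dx\<close> at fixed \<open>bs\<close> is \<open>hoch\<close> for this
  action.\<close>

lemma bimodule_action_conj: "bimodule_action la (\<lambda>g. ra (conjg B g))"
  by unfold_locales (simp_all add: la_add ra_add la_la ra_ra la_ra conjg_add)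

text \<open>Conjugation is a right action, so conjugating the argument of a function is a left one;
  \<open>dy\<close> is \<open>hoch\<close> with coefficients in the functions of
  \<open>xs\<close>.\<close>

lemma bimodule_action_fun:
  "bimodule_action (\<lambda>b \<Phi> xs. la b (\<Phi> (map (conjg b) xs))) (\<lambda>b \<Phi> xs. ra b (\<Phi> xs))"
  by unfold_locales (simp_all add: fun_eq_iff la_add ra_add la_la ra_ra la_ra conjg_conjg o_def)

text \<open>
  For fixed \<open>bs\<close>, \<open>dx\<close> is the coboundary in \<open>xs\<close> with the right action twisted by the product of \<open>bs\<close>;
  for fixed \<open>xs\<close>, \<open>dy\<close> is the coboundary in \<open>bs\<close> for functions of \<open>xs\<close>, on which \<open>b\<close> also acts by conjugation.
\<close>

definition dx :: "('g list \<Rightarrow> 'g list \<Rightarrow> 'n) \<Rightarrow> 'g list \<Rightarrow> 'g list \<Rightarrow> 'n"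
  where "dx F xs bs = la (hd xs) (F (tl xs) bs) + bd (\<lambda>xs. F xs bs) xs
    + sg (length xs) (ra (conjg (sum_list bs) (last xs)) (F (butlast xs) bs))"

definition dy :: "('g list \<Rightarrow> 'g list \<Rightarrow> 'n) \<Rightarrow> 'g list \<Rightarrow> 'g list \<Rightarrow> 'n"
  where "dy F xs bs = la (hd bs) (F (map (conjg (hd bs)) xs) (tl bs)) + bd (F xs) bs
    + sg (length bs) (ra (last bs) (F xs (butlast bs)))"

text \<open>\<open>dx\<close> and \<open>dy\<close> commute; the sign in front of \<open>dy\<close>
  makes them anticommute, as in a total complex. The tests for empty lists leave out the summand
  whose source would have negative degree.\<close>

definition dtot :: "('g list \<Rightarrow> 'g list \<Rightarrow> 'n) \<Rightarrow> 'g list \<Rightarrow> 'g list \<Rightarrow> 'n"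
  where "dtot F xs bs = (if xs = [] then 0 else dx F xs bs)
    + (if bs = [] then 0 else sg (length xs) (dy F xs bs))"

lemma dx_dx: "dx (dx F) (x # y # xs) bs = 0"
proof -
  interpret B: bimodule_action la "\<lambda>g. ra (conjg (sum_list bs) g)" by (rule bimodule_action_conj)
  have "dx F xs bs = B.hoch (\<lambda>xs. F xs bs) xs" for F xs
    by (simp add: dx_def B.hoch_def)
  then show ?thesis using B.hoch_hoch by simp
qed

lemma dy_dy: "dy (dy F) xs (b # c # bs) = 0"
proof -
  interpret B: bimodule_action "\<lambda>b \<Phi> xs. la b (\<Phi> (map (conjg b) xs))" "\<lambda>b \<Phi> xs. ra b (\<Phi> xs)"
    by (rule bimodule_action_fun)
  have eq: "dy F xs bs = B.hoch (\<lambda>bs xs. F xs bs) bs xs" for F xs bs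
    by (simp add: dy_def B.hoch_def bd_fun) (simp add: sg_def)
  have "dy (dy F) xs (b # c # bs) = B.hoch (B.hoch (\<lambda>bs xs. F xs bs)) (b # c # bs) xs"
    unfolding eq[of "dy F"] by (simp add: eq)
  then show ?thesis by (simp add: B.hoch_hoch)
qed

lemma dx_add: "dx (\<lambda>xs bs. F xs bs + F' xs bs) xs bs = dx F xs bs + dx F' xs bs"
  by (simp add: dx_def la_add ra_add bd_add sg_add)

lemma bd_bd_commute: "bd (\<lambda>xs. bd (F xs) bs) xs = bd (\<lambda>bs. bd (\<lambda>xs. F xs bs) xs) bs"
proof (induct "\<lambda>xs. bd (F xs) bs" xs arbitrary: F rule: bd.induct)
  case (1 x y l)
  have "bd (\<lambda>bs. bd (\<lambda>xs. F xs bs) (x # y # l)) bs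
    = bd (\<lambda>bs. - F ((x + y) # l) bs + - bd (\<lambda>xs. F (x # xs) bs) (y # l)) bs" by simp
  also have "\<dots> = - bd (F ((x + y) # l)) bs + - bd (\<lambda>bs. bd (\<lambda>xs. F (x # xs) bs) (y # l)) bs"
    by (simp only: bd_add bd_minus)
  finally show ?case using 1[of "\<lambda>xs. F (x # xs)"] by simp
qed (simp_all add: bd_hom[where h = "\<lambda>_. 0"] additive_def)

text \<open>Contracting two neighbours leaves \<open>sum_list bs\<close> unchanged, so a twist by it
  passes out of \<open>bd\<close>. The parameter \<open>c\<close> collects the letters already
  passed in the recursion.\<close>

lemma bd_sum_list:
  "bd (\<lambda>bs. ra (conjg (c + sum_list bs) z) (F bs)) bs = ra (conjg (c + sum_list bs) z) (bd F bs)"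
proof (induct F bs arbitrary: c rule: bd.induct)
  case (1 f x y l)
  show ?case using 1[of "c + x"]
    by (simp add: additive.diff[OF additive_ra] additive.minus[OF additive_ra] add.assoc)
qed (simp_all add: additive.zero[OF additive_ra])

text \<open>\<open>dy\<close> is split into its left, inner and right faces. The left face
  conjugates \<open>xs\<close> by the first letter of \<open>bs\<close> and removes that letter from
  \<open>bs\<close>, so the twist of the last letter by the whole of \<open>bs\<close> is
  unaffected. In the right face the twisted right action moves past \<open>last bs\<close> by
  \<open>add_conjg\<close>.\<close>

lemma dx_dy_commute:
  assumes "xs \<noteq> []" "bs \<noteq> []"
  shows "dx (dy F) xs bs = dy (dx F) xs bs"
proof -
  obtain b bs' where bs: "bs = b # bs'" using assms by (cases bs) auto
  obtain x xs' where xs: "xs = x # xs'" using assms by (cases xs) auto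
  have lastb: "sum_list bs = sum_list (butlast bs) + last bs"
    using assms(2) by (metis append_butlast_last_id sum_list.append sum_list.Cons sum_list.Nil add.right_neutral)
  have 1: "dx (\<lambda>xs bs. la (hd bs) (F (map (conjg (hd bs)) xs) (tl bs))) xs bs
     = la b (dx F (map (conjg b) xs) bs')"
  proof -
    have "bd (\<lambda>xs. F (map (conjg b) xs) bs') xs = bd (\<lambda>xs. F xs bs') (map (conjg b) xs)"
      by (rule bd_map) (rule conjg_add)
    moreover have "last (map (conjg b) xs) = conjg b (last xs)"
      by (rule last_map) fact
    ultimately show ?thesis
      by (simp add: bs dx_def la_add la_la additive_sg[OF additive_la] bd_hom[OF additive_la]
          hd_map[OF assms(1)] map_tl add_conjg la_ra map_butlast conjg_conjg)
  qed
  have 2: "dx (\<lambda>xs bs. bd (F xs) bs) xs bs = bd (dx F xs) bs"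
  proof -
    have "bd (dx F xs) bs = bd (\<lambda>bs. la (hd xs) (F (tl xs) bs)) bs + bd (\<lambda>bs. bd (\<lambda>xs. F xs bs) xs) bs
       + sg (length xs) (bd (\<lambda>bs. ra (conjg (sum_list bs) (last xs)) (F (butlast xs) bs)) bs)"
      by (simp add: dx_def[abs_def] bd_add bd_sg)
    then show ?thesis
      using bd_sum_list[of 0 "last xs" "F (butlast xs)" bs]
      by (simp add: dx_def bd_bd_commute[of F bs xs] bd_hom[OF additive_la])
  qed
  have 3: "dx (\<lambda>xs bs. sg (length bs) (ra (last bs) (F xs (butlast bs)))) xs bs
     = sg (length bs) (ra (last bs) (dx F xs (butlast bs)))"
  proof -
    have "ra (conjg (sum_list bs) z) (ra (last bs) w) = ra (last bs) (ra (conjg (sum_list (butlast bs)) z) w)" for z w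
      unfolding lastb ra_ra by (simp add: conjg_conjg[symmetric] add_conjg)
    then show ?thesis
      by (simp add: dx_def ra_add sg_add additive_sg[OF additive_la] additive_sg[OF additive_ra] la_ra
         bd_sg bd_hom[OF additive_ra] sg_commute)
  qed
  have "dx (dy F) xs bs = dx (\<lambda>xs bs. la (hd bs) (F (map (conjg (hd bs)) xs) (tl bs))) xs bs
     + dx (\<lambda>xs bs. bd (F xs) bs) xs bs + dx (\<lambda>xs bs. sg (length bs) (ra (last bs) (F xs (butlast bs)))) xs bs"
    unfolding dy_def[abs_def] by (simp only: dx_add)
  also have "\<dots> = dy (dx F) xs bs" unfolding 1 2 3 by (simp add: dy_def bs)
  finally show ?thesis .
qed

lemma dx_cong:
  assumes "\<And>k. Suc (length k) = length xs \<Longrightarrow> F k bs = F' k bs" "xs \<noteq> []"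
  shows "dx F xs bs = dx F' xs bs"
proof -
  have "Suc (length (tl xs)) = length xs" "Suc (length (butlast xs)) = length xs"
    using assms(2) by (cases xs; simp)+
  then show ?thesis
    using assms(1) bd_cong[of xs "\<lambda>xs. F xs bs" "\<lambda>xs. F' xs bs"] by (simp add: dx_def)
qed

lemma dy_cong:
  assumes "\<And>ks k. length ks = length xs \<Longrightarrow> Suc (length k) = length bs \<Longrightarrow> F ks k = F' ks k" "bs \<noteq> []"
  shows "dy F xs bs = dy F' xs bs"
proof -
  have "Suc (length (tl bs)) = length bs" "Suc (length (butlast bs)) = length bs"
    using assms(2) by (cases bs; simp)+
  then show ?thesis
    using assms(1) bd_cong[of bs "F xs" "F' xs"] by (simp add: dy_def)
qed

lemma dtot_cong:
  assumes "\<And>ks k. Suc (length ks + length k) = length xs + length bs \<Longrightarrow> F ks k = F' ks k"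
  shows "dtot F xs bs = dtot F' xs bs"
  using dx_cong[of xs F bs F'] dy_cong[of xs bs F F'] assms by (simp add: dtot_def)

lemma dy_add: "dy (\<lambda>xs bs. F xs bs + F' xs bs) xs bs = dy F xs bs + dy F' xs bs"
  by (simp add: dy_def la_add ra_add bd_add sg_add)

lemma dx_sg: "dx (\<lambda>xs bs. sg k (F xs bs)) xs bs = sg k (dx F xs bs)"
  by (simp add: dx_def sg_add additive_sg[OF additive_la] additive_sg[OF additive_ra] bd_sg sg_commute)

lemma dy_sg: "dy (\<lambda>xs bs. sg k (F xs bs)) xs bs = sg k (dy F xs bs)"
  by (simp add: dy_def sg_add additive_sg[OF additive_la] additive_sg[OF additive_ra] bd_sg sg_commute)

lemma dtot_dtot:
  assumes "length xs + length bs \<ge> 2"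
  shows "dtot (dtot F) xs bs = 0"
proof -
  let ?X = "\<lambda>xs bs. if xs = [] then 0 else dx F xs bs"
  let ?Y = "\<lambda>xs bs. if bs = [] then 0 else sg (length xs) (dy F xs bs)"
  have dt: "dtot F = (\<lambda>xs bs. ?X xs bs + ?Y xs bs)" by (simp add: dtot_def fun_eq_iff)
  have xx: "dx ?X xs bs = 0" if "xs \<noteq> []"
  proof (cases "tl xs")
    case Nil
    with that obtain x where "xs = [x]" by (cases xs) auto
    then show ?thesis by (simp add: dx_def additive.zero[OF additive_la] additive.zero[OF additive_ra])
  next
    case (Cons y ys)
    with that obtain x where x: "xs = x # y # ys" by (cases xs) auto
    have "dx ?X xs bs = dx (dx F) xs bs"
      using x by (intro dx_cong) auto
    then show ?thesis by (simp add: x dx_dx)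
  qed
  have yy: "dy ?Y xs bs = 0" if "bs \<noteq> []"
  proof (cases "tl bs")
    case Nil
    with that obtain x where "bs = [x]" by (cases bs) auto
    then show ?thesis by (simp add: dy_def additive.zero[OF additive_la] additive.zero[OF additive_ra])
  next
    case (Cons y ys)
    with that obtain x where x: "bs = x # y # ys" by (cases bs) auto
    have "dy ?Y xs bs = dy (\<lambda>ks k. sg (length xs) (dy F ks k)) xs bs"
      using x by (intro dy_cong) auto
    then show ?thesis by (simp add: x dy_dy dy_sg)
  qed
  \<comment> \<open>Inside \<open>dx\<close> the first block has one letter fewer, so the sign in
    front of \<open>dy\<close> flips; this turns commuting into cancelling.\<close>
  have xy: "dx ?Y xs bs + sg (length xs) (dy ?X xs bs) = 0" if "xs \<noteq> []" "bs \<noteq> []"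
  proof -
    from \<open>xs \<noteq> []\<close> obtain k where k: "length xs = Suc k" by (cases xs) auto
    have "dx ?Y xs bs = dx (\<lambda>xs bs. sg k (dy F xs bs)) xs bs"
      using that k by (intro dx_cong) auto
    moreover have "dy ?X xs bs = dy (dx F) xs bs"
      using that by (intro dy_cong) auto
    ultimately show ?thesis by (simp add: dx_sg dx_dy_commute[OF that] k sg_Suc)
  qed
  have "dx ?Y xs [] = 0" "dy ?X [] bs = 0"
    by (simp_all add: dx_def dy_def additive.zero[OF additive_la] additive.zero[OF additive_ra]
      bd_hom[where h = "\<lambda>_. 0"] additive_def)
  then show ?thesis
    using xx yy xy unfolding dt dtot_def[of "\<lambda>xs bs. ?X xs bs + ?Y xs bs"] dx_add dy_add
    by (cases "xs = []"; cases "bs = []") (simp_all add: sg_add algebra_simps)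
qed

end

text \<open>The signed sum of \<open>f\<close> over all shuffles, expanded along the first letter of
  the result. A letter \<open>b\<close> taken from the second block crosses all of the first: this
  costs the sign and conjugates the crossed letters, as the braiding does.\<close>

fun Sh :: "('g::group_add list \<Rightarrow> 'n::ab_group_add) \<Rightarrow> 'g list \<Rightarrow> 'g list \<Rightarrow> 'n"
  where
    "Sh f [] bs = f bs"
  | "Sh f (a # as) [] = f (a # as)"
  | "Sh f (a # as) (b # bs) = Sh (\<lambda>l. f (a # l)) as (b # bs)
       + sg (Suc (length as)) (Sh (\<lambda>l. f (b # l)) (map (conjg b) (a # as)) bs)"

lemma Sh_Nil [simp]: "Sh f as [] = f as"
  by (cases as) auto

lemma Sh_cong:
  "(\<And>l. length l = length as + length bs \<Longrightarrow> f l = f' l) \<Longrightarrow> Sh f as bs = Sh f' as bs"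
proof (induct f as bs arbitrary: f' rule: Sh.induct)
  case (3 f a as b bs)
  show ?case
    using "3.hyps"(1)[of "\<lambda>l. f' (a # l)"] "3.hyps"(2)[of "\<lambda>l. f' (b # l)"] 3(3) by simp
qed auto

lemma Sh_hom: "additive h \<Longrightarrow> Sh (\<lambda>l. h (f l)) as bs = h (Sh f as bs)"
  by (induct f as bs rule: Sh.induct) (auto simp: additive.add additive_sg)

lemma Sh_add: "Sh (\<lambda>l. f l + f' l) as bs = Sh f as bs + Sh f' as bs"
  by (induct f as bs arbitrary: f' rule: Sh.induct) (auto simp: sg_add)

lemma Sh_minus: "Sh (\<lambda>l. - f l) as bs = - Sh f as bs"
  by (intro Sh_hom additive.intro) simp

lemma Sh_sg: "Sh (\<lambda>l. sg k (f l)) as bs = sg k (Sh f as bs)"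
  by (intro Sh_hom additive.intro sg_add)

text \<open>Contractions within one block give the right-hand side. Contractions of one letter from
  each block cancel: the shuffles with \<open>a\<close> directly before \<open>b\<close> and those
  with \<open>b\<close> directly before \<open>conjg b a\<close> yield the same sum
  \<open>a + b\<close>, with opposite signs.\<close>

lemma Sh_bd: "Sh (bd f) as bs = bd (\<lambda>as. Sh f as bs) as + sg (length as) (bd (Sh f as) bs)"
proof (induct f as bs rule: Sh.induct)
  case (1 f bs)
  show ?case by simp
next
  case (2 f a as)
  show ?case by simp
next
  case (3 f a as b bs)
  \<comment> \<open>\<open>?m c\<close> contracts a new first letter \<open>c\<close> with the
    letter after it; \<open>bd1\<close> separates this contraction from the later ones.\<close>
  let ?fa = "\<lambda>l. f (a # l)" and ?fb = "\<lambda>l. f (b # l)" and ?m = "\<lambda>c l. f ((c + hd l) # tl l)"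
  let ?as = "map (conjg b) (a # as)"
  have bd1: "bd f (c # l) = - ?m c l + - bd (\<lambda>l. f (c # l)) l" if "l \<noteq> []" for c l
    using that by (cases l) auto
  have T1: "Sh (\<lambda>l. bd f (a # l)) as (b # bs) = - Sh (?m a) as (b # bs) - Sh (bd ?fa) as (b # bs)"
  proof -
    have "Sh (\<lambda>l. bd f (a # l)) as (b # bs) = Sh (\<lambda>l. - ?m a l + - bd ?fa l) as (b # bs)"
      by (intro Sh_cong bd1) auto
    then show ?thesis by (simp only: Sh_add Sh_minus) simp
  qed
  have T2: "Sh (\<lambda>l. bd f (b # l)) ?as bs = - Sh (?m b) ?as bs - Sh (bd ?fb) ?as bs"
  proof -
    have "Sh (\<lambda>l. bd f (b # l)) ?as bs = Sh (\<lambda>l. - ?m b l + - bd ?fb l) ?as bs"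
      by (intro Sh_cong bd1) auto
    then show ?thesis by (simp only: Sh_add Sh_minus) simp
  qed
  have IH1: "Sh (bd ?fa) as (b # bs) = bd (\<lambda>as. Sh ?fa as (b # bs)) as + sg (length as) (bd (Sh ?fa as) (b # bs))"
    by (rule 3(1))
  have IH2: "Sh (bd ?fb) ?as bs = bd (\<lambda>as. Sh ?fb as bs) ?as + sg (Suc (length as)) (bd (Sh ?fb ?as) bs)"
    using 3(2) by simp
  have A: "bd (\<lambda>as. Sh f as (b # bs)) (a # as) =
     - (if as = [] then 0 else Sh f ((a + hd as) # tl as) (b # bs) + bd (\<lambda>as. Sh ?fa as (b # bs)) as
         + sg (length as) (bd (\<lambda>as. Sh ?fb (map (conjg b) (a # as)) bs) as))"
  proof (cases as)
    case Nil
    then show ?thesis by simp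
  next
    case (Cons a' as')
    have "bd (\<lambda>as. Sh f (a # as) (b # bs)) as
      = bd (\<lambda>k. Sh ?fa k (b # bs) + sg (length as) (Sh ?fb (map (conjg b) (a # k)) bs)) as"
      by (intro bd_cong) auto
    then show ?thesis using Cons by (simp add: bd_add bd_sg del: Sh.simps)
  qed
  have A': "bd (\<lambda>as. Sh ?fb as bs) ?as = (if as = [] then 0 else
     - Sh ?fb (map (conjg b) ((a + hd as) # tl as)) bs - bd (\<lambda>as. Sh ?fb (map (conjg b) (a # as)) bs) as)"
  proof (cases as)
    case (Cons a' as')
    have "bd (\<lambda>l. Sh ?fb (map (conjg b) (a # l)) bs) (a' # as') = bd (\<lambda>l. Sh ?fb (conjg b a # l) bs) (map (conjg b) (a' # as'))"
      using bd_map[of "conjg b" "\<lambda>l. Sh ?fb (conjg b a # l) bs" "a' # as'", OF conjg_add] by simp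
    then show ?thesis by (simp add: Cons conjg_add)
  qed simp
  have B: "bd (Sh f (a # as)) (b # bs) = (if bs = [] then 0 else
      - Sh f (a # as) ((b + hd bs) # tl bs) - bd (\<lambda>bs. Sh f (a # as) (b # bs)) bs)"
    by (cases bs) simp_all
  have B1: "bd (\<lambda>bs. Sh f (a # as) (b # bs)) bs = bd (\<lambda>bs. Sh ?fa as (b # bs)) bs
      + sg (Suc (length as)) (bd (Sh ?fb ?as) bs)"
    by (simp add: bd_add bd_sg)
  have B2: "bd (Sh ?fa as) (b # bs) = (if bs = [] then 0 else
      - Sh ?fa as ((b + hd bs) # tl bs) - bd (\<lambda>bs. Sh ?fa as (b # bs)) bs)"
    by (cases bs) simp_all
  \<comment> \<open>The terms in which \<open>a\<close> and \<open>b\<close> are contracted appear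
    here and in \<open>D\<close>; they cancel in the final simplification.\<close>
  have C: "Sh (?m a) as (b # bs) = (if as = [] then f ((a + b) # bs) else
     Sh f ((a + hd as) # tl as) (b # bs) - sg (length as) (Sh ?fb (map (conjg b) ((a + hd as) # tl as)) bs)
      + sg (length as) (Sh (\<lambda>l. f ((a + b) # l)) (map (conjg b) as) bs))"
    by (cases as) (simp_all add: sg_Suc)
  have D: "Sh (?m b) ?as bs = (if bs = [] then f ((a + b) # map (conjg b) as) else
     Sh (\<lambda>l. f ((a + b) # l)) (map (conjg b) as) bs
      + sg (Suc (length as)) (Sh (\<lambda>l. f ((b + hd bs) # l)) (map (conjg (b + hd bs)) (a # as)) (tl bs)))"
    by (cases bs) (simp_all add: sg_Suc add_conjg conjg_conjg o_def)
  have E: "Sh f (a # as) ((b + hd bs) # tl bs) = Sh ?fa as ((b + hd bs) # tl bs)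
     + sg (Suc (length as)) (Sh (\<lambda>l. f ((b + hd bs) # l)) (map (conjg (b + hd bs)) (a # as)) (tl bs))"
    by simp
  have L: "Sh (bd f) (a # as) (b # bs) = Sh (\<lambda>l. bd f (a # l)) as (b # bs)
     + sg (Suc (length as)) (Sh (\<lambda>l. bd f (b # l)) ?as bs)" by simp
  show ?case
    unfolding L T1 T2 IH1 IH2 A A' B B1 B2 C D
    unfolding E
    by (cases "as = []"; cases "bs = []")
      (simp_all add: sg_Suc sg_diff sg_minus sg_add del: Sh.simps(3) list.map(2))
qed

context bimodule_action
begin

lemma Sh_left:
  assumes "as \<noteq> [] \<or> bs \<noteq> []"
  shows "Sh (\<lambda>l. la (hd l) (f (tl l))) as bs = (if as = [] then 0 else la (hd as) (Sh f (tl as) bs))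
    + (if bs = [] then 0 else sg (length as) (la (hd bs) (Sh f (map (conjg (hd bs)) as) (tl bs))))"
  using assms by (cases as; cases bs) (simp_all add: Sh_hom[OF additive_la])

text \<open>A last letter from the first block has been crossed by all of \<open>bs\<close>, hence
  its conjugation by \<open>sum_list bs\<close> and the sign. This is the origin of the twist in
  \<open>dx\<close>.\<close>

lemma Sh_right:
  assumes "as \<noteq> [] \<or> bs \<noteq> []"
  shows "Sh (\<lambda>l. ra (last l) (f (butlast l))) as bs
    = (if as = [] then 0 else sg (length bs) (ra (conjg (sum_list bs) (last as)) (Sh f (butlast as) bs)))
    + (if bs = [] then 0 else ra (last bs) (Sh f as (butlast bs)))"
  using assms
proof (induct f as bs rule: Sh.induct)
  case (3 f a as b bs)
  have *: "(\<lambda>l. ra (last (c # l)) (f (butlast (c # l)))) l = (\<lambda>l. ra (last l) (f (c # butlast l))) l"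
    if "l \<noteq> []" for c l using that by simp
  have 1: "Sh (\<lambda>l. ra (last (a # l)) (f (butlast (a # l)))) as (b # bs)
      = Sh (\<lambda>l. ra (last l) (f (a # butlast l))) as (b # bs)"
    by (intro Sh_cong *) auto
  have 2: "Sh (\<lambda>l. ra (last (b # l)) (f (butlast (b # l)))) (map (conjg b) (a # as)) bs
      = Sh (\<lambda>l. ra (last l) (f (b # butlast l))) (map (conjg b) (a # as)) bs"
    by (intro Sh_cong *) auto
  have L: "Sh (\<lambda>l. ra (last l) (f (butlast l))) (a # as) (b # bs) =
     Sh (\<lambda>l. ra (last l) (f (a # butlast l))) as (b # bs)
     + sg (Suc (length as)) (Sh (\<lambda>l. ra (last l) (f (b # butlast l))) (map (conjg b) (a # as)) bs)"
    using 1 2 by simp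
  have IH1: "Sh (\<lambda>l. ra (last l) (f (a # butlast l))) as (b # bs) =
     (if as = [] then 0 else sg (Suc (length bs)) (ra (conjg (sum_list (b # bs)) (last as)) (Sh (\<lambda>l. f (a # l)) (butlast as) (b # bs))))
    + ra (last (b # bs)) (Sh (\<lambda>l. f (a # l)) as (butlast (b # bs)))"
    using 3(1) by simp
  have IH2: "Sh (\<lambda>l. ra (last l) (f (b # butlast l))) (map (conjg b) (a # as)) bs =
     sg (length bs) (ra (conjg (sum_list (b # bs)) (last (a # as))) (Sh (\<lambda>l. f (b # l)) (map (conjg b) (butlast (a # as))) bs))
    + (if bs = [] then 0 else ra (last bs) (Sh (\<lambda>l. f (b # l)) (map (conjg b) (a # as)) (butlast bs)))"
  proof -
    have "last (map (conjg b) (a # as)) = conjg b (last (a # as))" by (rule last_map) simp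
    then show ?thesis using 3(2) by (simp only: map_butlast) (simp add: conjg_conjg)
  qed
  show ?case
  proof (cases "as = []")
    case True
    then show ?thesis unfolding L IH1 IH2
      by (cases bs) (simp_all add: sg_add ra_add sg_sg additive_sg[OF additive_ra] sg_Suc additive.minus[OF additive_ra] additive.diff[OF additive_ra] sg_minus)
  next
    case False
    then obtain k where "length as = Suc k" by (cases as) auto
    then show ?thesis using False unfolding L IH1 IH2
      by (cases bs; simp add: sg_add ra_add sg_sg additive_sg[OF additive_ra] sg_Suc additive.minus[OF additive_ra]
          additive.diff[OF additive_ra] sg_minus sg_diff; auto simp: sg_def)
  qed
qed auto

text \<open>The theorem for groups: shuffling matches the left, inner and right faces of the
  coboundary with those of \<open>dx\<close> and \<open>dy\<close>, and crossing the first block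
  produces the sign of \<open>dtot\<close>.\<close>

theorem Sh_hoch:
  assumes "as \<noteq> [] \<or> bs \<noteq> []"
  shows "Sh (hoch f) as bs = dtot (Sh f) as bs"
proof -
  have "Sh (hoch f) as bs = Sh (\<lambda>l. la (hd l) (f (tl l)) + bd f l
      + sg (length as + length bs) (ra (last l) (f (butlast l)))) as bs"
    by (intro Sh_cong) (auto simp: hoch_def)
  also have "\<dots> = Sh (\<lambda>l. la (hd l) (f (tl l))) as bs + Sh (bd f) as bs
     + sg (length as + length bs) (Sh (\<lambda>l. ra (last l) (f (butlast l))) as bs)"
    by (simp only: Sh_add Sh_sg)
  moreover have "sg (p + q) (sg q x) = sg p x" for p q and x :: 'n
    by (simp add: sg_def)
  ultimately show ?thesis
    unfolding Sh_left[OF assms] Sh_right[OF assms] Sh_bd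
    by (cases "as = []"; cases "bs = []") (simp_all add: dtot_def dx_def dy_def sg_add sg_sg add_ac)
qed

end

section \<open>Linear maps between spaces with explicit scalar multiplications\<close>

abbreviation lin where "lin \<equiv> Vector_Spaces.linear"

lemma lin_iff:
  "lin s1 s2 f \<longleftrightarrow> vector_space s1 \<and> vector_space s2 \<and> (\<forall>x y. f (x + y) = f x + f y)
    \<and> (\<forall>c x. f (s1 c x) = s2 c (f x))"
  by (auto simp: Vector_Spaces.linear_def module_hom_def module_hom_axioms_def module_iff_vector_space)

lemma lin_comp: "lin s1 s2 f \<Longrightarrow> lin s2 s3 h \<Longrightarrow> lin s1 s3 (\<lambda>x. h (f x))"
  by (simp add: lin_iff)

lemma lin_additive: "lin s1 s2 f \<Longrightarrow> additive f"
  by (simp add: lin_iff additive_def)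

lemma additive_sum_list: "additive h \<Longrightarrow> h (\<Sum>x\<leftarrow>xs. f x) = (\<Sum>x\<leftarrow>xs. h (f x))"
  by (induct xs) (auto simp: additive.zero additive.add)

lemma scale_zero_right: "vector_space s \<Longrightarrow> s c 0 = 0"
  by (simp add: module.scale_zero_right flip: module_iff_vector_space)

lemma lin_zero: "vector_space s1 \<Longrightarrow> vector_space s2 \<Longrightarrow> lin s1 s2 (\<lambda>_. 0)"
  by (simp add: lin_iff scale_zero_right)

lemma lin_add: "lin s1 s2 f \<Longrightarrow> lin s1 s2 g \<Longrightarrow> lin s1 s2 (\<lambda>x. f x + g x)"
  by (simp add: lin_iff vector_space_def algebra_simps)

lemma lin_sum_list:
  assumes "vector_space s1" "vector_space s2" "\<And>z. z \<in> set zs \<Longrightarrow> lin s1 s2 (f z)"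
  shows "lin s1 s2 (\<lambda>x. \<Sum>z\<leftarrow>zs. f z x)"
  using assms(3) by (induct zs) (auto simp: lin_zero assms(1,2) lin_add)

lemma lin_scale: "vector_space s \<Longrightarrow> lin s s (s c)"
  by (simp add: lin_iff vector_space_def mult.commute)

lemma lin_scale_left: "vector_space s \<Longrightarrow> lin s1 (*) f \<Longrightarrow> lin s1 s (\<lambda>x. s (f x) w)"
  by (simp add: lin_iff vector_space_def)

lemma sum_list_swap:
  fixes f :: "'x \<Rightarrow> 'y \<Rightarrow> 'w::comm_monoid_add"
  shows "(\<Sum>x\<leftarrow>xs. \<Sum>y\<leftarrow>ys. f x y) = (\<Sum>y\<leftarrow>ys. \<Sum>x\<leftarrow>xs. f x y)"
  by (induct xs) (auto simp: sum_list_addf)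

subsection \<open>Multilinear maps\<close>

lemma multilinear_cong:
  "(\<And>xs. length xs = n \<Longrightarrow> g xs = g' xs) \<Longrightarrow> multilinear sV sW n g = multilinear sV sW n g'"
  by (simp add: multilinear_def)

lemma multilinear_0 [simp]: "multilinear sV sW 0 g"
  by (simp add: multilinear_def)

text \<open>Sweedler sums are built letter by letter, so inductions use this recursive form of
  multilinearity.\<close>

lemma multilinear_Suc:
  "multilinear sV sW (Suc n) g \<longleftrightarrow> (\<forall>as. length as = n \<longrightarrow> lin sV sW (\<lambda>a. g (a # as)))
    \<and> (\<forall>a. multilinear sV sW n (\<lambda>as. g (a # as)))"
proof (intro iffI conjI allI impI)
  assume m: "multilinear sV sW (Suc n) g"
  fix as :: "'b list" assume "length as = n"
  then show "lin sV sW (\<lambda>a. g (a # as))"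
    using m[unfolded multilinear_def, rule_format, of "undefined # as" 0] by simp
next
  assume m: "multilinear sV sW (Suc n) g"
  fix a show "multilinear sV sW n (\<lambda>as. g (a # as))"
    unfolding multilinear_def using m[unfolded multilinear_def, rule_format, of "a # xs" "Suc i" for xs i] by simp
next
  assume m: "(\<forall>as. length as = n \<longrightarrow> lin sV sW (\<lambda>a. g (a # as))) \<and> (\<forall>a. multilinear sV sW n (\<lambda>as. g (a # as)))"
  show "multilinear sV sW (Suc n) g"
    unfolding multilinear_def
  proof (intro allI impI)
    fix xs :: "'b list" and i assume "length xs = Suc n" "i < Suc n"
    then obtain a as where "xs = a # as" "length as = n" by (cases xs) auto
    then show "lin sV sW (\<lambda>x. g (xs[i := x]))"
      using m \<open>i < Suc n\<close> by (cases i) (auto simp: multilinear_def)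
  qed
qed

lemma multilinear_SucI:
  "(\<And>as. length as = n \<Longrightarrow> lin sV sW (\<lambda>a. g (a # as))) \<Longrightarrow> (\<And>a. multilinear sV sW n (\<lambda>as. g (a # as)))
    \<Longrightarrow> multilinear sV sW (Suc n) g"
  by (simp add: multilinear_Suc)

lemma multilinear_append:
  "multilinear sV sW (m + n) g \<longleftrightarrow> (\<forall>ys. length ys = n \<longrightarrow> multilinear sV sW m (\<lambda>xs. g (xs @ ys)))
    \<and> (\<forall>xs. length xs = m \<longrightarrow> multilinear sV sW n (\<lambda>ys. g (xs @ ys)))"
proof (induct m arbitrary: g)
  case 0
  then show ?case by simp
next
  case (Suc m)
  show ?case
  proof (intro iffI conjI allI impI; (elim conjE)?)
    assume m: "multilinear sV sW (Suc m + n) g"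
    { fix ys :: "'b list" assume ys: "length ys = n"
      show "multilinear sV sW (Suc m) (\<lambda>xs. g (xs @ ys))"
        using m ys Suc[of "\<lambda>as. g (a # as)" for a] by (auto simp: multilinear_Suc) }
    fix xs :: "'b list" assume xs: "length xs = Suc m"
    show "multilinear sV sW n (\<lambda>ys. g (xs @ ys))"
      using m xs Suc[of "\<lambda>as. g (a # as)" for a] by (cases xs) (auto simp: multilinear_Suc)
  next
    assume 1: "\<forall>ys. length ys = n \<longrightarrow> multilinear sV sW (Suc m) (\<lambda>xs. g (xs @ ys))"
      and 2: "\<forall>xs. length xs = Suc m \<longrightarrow> multilinear sV sW n (\<lambda>ys. g (xs @ ys))"
    have "multilinear sV sW (Suc (m + n)) g"
    proof (rule multilinear_SucI)
      fix as :: "'b list" assume as: "length as = m + n"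
      have "lin sV sW (\<lambda>a. g ((a # take m as) @ drop m as))"
        using as 1[rule_format, of "drop m as"] unfolding multilinear_Suc by (auto dest: spec[of _ "take m as"])
      then show "lin sV sW (\<lambda>a. g (a # as))" by simp
    next
      fix a
      show "multilinear sV sW (m + n) (\<lambda>as. g (a # as))"
        unfolding Suc
      proof (intro conjI allI impI)
        fix ys :: "'b list" assume "length ys = n"
        then show "multilinear sV sW m (\<lambda>xs. g (a # xs @ ys))"
          using 1 by (simp add: multilinear_Suc)
      next
        fix xs :: "'b list" assume "length xs = m"
        then show "multilinear sV sW n (\<lambda>ys. g (a # xs @ ys))"
          using 2[rule_format, of "a # xs"] by simp
      qed
    qed
    then show "multilinear sV sW (Suc m + n) g" by simp
  qed
qed

lemma multilinear_comp: "lin sW sX h \<Longrightarrow> multilinear sV sW n g \<Longrightarrow> multilinear sV sX n (\<lambda>l. h (g l))"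
  by (simp add: multilinear_def lin_iff)

lemma multilinear_sum_list:
  "vector_space sV \<Longrightarrow> vector_space sW \<Longrightarrow> (\<And>z. z \<in> set zs \<Longrightarrow> multilinear sV sW n (g z))
    \<Longrightarrow> multilinear sV sW n (\<lambda>l. \<Sum>z\<leftarrow>zs. g z l)"
  by (auto simp: multilinear_def intro!: lin_sum_list)

lemma multilinear_map2:
  assumes "\<And>b. lin sV sV (h b)" "multilinear sV sW n g" "length bs = n"
  shows "multilinear sV sW n (\<lambda>as. g (map2 h bs as))"
  using assms(2,3)
proof (induct bs arbitrary: n g)
  case (Cons b bs)
  then obtain m where m: "n = Suc m" "length bs = m" by auto
  show ?case
    unfolding m(1)
  proof (rule multilinear_SucI)
    fix as :: "'c list" assume "length as = m"
    then show "lin sV sW (\<lambda>a. g (map2 h (b # bs) (a # as)))"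
      using Cons(2) m lin_comp[OF assms(1), of sW "\<lambda>a. g (a # map2 h bs as)" b] by (simp add: multilinear_Suc)
  next
    fix a
    show "multilinear sV sW m (\<lambda>as. g (map2 h (b # bs) (a # as)))"
      using Cons(1)[of m "\<lambda>l. g (h b a # l)"] Cons(2) m by (simp add: multilinear_Suc)
  qed
qed auto

lemma multilinear_map2_left:
  assumes "\<And>a. lin sV sV (\<lambda>b. h b a)" "multilinear sV sW n g" "length as = n"
  shows "multilinear sV sW n (\<lambda>bs. g (map2 h bs as))"
proof -
  have "multilinear sV sW n (\<lambda>bs. g (map2 (\<lambda>a b. h b a) as bs))"
    by (rule multilinear_map2[OF assms])
  moreover have "map2 (\<lambda>a b. h b a) as bs = map2 h bs as" for bs
    by (induct as bs rule: list_induct2') auto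
  ultimately show ?thesis by simp
qed

subsection \<open>Linear maps on tensor powers\<close>

lemma module_fscale: "Modules.module (fscale ((*) :: 'k::field \<Rightarrow> 'k \<Rightarrow> 'k))"
  using vector_space_fscale[OF vector_space_mult] by (simp add: module_iff_vector_space)

lemma tensor_in: "length xs = n \<Longrightarrow> tensor s xs \<in> tensor_power s n"
  unfolding tensor_power_def by (auto intro: module.span_base[OF module_fscale])

lemma tensor_power_zero: "0 \<in> tensor_power s n"
  unfolding tensor_power_def by (rule module.span_zero[OF module_fscale])

lemma tensor_power_add: "t \<in> tensor_power s n \<Longrightarrow> u \<in> tensor_power s n \<Longrightarrow> t + u \<in> tensor_power s n"
  unfolding tensor_power_def by (rule module.span_add[OF module_fscale])

lemma tensor_power_scale: "t \<in> tensor_power s n \<Longrightarrow> fscale (*) c t \<in> tensor_power s n"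
  unfolding tensor_power_def by (rule module.span_scale[OF module_fscale])

lemma tensor_power_sum_list: "(\<And>x. x \<in> set xs \<Longrightarrow> f x \<in> tensor_power s n) \<Longrightarrow> (\<Sum>x\<leftarrow>xs. f x) \<in> tensor_power s n"
  by (induct xs) (auto intro: tensor_power_zero tensor_power_add)

lemma tensor_power_induct [consumes 1, case_names zero step]:
  assumes "t \<in> tensor_power s n" "P 0"
    and "\<And>c xs y. length xs = n \<Longrightarrow> y \<in> tensor_power s n \<Longrightarrow> P y \<Longrightarrow> P (fscale (*) c (tensor s xs) + y)"
  shows "P t"
proof -
  have "t \<in> tensor_power s n \<and> P t"
    using assms(1) unfolding tensor_power_def
  proof (induct rule: module.span_induct_alt[OF module_fscale, consumes 1])
    case 1
    show ?case using assms(2) tensor_power_zero[of s n] unfolding tensor_power_def by (rule conjI[rotated])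
  next
    case (2 c x y)
    then show ?case using assms(3)[of _ y c] tensor_power_add[of _ s n y] tensor_power_scale[of _ s n c] tensor_in[of _ n s]
      unfolding tensor_power_def by blast
  qed
  then show ?thesis by simp
qed

lemma linear_maps_add: "f \<in> linear_maps sV sW n W \<Longrightarrow> t \<in> tensor_power sV n \<Longrightarrow> u \<in> tensor_power sV n \<Longrightarrow> f (t + u) = f t + f u"
  and linear_maps_scale: "f \<in> linear_maps sV sW n W \<Longrightarrow> t \<in> tensor_power sV n \<Longrightarrow> f (fscale (*) c t) = sW c (f t)"
  and linear_maps_outside: "f \<in> linear_maps sV sW n W \<Longrightarrow> t \<notin> tensor_power sV n \<Longrightarrow> f t = 0"
  by (simp_all add: linear_maps_def)

lemma linear_maps_zero: "f \<in> linear_maps sV sW n W \<Longrightarrow> f 0 = 0"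
  using linear_maps_add[of f sV sW n W 0 0] by (simp add: tensor_power_zero)

lemma linear_maps_sum_list:
  assumes "f \<in> linear_maps sV sW n W" "\<And>x. x \<in> set xs \<Longrightarrow> g x \<in> tensor_power sV n"
  shows "f (\<Sum>x\<leftarrow>xs. g x) = (\<Sum>x\<leftarrow>xs. f (g x))"
  using assms(2) by (induct xs) (auto simp: linear_maps_zero[OF assms(1)] linear_maps_add[OF assms(1)] tensor_power_sum_list)

lemma linear_maps_multilinear:
  assumes "vector_space sV" "vector_space sW" "f \<in> linear_maps sV sW n W"
  shows "multilinear sV sW n (\<lambda>l. f (tensor sV l))"
  using multilinear_tensor[OF assms(1), of n] assms
  by (auto simp: multilinear_def lin_iff linear_maps_add linear_maps_scale tensor_in)

lemma linear_maps_ext: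
  assumes V: "vector_space sV" "vector_space sW"
    and f: "f \<in> linear_maps sV sW n UNIV" "g \<in> linear_maps sV sW n UNIV"
    and eq: "\<And>xs. length xs = n \<Longrightarrow> f (tensor sV xs) = g (tensor sV xs)"
  shows "f = g"
  using tensor_universal[OF V linear_maps_multilinear[OF V f(2)]] f eq by blast

lemma lift_eq:
  assumes V: "vector_space sV" "vector_space sW"
    and f: "f \<in> linear_maps sV sW n UNIV"
    and eq: "\<And>xs. length xs = n \<Longrightarrow> f (tensor sV xs) = g xs"
  shows "lift sV sW n g = f"
  unfolding lift_def
proof (rule the_equality)
  show "f \<in> linear_maps sV sW n UNIV \<and> (\<forall>xs. length xs = n \<longrightarrow> f (tensor sV xs) = g xs)"
    using f eq by simp
  fix h assume "h \<in> linear_maps sV sW n UNIV \<and> (\<forall>xs. length xs = n \<longrightarrow> h (tensor sV xs) = g xs)"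
  then show "h = f" using eq by (intro linear_maps_ext[OF V _ f]) auto
qed

lemma lift_cong: "(\<And>xs. length xs = n \<Longrightarrow> g xs = g' xs) \<Longrightarrow> lift sV sW n g = lift sV sW n g'"
  by (simp add: lift_def cong: conj_cong)

lemma lift_in: "vector_space sV \<Longrightarrow> vector_space sW \<Longrightarrow> multilinear sV sW n g \<Longrightarrow> lift sV sW n g \<in> linear_maps sV sW n UNIV"
  using theI'[OF tensor_universal[of sV sW n g]] unfolding lift_def by blast

lemma linear_maps_comp:
  assumes "lin sW sX h" "f \<in> linear_maps sV sW n UNIV"
  shows "(\<lambda>t. h (f t)) \<in> linear_maps sV sX n UNIV"
proof -
  have "h 0 = 0" by (rule additive.zero[OF lin_additive[OF assms(1)]])
  then show ?thesis using assms by (simp add: linear_maps_def lin_iff)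
qed

text \<open>By induction on \<open>t\<close>, since a lift is known on pure tensors only. Outside
  the tensor power it is \<open>0\<close>, which is linear in the parameter as well.\<close>

lemma lift_param_lin:
  assumes V: "vector_space sV" "vector_space sW" "vector_space s'"
    and g: "\<And>z. multilinear sV sW n (g z)" "\<And>l. length l = n \<Longrightarrow> lin s' sW (\<lambda>z. g z l)"
  shows "lin s' sW (\<lambda>z. lift sV sW n (g z) t)"
proof (cases "t \<in> tensor_power sV n")
  case True
  then show ?thesis
  proof (induct rule: tensor_power_induct)
    case zero
    have "lift sV sW n (g z) 0 = 0" for z by (rule linear_maps_zero[OF lift_in[OF V(1,2) g(1)]])
    then show ?case using V by (simp only: lin_zero)
  next
    case (step c xs y)
    have "lift sV sW n (g z) (fscale (*) c (tensor sV xs) + y) = sW c (g z xs) + lift sV sW n (g z) y" for z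
    proof -
      note l = lift_in[OF V(1,2) g(1)[of z]]
      have "lift sV sW n (g z) (fscale (*) c (tensor sV xs) + y)
        = lift sV sW n (g z) (fscale (*) c (tensor sV xs)) + lift sV sW n (g z) y"
        by (rule linear_maps_add[OF l tensor_power_scale[OF tensor_in[OF step(1)]] step(2)])
      also have "lift sV sW n (g z) (fscale (*) c (tensor sV xs)) = sW c (g z xs)"
        unfolding linear_maps_scale[OF l tensor_in[OF step(1)]] lift_tensor[OF V(1,2) g(1) step(1)] ..
      finally show ?thesis .
    qed
    moreover have "lin s' sW (\<lambda>z. sW c (g z xs))" using lin_comp[OF g(2)[OF step(1)] lin_scale[OF V(2)]] .
    ultimately show ?case using step(3) by (simp only: lin_add)
  qed
next
  case False
  then have "lift sV sW n (g z) t = 0" for z by (rule linear_maps_outside[OF lift_in[OF V(1,2) g(1)]])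
  then show ?thesis using V by (simp only: lin_zero)
qed

lemma vector_space_tens2:
  "vector_space (fscale ((*) :: 'k::field \<Rightarrow> 'k \<Rightarrow> 'k) :: 'k \<Rightarrow> ('v, 'k) tens \<Rightarrow> _)"
  by (rule vector_space_fscale[OF vector_space_mult])

lemma multilinear_tprod:
  fixes s :: "'k::field \<Rightarrow> 'v::ab_group_add \<Rightarrow> 'v"
  assumes s: "vector_space s"
  shows "multilinear s (fscale (*)) m (\<lambda>xs. lift s (fscale (*)) n (\<lambda>ys. tensor s (xs @ ys)) u)"
  "length xs = m \<Longrightarrow> multilinear s (fscale (*)) n (\<lambda>ys. tensor s (xs @ ys))"
proof -
  have A: "length ys = n \<Longrightarrow> multilinear s (fscale (*)) m (\<lambda>xs. tensor s (xs @ ys))"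
    and B: "length xs = m \<Longrightarrow> multilinear s (fscale (*)) n (\<lambda>ys. tensor s (xs @ ys))" for xs ys
    using multilinear_tensor[OF s, of "m + n"] by (auto simp: multilinear_append)
  show "length xs = m \<Longrightarrow> multilinear s (fscale (*)) n (\<lambda>ys. tensor s (xs @ ys))" by (rule B)
  show "multilinear s (fscale (*)) m (\<lambda>xs. lift s (fscale (*)) n (\<lambda>ys. tensor s (xs @ ys)) u)"
    unfolding multilinear_def
  proof (intro allI impI)
    fix xs :: "'v list" and i assume x: "length xs = m" "i < m"
    show "lin s (fscale (*)) (\<lambda>x. lift s (fscale (*)) n (\<lambda>ys. tensor s (xs[i := x] @ ys)) u)"
      using x A by (intro lift_param_lin s vector_space_tens2 B) (auto simp: multilinear_def)
  qed
qed

lemma tprod_right: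
  assumes V: "vector_space s" and l: "length xs = m"
  shows "tprod s m n (tensor s xs) u = lift s (fscale (*)) n (\<lambda>ys. tensor s (xs @ ys)) u"
  using multilinear_tprod(1)[OF V, of m n u] l by (simp add: tprod_def lift_tensor[OF V vector_space_tens2])

lemma tprod_tensor:
  assumes V: "vector_space s" and l: "length xs = m" "length ys = n"
  shows "tprod s m n (tensor s xs) (tensor s ys) = tensor s (xs @ ys)"
proof -
  have "multilinear s (fscale (*)) (m + n) (tensor s)" by (rule multilinear_tensor[OF V])
  then show ?thesis
    unfolding tprod_right[OF V l(1)] multilinear_append using l
    by (simp add: lift_tensor[OF V vector_space_tens2])
qed

text \<open>Scalars are absorbed into the first factor, so a list of pairs without coefficients
  suffices; Sweedler notation thereby becomes a sum over a list.\<close>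

lemma tensor2_pairs:
  assumes V: "vector_space s" and t: "t \<in> tensor_power s 2"
  shows "\<exists>ps. t = (\<Sum>(x, y)\<leftarrow>ps. tensor s [x, y])"
  using t
proof (induct rule: tensor_power_induct)
  case zero
  show ?case by (rule exI[of _ "[]"]) simp
next
  case (step c xs u)
  then obtain ps where ps: "u = (\<Sum>(x, y)\<leftarrow>ps. tensor s [x, y])" by blast
  obtain x y where xs: "xs = [x, y]" using step(1) by (auto simp: numeral_2_eq_2 length_Suc_conv)
  have "multilinear s (fscale (*)) 2 (tensor s)" by (rule multilinear_tensor[OF V])
  then have "lin s (fscale (*)) (\<lambda>a. tensor s [a, y])"
    by (simp add: numeral_2_eq_2 multilinear_Suc)
  then have "fscale (*) c (tensor s xs) = tensor s [s c x, y]" by (simp add: lin_iff xs)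
  then have "fscale (*) c (tensor s xs) + u = (\<Sum>(x, y)\<leftarrow>(s c x, y) # ps. tensor s [x, y])"
    by (simp add: ps)
  then show ?case by blast
qed

lemma all_length_Suc: "(\<forall>as. length as = Suc n \<longrightarrow> P as) \<longleftrightarrow> (\<forall>x as. length as = n \<longrightarrow> P (x # as))"
  by (metis length_Suc_conv)

lemma multilinear_2:
  "multilinear sV sW 2 g \<longleftrightarrow> (\<forall>y. lin sV sW (\<lambda>x. g [x, y])) \<and> (\<forall>x. lin sV sW (\<lambda>y. g [x, y]))"
  unfolding numeral_2_eq_2 multilinear_Suc all_length_Suc by auto

lemma multilinear_3:
  "multilinear sV sW 3 g \<longleftrightarrow> (\<forall>y z. lin sV sW (\<lambda>x. g [x, y, z])) \<and> (\<forall>x z. lin sV sW (\<lambda>y. g [x, y, z]))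
     \<and> (\<forall>x y. lin sV sW (\<lambda>z. g [x, y, z]))"
  unfolding numeral_3_eq_3 multilinear_Suc all_length_Suc by auto

section \<open>Sweedler sums over a chosen presentation of the coproduct\<close>

context coalgebra
begin

definition presentation :: "'a \<Rightarrow> ('a \<times> 'a) list"
  where "presentation a = (SOME ps. comult a = (\<Sum>(x, y)\<leftarrow>ps. tensor scale [x, y]))"

text \<open>
  Sweedler sums over a fixed presentation of the coproduct: \<open>SW a B = \<Sum> B a\<^sub>(\<^sub>1\<^sub>) a\<^sub>(\<^sub>2\<^sub>)\<close>, and below \<open>SWL\<close> is its analogue for
  the coalgebra \<open>A\<^sup>\<otimes>\<^sup>n\<close>, \<open>MS s k a g = \<Sum> g [a\<^sub>(\<^sub>1\<^sub>), \<dots>, a\<^sub>(\<^sub>k\<^sub>)]\<close>, and \<open>MSL\<close> its analogue for \<open>A\<^sup>\<otimes>\<^sup>n\<close>.  They do not depend on the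
  presentation for (multi)linear arguments only.
\<close>

definition SW :: "'a \<Rightarrow> ('a \<Rightarrow> 'a \<Rightarrow> 'w::ab_group_add) \<Rightarrow> 'w"
  where "SW a B = (\<Sum>(x, y)\<leftarrow>presentation a. B x y)"

lemma vs: "vector_space scale"
  by (rule vector_space_axioms)

lemma comult_SW: "comult a = SW a (\<lambda>x y. tensor scale [x, y])"
  unfolding SW_def presentation_def by (rule someI_ex[OF tensor2_pairs[OF vs comult_closed]])

lemma SW_additive: "additive h \<Longrightarrow> h (SW a B) = SW a (\<lambda>x y. h (B x y))"
  by (simp add: SW_def additive_sum_list split_def)

lemma SW_swap: "SW a (\<lambda>x y. SW b (\<lambda>u v. B x y u v)) = SW b (\<lambda>u v. SW a (\<lambda>x y. B x y u v))"
  unfolding SW_def split_def by (rule sum_list_swap)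

lemma lin_SW:
  "vector_space s1 \<Longrightarrow> vector_space s2 \<Longrightarrow> (\<And>x y. lin s1 s2 (\<lambda>z. B z x y)) \<Longrightarrow> lin s1 s2 (\<lambda>z. SW a (B z))"
  unfolding SW_def split_def by (intro lin_sum_list)

lemma SW_tensor_power: "(\<And>x y. h x y \<in> tensor_power sV n) \<Longrightarrow> SW a h \<in> tensor_power sV n"
  unfolding SW_def by (intro tensor_power_sum_list) auto

lemma linear_maps_SW:
  "f \<in> linear_maps sV sW n UNIV \<Longrightarrow> (\<And>x y. h x y \<in> tensor_power sV n) \<Longrightarrow> f (SW a h) = SW a (\<lambda>x y. f (h x y))"
  unfolding SW_def split_def by (intro linear_maps_sum_list) auto

lemma lift_comult:
  assumes "vector_space s" "multilinear scale s 2 g"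
  shows "lift scale s 2 g (comult a) = SW a (\<lambda>x y. g [x, y])"
proof -
  have "lift scale s 2 g (comult a) = lift scale s 2 g (SW a (\<lambda>x y. tensor scale [x, y]))"
    by (rule arg_cong[OF comult_SW])
  also have "\<dots> = SW a (\<lambda>x y. lift scale s 2 g (tensor scale [x, y]))"
    by (rule linear_maps_SW[OF lift_in[OF vs assms]]) (simp add: tensor_in)
  finally show ?thesis by (simp add: lift_tensor[OF vs assms])
qed

text \<open>The presentation of \<open>a\<close> is an arbitrary choice and not linear in
  \<open>a\<close>. The sum nevertheless is, because for bilinear \<open>B\<close> it is the lift of
  \<open>B\<close> evaluated at \<open>comult a\<close>.\<close>

lemma lin_SW_arg:
  assumes "vector_space s" "\<And>y. lin scale s (\<lambda>x. B x y)" "\<And>x. lin scale s (B x)"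
  shows "lin scale s (\<lambda>a. SW a B)"
proof -
  let ?g = "\<lambda>c. B (c ! 0) (c ! 1)"
  have g: "multilinear scale s 2 ?g" using assms by (simp add: multilinear_2)
  have "(\<lambda>a. SW a B) = (\<lambda>a. lift scale s 2 ?g (comult a))"
    by (rule ext, subst lift_comult[OF assms(1) g]) simp
  moreover have "lift scale s 2 ?g (comult (x + y)) = lift scale s 2 ?g (comult x) + lift scale s 2 ?g (comult y)" for x y
    using linear_maps_add[OF lift_in[OF vs assms(1) g]] comult_closed comult_linear by (simp only: lin_iff)
  moreover have "lift scale s 2 ?g (comult (scale c x)) = s c (lift scale s 2 ?g (comult x))" for c x
    using linear_maps_scale[OF lift_in[OF vs assms(1) g]] comult_closed comult_linear by (simp only: lin_iff)
  ultimately show ?thesis using vs assms(1) by (simp add: lin_iff)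
qed

text \<open>The axiom is the case where \<open>T\<close> forms pure tensors; the linear extension of
  a trilinear \<open>T\<close> to the third tensor power carries this case to the general
  one.\<close>

lemma SW_coassoc:
  fixes T :: "'a \<Rightarrow> 'a \<Rightarrow> 'a \<Rightarrow> 'w::ab_group_add"
  assumes s: "vector_space s"
    and T: "\<And>y z. lin scale s (\<lambda>x. T x y z)" "\<And>x z. lin scale s (\<lambda>y. T x y z)" "\<And>x y. lin scale s (T x y)"
  shows "SW a (\<lambda>x y. SW x (\<lambda>u v. T u v y)) = SW a (\<lambda>x y. SW y (\<lambda>u v. T x u v))"
proof -
  let ?t = "tensor scale" and ?f = "fscale (*) :: 'k \<Rightarrow> ('a, 'k) tens \<Rightarrow> _"
  have t3: "multilinear scale ?f 3 ?t" by (rule multilinear_tensor[OF vs])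
  have t: "lin scale ?f (\<lambda>x. ?t [x, y, z])" "lin scale ?f (\<lambda>y. ?t [x, y, z])" "lin scale ?f (\<lambda>z. ?t [x, y, z])" for x y z
    using t3 unfolding multilinear_3 by blast+
  have L: "tprod scale 2 1 (comult x) (?t [y]) = SW x (\<lambda>u v. ?t [u, v, y])" for x y
  proof -
    have t21: "multilinear scale ?f (2 + 1) ?t" by (rule multilinear_tensor[OF vs])
    have e: "lift scale ?f 1 (\<lambda>ys. ?t (xs @ ys)) (?t [y]) = ?t (xs @ [y])" if "length xs = 2" for xs
      using t21[unfolded multilinear_append] that by (intro lift_tensor[OF vs vector_space_tens2]) auto
    have "multilinear scale ?f 2 (\<lambda>xs. lift scale ?f 1 (\<lambda>ys. ?t (xs @ ys)) (?t [y])) = multilinear scale ?f 2 (\<lambda>xs. ?t (xs @ [y]))"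
      by (rule multilinear_cong) (rule e)
    then have m: "multilinear scale ?f 2 (\<lambda>xs. lift scale ?f 1 (\<lambda>ys. ?t (xs @ ys)) (?t [y]))"
      using t21[unfolded multilinear_append] by simp
    show ?thesis unfolding tprod_def lift_comult[OF vector_space_tens2 m]
      using e[of "[u, v]" for u v] by simp
  qed
  have R: "tprod scale 1 2 (?t [x]) (comult y) = SW y (\<lambda>u v. ?t [x, u, v])" for x y
    using t by (simp add: tprod_right[OF vs] lift_comult[OF vector_space_tens2] multilinear_2)
  have "SW a (\<lambda>x y. SW x (\<lambda>u v. ?t [u, v, y])) = SW a (\<lambda>x y. SW y (\<lambda>u v. ?t [x, u, v]))"
  proof -
    have "lift scale ?f 2 (\<lambda>xs. tprod scale 2 1 (comult (xs ! 0)) (?t [xs ! 1])) (comult a)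
       = SW a (\<lambda>x y. SW x (\<lambda>u v. ?t [u, v, y]))"
      unfolding L by (subst lift_comult[OF vector_space_tens2])
        (auto simp: multilinear_2 intro!: lin_SW_arg lin_SW vector_space_tens2 vs t)
    moreover have "lift scale ?f 2 (\<lambda>xs. tprod scale 1 2 (?t [xs ! 0]) (comult (xs ! 1))) (comult a)
       = SW a (\<lambda>x y. SW y (\<lambda>u v. ?t [x, u, v]))"
      unfolding R by (subst lift_comult[OF vector_space_tens2])
        (auto simp: multilinear_2 intro!: lin_SW_arg lin_SW vector_space_tens2 vs t)
    ultimately show ?thesis using coassoc[of a] by simp
  qed
  then have eq: "lift scale s 3 g (SW a (\<lambda>x y. SW x (\<lambda>u v. ?t [u, v, y]))) = lift scale s 3 g (SW a (\<lambda>x y. SW y (\<lambda>u v. ?t [x, u, v])))" for g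
    by simp
  let ?g = "\<lambda>c. T (c ! 0) (c ! 1) (c ! 2)"
  have g: "multilinear scale s 3 ?g" using T by (simp add: multilinear_3)
  note L = lift_in[OF vs s g]
  have in3: "SW x (\<lambda>u v. ?t (h u v)) \<in> tensor_power scale 3" if "\<And>u v. length (h u v) = 3" for x h
    by (intro SW_tensor_power tensor_in that)
  have 1: "lift scale s 3 ?g (SW x (\<lambda>u v. ?t (h u v))) = SW x (\<lambda>u v. ?g (h u v))" if "\<And>u v. length (h u v) = 3" for x h
    by (subst linear_maps_SW[OF L tensor_in[OF that]]) (simp only: lift_tensor[OF vs s g that])
  have 2: "lift scale s 3 ?g (SW a (\<lambda>x y. SW x (\<lambda>u v. ?t [u, v, y]))) = SW a (\<lambda>x y. SW x (\<lambda>u v. T u v y))"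
    by (subst linear_maps_SW[OF L in3], simp, subst 1, simp_all)
  have 3: "lift scale s 3 ?g (SW a (\<lambda>x y. SW y (\<lambda>u v. ?t [x, u, v]))) = SW a (\<lambda>x y. SW y (\<lambda>u v. T x u v))"
    by (subst linear_maps_SW[OF L in3], simp, subst 1, simp_all)
  show ?thesis using eq[of ?g] unfolding 2 3 .
qed

lemma SW_counit_left:
  assumes "lin scale s h"
  shows "SW a (\<lambda>x y. s (counit x) (h y)) = h a"
proof -
  have "SW a (\<lambda>x y. scale (counit x) y) = a"
    using counit_left[of a] counit_linear vs
    by (subst (asm) lift_comult[OF vs]) (auto simp: multilinear_2 intro: lin_scale lin_scale_left)
  then have "h (SW a (\<lambda>x y. scale (counit x) y)) = h a" by simp
  then show ?thesis
    using assms by (simp add: SW_additive[OF lin_additive[OF assms]] lin_iff)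
qed

lemma SW_counit_right:
  assumes "lin scale s h"
  shows "SW a (\<lambda>x y. s (counit y) (h x)) = h a"
proof -
  have "SW a (\<lambda>x y. scale (counit y) x) = a"
    using counit_right[of a] counit_linear vs
    by (subst (asm) lift_comult[OF vs]) (auto simp: multilinear_2 intro: lin_scale lin_scale_left)
  then have "h (SW a (\<lambda>x y. scale (counit y) x)) = h a" by simp
  then show ?thesis
    using assms by (simp add: SW_additive[OF lin_additive[OF assms]] lin_iff)
qed

subsection \<open>The tensor powers as coalgebras\<close>

primrec SWL :: "'a list \<Rightarrow> ('a list \<Rightarrow> 'a list \<Rightarrow> 'w::ab_group_add) \<Rightarrow> 'w"
  where
    "SWL [] B = B [] []"
  | "SWL (a # as) B = SW a (\<lambda>x y. SWL as (\<lambda>xs ys. B (x # xs) (y # ys)))"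

lemma SWL_additive: "additive h \<Longrightarrow> h (SWL as B) = SWL as (\<lambda>x y. h (B x y))"
  by (induct as arbitrary: B) (auto simp: SW_additive)

lemma SWL_scale: "vector_space s \<Longrightarrow> s c (SWL as B) = SWL as (\<lambda>x y. s c (B x y))"
  by (intro SWL_additive lin_additive[OF lin_scale])

lemma SWL_cong:
  "(\<And>xs ys. length xs = length as \<Longrightarrow> length ys = length as \<Longrightarrow> B xs ys = B' xs ys) \<Longrightarrow> SWL as B = SWL as B'"
proof (induct as arbitrary: B B')
  case (Cons a as)
  have "SWL as (\<lambda>xs ys. B (x # xs) (y # ys)) = SWL as (\<lambda>xs ys. B' (x # xs) (y # ys))" for x y
    using Cons(2) by (intro Cons(1)) auto
  then show ?case by simp
qed simp

lemma SW_SWL_swap: "SW a (\<lambda>x y. SWL bs (\<lambda>u v. B x y u v)) = SWL bs (\<lambda>u v. SW a (\<lambda>x y. B x y u v))"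
  by (induct bs arbitrary: B) (auto simp: SW_swap[of a])

lemma SWL_swap: "SWL as (\<lambda>x y. SWL bs (\<lambda>u v. B x y u v)) = SWL bs (\<lambda>u v. SWL as (\<lambda>x y. B x y u v))"
  by (induct as arbitrary: B) (auto simp: SW_SWL_swap)

lemma SWL_append: "SWL (as @ bs) B = SWL as (\<lambda>x y. SWL bs (\<lambda>u v. B (x @ u) (y @ v)))"
  by (induct as arbitrary: B) auto

lemma lin_SWL:
  "vector_space s1 \<Longrightarrow> vector_space s2
    \<Longrightarrow> (\<And>x y. length x = length as \<Longrightarrow> length y = length as \<Longrightarrow> lin s1 s2 (\<lambda>z. B z x y)) \<Longrightarrow> lin s1 s2 (\<lambda>z. SWL as (B z))"
  by (induct as arbitrary: B) (auto intro!: lin_SW)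

lemma multilinear_SWL_param:
  assumes "vector_space sV" "vector_space s"
    and "\<And>x y. length x = length as \<Longrightarrow> length y = length as \<Longrightarrow> multilinear sV s n (\<lambda>z. B z x y)"
  shows "multilinear sV s n (\<lambda>z. SWL as (B z))"
  using assms(3) unfolding multilinear_def by (auto intro!: lin_SWL assms(1,2))

definition bimultilinear :: "nat \<Rightarrow> ('k \<Rightarrow> 'w::ab_group_add \<Rightarrow> 'w) \<Rightarrow> ('a list \<Rightarrow> 'a list \<Rightarrow> 'w) \<Rightarrow> bool"
  where "bimultilinear n s B \<longleftrightarrow> (\<forall>y. length y = n \<longrightarrow> multilinear scale s n (\<lambda>x. B x y))
    \<and> (\<forall>x. length x = n \<longrightarrow> multilinear scale s n (B x))"

lemma bimultilinear_Suc:
  assumes "bimultilinear (Suc n) s B"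
  shows "bimultilinear n s (\<lambda>x y. B (a # x) (b # y))"
    and "length x = n \<Longrightarrow> length y = n \<Longrightarrow> lin scale s (\<lambda>a. B (a # x) (b # y))"
    and "length x = n \<Longrightarrow> length y = n \<Longrightarrow> lin scale s (\<lambda>b. B (a # x) (b # y))"
  using assms by (auto simp: bimultilinear_def multilinear_Suc)

lemma multilinear_SWL:
  assumes s: "vector_space s" and "bimultilinear n s B"
  shows "multilinear scale s n (\<lambda>as. SWL as B)"
  using assms(2)
proof (induct n arbitrary: B)
  case 0
  then show ?case by simp
next
  case (Suc n)
  note S = bimultilinear_Suc[OF Suc(2)]
  show ?case
  proof (rule multilinear_SucI)
    fix as :: "'a list" assume "length as = n"
    then show "lin scale s (\<lambda>a. SWL (a # as) B)"
      by (auto intro!: lin_SW_arg s lin_SWL vs S)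
  next
    fix a
    show "multilinear scale s n (\<lambda>as. SWL (a # as) B)"
      unfolding SWL.simps SW_def split_def
      by (intro multilinear_sum_list vs s Suc(1) S)
  qed
qed

lemma SWL_counit_left:
  assumes "multilinear scale s (length as) h" "vector_space s"
  shows "SWL as (\<lambda>x y. s (prod_list (map counit x)) (h y)) = h as"
  using assms(1)
proof (induct as arbitrary: h)
  case Nil
  then show ?case using assms(2) by (simp add: vector_space_def)
next
  case (Cons a as)
  have "SWL (a # as) (\<lambda>x y. s (prod_list (map counit x)) (h y))
    = SW a (\<lambda>x y. s (counit x) (SWL as (\<lambda>xs ys. s (prod_list (map counit xs)) (h (y # ys)))))"
    using assms(2) by (simp add: SWL_scale vector_space_def)
  also have "\<dots> = SW a (\<lambda>x y. s (counit x) (h (y # as)))"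
    using Cons(2) by (subst Cons(1)) (auto simp: multilinear_Suc)
  also have "\<dots> = h (a # as)" using Cons(2) by (intro SW_counit_left) (auto simp: multilinear_Suc)
  finally show ?case .
qed

lemma SWL_counit_right:
  assumes "multilinear scale s (length as) h" "vector_space s"
  shows "SWL as (\<lambda>x y. s (prod_list (map counit y)) (h x)) = h as"
  using assms(1)
proof (induct as arbitrary: h)
  case Nil
  then show ?case using assms(2) by (simp add: vector_space_def)
next
  case (Cons a as)
  have "SWL (a # as) (\<lambda>x y. s (prod_list (map counit y)) (h x))
    = SW a (\<lambda>x y. s (counit y) (SWL as (\<lambda>xs ys. s (prod_list (map counit ys)) (h (x # xs)))))"
    using assms(2) by (simp add: SWL_scale vector_space_def)
  also have "\<dots> = SW a (\<lambda>x y. s (counit y) (h (x # as)))"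
    using Cons(2) by (subst Cons(1)) (auto simp: multilinear_Suc)
  also have "\<dots> = h (a # as)" using Cons(2) by (intro SW_counit_right) (auto simp: multilinear_Suc)
  finally show ?case .
qed

definition trimultilinear :: "nat \<Rightarrow> ('k \<Rightarrow> 'w::ab_group_add \<Rightarrow> 'w) \<Rightarrow> ('a list \<Rightarrow> 'a list \<Rightarrow> 'a list \<Rightarrow> 'w) \<Rightarrow> bool"
  where "trimultilinear n s T \<longleftrightarrow> (\<forall>y z. length y = n \<longrightarrow> length z = n \<longrightarrow> multilinear scale s n (\<lambda>x. T x y z))
    \<and> (\<forall>x z. length x = n \<longrightarrow> length z = n \<longrightarrow> multilinear scale s n (\<lambda>y. T x y z))
    \<and> (\<forall>x y. length x = n \<longrightarrow> length y = n \<longrightarrow> multilinear scale s n (T x y))"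

text \<open>Sums over different letters commute, so coassociativity can be applied to the tail and
  to the head separately.\<close>

lemma SWL_coassoc:
  assumes s: "vector_space s" and "trimultilinear (length as) s T"
  shows "SWL as (\<lambda>x y. SWL x (\<lambda>u v. T u v y)) = SWL as (\<lambda>x y. SWL y (\<lambda>u v. T x u v))"
  using assms(2)
proof (induct as arbitrary: T)
  case Nil
  then show ?case by simp
next
  case (Cons a as)
  have T: "trimultilinear (length as) s (\<lambda>x y z. T (a # x) (b # y) (c # z))" for a b c
    using Cons(2) by (auto simp: trimultilinear_def multilinear_Suc)
  have "SWL (a # as) (\<lambda>x y. SWL x (\<lambda>u v. T u v y))
    = SW a (\<lambda>x y. SWL as (\<lambda>xs ys. SW x (\<lambda>u v. SWL xs (\<lambda>us vs. T (u # us) (v # vs) (y # ys)))))" by simp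
  also have "\<dots> = SW a (\<lambda>x y. SW x (\<lambda>u v. SWL as (\<lambda>xs ys. SWL xs (\<lambda>us vs. T (u # us) (v # vs) (y # ys)))))"
    by (simp only: SW_SWL_swap)
  also have "\<dots> = SW a (\<lambda>x y. SW x (\<lambda>u v. SWL as (\<lambda>xs ys. SWL ys (\<lambda>us vs. T (u # xs) (v # us) (y # vs)))))"
    by (simp only: Cons(1)[OF T])
  also have "\<dots> = SW a (\<lambda>x y. SW y (\<lambda>u v. SWL as (\<lambda>xs ys. SWL ys (\<lambda>us vs. T (x # xs) (u # us) (v # vs)))))"
    using Cons(2) by (intro SW_coassoc[OF s] lin_SWL vs s) (auto simp: trimultilinear_def multilinear_Suc)
  also have "\<dots> = SWL (a # as) (\<lambda>x y. SWL y (\<lambda>u v. T x u v))"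
    by (simp add: SW_SWL_swap)
  finally show ?case .
qed

subsection \<open>Iterated coproducts\<close>

primrec MS :: "('k \<Rightarrow> 'w::ab_group_add \<Rightarrow> 'w) \<Rightarrow> nat \<Rightarrow> 'a \<Rightarrow> ('a list \<Rightarrow> 'w) \<Rightarrow> 'w"
  where
    "MS s 0 a g = s (counit a) (g [])"
  | "MS s (Suc k) a g = SW a (\<lambda>x y. MS s k y (\<lambda>c. g (x # c)))"

lemma lin_MS_param:
  assumes "vector_space s1" "vector_space s" "\<And>c. length c = k \<Longrightarrow> lin s1 s (\<lambda>z. g z c)"
  shows "lin s1 s (\<lambda>z. MS s k a (g z))"
  using assms(3)
  by (induct k arbitrary: a g) (auto intro!: lin_SW assms(1,2) lin_comp[OF _ lin_scale])

lemma lin_MS: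
  assumes "vector_space s" "multilinear scale s k g"
  shows "lin scale s (\<lambda>a. MS s k a g)"
  using assms(2)
proof (induct k arbitrary: g)
  case 0
  then show ?case using counit_linear assms(1) by (auto intro: lin_scale_left)
next
  case (Suc k)
  then show ?case unfolding MS.simps
    by (intro lin_SW_arg assms(1) lin_MS_param vs) (auto simp: multilinear_Suc)
qed

lemma MS_cong: "(\<And>c. length c = k \<Longrightarrow> g c = g' c) \<Longrightarrow> MS s k a g = MS s k a g'"
proof (induct k arbitrary: a g g')
  case (Suc k)
  have "MS s k y (\<lambda>c. g (x # c)) = MS s k y (\<lambda>c. g' (x # c))" for x y
    using Suc(2) by (intro Suc(1)) auto
  then show ?case by simp
qed simp

lemma MS_tens:
  "comult_pow k a = MS (fscale (*)) k a (tensor scale)"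
  "comult_pow k a \<in> tensor_power scale k"
  "vector_space s \<Longrightarrow> multilinear scale s k g \<Longrightarrow> lift scale s k g (comult_pow k a) = MS s k a g"
proof -
  let ?f = "fscale (*) :: 'k \<Rightarrow> ('a, 'k) tens \<Rightarrow> _"
  \<comment> \<open>The prefix \<open>zs\<close> of legs already produced is what the induction
    needs, because the recursion puts each new leg in front of the remaining ones.\<close>
  have tp: "MS ?f k a (\<lambda>c. tensor scale (zs @ c)) \<in> tensor_power scale (length zs + k)" for k a zs
  proof (induct k arbitrary: a zs)
    case 0
    then show ?case by (simp add: tensor_power_scale tensor_in)
  next
    case (Suc k)
    then show ?case using Suc[of _ "zs @ [x]" for x] by (auto intro!: SW_tensor_power)
  qed
  have lm: "f (MS ?f k a (\<lambda>c. tensor scale (zs @ c))) = MS s k a (\<lambda>c. f (tensor scale (zs @ c)))"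
    if f: "f \<in> linear_maps scale s (length zs + k) UNIV" for f k a zs and s :: "'k \<Rightarrow> 'w::ab_group_add \<Rightarrow> 'w"
    using f
  proof (induct k arbitrary: a zs)
    case 0
    then show ?case using linear_maps_scale[OF 0] by (simp add: tensor_in)
  next
    case (Suc k)
    have "f (SW a (\<lambda>x y. MS ?f k y (\<lambda>c. tensor scale ((zs @ [x]) @ c)))) =
       SW a (\<lambda>x y. f (MS ?f k y (\<lambda>c. tensor scale ((zs @ [x]) @ c))))"
      using tp[of k _ "zs @ [x]" for x] by (intro linear_maps_SW[OF Suc(2)]) simp
    then show ?case using Suc(1)[of "zs @ [x]" for x] Suc(2) by simp
  qed
  have *: "comult_pow k a = MS ?f k a (tensor scale)" for k a
  proof (induct k arbitrary: a)
    case 0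
    then show ?case by simp
  next
    case (Suc k)
    have t: "multilinear scale ?f (Suc k) (tensor scale)" by (rule multilinear_tensor[OF vs])
    have tm: "multilinear scale ?f k (\<lambda>ys. tensor scale (x # ys))" for x
      using t by (simp add: multilinear_Suc)
    have "tprod scale 1 k (tensor scale [x]) (comult_pow k y) = MS ?f k y (\<lambda>c. tensor scale (x # c))" for x y
      using lm[of "lift scale ?f k (\<lambda>ys. tensor scale (x # ys))" ?f "[]" k y] lift_in[OF vs vector_space_tens2 tm[of x]]
      by (simp add: tprod_right[OF vs] Suc lift_tensor[OF vs vector_space_tens2 tm] cong: MS_cong)
    then show ?case
      using t by (simp add: lift_comult[OF vector_space_tens2] multilinear_2 lin_MS tm lin_MS_param[OF vs] vector_space_tens2 multilinear_Suc)
  qed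
  show "comult_pow k a = MS ?f k a (tensor scale)" by (rule *)
  show "comult_pow k a \<in> tensor_power scale k" using tp[of k a "[]"] by (simp add: *)
  show "lift scale s k g (comult_pow k a) = MS s k a g" if "vector_space s" "multilinear scale s k g"
    using lm[of "lift scale s k g" s "[]" k a] lift_in[OF vs that] that
    by (simp add: * lift_tensor[OF vs] cong: MS_cong)
qed

lemma MS_SWL_swap:
  assumes "vector_space s"
  shows "MS s k a (\<lambda>c. SWL bs (\<lambda>u v. B c u v)) = SWL bs (\<lambda>u v. MS s k a (\<lambda>c. B c u v))"
  by (induct k arbitrary: a B) (auto simp: SWL_scale assms SW_SWL_swap)

primrec MSL :: "('k \<Rightarrow> 'w::ab_group_add \<Rightarrow> 'w) \<Rightarrow> nat \<Rightarrow> 'a list \<Rightarrow> ('a list list \<Rightarrow> 'w) \<Rightarrow> 'w"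
  where
    "MSL s 0 as H = s (prod_list (map counit as)) (H [])"
  | "MSL s (Suc k) as H = SWL as (\<lambda>x y. MSL s k y (\<lambda>L. H (x # L)))"

lemma MSL_cong:
  "(\<And>L. length L = k \<Longrightarrow> (\<forall>l\<in>set L. length l = length as) \<Longrightarrow> H L = H' L) \<Longrightarrow> MSL s k as H = MSL s k as H'"
proof (induct k arbitrary: as H H')
  case 0
  then show ?case by simp
next
  case (Suc k)
  show ?case unfolding MSL.simps by (intro SWL_cong Suc(1) Suc(2)) auto
qed

lemma MSL_hom: "lin s s' h \<Longrightarrow> h (MSL s k a g) = MSL s' k a (\<lambda>c. h (g c))"
  by (induct k arbitrary: a g) (auto simp: SWL_additive[OF lin_additive] lin_iff)

lemma MSL_Nil: "vector_space s \<Longrightarrow> MSL s k [] H = H (replicate k [])"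
  by (induct k arbitrary: H) (auto simp: vector_space_def)

text \<open>Exchanges legs and letters: \<open>MSL\<close> splits the whole list leg by leg, whereas
  \<open>sweedler\<close> splits one letter into all of its legs before turning to the next.\<close>

lemma MSL_Cons:
  assumes s: "vector_space s"
  shows "MSL s k (a # as) H = MS s k a (\<lambda>c. MSL s k as (\<lambda>L. H (map2 (#) c L)))"
proof (induct k arbitrary: a as H)
  case 0
  then show ?case using s by (simp add: vector_space_def)
next
  case (Suc k)
  show ?case by (simp add: Suc MS_SWL_swap[OF s])
qed

definition legwise_multilinear :: "('k \<Rightarrow> 'w::ab_group_add \<Rightarrow> 'w) \<Rightarrow> nat \<Rightarrow> nat \<Rightarrow> ('a list list \<Rightarrow> 'w) \<Rightarrow> bool"
  where "legwise_multilinear s k n H \<longleftrightarrow> (\<forall>L i. length L = k \<longrightarrow> (\<forall>l\<in>set L. length l = n) \<longrightarrow> i < k \<longrightarrow>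
    multilinear scale s n (\<lambda>l. H (L[i := l])))"

lemma legwise_Cons:
  assumes "legwise_multilinear s (Suc k) n H" "length l = n"
  shows "legwise_multilinear s k n (\<lambda>L. H (l # L))"
  unfolding legwise_multilinear_def
proof (intro allI impI)
  fix L :: "'a list list" and i assume L: "length L = k" "\<forall>l\<in>set L. length l = n" "i < k"
  have "\<forall>x\<in>set (l # L). length x = n" "length (l # L) = Suc k" "Suc i < Suc k"
    using L assms(2) by auto
  then have "multilinear scale s n (\<lambda>x. H ((l # L)[Suc i := x]))"
    using assms(1) unfolding legwise_multilinear_def by blast
  then show "multilinear scale s n (\<lambda>x. H (l # L[i := x]))" by simp
qed

lemma legwise_hd:
  assumes "legwise_multilinear s (Suc k) n H" "length L = k" "\<forall>l\<in>set L. length l = n"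
  shows "multilinear scale s n (\<lambda>l. H (l # L))"
proof -
  have "\<forall>l\<in>set (replicate n undefined # L). length l = n" "length (replicate n undefined # L) = Suc k"
    using assms(2,3) by auto
  then have "multilinear scale s n (\<lambda>l. H ((replicate n undefined # L)[0 := l]))"
    using assms(1) unfolding legwise_multilinear_def by blast
  then show ?thesis by simp
qed

lemma multilinear_MSL_param:
  assumes "vector_space sV" "vector_space s"
    and "\<And>L. length L = k \<Longrightarrow> (\<forall>l\<in>set L. length l = length as) \<Longrightarrow> multilinear sV s n (\<lambda>z. H z L)"
  shows "multilinear sV s n (\<lambda>z. MSL s k as (H z))"
  using assms(3)
proof (induct k arbitrary: as H)
  case 0
  then show ?case by (auto intro: multilinear_comp[OF lin_scale[OF assms(2)]])
next
  case (Suc k)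
  show ?case unfolding MSL.simps
    by (intro multilinear_SWL_param assms Suc(1) Suc(2)) auto
qed

lemma lin_counit_prod: "multilinear scale (*) n (\<lambda>as. prod_list (map counit as))"
proof (induct n)
  case (Suc n)
  show ?case
  proof (rule multilinear_SucI)
    fix as :: "'a list"
    show "lin scale (*) (\<lambda>a. prod_list (map counit (a # as)))"
      using counit_linear by (simp add: lin_iff algebra_simps)
    fix a show "multilinear scale (*) n (\<lambda>as. prod_list (map counit (a # as)))"
      using multilinear_comp[OF lin_scale[OF vector_space_mult] Suc] by simp
  qed
qed simp

lemma multilinear_MSL:
  assumes s: "vector_space s" and "legwise_multilinear s k n H"
  shows "multilinear scale s n (\<lambda>as. MSL s k as H)"
  using assms(2)
proof (induct k arbitrary: H)
  case 0
  show ?case unfolding MSL.simps using lin_counit_prod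
    by (rule multilinear_comp[rotated, where h = "\<lambda>c. s c (H [])"])
      (rule lin_scale_left[OF s, of "(*)" "\<lambda>x. x"], simp add: lin_iff vector_space_mult)
next
  case (Suc k)
  show ?case unfolding MSL.simps
  proof (intro multilinear_SWL s, unfold bimultilinear_def, intro conjI allI impI)
    fix y :: "'a list" assume y: "length y = n"
    show "multilinear scale s n (\<lambda>x. MSL s k y (\<lambda>L. H (x # L)))"
      by (intro multilinear_MSL_param vs s legwise_hd[OF Suc(2)]) (auto simp: y)
  next
    fix x :: "'a list" assume "length x = n"
    then show "multilinear scale s n (\<lambda>y. MSL s k y (\<lambda>L. H (x # L)))"
      by (intro Suc(1) legwise_Cons[OF Suc(2)])
  qed
qed

text \<open>A transposition: \<open>sweedler\<close> delivers one list for each letter,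
  \<open>MSL\<close> one list for each leg.\<close>

definition legs :: "nat \<Rightarrow> 'b list list \<Rightarrow> 'b list list"
  where "legs k \<alpha> = map (\<lambda>i. leg (Suc i) \<alpha>) [0..<k]"

lemma legs_Cons: "length c = k \<Longrightarrow> legs k (c # \<alpha>) = map2 (#) c (legs k \<alpha>)"
  by (rule nth_equalityI) (auto simp: legs_def leg_def)

lemma legs_Nil: "legs k [] = replicate k []"
  by (rule nth_equalityI) (auto simp: legs_def leg_def)

text \<open>The copies of the first letter sit in different legs, so multilinearity in each leg
  gives multilinearity in these copies. Every \<open>lift\<close> inside \<open>sweedler\<close>
  needs such a statement before it can be evaluated.\<close>

lemma multilinear_slot:
  assumes s: "vector_space s" and H: "legwise_multilinear s k (Suc n) H"
  shows "length c = k \<Longrightarrow> legwise_multilinear s k n (\<lambda>L. H (map2 (#) c L))"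
    and "length as = n \<Longrightarrow> multilinear scale s k (\<lambda>c. MSL s k as (\<lambda>L. H (map2 (#) c L)))"
proof -
  show lw: "legwise_multilinear s k n (\<lambda>L. H (map2 (#) c L))" if c: "length c = k" for c
    unfolding legwise_multilinear_def
  proof (intro allI impI)
    fix L :: "'a list list" and i assume L: "length L = k" "\<forall>l\<in>set L. length l = n" "i < k"
    have "\<forall>l\<in>set (map2 (#) c L). length l = Suc n"
      using L by (auto simp: set_zip)
    then have "multilinear scale s (Suc n) (\<lambda>l. H ((map2 (#) c L)[i := l]))"
      using H[unfolded legwise_multilinear_def] L c by simp
    then have "multilinear scale s (n) (\<lambda>l. H ((map2 (#) c L)[i := (c ! i) # l]))"
      by (simp add: multilinear_Suc)
    moreover have "map2 (#) c (L[i := l]) = (map2 (#) c L)[i := (c ! i) # l]" for l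
      using L c by (intro nth_equalityI) (auto simp: nth_list_update)
    ultimately show "multilinear scale s (n) (\<lambda>l. H (map2 (#) c (L[i := l])))" by simp
  qed
  show "multilinear scale s k (\<lambda>c. MSL s k as (\<lambda>L. H (map2 (#) c L)))" if n: "length as = n"
    unfolding multilinear_def
  proof (intro allI impI)
    fix c :: "'a list" and i assume c: "length c = k" "i < k"
    \<comment> \<open>A list of length one serves as the parameter, so that the result on
      multilinear parameters covers a single linear slot.\<close>
    have "multilinear scale s (Suc 0) (\<lambda>x. MSL s k as (\<lambda>L. H (map2 (#) (c[i := hd x]) L)))"
    proof (rule multilinear_MSL_param[OF vs s])
      fix L :: "'a list list" assume L: "length L = k" "\<forall>l\<in>set L. length l = length as"
      have "\<forall>l\<in>set (map2 (#) c L). length l = Suc n"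
        using L n by (auto simp: set_zip)
      then have "multilinear scale s (Suc n) (\<lambda>l. H ((map2 (#) c L)[i := l]))"
        using H[unfolded legwise_multilinear_def] L c by simp
      then have "lin scale s (\<lambda>x. H ((map2 (#) c L)[i := x # (L ! i)]))"
        using L c n by (simp add: multilinear_Suc)
      moreover have "map2 (#) (c[i := x]) L = (map2 (#) c L)[i := x # (L ! i)]" for x
        using L c by (intro nth_equalityI) (auto simp: nth_list_update)
      ultimately show "multilinear scale s (Suc 0) (\<lambda>x. H (map2 (#) (c[i := hd x]) L))"
        by (simp add: multilinear_Suc)
    qed
    then show "lin scale s (\<lambda>x. MSL s k as (\<lambda>L. H (map2 (#) (c[i := x]) L)))"
      by (simp add: multilinear_Suc)
  qed
qed

text \<open>The bridge from the nested lifts of the definitions to finite sums. Multilinearity in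
  each leg is what makes the lifts evaluate.\<close>

lemma sweedler_legs:
  assumes s: "vector_space s" and "legwise_multilinear s k (length as) H"
  shows "sweedler s (map (Pair k) as) (\<lambda>\<alpha>. H (legs k \<alpha>)) = MSL s k as H"
  using assms(2)
proof (induct as arbitrary: H)
  case Nil
  then show ?case by (simp add: MSL_Nil s legs_Nil)
next
  case (Cons a as)
  note lw = multilinear_slot(1)[OF s Cons(2)[unfolded list.size add_Suc_right add_0_right]]
    and ml = multilinear_slot(2)[OF s Cons(2)[unfolded list.size add_Suc_right add_0_right] refl]
  have "sweedler s (map (Pair k) (a # as)) (\<lambda>\<alpha>. H (legs k \<alpha>))
     = lift scale s k (\<lambda>c. sweedler s (map (Pair k) as) (\<lambda>\<alpha>. H (legs k (c # \<alpha>)))) (comult_pow k a)"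
    by simp
  also have "\<dots> = lift scale s k (\<lambda>c. MSL s k as (\<lambda>L. H (map2 (#) c L))) (comult_pow k a)"
    by (rule arg_cong[where f = "\<lambda>h. h (comult_pow k a)"], rule lift_cong) (simp only: legs_Cons Cons(1)[OF lw])
  also have "\<dots> = MS s k a (\<lambda>c. MSL s k as (\<lambda>L. H (map2 (#) c L)))"
    by (rule MS_tens(3)[OF s ml])
  finally show ?case by (simp add: MSL_Cons[OF s])
qed

text \<open>Detaches the first leg of the first letter, because \<open>\<D>\<close> splits its first
  letter into one leg more than the others.\<close>

lemma sweedler_Cons_Suc:
  assumes s: "vector_space s"
    and ml: "multilinear scale s (Suc k) (\<lambda>c. sweedler s xs (\<lambda>cs. g (c # cs)))"
  shows "sweedler s ((Suc k, a) # xs) g = SW a (\<lambda>x y. sweedler s ((k, y) # xs) (\<lambda>\<alpha>. g ((x # hd \<alpha>) # tl \<alpha>)))"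
proof -
  have "sweedler s ((Suc k, a) # xs) g = SW a (\<lambda>x y. MS s k y (\<lambda>c. sweedler s xs (\<lambda>cs. g ((x # c) # cs))))"
    using MS_tens(3)[OF s ml] by simp
  also have "\<dots> = SW a (\<lambda>x y. sweedler s ((k, y) # xs) (\<lambda>\<alpha>. g ((x # hd \<alpha>) # tl \<alpha>)))"
    using ml by (simp add: MS_tens(3)[OF s] multilinear_Suc)
  finally show ?thesis .
qed

end

section \<open>Sweedler sums in bialgebras and cocommutative Hopf algebras\<close>

lemma (in k_algebra) lin_mult_left: "lin scale scale (\<lambda>x. c * x)"
  by (simp add: lin_iff vector_space_axioms distrib_left scale_mult_right)

lemma (in k_algebra) lin_mult_right: "lin scale scale (\<lambda>x. x * c)"
  by (simp add: lin_iff vector_space_axioms distrib_right scale_mult_left)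

lemma sum_list_concat_map: "(\<Sum>x\<leftarrow>concat xss. f x) = (\<Sum>xs\<leftarrow>xss. \<Sum>x\<leftarrow>xs. f x)"
  by (induct xss) auto

lemma lin_id: "vector_space s \<Longrightarrow> lin s s (\<lambda>x. x)"
  by (simp add: lin_iff)

context coalgebra
begin

lemma SW_scale: "vector_space s \<Longrightarrow> s c (SW as B) = SW as (\<lambda>x y. s c (B x y))"
  by (intro SW_additive lin_additive[OF lin_scale])

lemma sweedler_2:
  assumes s: "vector_space s" and B: "\<And>y. lin scale s (\<lambda>x. g [[x, y]])" "\<And>x. lin scale s (\<lambda>y. g [[x, y]])"
  shows "sweedler s [(2, a)] g = SW a (\<lambda>x y. g [[x, y]])"
proof -
  have "sweedler s [(2, a)] g = MS s 2 a (\<lambda>c. g [c])"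
    using MS_tens(3)[OF s, of 2 "\<lambda>c. g [c]" a] B by (simp add: multilinear_2 del: comult_pow.simps)
  also have "\<dots> = SW a (\<lambda>x y. SW y (\<lambda>u v. s (counit v) (g [[x, u]])))" by (simp add: numeral_2_eq_2)
  finally show ?thesis by (simp add: SW_counit_right[OF B(2)])
qed

text \<open>Frees bilinear sums from the chosen presentation: any expression of
  \<open>comult a\<close> by pure tensors gives the same value. The axioms on units, products and
  cocommutativity become rules for \<open>SW\<close> in this way.\<close>

lemma SW_from_tensors:
  assumes s: "vector_space s" and B: "\<And>y. lin scale s (\<lambda>x. B x y)" "\<And>x. lin scale s (B x)"
    and eq: "comult a = (\<Sum>(x, y)\<leftarrow>ps. tensor scale [x, y])"
  shows "SW a B = (\<Sum>(x, y)\<leftarrow>ps. B x y)"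
proof -
  let ?g = "\<lambda>c. B (hd c) (last c)"
  have g: "multilinear scale s 2 ?g" using B by (simp add: multilinear_2)
  have "SW a B = lift scale s 2 ?g (comult a)" by (subst lift_comult[OF s g]) simp
  also have "\<dots> = (\<Sum>p\<leftarrow>ps. lift scale s 2 ?g (case p of (x, y) \<Rightarrow> tensor scale [x, y]))"
    unfolding eq by (rule linear_maps_sum_list[OF lift_in[OF vs s g]]) (auto intro: tensor_in)
  also have "\<dots> = (\<Sum>(x, y)\<leftarrow>ps. B x y)"
    by (rule arg_cong[where f = sum_list], rule map_cong) (auto simp: lift_tensor[OF vs s g])
  finally show ?thesis .
qed

end

context bialgebra
begin

lemma SW_one:
  assumes "vector_space s" "\<And>y. lin scale s (\<lambda>x. B x y)" "\<And>x. lin scale s (B x)"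
  shows "SW 1 B = B 1 1"
  using SW_from_tensors[OF assms, of 1 "[(1, 1)]"] comult_one by simp

lemma SW_mult:
  assumes s: "vector_space s" and B: "\<And>y. lin scale s (\<lambda>x. B x y)" "\<And>x. lin scale s (B x)"
  shows "SW (a * b) B = SW a (\<lambda>x y. SW b (\<lambda>u v. B (x * u) (y * v)))"
proof -
  let ?f = "fscale (*) :: 'k \<Rightarrow> ('a, 'k) tens \<Rightarrow> _"
  have "multilinear scale ?f 2 (tensor scale)" by (rule multilinear_tensor[OF vs])
  then have t: "lin scale ?f (\<lambda>x. tensor scale [x, y])" "lin scale ?f (\<lambda>y. tensor scale [x, y])" for x y
    by (simp_all add: multilinear_2)
  have t1: "lin scale ?f (\<lambda>z. tensor scale [x * z, y])" "lin scale ?f (\<lambda>z. tensor scale [z * x, y])"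
    "lin scale ?f (\<lambda>z. tensor scale [y, x * z])" "lin scale ?f (\<lambda>z. tensor scale [y, z * x])" for x y
    by (rule lin_comp[OF lin_mult_left t(1)] lin_comp[OF lin_mult_right t(1)]
      lin_comp[OF lin_mult_left t(2)] lin_comp[OF lin_mult_right t(2)])+
  let ?in = "\<lambda>xs. lift scale ?f 2 (\<lambda>ys. tensor scale (map2 (*) xs ys)) (comult b)"
  have i: "?in [x, y] = SW b (\<lambda>u v. tensor scale [x * u, y * v])" for x y
    by (subst lift_comult[OF vector_space_tens2]) (simp_all add: multilinear_2 t1)
  have ml: "multilinear scale ?f 2 ?in"
    unfolding multilinear_2 i by (auto intro!: lin_SW vs vector_space_tens2 t1)
  have "comult (a * b) = SW a (\<lambda>x y. SW b (\<lambda>u v. tensor scale [x * u, y * v]))"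
    unfolding comult_mult lift_comult[OF vector_space_tens2 ml] i ..
  then have "comult (a * b) = (\<Sum>(x, y)\<leftarrow>concat (map (\<lambda>(x, y). map (\<lambda>(u, v). (x * u, y * v)) (presentation b)) (presentation a)).
     tensor scale [x, y])"
    by (simp add: SW_def sum_list_concat_map split_def o_def)
  from SW_from_tensors[OF s B this] show ?thesis
    by (simp add: SW_def sum_list_concat_map split_def o_def)
qed

end

context cocommutative_hopf_algebra
begin

lemma SW_cocomm:
  assumes s: "vector_space s" and B: "\<And>y. lin scale s (\<lambda>x. B x y)" "\<And>x. lin scale s (B x)"
  shows "SW a (\<lambda>x y. B y x) = SW a B"
proof -
  let ?f = "fscale (*) :: 'k \<Rightarrow> ('a, 'k) tens \<Rightarrow> _"
  have "multilinear scale ?f 2 (tensor scale)" by (rule multilinear_tensor[OF vs])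
  then have t: "lin scale ?f (\<lambda>x. tensor scale [x, y])" "lin scale ?f (\<lambda>y. tensor scale [x, y])" for x y
    by (simp_all add: multilinear_2)
  have "comult a = SW a (\<lambda>x y. tensor scale [y, x])"
    using cocommutative[of a] by (subst (asm) lift_comult[OF vector_space_tens2]) (simp_all add: multilinear_2 t)
  then have "comult a = (\<Sum>(x, y)\<leftarrow>map (\<lambda>(x, y). (y, x)) (presentation a). tensor scale [x, y])"
    by (simp add: SW_def split_def o_def)
  from SW_from_tensors[OF s B this] show ?thesis
    by (simp add: SW_def split_def o_def)
qed

lemma SWL_cocomm:
  assumes s: "vector_space s" and "bimultilinear (length as) s B"
  shows "SWL as (\<lambda>x y. B y x) = SWL as B"
  using assms(2)
proof (induct as arbitrary: B)
  case (Cons a as)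
  note S = bimultilinear_Suc[OF Cons(2)[simplified]]
  have "SWL (a # as) (\<lambda>x y. B y x) = SW a (\<lambda>x y. SWL as (\<lambda>xs ys. B (y # xs) (x # ys)))"
    by (simp add: Cons(1)[OF S(1)])
  also have "\<dots> = SW a (\<lambda>x y. SWL as (\<lambda>xs ys. B (x # xs) (y # ys)))"
    by (rule SW_cocomm[OF s]) (auto intro!: lin_SWL vs s S)
  finally show ?case by simp
qed simp

definition quadmultilinear :: "nat \<Rightarrow> ('k \<Rightarrow> 'w::ab_group_add \<Rightarrow> 'w) \<Rightarrow> ('a list \<Rightarrow> 'a list \<Rightarrow> 'a list \<Rightarrow> 'a list \<Rightarrow> 'w) \<Rightarrow> bool"
  where "quadmultilinear n s Q \<longleftrightarrow>
      (\<forall>w. length w = n \<longrightarrow> trimultilinear n s (\<lambda>x y z. Q x y z w))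
    \<and> (\<forall>x. length x = n \<longrightarrow> trimultilinear n s (Q x))"

text \<open>Interchange of the two middle legs of four. Coassociativity brings them together
  (\<open>A\<close>), cocommutativity swaps them, and \<open>A\<close> read backwards restores the
  grouping. Products of coalgebra maps are coalgebra maps, and actions are multiplicative, for this
  reason.\<close>

lemma SWL_medial:
  assumes s: "vector_space s" and Q: "quadmultilinear (length as) s Q"
  shows "SWL as (\<lambda>x y. SWL x (\<lambda>u v. SWL y (\<lambda>z w. Q u v z w)))
       = SWL as (\<lambda>x y. SWL x (\<lambda>u z. SWL y (\<lambda>v w. Q u v z w)))"
proof -
  let ?n = "length as"
  have q: "multilinear scale s ?n (\<lambda>x. Q x b c d)" "multilinear scale s ?n (\<lambda>x. Q b x c d)"
    "multilinear scale s ?n (\<lambda>x. Q b c x d)" "multilinear scale s ?n (\<lambda>x. Q b c d x)"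
    if "length b = ?n" "length c = ?n" "length d = ?n" for b c d
    using Q that by (auto simp: quadmultilinear_def trimultilinear_def)
  have bm: "bimultilinear ?n s (\<lambda>v w. Q u x v w)" "bimultilinear ?n s (\<lambda>v w. Q u v x w)" "bimultilinear ?n s (\<lambda>v z. Q u v z x)"
    if "length u = ?n" "length x = ?n" for u x
    using q that by (auto simp: bimultilinear_def)
  have A: "SWL as (\<lambda>x y. SWL x (\<lambda>u v. SWL y (\<lambda>z w. R u v z w)))
      = SWL as (\<lambda>u r. SWL r (\<lambda>m w. SWL m (\<lambda>v z. R u v z w)))"
    if R: "\<And>b c d. length b = ?n \<Longrightarrow> length c = ?n \<Longrightarrow> length d = ?n \<Longrightarrow> multilinear scale s ?n (\<lambda>x. R x b c d)
     \<and> multilinear scale s ?n (\<lambda>x. R b x c d) \<and> multilinear scale s ?n (\<lambda>x. R b c x d) \<and> multilinear scale s ?n (\<lambda>x. R b c d x)" for R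
  proof -
    have "SWL as (\<lambda>x y. SWL x (\<lambda>u v. SWL y (\<lambda>z w. R u v z w))) = SWL as (\<lambda>u r. SWL r (\<lambda>v y. SWL y (\<lambda>z w. R u v z w)))"
      using R by (intro SWL_coassoc[OF s])
        (auto simp: trimultilinear_def bimultilinear_def intro!: multilinear_SWL_param multilinear_SWL vs s)
    also have "\<dots> = SWL as (\<lambda>u r. SWL r (\<lambda>m w. SWL m (\<lambda>v z. R u v z w)))"
      using R by (intro SWL_cong SWL_coassoc[OF s, symmetric]) (auto simp: trimultilinear_def)
    finally show ?thesis .
  qed
  have "SWL as (\<lambda>x y. SWL x (\<lambda>u v. SWL y (\<lambda>z w. Q u v z w)))
      = SWL as (\<lambda>u r. SWL r (\<lambda>m w. SWL m (\<lambda>v z. Q u v z w)))"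
    by (rule A) (simp add: q)
  also have "\<dots> = SWL as (\<lambda>u r. SWL r (\<lambda>m w. SWL m (\<lambda>z v. Q u v z w)))"
    by (rule SWL_cong, rule SWL_cong, rule SWL_cocomm[OF s, symmetric]) (simp add: bm(3))
  also have "\<dots> = SWL as (\<lambda>x y. SWL x (\<lambda>u z. SWL y (\<lambda>v w. Q u v z w)))"
    by (rule A[symmetric]) (simp add: q)
  finally show ?thesis .
qed

lemma SW_medial:
  assumes s: "vector_space s"
    and Q: "\<And>b c d. lin scale s (\<lambda>x. Q x b c d)" "\<And>b c d. lin scale s (\<lambda>x. Q b x c d)"
       "\<And>b c d. lin scale s (\<lambda>x. Q b c x d)" "\<And>b c d. lin scale s (\<lambda>x. Q b c d x)"
  shows "SW a (\<lambda>x y. SW x (\<lambda>u v. SW y (\<lambda>z w. Q u v z w)))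
       = SW a (\<lambda>x y. SW x (\<lambda>u z. SW y (\<lambda>v w. Q u v z w)))"
  using SWL_medial[OF s, of "[a]" "\<lambda>u v z w. Q (hd u) (hd v) (hd z) (hd w)"] Q
  by (simp add: quadmultilinear_def trimultilinear_def multilinear_Suc)

lemma antipode_left': "SW a (\<lambda>x y. antipode x * y) = scale (counit a) 1"
  and antipode_right': "SW a (\<lambda>x y. x * antipode y) = scale (counit a) 1"
proof -
  have l: "lin scale scale (\<lambda>x. antipode x * y)" "lin scale scale (\<lambda>x. y * antipode x)" for y
    by (rule lin_comp[OF antipode_linear lin_mult_right] lin_comp[OF antipode_linear lin_mult_left])+
  show "SW a (\<lambda>x y. antipode x * y) = scale (counit a) 1"
    using antipode_left[of a] by (subst (asm) sweedler_2[OF vs]) (simp_all add: l lin_mult_left)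
  show "SW a (\<lambda>x y. x * antipode y) = scale (counit a) 1"
    using antipode_right[of a] by (subst (asm) sweedler_2[OF vs]) (simp_all add: l lin_mult_right)
qed

lemma counit_antipode: "counit (antipode a) = counit a"
proof -
  have "counit (antipode a) = SW a (\<lambda>x y. counit y * counit (antipode x))"
    by (rule SW_counit_right[symmetric]) (rule lin_comp[OF antipode_linear counit_linear])
  also have "\<dots> = SW a (\<lambda>x y. counit (antipode x * y))" by (simp add: counit_mult mult.commute)
  also have "\<dots> = counit (SW a (\<lambda>x y. antipode x * y))"
    by (rule SW_additive[symmetric]) (rule lin_additive[OF counit_linear])
  finally show ?thesis using counit_linear by (simp add: antipode_left' lin_iff counit_one)
qed

text \<open>By cocommutativity the antipode is a coalgebra map: the coproduct after the antipode and
  the antipode on both factors after the coproduct are both convolution inverse to the coproduct,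
  and inverses are unique.\<close>

lemma SW_antipode:
  assumes s: "vector_space s" and B: "\<And>y. lin scale s (\<lambda>x. B x y)" "\<And>x. lin scale s (B x)"
  shows "SW (antipode a) B = SW a (\<lambda>x y. B (antipode x) (antipode y))"
proof -
  let ?S = antipode
  note ml = lin_mult_left and mr = lin_mult_right
  note S = antipode_linear
  have Bs: "B (scale c x) y = s c (B x y)" "B x (scale c y) = s c (B x y)" for c x y
    using B by (simp_all add: lin_iff)
  let ?K = "\<lambda>b p q. SW b (\<lambda>c d. B (p * ?S c) (q * ?S d))"
  \<comment> \<open>\<open>?F\<close> pairs \<open>B\<close> with a product of three factors: the
    coproduct of \<open>?S a1\<close>, the coproduct of \<open>a2\<close>, and the coproduct of
    \<open>b\<close> with \<open>?S\<close> on both sides. Cancelling the first two factors leaves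
    one side of the claim, cancelling the last two the other.\<close>
  let ?F = "\<lambda>a1 a2 b. SW (?S a1) (\<lambda>x y. SW a2 (\<lambda>u v. ?K b (x * u) (y * v)))"
  have K: "lin scale s (\<lambda>p. ?K b p q)" "lin scale s (?K b p)" "lin scale s (\<lambda>b. ?K b p q)" for b p q
    by (intro lin_SW lin_SW_arg s vs lin_comp[OF mr B(1)] lin_comp[OF mr B(2)]
       lin_comp[OF S lin_comp[OF ml B(1)]] lin_comp[OF S lin_comp[OF ml B(2)]])+
  have BS: "lin scale s (\<lambda>x. B (?S x) y)" "lin scale s (\<lambda>y. B x (?S y))" for x y
    by (rule lin_comp[OF S B(1)] lin_comp[OF S B(2)])+
  have F: "lin scale s (\<lambda>z. ?F z y b)" "lin scale s (\<lambda>z. ?F x z b)" "lin scale s (\<lambda>z. ?F x y z)" for x y b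
    by (intro lin_comp[OF S] lin_SW_arg lin_SW s vs lin_comp[OF mr K(1)] lin_comp[OF mr K(2)]
      lin_comp[OF ml K(1)] lin_comp[OF ml K(2)] K(3))+
  have "SW a (\<lambda>m b. SW m (\<lambda>a1 a2. ?F a1 a2 b)) = SW a (\<lambda>a1 r. SW r (\<lambda>a2 b. ?F a1 a2 b))"
    by (rule SW_coassoc[OF s]) (rule F)+
  moreover have "SW m (\<lambda>a1 a2. ?F a1 a2 b) = s (counit m) (SW b (\<lambda>x y. B (?S x) (?S y)))" for m b
  proof -
    have l: "lin scale s (\<lambda>z. SW z (?K b))" by (rule lin_SW_arg[OF s K(1,2)])
    have "SW m (\<lambda>a1 a2. ?F a1 a2 b) = SW m (\<lambda>a1 a2. SW (?S a1 * a2) (?K b))"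
      by (simp only: SW_mult[OF s K(1,2)])
    also have "\<dots> = SW (SW m (\<lambda>a1 a2. ?S a1 * a2)) (?K b)"
      by (rule SW_additive[symmetric]) (rule lin_additive[OF l])
    also have "\<dots> = s (counit m) (SW 1 (?K b))"
      using l by (simp add: antipode_left' lin_iff)
    finally show ?thesis by (simp add: SW_one[OF s K(1,2)])
  qed
  moreover have "SW a (\<lambda>m b. s (counit m) (SW b (\<lambda>x y. B (?S x) (?S y)))) = SW a (\<lambda>x y. B (?S x) (?S y))"
    by (rule SW_counit_left) (rule lin_SW_arg[OF s BS])
  moreover have "SW r (\<lambda>a2 b. ?F a1 a2 b) = s (counit r) (SW (?S a1) B)" for r a1
  proof -
    have "SW r (\<lambda>a2 b. ?F a1 a2 b)
       = SW (?S a1) (\<lambda>x y. SW r (\<lambda>a2 b. SW a2 (\<lambda>u v. SW b (\<lambda>c d. B (x * (u * ?S c)) (y * (v * ?S d))))))"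
      by (subst SW_swap) (simp add: mult.assoc)
    also have "\<dots> = SW (?S a1) (\<lambda>x y. SW r (\<lambda>a2 b. SW a2 (\<lambda>u c. SW b (\<lambda>v d. B (x * (u * ?S c)) (y * (v * ?S d))))))"
      by (subst SW_medial[OF s]) (simp_all add: lin_comp[OF mr lin_comp[OF ml B(1)]] lin_comp[OF mr lin_comp[OF ml B(2)]]
          lin_comp[OF S lin_comp[OF ml lin_comp[OF ml B(1)]]] lin_comp[OF S lin_comp[OF ml lin_comp[OF ml B(2)]]])
    also have "\<dots> = SW (?S a1) (\<lambda>x y. SW r (\<lambda>a2 b. s (counit a2) (s (counit b) (B x y))))"
    proof -
      have "SW b (\<lambda>v d. B X (y * (v * ?S d))) = B X (y * SW b (\<lambda>v d. v * ?S d))" for b X y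
        by (rule SW_additive[OF lin_additive[OF lin_comp[OF ml B(2)]], symmetric])
      then have 1: "SW b (\<lambda>v d. B X (y * (v * ?S d))) = s (counit b) (B X y)" for b X y
        by (simp add: antipode_right' scale_mult_right Bs)
      have "SW b (\<lambda>v d. B (x * (v * ?S d)) Y) = B (x * SW b (\<lambda>v d. v * ?S d)) Y" for b x Y
        by (rule SW_additive[OF lin_additive[OF lin_comp[OF ml B(1)]], symmetric])
      then have 2: "SW b (\<lambda>v d. B (x * (v * ?S d)) Y) = s (counit b) (B x Y)" for b Y x
        by (simp add: antipode_right' scale_mult_right Bs)
      have 3: "SW a2 (\<lambda>u c. s k (B (x * (u * ?S c)) y)) = s (counit a2) (s k (B x y))" for a2 k x y
        using s by (simp add: SW_scale[OF s, symmetric] 2 vector_space_def mult.commute)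
      show ?thesis by (simp only: 1 3)
    qed
    also have "\<dots> = SW (?S a1) (\<lambda>x y. s (counit r) (B x y))"
      by (subst SW_counit_left) (simp_all add: lin_scale_left[OF s counit_linear])
    finally show ?thesis by (simp add: SW_scale[OF s])
  qed
  moreover have "SW a (\<lambda>a1 r. s (counit r) (SW (?S a1) B)) = SW (?S a) B"
    by (rule SW_counit_right) (rule lin_comp[OF S lin_SW_arg[OF s B]])
  ultimately show ?thesis by simp
qed

end

section \<open>Convolution algebras of linear maps into an algebra\<close>

definition alg_monoid :: "'w::{times,one} monoid"
  where "alg_monoid = \<lparr>carrier = UNIV, monoid.mult = (*), one = 1\<rparr>"

lemma alg_monoid_simps [simp]:
  "carrier alg_monoid = UNIV" "x \<otimes>\<^bsub>alg_monoid\<^esub> y = x * y" "\<one>\<^bsub>alg_monoid\<^esub> = 1"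
  by (simp_all add: alg_monoid_def)

context coalgebra
begin

abbreviation conv :: "nat \<Rightarrow> ('k \<Rightarrow> 'w::{ab_group_add,times,one} \<Rightarrow> 'w) \<Rightarrow> (('a, 'k) tens \<Rightarrow> 'w) monoid"
  where "conv n s \<equiv> conv_monoid n s alg_monoid"

abbreviation Hom :: "nat \<Rightarrow> ('k \<Rightarrow> 'w::ab_group_add \<Rightarrow> 'w) \<Rightarrow> (('a, 'k) tens \<Rightarrow> 'w) set"
  where "Hom n s \<equiv> linear_maps scale s n UNIV"

abbreviation T :: "'a list \<Rightarrow> ('a, 'k) tens"
  where "T \<equiv> tensor scale"

lemma Hom_multilinear: "vector_space s \<Longrightarrow> f \<in> Hom n s \<Longrightarrow> multilinear scale s n (\<lambda>l. f (T l))"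
  by (rule linear_maps_multilinear[OF vs])

lemma Hom_eqI:
  assumes "vector_space s" "f \<in> Hom n s" "g \<in> Hom n s" "\<And>as. length as = n \<Longrightarrow> f (T as) = g (T as)"
  shows "f = g"
  by (rule linear_maps_ext[OF vs assms])

text \<open>Convolution is defined with two-leg Sweedler sums, while the recursion of
  \<open>MSL\<close> ends in a counit; the counit law removes it.\<close>

lemma sweedler_leg2:
  assumes s: "vector_space s" and B: "bimultilinear (length as) s B"
  shows "sweedler s (map (Pair 2) as) (\<lambda>\<alpha>. B (leg 1 \<alpha>) (leg 2 \<alpha>)) = SWL as B"
proof -
  let ?H = "\<lambda>L. B (hd L) (last L)"
  have "legwise_multilinear s 2 (length as) ?H"
    unfolding legwise_multilinear_def
  proof (intro allI impI)
    fix L :: "'a list list" and i :: nat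
    assume L: "length L = 2" "\<forall>l\<in>set L. length l = length as" "i < 2"
    then obtain x y where "L = [x, y]" "length x = length as" "length y = length as"
      by (auto simp: numeral_2_eq_2 length_Suc_conv)
    moreover have "i = 0 \<or> i = 1" using L(3) by auto
    ultimately show "multilinear scale s (length as) (\<lambda>l. ?H (L[i := l]))"
      using B by (auto simp: bimultilinear_def)
  qed
  from sweedler_legs[OF s this]
  have "sweedler s (map (Pair 2) as) (\<lambda>\<alpha>. ?H (legs 2 \<alpha>)) = MSL s 2 as ?H" .
  moreover have "?H (legs 2 \<alpha>) = B (leg 1 \<alpha>) (leg 2 \<alpha>)" for \<alpha>
    by (simp add: legs_def numeral_2_eq_2)
  moreover have "MSL s 2 as ?H = SWL as B"
  proof -
    have "MSL s 2 as ?H = SWL as (\<lambda>x y. SWL y (\<lambda>u v. s (prod_list (map counit v)) (B x u)))"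
      by (simp add: numeral_2_eq_2)
    also have "\<dots> = SWL as B"
      using B by (intro SWL_cong SWL_counit_right s) (auto simp: bimultilinear_def)
    finally show ?thesis .
  qed
  ultimately show ?thesis by simp
qed

lemma lift_SWL:
  assumes s: "vector_space s" and B: "bimultilinear n s B"
  shows "lift scale s n (\<lambda>as. SWL as B) \<in> Hom n s"
    "length as = n \<Longrightarrow> lift scale s n (\<lambda>as. SWL as B) (T as) = SWL as B"
  using lift_in[OF vs s multilinear_SWL[OF s B]] lift_tensor[OF vs s multilinear_SWL[OF s B]] by auto

lemma bimultilinear_pairing:
  assumes s: "vector_space s1" "vector_space s2" and f: "f \<in> Hom n s1" and g: "g \<in> Hom n s2"
    and \<beta>: "\<And>y. lin s1 s (\<lambda>x. \<beta> x y)" "\<And>x. lin s2 s (\<beta> x)"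
  shows "bimultilinear n s (\<lambda>x y. \<beta> (f (T x)) (g (T y)))"
  unfolding bimultilinear_def
  using multilinear_comp[OF \<beta>(1) Hom_multilinear[OF s(1) f]] multilinear_comp[OF \<beta>(2) Hom_multilinear[OF s(2) g]]
  by blast

lemma multilinear_counit: "vector_space s \<Longrightarrow> multilinear scale s n (\<lambda>as. s (prod_list (map counit as)) w)"
  using multilinear_comp[OF lin_scale_left[of s "(*)" "\<lambda>x. x" w] lin_counit_prod] lin_id[OF vector_space_mult] by simp

context
  fixes s :: "'k \<Rightarrow> 'w::{ring,monoid_mult} \<Rightarrow> 'w"
  assumes alg: "k_algebra s"
begin

interpretation W: k_algebra s by (rule alg)

lemma conv_bimultilinear: "f \<in> Hom n s \<Longrightarrow> g \<in> Hom n s \<Longrightarrow> bimultilinear n s (\<lambda>x y. f (T x) * g (T y))"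
  by (rule bimultilinear_pairing[OF W.vector_space_axioms W.vector_space_axioms _ _ W.lin_mult_right W.lin_mult_left])

lemma conv_mult_eq:
  assumes "f \<in> Hom n s" "g \<in> Hom n s"
  shows "f \<otimes>\<^bsub>conv n s\<^esub> g = lift scale s n (\<lambda>as. SWL as (\<lambda>x y. f (T x) * g (T y)))"
  unfolding conv_monoid_def monoid.simps alg_monoid_simps
  by (intro lift_cong sweedler_leg2[where B = "\<lambda>x y. f (T x) * g (T y)"] W.vector_space_axioms)
    (simp add: conv_bimultilinear assms)

lemma conv_mult_in:
  "f \<in> Hom n s \<Longrightarrow> g \<in> Hom n s \<Longrightarrow> f \<otimes>\<^bsub>conv n s\<^esub> g \<in> Hom n s"
  by (simp add: conv_mult_eq lift_SWL W.vector_space_axioms conv_bimultilinear)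

lemma conv_mult_tensor:
  "f \<in> Hom n s \<Longrightarrow> g \<in> Hom n s \<Longrightarrow> length as = n \<Longrightarrow>
    (f \<otimes>\<^bsub>conv n s\<^esub> g) (T as) = SWL as (\<lambda>x y. f (T x) * g (T y))"
  by (simp add: conv_mult_eq lift_SWL W.vector_space_axioms conv_bimultilinear)

lemma conv_carrier: "carrier (conv n s) = Hom n s"
  by (simp add: conv_monoid_def)

lemma conv_one_in: "\<one>\<^bsub>conv n s\<^esub> \<in> Hom n s"
  and conv_one_tensor: "length as = n \<Longrightarrow> \<one>\<^bsub>conv n s\<^esub> (T as) = s (prod_list (map counit as)) 1"
  unfolding conv_monoid_def monoid.simps alg_monoid_simps
  by (rule lift_in[OF vs W.vector_space_axioms multilinear_counit[OF W.vector_space_axioms]])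
    (rule lift_tensor[OF vs W.vector_space_axioms multilinear_counit[OF W.vector_space_axioms]])

lemma conv_monoid: "Group.monoid (conv_monoid n s (alg_monoid :: 'w monoid))"
proof (rule Group.monoid.intro; unfold conv_carrier)
  let ?M = "conv_monoid n s (alg_monoid :: 'w monoid)"
  note s = W.vector_space_axioms
  show "f \<otimes>\<^bsub>?M\<^esub> g \<in> Hom n s" if "f \<in> Hom n s" "g \<in> Hom n s" for f g
    by (rule conv_mult_in[OF that])
  show "\<one>\<^bsub>?M\<^esub> \<in> Hom n s" by (rule conv_one_in)
  show "f \<otimes>\<^bsub>?M\<^esub> g \<otimes>\<^bsub>?M\<^esub> h = f \<otimes>\<^bsub>?M\<^esub> (g \<otimes>\<^bsub>?M\<^esub> h)"
    if f: "f \<in> Hom n s" and g: "g \<in> Hom n s" and h: "h \<in> Hom n s" for f g h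
  proof (rule Hom_eqI[OF s])
    note m = Hom_multilinear[OF s f] Hom_multilinear[OF s g] Hom_multilinear[OF s h]
    fix as :: "'a list" assume as: "length as = n"
    have "(f \<otimes>\<^bsub>?M\<^esub> g \<otimes>\<^bsub>?M\<^esub> h) (T as) = SWL as (\<lambda>x y. SWL x (\<lambda>u v. f (T u) * g (T v) * h (T y)))"
      unfolding conv_mult_tensor[OF conv_mult_in[OF f g] h as]
      by (rule SWL_cong, subst conv_mult_tensor[OF f g])
        (simp_all add: as SWL_additive[OF lin_additive[OF W.lin_mult_right]])
    also have "\<dots> = SWL as (\<lambda>x y. SWL y (\<lambda>u v. f (T x) * g (T u) * h (T v)))"
      using m as by (intro SWL_coassoc[OF s])
        (auto simp: trimultilinear_def intro!: multilinear_comp[OF W.lin_mult_left] multilinear_comp[OF W.lin_mult_right])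
    also have "\<dots> = (f \<otimes>\<^bsub>?M\<^esub> (g \<otimes>\<^bsub>?M\<^esub> h)) (T as)"
      unfolding conv_mult_tensor[OF f conv_mult_in[OF g h] as]
      by (rule SWL_cong, subst conv_mult_tensor[OF g h])
        (simp_all add: as SWL_additive[OF lin_additive[OF W.lin_mult_left]] mult.assoc)
    finally show "(f \<otimes>\<^bsub>?M\<^esub> g \<otimes>\<^bsub>?M\<^esub> h) (T as) = (f \<otimes>\<^bsub>?M\<^esub> (g \<otimes>\<^bsub>?M\<^esub> h)) (T as)" .
  qed (intro conv_mult_in f g h)+
  show "\<one>\<^bsub>?M\<^esub> \<otimes>\<^bsub>?M\<^esub> f = f" if f: "f \<in> Hom n s" for f
  proof (rule Hom_eqI[OF s])
    note m = Hom_multilinear[OF s f]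
    fix as :: "'a list" assume as: "length as = n"
    have "(\<one>\<^bsub>?M\<^esub> \<otimes>\<^bsub>?M\<^esub> f) (T as) = SWL as (\<lambda>x y. s (prod_list (map counit x)) (f (T y)))"
      unfolding conv_mult_tensor[OF conv_one_in f as]
      by (rule SWL_cong) (simp add: conv_one_tensor as W.scale_mult_left)
    then show "(\<one>\<^bsub>?M\<^esub> \<otimes>\<^bsub>?M\<^esub> f) (T as) = f (T as)"
      using SWL_counit_left[of s as "\<lambda>l. f (T l)"] m as s by simp
  qed (intro conv_mult_in conv_one_in f)+
  show "f \<otimes>\<^bsub>?M\<^esub> \<one>\<^bsub>?M\<^esub> = f" if f: "f \<in> Hom n s" for f
  proof (rule Hom_eqI[OF s])
    note m = Hom_multilinear[OF s f]
    fix as :: "'a list" assume as: "length as = n"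
    have "(f \<otimes>\<^bsub>?M\<^esub> \<one>\<^bsub>?M\<^esub>) (T as) = SWL as (\<lambda>x y. s (prod_list (map counit y)) (f (T x)))"
      unfolding conv_mult_tensor[OF f conv_one_in as]
      by (rule SWL_cong) (simp add: conv_one_tensor as W.scale_mult_right)
    then show "(f \<otimes>\<^bsub>?M\<^esub> \<one>\<^bsub>?M\<^esub>) (T as) = f (T as)"
      using SWL_counit_right[of s as "\<lambda>l. f (T l)"] m as s by simp
  qed (intro conv_mult_in conv_one_in f)+
qed

end

end

context cocommutative_hopf_algebra
begin

lemma k_algebra_scale: "k_algebra scale"
  by (rule k_algebra_axioms)

lemma conv_comm_monoid:
  fixes s :: "'k \<Rightarrow> 'w::{comm_ring,comm_monoid_mult} \<Rightarrow> 'w"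
  assumes alg: "k_algebra s"
  shows "comm_monoid (conv_monoid n s (alg_monoid :: 'w monoid))"
proof -
  interpret W: k_algebra s by (rule alg)
  interpret M: Group.monoid "conv_monoid n s (alg_monoid :: 'w monoid)" by (rule conv_monoid[OF alg])
  note s = W.vector_space_axioms
  show ?thesis
  proof (unfold_locales, unfold conv_carrier[OF alg])
    fix f g assume fg: "f \<in> Hom n s" "g \<in> Hom n s"
    show "f \<otimes>\<^bsub>conv n s\<^esub> g = g \<otimes>\<^bsub>conv n s\<^esub> f"
    proof (rule Hom_eqI[OF s])
      fix as :: "'a list" assume as: "length as = n"
      show "(f \<otimes>\<^bsub>conv n s\<^esub> g) (T as) = (g \<otimes>\<^bsub>conv n s\<^esub> f) (T as)"
        unfolding conv_mult_tensor[OF alg fg as] conv_mult_tensor[OF alg fg(2,1) as]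
        using SWL_cocomm[OF s conv_bimultilinear[OF alg fg, folded as]] by (simp add: mult.commute)
    qed (intro conv_mult_in[OF alg] fg)+
  qed
qed

definition coalgebra_map :: "nat \<Rightarrow> (('a, 'k) tens \<Rightarrow> 'a) \<Rightarrow> bool"
  where "coalgebra_map n g \<longleftrightarrow> g \<in> Hom n scale \<and> (\<forall>as. length as = n \<longrightarrow>
    comult (g (T as)) = SWL as (\<lambda>x y. T [g (T x), g (T y)])
    \<and> counit (g (T as)) = prod_list (map counit as))"

lemma coalgebra_map_Hom: "coalgebra_map n g \<Longrightarrow> g \<in> Hom n scale"
  and coalgebra_map_counit: "coalgebra_map n g \<Longrightarrow> length as = n \<Longrightarrow> counit (g (T as)) = prod_list (map counit as)"
  by (simp_all add: coalgebra_map_def)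

lemma linear_maps_SWL:
  assumes f: "f \<in> linear_maps sV sW n UNIV"
    and h: "\<And>x y. length x = length as \<Longrightarrow> length y = length as \<Longrightarrow> h x y \<in> tensor_power sV n"
  shows "f (SWL as h) = SWL as (\<lambda>x y. f (h x y))" "SWL as h \<in> tensor_power sV n"
proof -
  have "f (SWL as h) = SWL as (\<lambda>x y. f (h x y)) \<and> SWL as h \<in> tensor_power sV n"
    using h
  proof (induct as arbitrary: h)
    case (Cons a as)
    have "SWL as (\<lambda>xs ys. h (x # xs) (y # ys)) \<in> tensor_power sV n"
      "f (SWL as (\<lambda>xs ys. h (x # xs) (y # ys))) = SWL as (\<lambda>xs ys. f (h (x # xs) (y # ys)))" for x y
      using Cons(1)[of "\<lambda>xs ys. h (x # xs) (y # ys)"] Cons(2) by auto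
    then show ?case by (simp add: linear_maps_SW[OF f] SW_tensor_power)
  qed auto
  then show "f (SWL as h) = SWL as (\<lambda>x y. f (h x y))" "SWL as h \<in> tensor_power sV n" by auto
qed

lemma coalgebra_map_SW:
  assumes g: "coalgebra_map n g" and as: "length as = n"
    and s: "vector_space s" and B: "\<And>y. lin scale s (\<lambda>x. B x y)" "\<And>x. lin scale s (B x)"
  shows "SW (g (T as)) B = SWL as (\<lambda>x y. B (g (T x)) (g (T y)))"
proof -
  let ?g = "\<lambda>c. B (hd c) (last c)"
  have m: "multilinear scale s 2 ?g" using B by (simp add: multilinear_2)
  have "SW (g (T as)) B = lift scale s 2 ?g (comult (g (T as)))" by (subst lift_comult[OF s m]) simp
  also have "\<dots> = lift scale s 2 ?g (SWL as (\<lambda>x y. T [g (T x), g (T y)]))"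
    using g as by (simp add: coalgebra_map_def)
  also have "\<dots> = SWL as (\<lambda>x y. lift scale s 2 ?g (T [g (T x), g (T y)]))"
    by (rule linear_maps_SWL[OF lift_in[OF vs s m]]) (simp add: tensor_in)
  finally show ?thesis by (simp add: lift_tensor[OF vs s m])
qed

text \<open>Compatibility with the coproduct is tested through bilinear \<open>B\<close>, so that
  the rules for \<open>SW\<close> apply; the pure tensor as \<open>B\<close> gives the condition on
  \<open>comult\<close>.\<close>

lemma coalgebra_mapI:
  assumes g: "g \<in> Hom n scale" and c: "\<And>as. length as = n \<Longrightarrow> counit (g (T as)) = prod_list (map counit as)"
    and SW: "\<And>as B. length as = n \<Longrightarrow> (\<And>y. lin scale (fscale (*) :: 'k \<Rightarrow> ('a, 'k) tens \<Rightarrow> _) (\<lambda>x. B x y)) \<Longrightarrow>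
      (\<And>x. lin scale (fscale (*)) (B x)) \<Longrightarrow> SW (g (T as)) B = SWL as (\<lambda>x y. B (g (T x)) (g (T y)))"
  shows "coalgebra_map n g"
proof -
  have "multilinear scale (fscale (*)) 2 T" by (rule multilinear_tensor[OF vs])
  then have t: "lin scale (fscale (*)) (\<lambda>x. T [x, y])" "lin scale (fscale (*)) (\<lambda>y. T [x, y])" for x y
    by (simp_all add: multilinear_2)
  show ?thesis
    unfolding coalgebra_map_def using g c SW[OF _ t] comult_SW by auto
qed

definition coalgebra_maps :: "nat \<Rightarrow> (('a, 'k) tens \<Rightarrow> 'a) monoid"
  where "coalgebra_maps n = (conv n scale)\<lparr>carrier := {g. coalgebra_map n g}\<rparr>"

text \<open>The coproduct of a product yields four legs, two for \<open>g\<close> followed by two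
  for \<open>h\<close>; \<open>SWL_medial\<close> regroups them into a pair of \<open>g\<close> and
  \<open>h\<close> for each factor.\<close>

lemma coalgebra_map_mult:
  assumes g: "coalgebra_map n g" and h: "coalgebra_map n h"
  shows "coalgebra_map n (g \<otimes>\<^bsub>conv n scale\<^esub> h)"
proof (rule coalgebra_mapI)
  let ?p = "g \<otimes>\<^bsub>conv n scale\<^esub> h"
  note gH = coalgebra_map_Hom[OF g] and hH = coalgebra_map_Hom[OF h]
  note v = conv_mult_tensor[OF k_algebra_scale gH hH]
  note gm = Hom_multilinear[OF vs gH] and hm = Hom_multilinear[OF vs hH]
  show "?p \<in> Hom n scale" by (rule conv_mult_in[OF k_algebra_scale gH hH])
  fix as :: "'a list" assume as: "length as = n"
  have "counit (?p (T as)) = SWL as (\<lambda>x y. prod_list (map counit x) * prod_list (map counit y))"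
    unfolding v[OF as] SWL_additive[OF lin_additive[OF counit_linear]]
    by (rule SWL_cong) (simp add: counit_mult coalgebra_map_counit[OF g] coalgebra_map_counit[OF h] as)
  then show "counit (?p (T as)) = prod_list (map counit as)"
    using SWL_counit_left[of "(*)" as "\<lambda>l. prod_list (map counit l)"] lin_counit_prod vector_space_mult by simp
  fix B :: "'a \<Rightarrow> 'a \<Rightarrow> ('a, 'k) tens"
  let ?s = "fscale (*) :: 'k \<Rightarrow> ('a, 'k) tens \<Rightarrow> _"
  assume B: "\<And>y. lin scale ?s (\<lambda>x. B x y)" "\<And>x. lin scale ?s (B x)"
  note s = vector_space_tens2
  note BM = lin_comp[OF lin_mult_left B(1)] lin_comp[OF lin_mult_right B(1)] lin_comp[OF lin_mult_left B(2)] lin_comp[OF lin_mult_right B(2)]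
  have "SW (?p (T as)) B = SWL as (\<lambda>x y. SW (g (T x) * h (T y)) B)"
    unfolding v[OF as] by (rule SWL_additive) (rule lin_additive[OF lin_SW_arg[OF s B]])
  also have "\<dots> = SWL as (\<lambda>x y. SWL x (\<lambda>x1 x2. SWL y (\<lambda>y1 y2. B (g (T x1) * h (T y1)) (g (T x2) * h (T y2)))))"
  proof (rule SWL_cong)
    fix x y :: "'a list" assume l: "length x = length as" "length y = length as"
    have "SW (g (T x) * h (T y)) B = SW (g (T x)) (\<lambda>p q. SW (h (T y)) (\<lambda>u v. B (p * u) (q * v)))"
      by (rule SW_mult[OF s B])
    also have "\<dots> = SWL x (\<lambda>x1 x2. SW (h (T y)) (\<lambda>u v. B (g (T x1) * u) (g (T x2) * v)))"
      using l as by (intro coalgebra_map_SW[OF g _ s] lin_SW s vs BM) auto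
    also have "\<dots> = SWL x (\<lambda>x1 x2. SWL y (\<lambda>y1 y2. B (g (T x1) * h (T y1)) (g (T x2) * h (T y2))))"
      using l as by (intro SWL_cong coalgebra_map_SW[OF h _ s] BM) auto
    finally show "SW (g (T x) * h (T y)) B = \<dots>" .
  qed
  also have "\<dots> = SWL as (\<lambda>x y. SWL x (\<lambda>x1 y1. SWL y (\<lambda>x2 y2. B (g (T x1) * h (T y1)) (g (T x2) * h (T y2)))))"
    using gm hm as by (intro SWL_medial[OF s])
      (auto simp: quadmultilinear_def trimultilinear_def intro!: multilinear_comp[OF BM(1)] multilinear_comp[OF BM(2)]
        multilinear_comp[OF BM(3)] multilinear_comp[OF BM(4)])
  also have "\<dots> = SWL as (\<lambda>x y. B (?p (T x)) (?p (T y)))"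
  proof (rule SWL_cong)
    fix x y :: "'a list" assume l: "length x = length as" "length y = length as"
    show "SWL x (\<lambda>x1 y1. SWL y (\<lambda>x2 y2. B (g (T x1) * h (T y1)) (g (T x2) * h (T y2)))) = B (?p (T x)) (?p (T y))"
      using l as by (subst SWL_swap) (simp add: v SWL_additive[OF lin_additive[OF B(1)]] SWL_additive[OF lin_additive[OF B(2)]])
  qed
  finally show "SW (?p (T as)) B = SWL as (\<lambda>x y. B (?p (T x)) (?p (T y)))" .
qed

lemma coalgebra_map_one: "coalgebra_map n \<one>\<^bsub>conv n scale\<^esub>"
proof (rule coalgebra_mapI)
  let ?one = "\<one>\<^bsub>conv n scale\<^esub>"
  note v = conv_one_tensor[OF k_algebra_scale]
  show "?one \<in> Hom n scale" by (rule conv_one_in[OF k_algebra_scale])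
  fix as :: "'a list" assume as: "length as = n"
  show "counit (?one (T as)) = prod_list (map counit as)"
    using counit_linear by (simp add: v as lin_iff counit_one)
  fix B :: "'a \<Rightarrow> 'a \<Rightarrow> ('a, 'k) tens"
  let ?s = "fscale (*) :: 'k \<Rightarrow> ('a, 'k) tens \<Rightarrow> _"
  assume B: "\<And>y. lin scale ?s (\<lambda>x. B x y)" "\<And>x. lin scale ?s (B x)"
  note s = vector_space_tens2
  have "SW (?one (T as)) B = ?s (prod_list (map counit as)) (B 1 1)"
    using lin_SW_arg[OF s B] by (simp add: v as lin_iff SW_one[OF s B])
  moreover have "SWL as (\<lambda>x y. B (?one (T x)) (?one (T y)))
     = SWL as (\<lambda>x y. ?s (prod_list (map counit x)) (?s (prod_list (map counit y)) (B 1 1)))"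
    using B by (intro SWL_cong) (simp add: v as lin_iff, simp add: fscale_def mult.left_commute)
  moreover have "\<dots> = ?s (prod_list (map counit as)) (B 1 1)"
    by (rule SWL_counit_left[OF multilinear_counit[OF s] s])
  ultimately show "SW (?one (T as)) B = SWL as (\<lambda>x y. B (?one (T x)) (?one (T y)))" by simp
qed

lemma coalgebra_map_antipode:
  assumes g: "coalgebra_map n g"
  shows "coalgebra_map n (\<lambda>t. antipode (g t))"
proof (rule coalgebra_mapI)
  show "(\<lambda>t. antipode (g t)) \<in> Hom n scale"
    by (rule linear_maps_comp[OF antipode_linear coalgebra_map_Hom[OF g]])
  fix as :: "'a list" assume as: "length as = n"
  show "counit (antipode (g (T as))) = prod_list (map counit as)"
    by (simp add: counit_antipode coalgebra_map_counit[OF g as])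
  fix B :: "'a \<Rightarrow> 'a \<Rightarrow> ('a, 'k) tens"
  let ?s = "fscale (*) :: 'k \<Rightarrow> ('a, 'k) tens \<Rightarrow> _"
  assume B: "\<And>y. lin scale ?s (\<lambda>x. B x y)" "\<And>x. lin scale ?s (B x)"
  show "SW (antipode (g (T as))) B = SWL as (\<lambda>x y. B (antipode (g (T x))) (antipode (g (T y))))"
    unfolding SW_antipode[OF vector_space_tens2 B]
    by (rule coalgebra_map_SW[OF g as vector_space_tens2]) (rule lin_comp[OF antipode_linear B(1)] lin_comp[OF antipode_linear B(2)])+
qed

lemma coalgebra_map_inverse:
  assumes g: "coalgebra_map n g"
  shows "(\<lambda>t. antipode (g t)) \<otimes>\<^bsub>conv n scale\<^esub> g = \<one>\<^bsub>conv n scale\<^esub>"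
proof (rule Hom_eqI[OF vs])
  note H = coalgebra_map_Hom[OF coalgebra_map_antipode[OF g]] coalgebra_map_Hom[OF g]
  show "(\<lambda>t. antipode (g t)) \<otimes>\<^bsub>conv n scale\<^esub> g \<in> Hom n scale"
    by (rule conv_mult_in[OF k_algebra_scale H])
  show "\<one>\<^bsub>conv n scale\<^esub> \<in> Hom n scale" by (rule conv_one_in[OF k_algebra_scale])
  fix as :: "'a list" assume as: "length as = n"
  have "SW (g (T as)) (\<lambda>x y. antipode x * y) = SWL as (\<lambda>x y. antipode (g (T x)) * g (T y))"
    by (rule coalgebra_map_SW[OF g as vs]) (rule lin_comp[OF antipode_linear lin_mult_right] lin_mult_left)+
  then show "((\<lambda>t. antipode (g t)) \<otimes>\<^bsub>conv n scale\<^esub> g) (T as) = \<one>\<^bsub>conv n scale\<^esub> (T as)"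
    by (simp add: conv_mult_tensor[OF k_algebra_scale H as] conv_one_tensor[OF k_algebra_scale as] antipode_left'
        coalgebra_map_counit[OF g as])
qed

lemma coalgebra_maps_simps [simp]:
  "carrier (coalgebra_maps n) = {g. coalgebra_map n g}"
  "monoid.mult (coalgebra_maps n) = monoid.mult (conv n scale)"
  "one (coalgebra_maps n) = one (conv n scale)"
  by (simp_all add: coalgebra_maps_def)

lemma group_coalgebra_maps: "group (coalgebra_maps n)"
proof (rule groupI)
  interpret M: Group.monoid "conv_monoid n scale (alg_monoid :: 'a monoid)" by (rule conv_monoid[OF k_algebra_scale])
  have H: "x \<in> carrier (conv n scale)" if "x \<in> carrier (coalgebra_maps n)" for x
    using that by (simp add: conv_carrier[OF k_algebra_scale] coalgebra_map_Hom)
  show "x \<otimes>\<^bsub>coalgebra_maps n\<^esub> y \<in> carrier (coalgebra_maps n)"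
    if "x \<in> carrier (coalgebra_maps n)" "y \<in> carrier (coalgebra_maps n)" for x y
    using that by (simp add: coalgebra_map_mult)
  fix x assume x: "x \<in> carrier (coalgebra_maps n)"
  show "x \<otimes>\<^bsub>coalgebra_maps n\<^esub> y \<otimes>\<^bsub>coalgebra_maps n\<^esub> z = x \<otimes>\<^bsub>coalgebra_maps n\<^esub> (y \<otimes>\<^bsub>coalgebra_maps n\<^esub> z)"
    if "y \<in> carrier (coalgebra_maps n)" "z \<in> carrier (coalgebra_maps n)" for y z
    using H[OF x] H[OF that(1)] H[OF that(2)] by (simp add: M.m_assoc)
  show "\<one>\<^bsub>coalgebra_maps n\<^esub> \<otimes>\<^bsub>coalgebra_maps n\<^esub> x = x" using H[OF x] by simp
  show "\<exists>y\<in>carrier (coalgebra_maps n). y \<otimes>\<^bsub>coalgebra_maps n\<^esub> x = \<one>\<^bsub>coalgebra_maps n\<^esub>"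
    using x coalgebra_map_inverse[of n x] coalgebra_map_antipode[of n x] by auto
qed (simp add: coalgebra_map_one)

lemma inv_coalgebra_maps:
  assumes "coalgebra_map n g"
  shows "inv\<^bsub>coalgebra_maps n\<^esub> g = (\<lambda>t. antipode (g t))"
  using assms by (intro group.inv_equality[OF group_coalgebra_maps]) (simp_all add: coalgebra_map_inverse coalgebra_map_antipode)

subsection \<open>Actions of coalgebra maps\<close>

text \<open>A measuring in the sense of Sweedler. It covers the left and the right action at once:
  associativity, whose order differs between them, is left to the instances, and
  \<open>\<beta>\<close> always takes the algebra element first.\<close>

definition measuring :: "('k \<Rightarrow> 'm::{comm_ring,comm_monoid_mult} \<Rightarrow> 'm) \<Rightarrow> ('a \<Rightarrow> 'm \<Rightarrow> 'm) \<Rightarrow> bool"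
  where "measuring s \<beta> \<longleftrightarrow> k_algebra s \<and> (\<forall>m. lin scale s (\<lambda>a. \<beta> a m)) \<and> (\<forall>a. lin s s (\<beta> a))
    \<and> (\<forall>a m m'. \<beta> a (m * m') = SW a (\<lambda>x y. \<beta> x m * \<beta> y m')) \<and> (\<forall>a. \<beta> a 1 = s (counit a) 1)"

definition act :: "nat \<Rightarrow> ('k \<Rightarrow> 'm::ab_group_add \<Rightarrow> 'm) \<Rightarrow> ('a \<Rightarrow> 'm \<Rightarrow> 'm)
    \<Rightarrow> (('a, 'k) tens \<Rightarrow> 'a) \<Rightarrow> (('a, 'k) tens \<Rightarrow> 'm) \<Rightarrow> ('a, 'k) tens \<Rightarrow> 'm"
  where "act n s \<beta> g \<phi> = lift scale s n (\<lambda>as. SWL as (\<lambda>x y. \<beta> (g (T x)) (\<phi> (T y))))"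

lemma act_bimultilinear:
  assumes "measuring s \<beta>" "g \<in> Hom n scale" "\<phi> \<in> Hom n s"
  shows "bimultilinear n s (\<lambda>x y. \<beta> (g (T x)) (\<phi> (T y)))"
  using assms by (intro bimultilinear_pairing[OF vs]) (auto simp: measuring_def k_algebra_def)

lemma measuring_vs: "measuring s \<beta> \<Longrightarrow> vector_space s"
  by (simp add: measuring_def k_algebra_def)

lemma act_in: "measuring s \<beta> \<Longrightarrow> g \<in> Hom n scale \<Longrightarrow> \<phi> \<in> Hom n s \<Longrightarrow> act n s \<beta> g \<phi> \<in> Hom n s"
  and act_tensor: "measuring s \<beta> \<Longrightarrow> g \<in> Hom n scale \<Longrightarrow> \<phi> \<in> Hom n s \<Longrightarrow> length as = n \<Longrightarrow>
    act n s \<beta> g \<phi> (T as) = SWL as (\<lambda>x y. \<beta> (g (T x)) (\<phi> (T y)))"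
  by (simp_all add: act_def lift_SWL measuring_vs act_bimultilinear)

text \<open>The coproduct splits both \<open>g\<close> and the convolution product, giving four
  legs; \<open>SWL_medial\<close> joins each half of \<open>g\<close> to one of the two
  factors.\<close>

lemma act_mult:
  fixes s :: "'k \<Rightarrow> 'm::{comm_ring,comm_monoid_mult} \<Rightarrow> 'm"
  assumes b: "measuring s \<beta>" and g: "coalgebra_map n g" and \<phi>: "\<phi> \<in> Hom n s" and \<psi>: "\<psi> \<in> Hom n s"
  shows "act n s \<beta> g (\<phi> \<otimes>\<^bsub>conv n s\<^esub> \<psi>)
    = act n s \<beta> g \<phi> \<otimes>\<^bsub>conv n s\<^esub> act n s \<beta> g \<psi>"
proof -
  have alg: "k_algebra s" and \<beta>: "\<And>m. lin scale s (\<lambda>a. \<beta> a m)" "\<And>a. lin s s (\<beta> a)"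
    "\<And>a m m'. \<beta> a (m * m') = SW a (\<lambda>x y. \<beta> x m * \<beta> y m')"
    using b by (auto simp: measuring_def)
  interpret W: k_algebra s by (rule alg)
  note s = W.vector_space_axioms
  note gH = coalgebra_map_Hom[OF g]
  note ml = W.lin_mult_left and mr = W.lin_mult_right
  note a\<phi> = act_in[OF b gH \<phi>] and a\<psi> = act_in[OF b gH \<psi>]
  note pq = conv_mult_in[OF alg \<phi> \<psi>]
  show ?thesis
  proof (rule Hom_eqI[OF s act_in[OF b gH pq] conv_mult_in[OF alg a\<phi> a\<psi>]])
    fix as :: "'a list" assume as: "length as = n"
    have "act n s \<beta> g (\<phi> \<otimes>\<^bsub>conv n s\<^esub> \<psi>) (T as)
       = SWL as (\<lambda>x y. SWL x (\<lambda>p q. SWL y (\<lambda>u v. \<beta> (g (T p)) (\<phi> (T u)) * \<beta> (g (T q)) (\<psi> (T v)))))"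
      unfolding act_tensor[OF b gH pq as]
    proof (rule SWL_cong)
      fix x y :: "'a list" assume l: "length x = length as" "length y = length as"
      have "\<beta> (g (T x)) ((\<phi> \<otimes>\<^bsub>conv n s\<^esub> \<psi>) (T y))
         = SWL y (\<lambda>u v. SW (g (T x)) (\<lambda>p q. \<beta> p (\<phi> (T u)) * \<beta> q (\<psi> (T v))))"
        using l as by (simp add: conv_mult_tensor[OF alg \<phi> \<psi>] SWL_additive[OF lin_additive[OF \<beta>(2)]] \<beta>(3))
      also have "\<dots> = SWL y (\<lambda>u v. SWL x (\<lambda>p q. \<beta> (g (T p)) (\<phi> (T u)) * \<beta> (g (T q)) (\<psi> (T v))))"
        using l as by (intro SWL_cong coalgebra_map_SW[OF g _ s] lin_comp[OF \<beta>(1) mr] lin_comp[OF \<beta>(1) ml]) auto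
      also have "\<dots> = SWL x (\<lambda>p q. SWL y (\<lambda>u v. \<beta> (g (T p)) (\<phi> (T u)) * \<beta> (g (T q)) (\<psi> (T v))))"
        by (rule SWL_swap)
      finally show "\<beta> (g (T x)) ((\<phi> \<otimes>\<^bsub>conv n s\<^esub> \<psi>) (T y)) = \<dots>" .
    qed
    also have "\<dots> = SWL as (\<lambda>x y. SWL x (\<lambda>p u. SWL y (\<lambda>q v. \<beta> (g (T p)) (\<phi> (T u)) * \<beta> (g (T q)) (\<psi> (T v)))))"
      using Hom_multilinear[OF vs gH] Hom_multilinear[OF s \<phi>] Hom_multilinear[OF s \<psi>] as
      by (intro SWL_medial[OF s])
        (auto simp: quadmultilinear_def trimultilinear_def
          intro!: multilinear_comp[OF lin_comp[OF \<beta>(1) mr]] multilinear_comp[OF lin_comp[OF \<beta>(1) ml]]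
            multilinear_comp[OF lin_comp[OF \<beta>(2) mr]] multilinear_comp[OF lin_comp[OF \<beta>(2) ml]])
    also have "\<dots> = (act n s \<beta> g \<phi> \<otimes>\<^bsub>conv n s\<^esub> act n s \<beta> g \<psi>) (T as)"
      unfolding conv_mult_tensor[OF alg a\<phi> a\<psi> as]
      by (rule SWL_cong, subst SWL_swap) (simp add: act_tensor[OF b gH] \<phi> \<psi> as SWL_additive[OF lin_additive[OF ml]] SWL_additive[OF lin_additive[OF mr]])
    finally show "act n s \<beta> g (\<phi> \<otimes>\<^bsub>conv n s\<^esub> \<psi>) (T as)
       = (act n s \<beta> g \<phi> \<otimes>\<^bsub>conv n s\<^esub> act n s \<beta> g \<psi>) (T as)" .
  qed
qed

lemma act_one:
  assumes b: "measuring s \<beta>" and g: "coalgebra_map n g"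
  shows "act n s \<beta> g \<one>\<^bsub>conv n s\<^esub> = \<one>\<^bsub>conv n s\<^esub>"
proof -
  have alg: "k_algebra s" and \<beta>: "\<And>a. lin s s (\<beta> a)" "\<And>a. \<beta> a 1 = s (counit a) 1"
    using b by (auto simp: measuring_def)
  note s = measuring_vs[OF b]
  note gH = coalgebra_map_Hom[OF g]
  show ?thesis
  proof (rule Hom_eqI[OF s act_in[OF b gH conv_one_in[OF alg]] conv_one_in[OF alg]])
    fix as :: "'a list" assume as: "length as = n"
    have "act n s \<beta> g \<one>\<^bsub>conv n s\<^esub> (T as)
      = SWL as (\<lambda>x y. s (prod_list (map counit y)) (s (prod_list (map counit x)) 1))"
      unfolding act_tensor[OF b gH conv_one_in[OF alg] as]
      using \<beta>(1) by (intro SWL_cong) (simp add: conv_one_tensor[OF alg] as lin_iff \<beta>(2) coalgebra_map_counit[OF g])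
    also have "\<dots> = s (prod_list (map counit as)) 1"
      by (rule SWL_counit_right[OF multilinear_counit[OF s] s])
    finally show "act n s \<beta> g \<one>\<^bsub>conv n s\<^esub> (T as) = \<one>\<^bsub>conv n s\<^esub> (T as)"
      by (simp add: conv_one_tensor[OF alg as])
  qed
qed

text \<open>The two forms differ by cocommutativity. The first fits a left action, where the
  composite belongs to \<open>g\<close> times \<open>h\<close>; the second fits a right action,
  where the order is reversed.\<close>

lemma act_act_tensor:
  assumes b: "measuring s \<beta>" "measuring s \<beta>'" and gH: "g \<in> Hom n scale" "h \<in> Hom n scale"
    and \<phi>: "\<phi> \<in> Hom n s" and as: "length as = n"
  shows "act n s \<beta> g (act n s \<beta>' h \<phi>) (T as) = SWL as (\<lambda>m v. SWL m (\<lambda>x u. \<beta> (g (T x)) (\<beta>' (h (T u)) (\<phi> (T v)))))" (is ?A)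
    and "act n s \<beta> g (act n s \<beta>' h \<phi>) (T as) = SWL as (\<lambda>m v. SWL m (\<lambda>u x. \<beta> (g (T x)) (\<beta>' (h (T u)) (\<phi> (T v)))))" (is ?B)
proof -
  have \<beta>: "\<And>m. lin scale s (\<lambda>a. \<beta> a m)" "\<And>a. lin s s (\<beta> a)" "\<And>m. lin scale s (\<lambda>a. \<beta>' a m)" "\<And>a. lin s s (\<beta>' a)"
    using b by (auto simp: measuring_def)
  note s = measuring_vs[OF b(1)]
  note m = Hom_multilinear[OF vs gH(1)] Hom_multilinear[OF vs gH(2)] Hom_multilinear[OF s \<phi>]
  have "act n s \<beta> g (act n s \<beta>' h \<phi>) (T as) = SWL as (\<lambda>x r. SWL r (\<lambda>u v. \<beta> (g (T x)) (\<beta>' (h (T u)) (\<phi> (T v)))))"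
    unfolding act_tensor[OF b(1) gH(1) act_in[OF b(2) gH(2) \<phi>] as]
    by (rule SWL_cong) (simp add: act_tensor[OF b(2) gH(2) \<phi>] as SWL_additive[OF lin_additive[OF \<beta>(2)]])
  also have "\<dots> = SWL as (\<lambda>m v. SWL m (\<lambda>x u. \<beta> (g (T x)) (\<beta>' (h (T u)) (\<phi> (T v)))))"
    using m as by (intro SWL_coassoc[OF s, symmetric])
      (auto simp: trimultilinear_def intro!: multilinear_comp[OF \<beta>(1)] multilinear_comp[OF lin_comp[OF \<beta>(3) \<beta>(2)]]
        multilinear_comp[OF lin_comp[OF \<beta>(4) \<beta>(2)]])
  finally show A: ?A .
  have "SWL m (\<lambda>x u. \<beta> (g (T x)) (\<beta>' (h (T u)) (\<phi> (T v)))) = SWL m (\<lambda>u x. \<beta> (g (T x)) (\<beta>' (h (T u)) (\<phi> (T v))))"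
    if "length m = n" for m v
    using m by (intro SWL_cocomm[OF s, symmetric])
      (auto simp: bimultilinear_def that intro!: multilinear_comp[OF \<beta>(1)] multilinear_comp[OF lin_comp[OF \<beta>(3) \<beta>(2)]])
  then show ?B unfolding A using as by (rule_tac SWL_cong) simp
qed

lemma act_mult_tensor:
  assumes b: "measuring s \<beta>" and gH: "g \<in> Hom n scale" "h \<in> Hom n scale"
    and \<phi>: "\<phi> \<in> Hom n s" and as: "length as = n"
  shows "act n s \<beta> (g \<otimes>\<^bsub>conv n scale\<^esub> h) \<phi> (T as)
    = SWL as (\<lambda>m v. SWL m (\<lambda>x u. \<beta> (g (T x) * h (T u)) (\<phi> (T v))))"
proof -
  have \<beta>: "\<And>m. lin scale s (\<lambda>a. \<beta> a m)" using b by (auto simp: measuring_def)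
  show ?thesis
    unfolding act_tensor[OF b conv_mult_in[OF k_algebra_scale gH] \<phi> as]
    by (rule SWL_cong) (simp add: conv_mult_tensor[OF k_algebra_scale gH] as SWL_additive[OF lin_additive[OF \<beta>]])
qed

end

section \<open>Evaluation of multilinear maps on tuples of coalgebra maps\<close>

context cocommutative_hopf_algebra
begin

text \<open>The first of four legs moves behind the next two. In the braiding it belongs to the
  crossed letter, which has to follow both legs of the crossing letter.\<close>

lemma SWL_rotate:
  assumes s: "vector_space s" and Q: "quadmultilinear (length as) s Q"
  shows "SWL as (\<lambda>x y. SWL y (\<lambda>z w. SWL z (\<lambda>z1 z2. Q x z1 z2 w)))
       = SWL as (\<lambda>z1 r. SWL r (\<lambda>m w. SWL m (\<lambda>z2 x. Q x z1 z2 w)))"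
proof -
  let ?n = "length as"
  have q: "multilinear scale s ?n (\<lambda>x. Q x b c d)" "multilinear scale s ?n (\<lambda>x. Q b x c d)"
    "multilinear scale s ?n (\<lambda>x. Q b c x d)" "multilinear scale s ?n (\<lambda>x. Q b c d x)"
    if "length b = ?n" "length c = ?n" "length d = ?n" for b c d
    using Q that by (auto simp: quadmultilinear_def trimultilinear_def)
  have "SWL as (\<lambda>x y. SWL y (\<lambda>z w. SWL z (\<lambda>z1 z2. Q x z1 z2 w)))
      = SWL as (\<lambda>m w. SWL m (\<lambda>x z. SWL z (\<lambda>z1 z2. Q x z1 z2 w)))"
    using q by (intro SWL_coassoc[OF s, symmetric])
      (auto simp: trimultilinear_def bimultilinear_def intro!: multilinear_SWL_param multilinear_SWL vs s)
  also have "\<dots> = SWL as (\<lambda>m w. SWL m (\<lambda>z x. SWL z (\<lambda>z1 z2. Q x z1 z2 w)))"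
    using q by (intro SWL_cong[of as] SWL_cocomm[OF s, symmetric])
      (auto simp: bimultilinear_def intro!: multilinear_SWL_param multilinear_SWL vs s)
  also have "\<dots> = SWL as (\<lambda>m w. SWL m (\<lambda>z1 n. SWL n (\<lambda>z2 x. Q x z1 z2 w)))"
    using q by (intro SWL_cong[of as] SWL_coassoc[OF s]) (auto simp: trimultilinear_def)
  also have "\<dots> = SWL as (\<lambda>z1 r. SWL r (\<lambda>m w. SWL m (\<lambda>z2 x. Q x z1 z2 w)))"
    using q by (intro SWL_coassoc[OF s])
      (auto simp: trimultilinear_def bimultilinear_def intro!: multilinear_SWL_param multilinear_SWL vs s)
  finally show ?thesis .
qed

text \<open>The second of four legs moves to the end. In \<open>PL_right\<close> it belongs to the
  letter that acts from the right, which then directly follows the leg by which it is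
  conjugated.\<close>

lemma SWL_rotate':
  assumes s: "vector_space s" and Q: "quadmultilinear (length as) s Q"
  shows "SWL as (\<lambda>x r. SWL r (\<lambda>y z. SWL z (\<lambda>u v. Q x y u v)))
       = SWL as (\<lambda>m n. SWL m (\<lambda>x u. SWL n (\<lambda>v y. Q x y u v)))"
proof -
  let ?n = "length as"
  have q: "multilinear scale s ?n (\<lambda>x. Q x b c d)" "multilinear scale s ?n (\<lambda>x. Q b x c d)"
    "multilinear scale s ?n (\<lambda>x. Q b c x d)" "multilinear scale s ?n (\<lambda>x. Q b c d x)"
    if "length b = ?n" "length c = ?n" "length d = ?n" for b c d
    using Q that by (auto simp: quadmultilinear_def trimultilinear_def)
  have 1: "SWL r (\<lambda>y z. SWL z (\<lambda>u v. Q x y u v)) = SWL r (\<lambda>u n. SWL n (\<lambda>v y. Q x y u v))"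
    if l: "length r = ?n" "length x = ?n" for r x
  proof -
    have "SWL r (\<lambda>y z. SWL z (\<lambda>u v. Q x y u v)) = SWL r (\<lambda>z y. SWL z (\<lambda>u v. Q x y u v))"
      using q l by (intro SWL_cocomm[OF s, symmetric])
        (auto simp: bimultilinear_def intro!: multilinear_SWL_param multilinear_SWL vs s)
    also have "\<dots> = SWL r (\<lambda>u n. SWL n (\<lambda>v y. Q x y u v))"
      using q l by (intro SWL_coassoc[OF s]) (auto simp: trimultilinear_def)
    finally show ?thesis .
  qed
  have "SWL as (\<lambda>x r. SWL r (\<lambda>y z. SWL z (\<lambda>u v. Q x y u v))) = SWL as (\<lambda>x r. SWL r (\<lambda>u n. SWL n (\<lambda>v y. Q x y u v)))"
    by (rule SWL_cong) (rule 1)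
  also have "\<dots> = SWL as (\<lambda>m n. SWL m (\<lambda>x u. SWL n (\<lambda>v y. Q x y u v)))"
    using q by (intro SWL_coassoc[OF s, symmetric])
      (auto simp: trimultilinear_def bimultilinear_def intro!: multilinear_SWL_param multilinear_SWL vs s)
  finally show ?thesis .
qed

lemma ad_SW: "ad a b = SW a (\<lambda>x y. antipode x * b * y)"
  unfolding ad_def
  by (subst sweedler_2[OF vs])
    (simp_all add: lin_comp[OF antipode_linear lin_comp[OF lin_mult_right lin_mult_right]] lin_mult_left)

lemma lin_ad: "lin scale scale (\<lambda>a. ad a b)" "lin scale scale (ad a)"
  unfolding ad_SW
  by (rule lin_SW_arg[OF vs] lin_SW[OF vs vs] lin_comp[OF antipode_linear lin_comp[OF lin_mult_right lin_mult_right]]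
      lin_mult_left lin_comp[OF lin_mult_left lin_mult_right])+

text \<open>\<open>PL s [g\<^sub>1, \<dots>, g\<^sub>m] f as = \<Sum> f [g\<^sub>1(as\<^sub>(\<^sub>1\<^sub>)), \<dots>, g\<^sub>m(as\<^sub>(\<^sub>m\<^sub>))]\<close>\<close>

primrec PL :: "('k \<Rightarrow> 'w::ab_group_add \<Rightarrow> 'w) \<Rightarrow> (('a, 'k) tens \<Rightarrow> 'a) list \<Rightarrow> ('a list \<Rightarrow> 'w) \<Rightarrow> 'a list \<Rightarrow> 'w"
  where
    "PL s [] f as = s (prod_list (map counit as)) (f [])"
  | "PL s (g # gs) f as = SWL as (\<lambda>x y. PL s gs (\<lambda>l. f (g (T x) # l)) y)"

lemma PL_cong: "(\<And>l. length l = length gs \<Longrightarrow> f l = f' l) \<Longrightarrow> PL s gs f as = PL s gs f' as"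
proof (induct gs arbitrary: f f' as)
  case (Cons g gs)
  have "PL s gs (\<lambda>l. f (g (T x) # l)) y = PL s gs (\<lambda>l. f' (g (T x) # l)) y" for x y
    by (rule Cons(1)) (simp add: Cons(2))
  then show ?case by simp
qed simp

lemma PL_hom: "lin s s' h \<Longrightarrow> h (PL s gs f as) = PL s' gs (\<lambda>l. h (f l)) as"
proof (induct gs arbitrary: f as)
  case Nil
  then show ?case by (simp add: lin_iff)
next
  case (Cons g gs)
  then show ?case by (simp add: SWL_additive[OF lin_additive[OF Cons(2)]])
qed

lemma PL_SWL_swap:
  "vector_space s \<Longrightarrow> PL s gs (\<lambda>l. SWL bs (\<lambda>x y. B x y l)) as = SWL bs (\<lambda>x y. PL s gs (B x y) as)"
  by (induct gs arbitrary: B as) (simp_all add: SWL_scale SWL_swap[of bs])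

lemma PL_SW_swap:
  "vector_space s \<Longrightarrow> PL s gs (\<lambda>l. SW a (\<lambda>x y. B x y l)) as = SW a (\<lambda>x y. PL s gs (B x y) as)"
  by (induct gs arbitrary: B as) (simp_all add: SW_scale SW_SWL_swap)

lemma lin_PL_param:
  assumes "vector_space s1" "vector_space s" "\<And>l. length l = length gs \<Longrightarrow> lin s1 s (\<lambda>z. f z l)"
  shows "lin s1 s (\<lambda>z. PL s gs (f z) as)"
  using assms(3)
  by (induct gs arbitrary: f as) (auto intro!: lin_SWL assms(1,2) lin_comp[OF _ lin_scale])

lemma multilinear_PL_param:
  assumes "vector_space sV" "vector_space s" "\<And>l. length l = length gs \<Longrightarrow> multilinear sV s n (\<lambda>z. f z l)"
  shows "multilinear sV s n (\<lambda>z. PL s gs (f z) as)"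
  using assms(3) unfolding multilinear_def by (auto intro!: lin_PL_param assms(1,2))

lemma multilinear_PL:
  assumes s: "vector_space s" and "\<forall>g\<in>set gs. g \<in> Hom n scale" "multilinear scale s (length gs) f"
  shows "multilinear scale s n (PL s gs f)"
  using assms(2,3)
proof (induct gs arbitrary: f)
  case Nil
  then show ?case using multilinear_counit[OF s] by simp
next
  case (Cons g gs)
  have g: "multilinear scale scale n (\<lambda>x. g (T x))"
    using Cons(2) by (intro Hom_multilinear vs) simp
  show ?case unfolding PL.simps
  proof (rule multilinear_SWL[OF s], unfold bimultilinear_def, intro conjI allI impI)
    fix y :: "'a list" assume "length y = n"
    show "multilinear scale s n (\<lambda>x. PL s gs (\<lambda>l. f (g (T x) # l)) y)"
      using Cons(3) by (intro multilinear_PL_param vs s multilinear_comp[OF _ g]) (simp add: multilinear_Suc)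
  next
    fix x :: "'a list" assume "length x = n"
    show "multilinear scale s n (PL s gs (\<lambda>l. f (g (T x) # l)))"
      using Cons(2,3) by (intro Cons(1)) (auto simp: multilinear_Suc)
  qed
qed

text \<open>By coassociativity a tuple can be evaluated block by block, each block consuming one leg
  of \<open>as\<close>.\<close>

lemma PL_append:
  assumes s: "vector_space s" and "\<forall>g\<in>set (gs @ hs). g \<in> Hom (length as) scale"
    and "multilinear scale s (length gs + length hs) f"
  shows "PL s (gs @ hs) f as = SWL as (\<lambda>x y. PL s gs (\<lambda>l. PL s hs (\<lambda>k. f (l @ k)) y) x)"
  using assms(2,3)
proof (induct gs arbitrary: f as)
  case Nil
  then show ?case by (simp add: SWL_counit_left s multilinear_PL)
next
  case (Cons g gs)
  have H: "\<forall>g\<in>set (gs @ hs). g \<in> Hom n scale" "g \<in> Hom n scale" if "n = length as" for n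
    using Cons(2) that by auto
  have g: "multilinear scale scale (length as) (\<lambda>x. g (T x))"
    using Cons(2) by (intro Hom_multilinear vs) simp
  have f: "multilinear scale s (length gs + length hs) (\<lambda>k. f (a # k))" for a
    using Cons(3) by (simp add: multilinear_Suc)
  have "PL s ((g # gs) @ hs) f as = SWL as (\<lambda>x r. SWL r (\<lambda>y z. PL s gs (\<lambda>l. PL s hs (\<lambda>k. f (g (T x) # l @ k)) z) y))"
    unfolding append_Cons PL.simps
    by (rule SWL_cong) (simp add: Cons(1)[OF H(1) f])
  also have "\<dots> = SWL as (\<lambda>m z. SWL m (\<lambda>x y. PL s gs (\<lambda>l. PL s hs (\<lambda>k. f (g (T x) # l @ k)) z) y))"
  proof (rule SWL_coassoc[OF s, symmetric], unfold trimultilinear_def, intro conjI allI impI)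
    fix y z :: "'a list"
    show "multilinear scale s (length as) (\<lambda>x. PL s gs (\<lambda>l. PL s hs (\<lambda>k. f (g (T x) # l @ k)) z) y)"
      using Cons(3) by (intro multilinear_PL_param vs s multilinear_comp[OF _ g]) (auto simp: multilinear_Suc)
  next
    fix x z :: "'a list"
    show "multilinear scale s (length as) (\<lambda>y. PL s gs (\<lambda>l. PL s hs (\<lambda>k. f (g (T x) # l @ k)) z) y)"
      using f[of "g (T x)"] Cons(2)
      by (intro multilinear_PL multilinear_PL_param vs s) (auto simp: multilinear_append)
  next
    fix x y :: "'a list"
    show "multilinear scale s (length as) (\<lambda>z. PL s gs (\<lambda>l. PL s hs (\<lambda>k. f (g (T x) # l @ k)) z) y)"
      using f[of "g (T x)"] Cons(2)
      by (intro multilinear_PL_param multilinear_PL vs s) (auto simp: multilinear_append)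
  qed
  finally show ?case by simp
qed

lemma PL_counit:
  assumes s: "vector_space s" and "\<forall>g\<in>set gs. coalgebra_map (length as) g"
  shows "PL s gs (\<lambda>l. s (prod_list (map counit l)) w) as = s (prod_list (map counit as)) w"
  using assms(2)
proof (induct gs arbitrary: as w)
  case Nil
  then show ?case using s by (simp add: vector_space_def)
next
  case (Cons g gs)
  have "PL s (g # gs) (\<lambda>l. s (prod_list (map counit l)) w) as
     = SWL as (\<lambda>x y. PL s gs (\<lambda>l. s (prod_list (map counit l)) (s (prod_list (map counit x)) w)) y)"
    unfolding PL.simps using s Cons(2)
    by (intro SWL_cong PL_cong) (simp add: coalgebra_map_counit[of "length as" g] vector_space_def mult.commute)
  also have "\<dots> = SWL as (\<lambda>x y. s (prod_list (map counit y)) (s (prod_list (map counit x)) w))"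
    using Cons(2) by (intro SWL_cong Cons(1)) auto
  also have "\<dots> = s (prod_list (map counit as)) w"
    by (rule SWL_counit_right[OF multilinear_counit[OF s] s])
  finally show ?case .
qed

text \<open>The tuple composed with the iterated coproduct is again a coalgebra map, each new entry
  being woven in by \<open>SWL_medial\<close>. Pulling back therefore respects convolution.\<close>

lemma PL_SWL:
  assumes s: "vector_space s" and "\<forall>g\<in>set gs. coalgebra_map (length as) g" "bimultilinear (length gs) s B"
  shows "PL s gs (\<lambda>l. SWL l B) as = SWL as (\<lambda>u v. PL s gs (\<lambda>x. PL s gs (B x) v) u)"
  using assms(2,3)
proof (induct gs arbitrary: B as)
  case Nil
  have "s (prod_list (map counit as)) (B [] []) = SWL as (\<lambda>u v. s (prod_list (map counit u)) (s (prod_list (map counit v)) (B [] [])))"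
    by (rule SWL_counit_left[OF multilinear_counit[OF s] s, symmetric])
  then show ?case by simp
next
  case (Cons g gs)
  have C: "\<forall>g\<in>set gs. coalgebra_map n g" "coalgebra_map n g" if "n = length as" for n
    using Cons(2) that by auto
  have H: "\<forall>g\<in>set gs. g \<in> Hom n scale" "g \<in> Hom n scale" if "n = length as" for n
    using C[OF that] by (auto simp: coalgebra_map_Hom)
  have g: "multilinear scale scale (length as) (\<lambda>x. g (T x))"
    by (intro Hom_multilinear vs H refl)
  have B2: "bimultilinear (length gs) s (\<lambda>x y. B (a # x) (b # y))" for a b
    using Cons(3) by (auto simp: bimultilinear_def multilinear_Suc)
  have Bl: "lin scale s (\<lambda>a. B (a # x) (b # y))" "lin scale s (\<lambda>b. B (a # x) (b # y))"
    if "length x = length gs" "length y = length gs" for x y a b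
    using Cons(3) that by (auto simp: bimultilinear_def multilinear_Suc)
  have Bm: "multilinear scale s (length gs) (\<lambda>x. B (a # x) (b # y))" "multilinear scale s (length gs) (\<lambda>x. B (a # y) (b # x))"
    if "length y = length gs" for y a b
    using Cons(3) that by (auto simp: bimultilinear_def multilinear_Suc)
  let ?Q = "\<lambda>a1 a2 b1 b2. PL s gs (\<lambda>xs. PL s gs (\<lambda>ys. B (g (T a1) # xs) (g (T a2) # ys)) b2) b1"
  have "PL s (g # gs) (\<lambda>l. SWL l B) as = SWL as (\<lambda>a b. SW (g (T a)) (\<lambda>x y. PL s gs (\<lambda>l. SWL l (\<lambda>xs ys. B (x # xs) (y # ys))) b))"
    by (simp add: PL_SW_swap[OF s])
  also have "\<dots> = SWL as (\<lambda>a b. SW (g (T a)) (\<lambda>x y. SWL b (\<lambda>b1 b2. PL s gs (\<lambda>xs. PL s gs (\<lambda>ys. B (x # xs) (y # ys)) b2) b1)))"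
    by (rule SWL_cong) (simp add: Cons(1)[OF C(1) B2])
  also have "\<dots> = SWL as (\<lambda>a b. SWL a (\<lambda>a1 a2. SWL b (\<lambda>b1 b2. ?Q a1 a2 b1 b2)))"
    by (rule SWL_cong, rule coalgebra_map_SW[OF C(2) _ s])
      (auto intro!: lin_SWL lin_PL_param vs s Bl)
  also have "\<dots> = SWL as (\<lambda>a b. SWL a (\<lambda>a1 b1. SWL b (\<lambda>a2 b2. ?Q a1 a2 b1 b2)))"
    using H(1)[OF refl]
    by (intro SWL_medial[OF s]) (auto simp: quadmultilinear_def trimultilinear_def
        intro!: multilinear_PL_param multilinear_PL vs s Bm multilinear_comp[OF Bl(1) g] multilinear_comp[OF Bl(2) g])
  also have "\<dots> = SWL as (\<lambda>u v. PL s (g # gs) (\<lambda>x. PL s (g # gs) (B x) v) u)"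
    by (simp add: PL_SWL_swap[OF s])
  finally show ?case .
qed

text \<open>Neighbouring maps receive neighbouring legs, so multiplying their values amounts to
  convolving the maps.\<close>

lemma PL_contract:
  assumes s: "vector_space s" and "\<forall>g\<in>set (pre @ g # h # post). g \<in> Hom (length as) scale"
    and "multilinear scale s (Suc (length pre + length post)) f"
  shows "PL s (pre @ g # h # post) (\<lambda>l. f (contract (Suc (length pre)) l)) as
     = PL s (pre @ (g \<otimes>\<^bsub>conv (length as) scale\<^esub> h) # post) f as"
  using assms(2,3)
proof (induct pre arbitrary: f as)
  case Nil
  then have H: "g \<in> Hom (length as) scale" "h \<in> Hom (length as) scale" "\<forall>g\<in>set post. g \<in> Hom (length as) scale" by auto
  note gm = Hom_multilinear[OF vs H(1)] and hm = Hom_multilinear[OF vs H(2)]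
  have f: "lin scale s (\<lambda>a. f (a # l))" if "length l = length post" for l
    using Nil(2) that by (simp add: multilinear_Suc)
  have f': "multilinear scale s (length post) (\<lambda>l. f (a # l))" for a
    using Nil(2) by (simp add: multilinear_Suc)
  have lin: "lin scale s (\<lambda>a. PL s post (\<lambda>l. f (a # l)) w)" for w
    by (intro lin_PL_param vs s f)
  have "PL s (g # h # post) (\<lambda>l. f (contract (Suc 0) l)) as
     = SWL as (\<lambda>x y. SWL y (\<lambda>z w. PL s post (\<lambda>l. f ((g (T x) * h (T z)) # l)) w))"
    by (simp add: contract_def)
  also have "\<dots> = SWL as (\<lambda>m w. SWL m (\<lambda>x z. PL s post (\<lambda>l. f ((g (T x) * h (T z)) # l)) w))"
    by (rule SWL_coassoc[OF s, symmetric])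
      (auto simp: trimultilinear_def intro!: multilinear_PL s H f' multilinear_comp[OF lin_comp[OF lin_mult_left lin] hm]
        multilinear_comp[OF lin_comp[OF lin_mult_right lin] gm])
  also have "\<dots> = SWL as (\<lambda>m w. PL s post (\<lambda>l. f ((g \<otimes>\<^bsub>conv (length as) scale\<^esub> h) (T m) # l)) w)"
    by (rule SWL_cong) (simp add: conv_mult_tensor[OF k_algebra_scale H(1,2)] SWL_additive[OF lin_additive[OF lin]])
  finally show ?case by simp
next
  case (Cons p pre)
  have C: "contract (Suc (Suc k)) (a # l) = a # contract (Suc k) l" for k and a :: 'a and l
    by (simp add: contract_def)
  have "PL s (pre @ g # h # post) (\<lambda>l. f (a # contract (Suc (length pre)) l)) y
     = PL s (pre @ (g \<otimes>\<^bsub>conv (length as) scale\<^esub> h) # post) (\<lambda>l. f (a # l)) y"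
    if "length y = length as" for y a
    using Cons(1)[of y "\<lambda>l. f (a # l)"] Cons(2,3) that by (auto simp: multilinear_Suc)
  then show ?case by (auto simp: C intro: SWL_cong)
qed

definition conj_map :: "nat \<Rightarrow> (('a, 'k) tens \<Rightarrow> 'a) \<Rightarrow> (('a, 'k) tens \<Rightarrow> 'a) \<Rightarrow> ('a, 'k) tens \<Rightarrow> 'a"
  where "conj_map n h g = (\<lambda>t. antipode (h t)) \<otimes>\<^bsub>conv n scale\<^esub> g \<otimes>\<^bsub>conv n scale\<^esub> h"

lemma coalgebra_map_conj: "coalgebra_map n h \<Longrightarrow> coalgebra_map n g \<Longrightarrow> coalgebra_map n (conj_map n h g)"
  unfolding conj_map_def by (intro coalgebra_map_mult coalgebra_map_antipode)

text \<open>In \<open>ad\<close> the legs of \<open>h\<close> stand on both sides of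
  \<open>g\<close>, so the second of them has to pass the leg of \<open>g\<close>. Cocommutativity
  allows this, and the adjoint action becomes conjugation in the group of coalgebra maps.\<close>

lemma conj_map_tensor:
  assumes h: "coalgebra_map n h" and g: "coalgebra_map n g" and m: "length m = n"
  shows "conj_map n h g (T m) = SWL m (\<lambda>z x. ad (h (T z)) (g (T x)))"
proof -
  note H = coalgebra_map_Hom[OF coalgebra_map_antipode[OF h]] coalgebra_map_Hom[OF g] coalgebra_map_Hom[OF h]
  note ml = Hom_multilinear[OF vs H(1)] Hom_multilinear[OF vs H(2)] Hom_multilinear[OF vs H(3)]
  note ka = k_algebra_scale
  let ?Q = "\<lambda>a x c. antipode (h (T a)) * g (T x) * h (T c)"
  have q: "multilinear scale scale n (\<lambda>a. ?Q a x c)" "multilinear scale scale n (\<lambda>x. ?Q a x c)" "multilinear scale scale n (?Q a x)"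
    for a x c
    by (rule multilinear_comp[OF lin_mult_left ml(3)] multilinear_comp[OF lin_comp[OF lin_mult_left lin_mult_right] ml(2)]
      multilinear_comp[OF lin_comp[OF lin_mult_right lin_mult_right] ml(1)])+
  have "SWL m (\<lambda>z x. ad (h (T z)) (g (T x))) = SWL m (\<lambda>z x. SWL z (\<lambda>a c. ?Q a x c))"
    using m by (intro SWL_cong, unfold ad_SW, intro coalgebra_map_SW[OF h _ vs])
      (simp_all add: lin_comp[OF antipode_linear lin_comp[OF lin_mult_right lin_mult_right]] lin_mult_left)
  also have "\<dots> = SWL m (\<lambda>a r. SWL r (\<lambda>c x. ?Q a x c))"
    using m q by (intro SWL_coassoc[OF vs]) (auto simp: trimultilinear_def)
  also have "\<dots> = SWL m (\<lambda>a r. SWL r (\<lambda>x c. ?Q a x c))"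
    using m q by (intro SWL_cong[of m] SWL_cocomm[OF vs]) (auto simp: bimultilinear_def)
  also have "\<dots> = SWL m (\<lambda>u c. SWL u (\<lambda>a x. ?Q a x c))"
    using m q by (intro SWL_coassoc[OF vs, symmetric]) (auto simp: trimultilinear_def)
  also have "\<dots> = conj_map n h g (T m)"
    unfolding conj_map_def conv_mult_tensor[OF ka conv_mult_in[OF ka H(1,2)] H(3) m]
    using m by (intro SWL_cong[of m]) (simp add: conv_mult_tensor[OF ka H(1,2)] SWL_additive[OF lin_additive[OF lin_mult_right]])
  finally show ?thesis by simp
qed

text \<open>The crossing letter has two legs, one kept as a letter and one spent on
  \<open>ad\<close>. After \<open>SWL_rotate\<close> the former gives \<open>h\<close>, and the
  latter joins the crossed letter to form the conjugate of \<open>g\<close>.\<close>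

lemma PL_braid:
  assumes s: "vector_space s" and "\<forall>g\<in>set (pre @ g # h # post). coalgebra_map (length as) g"
    and "multilinear scale s (Suc (Suc (length pre + length post))) f"
  shows "PL s (pre @ g # h # post) (\<lambda>l. SW (l ! Suc (length pre))
       (\<lambda>u v. f (take (length pre) l @ [u, ad v (l ! length pre)] @ drop (Suc (Suc (length pre))) l))) as
     = PL s (pre @ h # conj_map (length as) h g # post) f as"
  using assms(2,3)
proof (induct pre arbitrary: f as)
  case Nil
  then have C: "coalgebra_map (length as) g" "coalgebra_map (length as) h" "\<forall>g\<in>set post. coalgebra_map (length as) g" by auto
  then have H: "g \<in> Hom (length as) scale" "h \<in> Hom (length as) scale" "\<forall>g\<in>set post. g \<in> Hom (length as) scale"
    by (auto simp: coalgebra_map_Hom)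
  note gm = Hom_multilinear[OF vs H(1)] and hm = Hom_multilinear[OF vs H(2)]
  have f: "lin scale s (\<lambda>a. f (a # b # l))" "lin scale s (\<lambda>b. f (a # b # l))" if "length l = length post" for a b l
    using Nil(2) that by (simp_all add: multilinear_Suc)
  have f': "multilinear scale s (length post) (\<lambda>l. f (a # b # l))" for a b
    using Nil(2) by (simp add: multilinear_Suc)
  have lin: "lin scale s (\<lambda>a. PL s post (\<lambda>l. f (a # b # l)) w)" "lin scale s (\<lambda>b. PL s post (\<lambda>l. f (a # b # l)) w)" for a b w
    by (intro lin_PL_param vs s f; assumption)+
  let ?Q = "\<lambda>x z1 z2 w. PL s post (\<lambda>l. f (h (T z1) # ad (h (T z2)) (g (T x)) # l)) w"
  have "PL s (g # h # post) (\<lambda>l. SW (l ! Suc 0) (\<lambda>u v. f (take 0 l @ [u, ad v (l ! 0)] @ drop (Suc (Suc 0)) l))) as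
     = SWL as (\<lambda>x y. SWL y (\<lambda>z w. SW (h (T z)) (\<lambda>u v. PL s post (\<lambda>l. f (u # ad v (g (T x)) # l)) w)))"
    by (simp add: PL_SW_swap[OF s])
  also have "\<dots> = SWL as (\<lambda>x y. SWL y (\<lambda>z w. SWL z (\<lambda>z1 z2. ?Q x z1 z2 w)))"
    by (rule SWL_cong, rule SWL_cong, rule coalgebra_map_SW[OF C(2) _ s])
      (auto intro!: lin(1) lin_comp[OF lin_ad(1) lin(2)])
  also have "\<dots> = SWL as (\<lambda>z1 r. SWL r (\<lambda>m w. SWL m (\<lambda>z2 x. ?Q x z1 z2 w)))"
    by (intro SWL_rotate[OF s]) (auto simp: quadmultilinear_def trimultilinear_def
        intro!: multilinear_PL s H f' multilinear_comp[OF lin(1) hm] multilinear_comp[OF lin_comp[OF lin_ad(1) lin(2)] hm]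
          multilinear_comp[OF lin_comp[OF lin_ad(2) lin(2)] gm])
  also have "\<dots> = SWL as (\<lambda>z1 r. SWL r (\<lambda>m w. PL s post (\<lambda>l. f (h (T z1) # conj_map (length as) h g (T m) # l)) w))"
    by (rule SWL_cong, rule SWL_cong) (simp add: conj_map_tensor[OF C(2,1)] SWL_additive[OF lin_additive[OF lin(2)]])
  finally show ?case by simp
next
  case (Cons p pre)
  have "PL s (pre @ g # h # post) (\<lambda>l. SW (l ! Suc (length pre))
       (\<lambda>u v. f (a # take (length pre) l @ [u, ad v (l ! length pre)] @ drop (Suc (Suc (length pre))) l))) y
     = PL s (pre @ h # conj_map (length as) h g # post) (\<lambda>l. f (a # l)) y"
    if "length y = length as" for y a
    using Cons(1)[of y "\<lambda>l. f (a # l)"] Cons(2,3) that by (auto simp: multilinear_Suc)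
  then show ?case by (auto intro: SWL_cong)
qed

text \<open>The diagonal adjoint action distributes over the entries: in each step
  \<open>SWL_medial\<close> hands one leg of \<open>g\<close> to one of the maps.\<close>

lemma PL_adjoint:
  assumes s: "vector_space s" and "\<forall>h\<in>set hs. coalgebra_map (length as) h" and "coalgebra_map (length as) g"
    and "multilinear scale s (length hs) f"
  shows "SWL as (\<lambda>y x. PL s hs (\<lambda>xs. MS s (length hs) (g (T y)) (\<lambda>c. f (map2 ad c xs))) x)
    = PL s (map (conj_map (length as) g) hs) f as"
  using assms(2-)
proof (induct hs arbitrary: f as)
  case Nil
  then show ?case
    using SWL_counit_right[OF multilinear_counit[OF s] s, of as "f []"]
    by (simp add: coalgebra_map_counit cong: SWL_cong)
next
  case (Cons h hs)
  have C: "coalgebra_map n g" "coalgebra_map n h" "\<forall>g\<in>set hs. coalgebra_map n g" if "n = length as" for n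
    using Cons(2,3) that by auto
  have H: "g \<in> Hom n scale" "h \<in> Hom n scale" "\<forall>g\<in>set hs. g \<in> Hom n scale" if "n = length as" for n
    using C[OF that] by (auto simp: coalgebra_map_Hom)
  note gm = Hom_multilinear[OF vs H(1)[OF refl]] and hm = Hom_multilinear[OF vs H(2)[OF refl]]
  have f: "lin scale s (\<lambda>a. f (a # l))" if "length l = length hs" for l
    using Cons(4) that by (simp add: multilinear_Suc)
  have f': "multilinear scale s (length hs) (\<lambda>l. f (a # l))" for a
    using Cons(4) by (simp add: multilinear_Suc)
  have fc: "multilinear scale s (length hs) (\<lambda>c. f (a # map2 ad c xs))" if "length xs = length hs" for a xs
    by (rule multilinear_map2_left[OF lin_ad(1) f' that])
  have fx: "multilinear scale s (length hs) (\<lambda>xs. f (a # map2 ad c xs))" if "length c = length hs" for a c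
    by (rule multilinear_map2[OF lin_ad(2) f' that])
  have ml1: "lin scale s (\<lambda>a. PL s hs (\<lambda>xs. MS s (length hs) w (\<lambda>c. f (a # map2 ad c xs))) z)" for w z
    by (intro lin_PL_param lin_MS_param vs s) (simp add: f)
  have ml2: "lin scale s (\<lambda>w. PL s hs (\<lambda>xs. MS s (length hs) w (\<lambda>c. f (a # map2 ad c xs))) z)" for a z
    by (intro lin_PL_param lin_MS vs s fc)
  have ml3: "multilinear scale s (length as) (PL s hs (\<lambda>xs. MS s (length hs) w (\<lambda>c. f (a # map2 ad c xs))))" for w a
  proof -
    have "multilinear scale s (length hs) (\<lambda>xs. MS s (length hs) w (\<lambda>c. f (a # map2 ad c xs)))"
      using fx unfolding multilinear_def by (auto intro!: lin_MS_param vs s)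
    then show ?thesis using H[OF refl] by (intro multilinear_PL s)
  qed
  have lin: "lin scale s (\<lambda>a. PL s (map (conj_map (length as) g) hs) (\<lambda>l. f (a # l)) n)" for n
    by (intro lin_PL_param vs s) (simp add: f)
  let ?Q = "\<lambda>y1 y2 x1 x2. PL s hs (\<lambda>xs. MS s (length hs) (g (T y2)) (\<lambda>c. f (ad (g (T y1)) (h (T x1)) # map2 ad c xs))) x2"
  have "SWL as (\<lambda>y x. PL s (h # hs) (\<lambda>xs. MS s (length (h # hs)) (g (T y)) (\<lambda>c. f (map2 ad c xs))) x)
      = SWL as (\<lambda>y x. SWL x (\<lambda>x1 x2. SW (g (T y)) (\<lambda>u w. PL s hs (\<lambda>xs. MS s (length hs) w (\<lambda>c. f (ad u (h (T x1)) # map2 ad c xs))) x2)))"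
    by (simp add: PL_SW_swap[OF s])
  also have "\<dots> = SWL as (\<lambda>y x. SWL x (\<lambda>x1 x2. SWL y (\<lambda>y1 y2. ?Q y1 y2 x1 x2)))"
    by (rule SWL_cong, rule SWL_cong, rule coalgebra_map_SW[OF C(1) _ s])
      (auto intro!: ml2 lin_comp[OF lin_ad(1) ml1])
  also have "\<dots> = SWL as (\<lambda>y x. SWL y (\<lambda>y1 y2. SWL x (\<lambda>x1 x2. ?Q y1 y2 x1 x2)))"
    by (rule SWL_cong, rule SWL_swap)
  also have "\<dots> = SWL as (\<lambda>m n. SWL m (\<lambda>y1 x1. SWL n (\<lambda>y2 x2. ?Q y1 y2 x1 x2)))"
    by (intro SWL_medial[OF s]) (auto simp: quadmultilinear_def trimultilinear_def
        intro!: ml3 multilinear_comp[OF ml2 gm] multilinear_comp[OF lin_comp[OF lin_ad(1) ml1] gm]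
          multilinear_comp[OF lin_comp[OF lin_ad(2) ml1] hm])
  also have "\<dots> = SWL as (\<lambda>m n. SWL m (\<lambda>y1 x1. PL s (map (conj_map (length as) g) hs) (\<lambda>l. f (ad (g (T y1)) (h (T x1)) # l)) n))"
  proof (rule SWL_cong, rule SWL_cong)
    fix m n y1 x1 :: "'a list" assume l: "length n = length as"
    show "SWL n (\<lambda>y2 x2. ?Q y1 y2 x1 x2) = PL s (map (conj_map (length as) g) hs) (\<lambda>l. f (ad (g (T y1)) (h (T x1)) # l)) n"
      using Cons(1)[of n "\<lambda>l. f (ad (g (T y1)) (h (T x1)) # l)"] C f' l by auto
  qed
  also have "\<dots> = SWL as (\<lambda>m n. PL s (map (conj_map (length as) g) hs) (\<lambda>l. f (conj_map (length as) g h (T m) # l)) n)"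
    by (rule SWL_cong) (simp add: conj_map_tensor[OF C(1,2)[OF refl]] SWL_additive[OF lin_additive[OF lin]])
  finally show ?case by simp
qed

lemma multilinear_prod_list: "multilinear scale scale n prod_list"
proof (induct n)
  case (Suc n)
  show ?case
    using multilinear_comp[OF lin_mult_left Suc]
    by (intro multilinear_SucI) (simp_all add: lin_mult_right)
qed simp

lemma coalgebra_map_foldr:
  "\<forall>g\<in>set gs. coalgebra_map n g \<Longrightarrow>
    coalgebra_map n (foldr (\<otimes>\<^bsub>conv n scale\<^esub>) gs \<one>\<^bsub>conv n scale\<^esub>)"
  by (induct gs) (auto intro: coalgebra_map_one coalgebra_map_mult)

lemma PL_prod_list:
  assumes "\<forall>g\<in>set gs. coalgebra_map n g" "length v = n"
  shows "PL scale gs prod_list v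
    = foldr (\<otimes>\<^bsub>conv n scale\<^esub>) gs \<one>\<^bsub>conv n scale\<^esub> (T v)"
  using assms
proof (induct gs arbitrary: v)
  case Nil
  then show ?case by (simp add: conv_one_tensor[OF k_algebra_scale])
next
  case (Cons g gs)
  note H = coalgebra_map_Hom[of n g] coalgebra_map_Hom[OF coalgebra_map_foldr[of gs n]]
  have "PL scale (g # gs) prod_list v = SWL v (\<lambda>x y. g (T x) * PL scale gs prod_list y)"
    by (simp add: PL_hom[OF lin_mult_left])
  also have "\<dots> = SWL v (\<lambda>x y. g (T x) * foldr (\<otimes>\<^bsub>conv n scale\<^esub>) gs \<one>\<^bsub>conv n scale\<^esub> (T y))"
    using Cons by (intro SWL_cong) simp
  finally show ?case using Cons(2,3) H by (simp add: conv_mult_tensor[OF k_algebra_scale])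
qed

text \<open>The layout of an outer face: \<open>p\<close> letters, the acting letter at index
  \<open>p\<close>, then \<open>q\<close> more letters. The second statement holds \<open>u\<close>
  fixed, since \<open>\<D>\<close> treats the acting leg as a separate one.\<close>

lemma multilinear_left:
  fixes s :: "'k \<Rightarrow> 'm::{comm_ring,comm_monoid_mult} \<Rightarrow> 'm"
  assumes b: "measuring s \<beta>" and f: "multilinear scale s (p + q) f"
  shows "multilinear scale s (p + Suc q) (\<lambda>l. SW (l ! p) (\<lambda>u v. \<beta> u (MS s p v (\<lambda>c. f (map2 ad c (take p l) @ drop (Suc p) l)))))"
    (is "multilinear _ _ _ ?F")
    and "multilinear scale s (p + Suc q) (\<lambda>l. \<beta> u (MS s p (l ! p) (\<lambda>c. f (map2 ad c (take p l) @ drop (Suc p) l))))"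
    (is "multilinear _ _ _ ?G")
    and "length xs = p \<Longrightarrow> length as = q \<Longrightarrow> lin scale s (\<lambda>u. \<beta> u (MS s p y (\<lambda>c. f (map2 ad c xs @ as))))"
proof -
  have \<beta>: "\<And>m. lin scale s (\<lambda>a. \<beta> a m)" "\<And>a. lin s s (\<beta> a)" using b by (auto simp: measuring_def)
  note s = measuring_vs[OF b]
  have f1: "multilinear scale s p (\<lambda>l. f (l @ as))" if "length as = q" for as
    using f that by (simp add: multilinear_append)
  have f2: "multilinear scale s q (\<lambda>as. f (l @ as))" if "length l = p" for l
    using f that by (simp add: multilinear_append)
  let ?m = "\<lambda>v xs as. MS s p v (\<lambda>c. f (map2 ad c xs @ as))"
  have fc: "multilinear scale s p (\<lambda>c. f (map2 ad c xs @ as))" if "length xs = p" "length as = q" for as xs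
    by (rule multilinear_map2_left[OF lin_ad(1) f1[OF that(2)] that(1)])
  have fx: "multilinear scale s p (\<lambda>xs. f (map2 ad c xs @ as))" if "length c = p" "length as = q" for c as
    by (rule multilinear_map2[OF lin_ad(2) f1[OF that(2)] that(1)])
  have m1: "lin scale s (\<lambda>v. ?m v xs as)" if "length xs = p" "length as = q" for xs as
    by (rule lin_MS[OF s fc[OF that]])
  have m2: "multilinear scale s p (\<lambda>xs. ?m v xs as)" if "length as = q" for v as
    using fx that unfolding multilinear_def by (auto intro!: lin_MS_param vs s)
  have m3: "multilinear scale s q (?m v xs)" if "length xs = p" for v xs
    using f2 that unfolding multilinear_def by (auto intro!: lin_MS_param vs s)
  show "length xs = p \<Longrightarrow> length as = q \<Longrightarrow> lin scale s (\<lambda>u. \<beta> u (MS s p y (\<lambda>c. f (map2 ad c xs @ as))))"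
    by (rule \<beta>(1))
  show "multilinear scale s (p + Suc q) ?F"
    unfolding multilinear_append
  proof (intro conjI allI impI)
    fix ys :: "'a list" assume "length ys = Suc q"
    then obtain y as where y: "ys = y # as" "length as = q" by (cases ys) auto
    have "multilinear scale s p (\<lambda>xs. SW y (\<lambda>u v. \<beta> u (?m v xs as)))"
      using multilinear_comp[OF \<beta>(2) m2[OF y(2)]] unfolding multilinear_def by (auto intro!: lin_SW vs s)
    then show "multilinear scale s p (\<lambda>xs. ?F (xs @ ys))"
      by (rule multilinear_cong[THEN iffD1, rotated]) (simp add: y nth_append)
  next
    fix xs :: "'a list" assume xs: "length xs = p"
    have "multilinear scale s (Suc q) (\<lambda>l. SW (hd l) (\<lambda>u v. \<beta> u (?m v xs (tl l))))"
    proof (rule multilinear_SucI)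
      fix as :: "'a list" assume as: "length as = q"
      show "lin scale s (\<lambda>a. SW (hd (a # as)) (\<lambda>u v. \<beta> u (?m v xs (tl (a # as)))))"
        by simp (intro lin_SW_arg s \<beta>(1) lin_comp[OF m1[OF xs as] \<beta>(2)])
    next
      fix a
      show "multilinear scale s q (\<lambda>as. SW (hd (a # as)) (\<lambda>u v. \<beta> u (?m v xs (tl (a # as)))))"
        using multilinear_comp[OF \<beta>(2) m3[OF xs]] unfolding multilinear_def by (auto intro!: lin_SW vs s)
    qed
    then show "multilinear scale s (Suc q) (\<lambda>ys. ?F (xs @ ys))"
      by (rule multilinear_cong[THEN iffD1, rotated]) (auto simp: xs nth_append length_Suc_conv)
  qed
  show "multilinear scale s (p + Suc q) ?G"
    unfolding multilinear_append
  proof (intro conjI allI impI)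
    fix ys :: "'a list" assume "length ys = Suc q"
    then obtain y as where y: "ys = y # as" "length as = q" by (cases ys) auto
    have "multilinear scale s p (\<lambda>xs. \<beta> u (?m y xs as))"
      by (rule multilinear_comp[OF \<beta>(2) m2[OF y(2)]])
    then show "multilinear scale s p (\<lambda>xs. ?G (xs @ ys))"
      by (rule multilinear_cong[THEN iffD1, rotated]) (simp add: y nth_append)
  next
    fix xs :: "'a list" assume xs: "length xs = p"
    have "multilinear scale s (Suc q) (\<lambda>l. \<beta> u (?m (hd l) xs (tl l)))"
      by (rule multilinear_SucI) (simp_all add: lin_comp[OF m1[OF xs] \<beta>(2)] multilinear_comp[OF \<beta>(2) m3[OF xs]])
    then show "multilinear scale s (Suc q) (\<lambda>ys. ?G (xs @ ys))"
      by (rule multilinear_cong[THEN iffD1, rotated]) (auto simp: xs nth_append length_Suc_conv)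
  qed
qed

text \<open>The first leg of the middle letter acts on the values, the others act by
  \<open>ad\<close> on the block before it. \<open>SWL_rotate\<close> puts its legs in front of
  those of this block, and \<open>PL_adjoint\<close> turns the adjoint part into conjugated
  maps.\<close>

lemma PL_left:
  fixes s :: "'k \<Rightarrow> 'm::{comm_ring,comm_monoid_mult} \<Rightarrow> 'm"
  assumes b: "measuring s \<beta>" and hs: "\<forall>h\<in>set hs. coalgebra_map (length cs) h" and gs: "\<forall>h\<in>set gs. coalgebra_map (length cs) h"
    and g: "coalgebra_map (length cs) g" and f: "multilinear scale s (length hs + length gs) f"
  shows "PL s (hs @ g # gs) (\<lambda>l. SW (l ! length hs) (\<lambda>u v. \<beta> u (MS s (length hs) v
       (\<lambda>c. f (map2 ad c (take (length hs) l) @ drop (Suc (length hs)) l))))) cs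
    = SWL cs (\<lambda>x y. \<beta> (g (T x)) (PL s (map (conj_map (length cs) g) hs @ gs) f y))"
proof -
  have \<beta>: "\<And>m. lin scale s (\<lambda>a. \<beta> a m)" "\<And>a. lin s s (\<beta> a)" using b by (auto simp: measuring_def)
  note s = measuring_vs[OF b]
  have H: "\<forall>h\<in>set hs. h \<in> Hom (length cs) scale" "\<forall>h\<in>set gs. h \<in> Hom (length cs) scale" "g \<in> Hom (length cs) scale"
    using hs gs g by (auto simp: coalgebra_map_Hom)
  note gm = Hom_multilinear[OF vs H(3)]
  let ?q = "length hs"
  let ?m = "\<lambda>v xs as. MS s ?q v (\<lambda>c. f (map2 ad c xs @ as))"
  have f1: "multilinear scale s ?q (\<lambda>l. f (l @ as))" if "length as = length gs" for as
    using f that by (simp add: multilinear_append)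
  have f2: "multilinear scale s (length gs) (\<lambda>as. f (l @ as))" if "length l = ?q" for l
    using f that by (simp add: multilinear_append)
  have fc: "multilinear scale s ?q (\<lambda>c. f (map2 ad c xs @ as))" if "length xs = ?q" "length as = length gs" for as xs
    by (rule multilinear_map2_left[OF lin_ad(1) f1[OF that(2)] that(1)])
  have fx: "multilinear scale s ?q (\<lambda>xs. f (map2 ad c xs @ as))" if "length c = ?q" "length as = length gs" for c as
    by (rule multilinear_map2[OF lin_ad(2) f1[OF that(2)] that(1)])
  have m1: "lin scale s (\<lambda>v. ?m v xs as)" if "length xs = ?q" "length as = length gs" for xs as
    by (rule lin_MS[OF s fc[OF that]])
  have m2: "multilinear scale s ?q (\<lambda>xs. ?m v xs as)" if "length as = length gs" for v as
    using fx that unfolding multilinear_def by (auto intro!: lin_MS_param vs s)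
  have m3: "multilinear scale s (length gs) (?m v xs)" if "length xs = ?q" for v xs
    using f2 that unfolding multilinear_def by (auto intro!: lin_MS_param vs s)
  let ?P = "\<lambda>v X z. PL s hs (\<lambda>xs. PL s gs (\<lambda>as. ?m v xs as) z) X"
  have P1: "lin scale s (\<lambda>v. ?P v X z)" for X z by (intro lin_PL_param vs s m1)
  have P2: "multilinear scale s (length cs) (\<lambda>X. ?P v X z)" for v z
    by (intro multilinear_PL s H multilinear_PL_param vs m2)
  have P3: "multilinear scale s (length cs) (\<lambda>z. ?P v X z)" for v X
    by (intro multilinear_PL_param vs s multilinear_PL H m3)
  let ?F = "\<lambda>l. SW (l ! ?q) (\<lambda>u v. \<beta> u (?m v (take ?q l) (drop (Suc ?q) l)))"
  note ml = multilinear_left(1)[OF b f]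
  let ?Q = "\<lambda>X y1 y2 z. \<beta> (g (T y1)) (?P (g (T y2)) X z)"
  have "PL s (hs @ g # gs) ?F cs = SWL cs (\<lambda>X Y. PL s hs (\<lambda>l. PL s (g # gs) (\<lambda>k. ?F (l @ k)) Y) X)"
    using H ml by (intro PL_append s) auto
  also have "\<dots> = SWL cs (\<lambda>X Y. PL s hs (\<lambda>l. SWL Y (\<lambda>y z. PL s gs (\<lambda>as. SW (g (T y)) (\<lambda>u v. \<beta> u (?m v l as))) z)) X)"
    by (rule SWL_cong, rule PL_cong) (simp add: nth_append)
  also have "\<dots> = SWL cs (\<lambda>X Y. SWL Y (\<lambda>y z. SW (g (T y)) (\<lambda>u v. \<beta> u (?P v X z))))"
    by (simp add: PL_SWL_swap[OF s] PL_SW_swap[OF s] PL_hom[OF \<beta>(2)])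
  also have "\<dots> = SWL cs (\<lambda>X Y. SWL Y (\<lambda>y z. SWL y (\<lambda>y1 y2. ?Q X y1 y2 z)))"
    by (rule SWL_cong, rule SWL_cong, rule coalgebra_map_SW[OF g _ s]) (auto intro!: \<beta>(1) lin_comp[OF P1 \<beta>(2)])
  also have "\<dots> = SWL cs (\<lambda>y1 r. SWL r (\<lambda>n z. SWL n (\<lambda>y2 X. ?Q X y1 y2 z)))"
    by (intro SWL_rotate[OF s]) (auto simp: quadmultilinear_def trimultilinear_def
      intro!: multilinear_comp[OF \<beta>(1) gm] multilinear_comp[OF \<beta>(2) P2] multilinear_comp[OF \<beta>(2) P3]
         multilinear_comp[OF lin_comp[OF P1 \<beta>(2)] gm])
  also have "\<dots> = SWL cs (\<lambda>y1 r. SWL r (\<lambda>n z. \<beta> (g (T y1)) (PL s (map (conj_map (length cs) g) hs) (\<lambda>l. PL s gs (\<lambda>as. f (l @ as)) z) n)))"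
  proof (rule SWL_cong, rule SWL_cong)
    fix y1 r n z :: "'a list" assume "length r = length cs" "length n = length r" "length z = length r"
    then have l: "length n = length cs" "length z = length cs" by auto
    \<comment> \<open>The sum over the legs used by \<open>ad\<close> is pulled out of the trailing
      block, which leaves a statement about the first block alone.\<close>
    have sw: "PL s gs (\<lambda>as. ?m v xs as) z = MS s ?q v (\<lambda>c. PL s gs (\<lambda>as. f (map2 ad c xs @ as)) z)" for v xs
    proof -
      have "PL s gs (\<lambda>as. MS s k v (\<lambda>c. B c as)) z = MS s k v (\<lambda>c. PL s gs (B c) z)" for k B
        using s by (induct k arbitrary: v B) (simp_all add: PL_SW_swap PL_hom[OF lin_scale])
      then show ?thesis .
    qed
    have "SWL n (\<lambda>y2 X. ?P (g (T y2)) X z) = PL s (map (conj_map (length cs) g) hs) (\<lambda>l. PL s gs (\<lambda>as. f (l @ as)) z) n"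
    proof -
      have "multilinear scale s ?q (\<lambda>l. PL s gs (\<lambda>as. f (l @ as)) z)"
        by (intro multilinear_PL_param vs s f1)
      then show ?thesis
        unfolding sw using PL_adjoint[OF s, of hs n g "\<lambda>l. PL s gs (\<lambda>as. f (l @ as)) z"] hs g l by simp
    qed
    then show "SWL n (\<lambda>y2 X. ?Q X y1 y2 z) = \<beta> (g (T y1)) (PL s (map (conj_map (length cs) g) hs) (\<lambda>l. PL s gs (\<lambda>as. f (l @ as)) z) n)"
      by (simp add: SWL_additive[OF lin_additive[OF \<beta>(2)], symmetric])
  qed
  also have "\<dots> = SWL cs (\<lambda>x y. \<beta> (g (T x)) (PL s (map (conj_map (length cs) g) hs @ gs) f y))"
  proof (rule SWL_cong)
    fix x y :: "'a list" assume y: "length y = length cs"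
    have "PL s (map (conj_map (length cs) g) hs @ gs) f y
       = SWL y (\<lambda>n z. PL s (map (conj_map (length cs) g) hs) (\<lambda>l. PL s gs (\<lambda>as. f (l @ as)) z) n)"
      using gs hs g f y by (intro PL_append s) (auto intro!: coalgebra_map_Hom coalgebra_map_conj)
    then show "SWL y (\<lambda>n z. \<beta> (g (T x)) (PL s (map (conj_map (length cs) g) hs) (\<lambda>l. PL s gs (\<lambda>as. f (l @ as)) z) n))
      = \<beta> (g (T x)) (PL s (map (conj_map (length cs) g) hs @ gs) f y)"
      by (simp add: SWL_additive[OF lin_additive[OF \<beta>(2)]])
  qed
  finally show ?thesis .
qed

end

context cocommutative_hopf_algebra
begin

lemma multilinear_right:
  fixes s :: "'k \<Rightarrow> 'm::{comm_ring,comm_monoid_mult} \<Rightarrow> 'm"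
  assumes b: "measuring s \<beta>" and f: "multilinear scale s (p + q) f"
  shows "multilinear scale s (p + Suc q)
    (\<lambda>l. SWL (drop (Suc p) l) (\<lambda>us vs. \<beta> (ad (prod_list vs) (l ! p)) (f (take p l @ us))))" (is "multilinear _ _ _ ?F")
    and "length xs = p \<Longrightarrow> bimultilinear q s (\<lambda>us vs. \<beta> (ad (prod_list vs) x) (f (xs @ us)))"
proof -
  have \<beta>: "\<And>m. lin scale s (\<lambda>a. \<beta> a m)" "\<And>a. lin s s (\<beta> a)" using b by (auto simp: measuring_def)
  note s = measuring_vs[OF b]
  have f1: "multilinear scale s p (\<lambda>l. f (l @ as))" if "length as = q" for as
    using f that by (simp add: multilinear_append)
  have f2: "multilinear scale s q (\<lambda>as. f (l @ as))" if "length l = p" for l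
    using f that by (simp add: multilinear_append)
  have bm: "bimultilinear q s (\<lambda>us vs. \<beta> (ad (prod_list vs) x) (f (xs @ us)))" if "length xs = p" for xs x
    unfolding bimultilinear_def
  proof (intro conjI allI impI)
    fix vs :: "'a list"
    show "multilinear scale s q (\<lambda>us. \<beta> (ad (prod_list vs) x) (f (xs @ us)))"
      by (rule multilinear_comp[OF \<beta>(2) f2[OF that]])
  next
    fix us :: "'a list"
    show "multilinear scale s q (\<lambda>vs. \<beta> (ad (prod_list vs) x) (f (xs @ us)))"
      by (rule multilinear_comp[OF lin_comp[OF lin_ad(1) \<beta>(1)] multilinear_prod_list])
  qed
  then show "length xs = p \<Longrightarrow> bimultilinear q s (\<lambda>us vs. \<beta> (ad (prod_list vs) x) (f (xs @ us)))" .
  show "multilinear scale s (p + Suc q) ?F"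
    unfolding multilinear_append
  proof (intro conjI allI impI)
    fix ys :: "'a list" assume "length ys = Suc q"
    then obtain y as where y: "ys = y # as" "length as = q" by (cases ys) auto
    have "multilinear scale s p (\<lambda>xs. SWL as (\<lambda>us vs. \<beta> (ad (prod_list vs) y) (f (xs @ us))))"
      using y by (intro multilinear_SWL_param vs s multilinear_comp[OF \<beta>(2) f1]) auto
    then show "multilinear scale s p (\<lambda>xs. ?F (xs @ ys))"
      by (rule multilinear_cong[THEN iffD1, rotated]) (simp add: y nth_append)
  next
    fix xs :: "'a list" assume xs: "length xs = p"
    have "multilinear scale s (Suc q) (\<lambda>l. SWL (tl l) (\<lambda>us vs. \<beta> (ad (prod_list vs) (hd l)) (f (xs @ us))))"
    proof (rule multilinear_SucI)
      fix as :: "'a list" assume as: "length as = q"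
      show "lin scale s (\<lambda>a. SWL (tl (a # as)) (\<lambda>us vs. \<beta> (ad (prod_list vs) (hd (a # as))) (f (xs @ us))))"
        by simp (intro lin_SWL vs s lin_comp[OF lin_ad(2) \<beta>(1)])
    next
      fix a
      show "multilinear scale s q (\<lambda>as. SWL (tl (a # as)) (\<lambda>us vs. \<beta> (ad (prod_list vs) (hd (a # as))) (f (xs @ us))))"
        by simp (intro multilinear_SWL s bm xs)
    qed
    then show "multilinear scale s (Suc q) (\<lambda>ys. ?F (xs @ ys))"
      by (rule multilinear_cong[THEN iffD1, rotated]) (auto simp: xs nth_append length_Suc_conv)
  qed
qed

text \<open>The trailing block is used twice, as arguments of \<open>f\<close> and as the product
  that conjugates the acting letter. \<open>PL_SWL\<close> separates the two uses, and the second
  becomes the convolution product \<open>P\<close>.\<close>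

lemma PL_right:
  fixes s :: "'k \<Rightarrow> 'm::{comm_ring,comm_monoid_mult} \<Rightarrow> 'm"
  assumes b: "measuring s \<beta>" and hs: "\<forall>h\<in>set hs. coalgebra_map (length cs) h" and gs: "\<forall>h\<in>set gs. coalgebra_map (length cs) h"
    and h: "coalgebra_map (length cs) h" and f: "multilinear scale s (length hs + length gs) f"
  defines "P \<equiv> foldr (\<otimes>\<^bsub>conv (length cs) scale\<^esub>) gs \<one>\<^bsub>conv (length cs) scale\<^esub>"
  shows "PL s (hs @ h # gs) (\<lambda>l. SWL (drop (Suc (length hs)) l)
      (\<lambda>us vs. \<beta> (ad (prod_list vs) (l ! length hs)) (f (take (length hs) l @ us)))) cs
    = SWL cs (\<lambda>m n. \<beta> (conj_map (length cs) P h (T n)) (PL s (hs @ gs) f m))"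
proof -
  have \<beta>: "\<And>m. lin scale s (\<lambda>a. \<beta> a m)" "\<And>a. lin s s (\<beta> a)" using b by (auto simp: measuring_def)
  note s = measuring_vs[OF b]
  have P: "coalgebra_map (length cs) P" unfolding P_def by (rule coalgebra_map_foldr[OF gs])
  have H: "\<forall>h\<in>set hs. h \<in> Hom (length cs) scale" "\<forall>h\<in>set gs. h \<in> Hom (length cs) scale" "h \<in> Hom (length cs) scale"
    "P \<in> Hom (length cs) scale"
    using hs gs h P by (auto simp: coalgebra_map_Hom)
  note hm = Hom_multilinear[OF vs H(3)] and Pm = Hom_multilinear[OF vs H(4)]
  let ?p = "length hs" and ?q = "length gs"
  have f1: "multilinear scale s ?p (\<lambda>l. f (l @ as))" if "length as = ?q" for as
    using f that by (simp add: multilinear_append)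
  have f2: "multilinear scale s ?q (\<lambda>as. f (l @ as))" if "length l = ?p" for l
    using f that by (simp add: multilinear_append)
  let ?F = "\<lambda>l. SWL (drop (Suc ?p) l) (\<lambda>us vs. \<beta> (ad (prod_list vs) (l ! ?p)) (f (take ?p l @ us)))"
  note ml = multilinear_right[OF b f]
  let ?f = "\<lambda>u X. PL s hs (\<lambda>xs. PL s gs (\<lambda>us. f (xs @ us)) u) X"
  have F1: "multilinear scale s (length cs) (\<lambda>X. ?f u X)" for u
    by (intro multilinear_PL s H multilinear_PL_param vs f1)
  have F2: "multilinear scale s (length cs) (\<lambda>u. ?f u X)" for X
    by (intro multilinear_PL_param vs s multilinear_PL H f2)
  let ?Q = "\<lambda>X Y u v. \<beta> (ad (P (T v)) (h (T Y))) (?f u X)"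
  have "PL s (hs @ h # gs) ?F cs = SWL cs (\<lambda>X R. PL s hs (\<lambda>l. PL s (h # gs) (\<lambda>k. ?F (l @ k)) R) X)"
    using H ml by (intro PL_append s) auto
  also have "\<dots> = SWL cs (\<lambda>X R. PL s hs (\<lambda>l. SWL R (\<lambda>Y Z. SWL Z (\<lambda>u v. \<beta> (ad (P (T v)) (h (T Y))) (PL s gs (\<lambda>us. f (l @ us)) u)))) X)"
  proof (rule SWL_cong, rule PL_cong)
    fix X R l :: "'a list" assume R: "length R = length cs" and l: "length l = ?p"
    have "PL s (h # gs) (\<lambda>k. ?F (l @ k)) R = SWL R (\<lambda>Y Z. PL s gs (\<lambda>k. SWL k (\<lambda>us vs. \<beta> (ad (prod_list vs) (h (T Y))) (f (l @ us)))) Z)"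
      using l by (simp add: nth_append)
    also have "\<dots> = SWL R (\<lambda>Y Z. SWL Z (\<lambda>u v. \<beta> (ad (P (T v)) (h (T Y))) (PL s gs (\<lambda>us. f (l @ us)) u)))"
    proof (rule SWL_cong)
      fix Y Z :: "'a list" assume Z: "length Z = length R"
      have "PL s gs (\<lambda>k. SWL k (\<lambda>us vs. \<beta> (ad (prod_list vs) (h (T Y))) (f (l @ us)))) Z
        = SWL Z (\<lambda>u v. PL s gs (\<lambda>us. PL s gs (\<lambda>vs. \<beta> (ad (prod_list vs) (h (T Y))) (f (l @ us))) v) u)"
        using gs Z R by (intro PL_SWL s ml(2) l) simp
      also have "\<dots> = SWL Z (\<lambda>u v. \<beta> (ad (P (T v)) (h (T Y))) (PL s gs (\<lambda>us. f (l @ us)) u))"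
      proof (rule SWL_cong)
        fix u v :: "'a list" assume v: "length v = length Z"
        have "PL s gs (\<lambda>vs. \<beta> (ad (prod_list vs) (h (T Y))) m) v = \<beta> (ad (PL scale gs prod_list v) (h (T Y))) m" for m
          by (rule PL_hom[OF lin_comp[OF lin_ad(1) \<beta>(1)], symmetric])
        moreover have "PL scale gs prod_list v = P (T v)"
          unfolding P_def using v Z R gs by (intro PL_prod_list) auto
        ultimately show "PL s gs (\<lambda>us. PL s gs (\<lambda>vs. \<beta> (ad (prod_list vs) (h (T Y))) (f (l @ us))) v) u
          = \<beta> (ad (P (T v)) (h (T Y))) (PL s gs (\<lambda>us. f (l @ us)) u)"
          by (simp add: PL_hom[OF \<beta>(2)])
      qed
      finally show "PL s gs (\<lambda>k. SWL k (\<lambda>us vs. \<beta> (ad (prod_list vs) (h (T Y))) (f (l @ us)))) Z = \<dots>" .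
    qed
    finally show "PL s (h # gs) (\<lambda>k. ?F (l @ k)) R = \<dots>" .
  qed
  also have "\<dots> = SWL cs (\<lambda>X R. SWL R (\<lambda>Y Z. SWL Z (\<lambda>u v. ?Q X Y u v)))"
    by (simp add: PL_SWL_swap[OF s] PL_hom[OF \<beta>(2)])
  also have "\<dots> = SWL cs (\<lambda>m n. SWL m (\<lambda>X u. SWL n (\<lambda>v Y. ?Q X Y u v)))"
    by (intro SWL_rotate'[OF s]) (auto simp: quadmultilinear_def trimultilinear_def
      intro!: multilinear_comp[OF \<beta>(2) F1] multilinear_comp[OF \<beta>(2) F2]
        multilinear_comp[OF lin_comp[OF lin_ad(1) \<beta>(1)] Pm] multilinear_comp[OF lin_comp[OF lin_ad(2) \<beta>(1)] hm])
  also have "\<dots> = SWL cs (\<lambda>m n. \<beta> (conj_map (length cs) P h (T n)) (PL s (hs @ gs) f m))"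
  proof (rule SWL_cong)
    fix m n :: "'a list" assume l: "length m = length cs" "length n = length cs"
    have "PL s (hs @ gs) f m = SWL m (\<lambda>X u. ?f u X)"
      using H l f by (intro PL_append s) auto
    then have "\<beta> a (PL s (hs @ gs) f m) = SWL m (\<lambda>X u. \<beta> a (?f u X))" for a
      by (simp add: SWL_additive[OF lin_additive[OF \<beta>(2)]])
    moreover have "SWL n (\<lambda>v Y. ?Q X Y u v) = \<beta> (conj_map (length cs) P h (T n)) (?f u X)" for X u
      by (simp add: conj_map_tensor[OF P h] l SWL_additive[OF lin_additive[OF \<beta>(1)]])
    ultimately show "SWL m (\<lambda>X u. SWL n (\<lambda>v Y. ?Q X Y u v)) = \<beta> (conj_map (length cs) P h (T n)) (PL s (hs @ gs) f m)"
      by simp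
  qed
  finally show ?thesis .
qed

lemma multilinear_contract:
  assumes "multilinear scale s n f" "1 \<le> i" "i \<le> n"
  shows "multilinear scale s (Suc n) (\<lambda>l. f (contract i l))"
  using assms
proof (induct i arbitrary: n f)
  case (Suc i)
  then obtain m where n: "n = Suc m" by (cases n) auto
  have f: "lin scale s (\<lambda>a. f (a # l))" if "length l = m" for l using Suc(2) n that by (simp add: multilinear_Suc)
  have f': "multilinear scale s m (\<lambda>l. f (a # l))" for a using Suc(2) n by (simp add: multilinear_Suc)
  show ?case
  proof (cases i)
    case 0
    have "multilinear scale s (Suc (Suc m)) (\<lambda>l. f (contract 1 l))"
      by (intro multilinear_SucI)
        (auto simp: contract_def length_Suc_conv intro!: lin_comp[OF lin_mult_right f] lin_comp[OF lin_mult_left f] f')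
    then show ?thesis by (simp add: 0 n)
  next
    case (Suc k)
    have C: "contract (Suc (Suc k)) (a # l) = a # contract (Suc k) l" for a :: 'a and l
      by (simp add: contract_def)
    have l: "length (contract (Suc k) l) = m" if "length l = Suc m" for l :: "'a list"
      using that Suc Suc.prems(3) n by (auto simp: contract_def)
    have "multilinear scale s (Suc (Suc m)) (\<lambda>l. f (contract (Suc (Suc k)) l))"
    proof (rule multilinear_SucI)
      fix as :: "'a list" assume "length as = Suc m"
      then show "lin scale s (\<lambda>a. f (contract (Suc (Suc k)) (a # as)))"
        unfolding C by (rule f[OF l])
    next
      fix a
      show "multilinear scale s (Suc m) (\<lambda>as. f (contract (Suc (Suc k)) (a # as)))"
        using Suc.hyps[OF f', of a] Suc.prems n Suc by (simp add: C)
    qed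
    then show ?thesis by (simp add: Suc n)
  qed
qed simp

subsection \<open>The universal point\<close>

definition coord1 :: "nat \<Rightarrow> ('a, 'k) tens \<Rightarrow> 'a"
  where "coord1 n = lift scale scale (Suc n) (\<lambda>as. scale (prod_list (map counit (tl as))) (hd as))"

definition weaken :: "nat \<Rightarrow> (('a, 'k) tens \<Rightarrow> 'a) \<Rightarrow> ('a, 'k) tens \<Rightarrow> 'a"
  where "weaken n g = lift scale scale (Suc n) (\<lambda>as. scale (counit (hd as)) (g (T (tl as))))"

primrec coords :: "nat \<Rightarrow> (('a, 'k) tens \<Rightarrow> 'a) list"
  where
    "coords 0 = []"
  | "coords (Suc n) = coord1 n # map (weaken n) (coords n)"

lemma length_coords [simp]: "length (coords n) = n"
  by (induct n) auto

lemma coord1: "coord1 n \<in> Hom (Suc n) scale"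
  "length as = n \<Longrightarrow> coord1 n (T (a # as)) = scale (prod_list (map counit as)) a"
proof -
  have m: "multilinear scale scale (Suc n) (\<lambda>as. scale (prod_list (map counit (tl as))) (hd as))"
    by (rule multilinear_SucI) (simp_all add: lin_scale[OF vs] multilinear_counit[OF vs])
  show "coord1 n \<in> Hom (Suc n) scale"
    "length as = n \<Longrightarrow> coord1 n (T (a # as)) = scale (prod_list (map counit as)) a"
    unfolding coord1_def using lift_in[OF vs vs m] lift_tensor[OF vs vs m, of "a # as"] by simp_all
qed

lemma weaken:
  assumes g: "g \<in> Hom n scale"
  shows "weaken n g \<in> Hom (Suc n) scale"
    "length as = n \<Longrightarrow> weaken n g (T (a # as)) = scale (counit a) (g (T as))"
proof -
  have m: "multilinear scale scale (Suc n) (\<lambda>as. scale (counit (hd as)) (g (T (tl as))))"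
    by (rule multilinear_SucI) (simp_all add: lin_scale_left[OF vs counit_linear] multilinear_comp[OF lin_scale[OF vs] Hom_multilinear[OF vs g]])
  show "weaken n g \<in> Hom (Suc n) scale"
    "length as = n \<Longrightarrow> weaken n g (T (a # as)) = scale (counit a) (g (T as))"
    unfolding weaken_def using lift_in[OF vs vs m] lift_tensor[OF vs vs m, of "a # as"] by simp_all
qed

lemma SW_scale_arg:
  assumes "vector_space s" "\<And>y. lin scale s (\<lambda>x. B x y)" "\<And>x. lin scale s (B x)"
  shows "SW (scale c a) B = s c (SW a B)"
  using lin_SW_arg[OF assms] by (simp add: lin_iff)

lemma coalgebra_map_coord1: "coalgebra_map (Suc n) (coord1 n)"
proof (rule coalgebra_mapI)
  show "coord1 n \<in> Hom (Suc n) scale" by (rule coord1)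
  fix as :: "'a list" assume "length as = Suc n"
  then obtain a bs where as: "as = a # bs" "length bs = n" by (cases as) auto
  show "counit (coord1 n (T as)) = prod_list (map counit as)"
    using counit_linear by (simp add: as coord1 lin_iff)
  fix B :: "'a \<Rightarrow> 'a \<Rightarrow> ('a, 'k) tens"
  let ?s = "fscale (*) :: 'k \<Rightarrow> ('a, 'k) tens \<Rightarrow> _"
  assume B: "\<And>y. lin scale ?s (\<lambda>x. B x y)" "\<And>x. lin scale ?s (B x)"
  note s = vector_space_tens2
  have "SWL as (\<lambda>x y. B (coord1 n (T x)) (coord1 n (T y)))
     = SW a (\<lambda>u v. SWL bs (\<lambda>x y. ?s (prod_list (map counit x)) (?s (prod_list (map counit y)) (B u v))))"
  proof -
    have "SWL bs (\<lambda>x y. B (coord1 n (T (u # x))) (coord1 n (T (v # y))))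
      = SWL bs (\<lambda>x y. ?s (prod_list (map counit x)) (?s (prod_list (map counit y)) (B u v)))" for u v
      using B by (intro SWL_cong) (simp add: coord1 as lin_iff, simp add: fscale_def mult.left_commute)
    then show ?thesis by (simp add: as)
  qed
  also have "\<dots> = SW a (\<lambda>u v. ?s (prod_list (map counit bs)) (B u v))"
    by (simp only: SWL_counit_left[OF multilinear_counit[OF s] s])
  also have "\<dots> = SW (coord1 n (T as)) B"
    by (simp add: as coord1 SW_scale_arg[OF s B] SW_scale[OF s])
  finally show "SW (coord1 n (T as)) B = SWL as (\<lambda>x y. B (coord1 n (T x)) (coord1 n (T y)))" ..
qed

lemma coalgebra_map_weaken:
  assumes g: "coalgebra_map n g"
  shows "coalgebra_map (Suc n) (weaken n g)"
proof (rule coalgebra_mapI)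
  note w = weaken[OF coalgebra_map_Hom[OF g]]
  show "weaken n g \<in> Hom (Suc n) scale" by (rule w)
  fix as :: "'a list" assume "length as = Suc n"
  then obtain a bs where as: "as = a # bs" "length bs = n" by (cases as) auto
  show "counit (weaken n g (T as)) = prod_list (map counit as)"
    using counit_linear by (simp add: as w lin_iff coalgebra_map_counit[OF g])
  fix B :: "'a \<Rightarrow> 'a \<Rightarrow> ('a, 'k) tens"
  let ?s = "fscale (*) :: 'k \<Rightarrow> ('a, 'k) tens \<Rightarrow> _"
  assume B: "\<And>y. lin scale ?s (\<lambda>x. B x y)" "\<And>x. lin scale ?s (B x)"
  note s = vector_space_tens2
  have "SWL as (\<lambda>x y. B (weaken n g (T x)) (weaken n g (T y)))
     = SW a (\<lambda>u v. ?s (counit u) (?s (counit v) (SWL bs (\<lambda>x y. B (g (T x)) (g (T y))))))"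
  proof -
    have "SWL bs (\<lambda>x y. B (weaken n g (T (u # x))) (weaken n g (T (v # y))))
      = SWL bs (\<lambda>x y. ?s (counit u) (?s (counit v) (B (g (T x)) (g (T y)))))" for u v
      using B by (intro SWL_cong) (simp add: w as lin_iff, simp add: fscale_def mult.left_commute)
    then show ?thesis by (simp add: as SWL_scale[OF s])
  qed
  also have "\<dots> = ?s (counit a) (SWL bs (\<lambda>x y. B (g (T x)) (g (T y))))"
    by (rule SW_counit_left) (rule lin_scale_left[OF s counit_linear])
  also have "\<dots> = SW (weaken n g (T as)) B"
    by (simp add: as w SW_scale_arg[OF s B] coalgebra_map_SW[OF g _ s B])
  finally show "SW (weaken n g (T as)) B = SWL as (\<lambda>x y. B (weaken n g (T x)) (weaken n g (T y)))" ..
qed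

lemma coalgebra_map_coords: "\<forall>g\<in>set (coords n). coalgebra_map n g"
  by (induct n) (auto intro: coalgebra_map_coord1 coalgebra_map_weaken)

text \<open>These maps see the first letter through the counit only, and the counits of its legs
  combine to \<open>counit a\<close>.\<close>

lemma PL_weaken:
  assumes s: "vector_space s" and "\<forall>g\<in>set gs. g \<in> Hom (length as) scale" "multilinear scale s (length gs) f"
  shows "PL s (map (weaken (length as)) gs) f (a # as) = s (counit a) (PL s gs f as)"
  using assms(2,3)
proof (induct gs arbitrary: f a as)
  case Nil
  then show ?case using s by (simp add: vector_space_def)
next
  case (Cons g gs)
  have w: "weaken (length as) g (T (a # x)) = scale (counit a) (g (T x))" if "length x = length as" for a x
    using Cons(2) that by (intro weaken) auto
  have f: "lin scale s (\<lambda>a. f (a # l))" if "length l = length gs" for l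
    using Cons(3) that by (simp add: multilinear_Suc)
  have f': "multilinear scale s (length gs) (\<lambda>l. f (a # l))" for a
    using Cons(3) by (simp add: multilinear_Suc)
  have lin: "lin scale s (\<lambda>a. PL s gs (\<lambda>l. f (a # l)) y)" for y
    by (intro lin_PL_param vs s f)
  have "SWL as (\<lambda>x y. PL s (map (weaken (length as)) gs) (\<lambda>l. f (weaken (length as) g (T (u # x)) # l)) (v # y))
    = SWL as (\<lambda>x y. s (counit u) (s (counit v) (PL s gs (\<lambda>l. f (g (T x) # l)) y)))" for u v
  proof (rule SWL_cong)
    fix x y :: "'a list" assume l: "length x = length as" "length y = length as"
    have "PL s (map (weaken (length as)) gs) (\<lambda>l. f (scale (counit u) (g (T x)) # l)) (v # y)
       = s (counit v) (PL s gs (\<lambda>l. f (scale (counit u) (g (T x)) # l)) y)"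
      using Cons(1)[of y "\<lambda>l. f (scale (counit u) (g (T x)) # l)" v] Cons(2) f' l by simp
    also have "\<dots> = s (counit u) (s (counit v) (PL s gs (\<lambda>l. f (g (T x) # l)) y))"
      using lin s by (simp add: lin_iff vector_space_def mult.commute)
    finally show "PL s (map (weaken (length as)) gs) (\<lambda>l. f (weaken (length as) g (T (u # x)) # l)) (v # y) = \<dots>"
      by (simp add: w l)
  qed
  then have "PL s (map (weaken (length as)) (g # gs)) f (a # as)
    = SW a (\<lambda>u v. s (counit u) (s (counit v) (PL s (g # gs) f as)))"
    by (simp add: SWL_scale[OF s])
  also have "\<dots> = s (counit a) (PL s (g # gs) f as)"
    by (rule SW_counit_left) (rule lin_scale_left[OF s counit_linear])
  finally show ?case .
qed

text \<open>Each coordinate reads one letter and applies the counit to the others, so summing over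
  all legs leaves every letter in its own slot.\<close>

lemma PL_coords:
  assumes s: "vector_space s" and "multilinear scale s n f" "length as = n"
  shows "PL s (coords n) f as = f as"
  using assms(2,3)
proof (induct n arbitrary: f as)
  case 0
  then show ?case using s by (simp add: vector_space_def)
next
  case (Suc n)
  then obtain a bs where as: "as = a # bs" "length bs = n" by (cases as) auto
  have f: "lin scale s (\<lambda>a. f (a # l))" if "length l = n" for l
    using Suc(2) that by (simp add: multilinear_Suc)
  have f': "multilinear scale s n (\<lambda>l. f (a # l))" for a
    using Suc(2) by (simp add: multilinear_Suc)
  have H: "\<forall>g\<in>set (coords n). g \<in> Hom m scale" if "m = n" for m
    using coalgebra_map_coords[of n] that by (auto intro: coalgebra_map_Hom)
  have "SWL bs (\<lambda>x y. PL s (map (weaken n) (coords n)) (\<lambda>l. f (coord1 n (T (u # x)) # l)) (v # y))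
     = s (counit v) (f (u # bs))" for u v
  proof -
    have "SWL bs (\<lambda>x y. PL s (map (weaken n) (coords n)) (\<lambda>l. f (coord1 n (T (u # x)) # l)) (v # y))
      = SWL bs (\<lambda>x y. s (prod_list (map counit x)) (s (counit v) (f (u # y))))"
    proof (rule SWL_cong)
      fix x y :: "'a list" assume l: "length x = length bs" "length y = length bs"
      have "PL s (map (weaken n) (coords n)) (\<lambda>l. f (coord1 n (T (u # x)) # l)) (v # y)
         = s (counit v) (f (coord1 n (T (u # x)) # y))"
        using PL_weaken[OF s, of "coords n" y "\<lambda>l. f (coord1 n (T (u # x)) # l)" v] H f' l as Suc(1)[OF f', of y] by simp
      also have "\<dots> = s (prod_list (map counit x)) (s (counit v) (f (u # y)))"
        using f[of y] s l as by (simp add: coord1 lin_iff vector_space_def mult.commute)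
      finally show "PL s (map (weaken n) (coords n)) (\<lambda>l. f (coord1 n (T (u # x)) # l)) (v # y) = \<dots>" .
    qed
    also have "\<dots> = s (counit v) (f (u # bs))"
    proof (rule SWL_counit_left[OF _ s])
      show "multilinear scale s (length bs) (\<lambda>y. s (counit v) (f (u # y)))"
        unfolding as(2) by (rule multilinear_comp[OF lin_scale[OF s] f'])
    qed
    finally show ?thesis .
  qed
  then have "PL s (coords (Suc n)) f as = SW a (\<lambda>u v. s (counit v) (f (u # bs)))" by (simp add: as)
  also have "\<dots> = f as" unfolding as(1) by (rule SW_counit_right[OF f[OF as(2)]])
  finally show ?case .
qed

subsection \<open>Pulling back along tuples of coalgebra maps\<close>

definition pull :: "('k \<Rightarrow> 'w::ab_group_add \<Rightarrow> 'w) \<Rightarrow> nat \<Rightarrow> (('a, 'k) tens \<Rightarrow> 'a) list \<Rightarrow> (('a, 'k) tens \<Rightarrow> 'w) \<Rightarrow> ('a, 'k) tens \<Rightarrow> 'w"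
  where "pull s n gs f = lift scale s n (PL s gs (\<lambda>l. f (T l)))"

lemma pull:
  assumes s: "vector_space s" and f: "f \<in> Hom (length gs) s" and gs: "\<forall>g\<in>set gs. coalgebra_map n g"
  shows "pull s n gs f \<in> Hom n s" "length as = n \<Longrightarrow> pull s n gs f (T as) = PL s gs (\<lambda>l. f (T l)) as"
proof -
  have "multilinear scale s n (PL s gs (\<lambda>l. f (T l)))"
    using gs by (intro multilinear_PL s Hom_multilinear f) (auto intro: coalgebra_map_Hom)
  from lift_in[OF vs s this] lift_tensor[OF vs s this]
  show "pull s n gs f \<in> Hom n s" "length as = n \<Longrightarrow> pull s n gs f (T as) = PL s gs (\<lambda>l. f (T l)) as"
    by (simp_all add: pull_def)
qed

lemma pull_coords: "vector_space s \<Longrightarrow> f \<in> Hom n s \<Longrightarrow> pull s n (coords n) f = f"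
  using pull[of s f "coords n" n] coalgebra_map_coords[of n] PL_coords[OF _ Hom_multilinear[of s f n]]
  by (intro Hom_eqI[of s _ n]) auto

lemma pull_mult:
  fixes s :: "'k \<Rightarrow> 'w::{ring,monoid_mult} \<Rightarrow> 'w"
  assumes alg: "k_algebra s" and f: "f \<in> Hom m s" "g \<in> Hom m s" and gs: "\<forall>g\<in>set gs. coalgebra_map n g" "length gs = m"
  shows "pull s n gs (f \<otimes>\<^bsub>conv m s\<^esub> g)
     = pull s n gs f \<otimes>\<^bsub>conv n s\<^esub> pull s n gs g"
proof -
  interpret W: k_algebra s by (rule alg)
  note s = W.vector_space_axioms
  note fg = conv_mult_in[OF alg f]
  note P = pull[OF s _ gs(1), unfolded gs(2)]
  show ?thesis
  proof (rule Hom_eqI[OF s P(1)[OF fg] conv_mult_in[OF alg P(1)[OF f(1)] P(1)[OF f(2)]]])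
    fix as :: "'a list" assume as: "length as = n"
    have "pull s n gs (f \<otimes>\<^bsub>conv m s\<^esub> g) (T as) = PL s gs (\<lambda>l. SWL l (\<lambda>x y. f (T x) * g (T y))) as"
      unfolding P(2)[OF fg as] by (rule PL_cong) (simp add: conv_mult_tensor[OF alg f] gs)
    also have "\<dots> = SWL as (\<lambda>u v. PL s gs (\<lambda>x. PL s gs (\<lambda>y. f (T x) * g (T y)) v) u)"
      using gs as conv_bimultilinear[OF alg f, folded gs(2)] by (intro PL_SWL s) auto
    also have "\<dots> = SWL as (\<lambda>u v. PL s gs (\<lambda>l. f (T l)) u * PL s gs (\<lambda>l. g (T l)) v)"
      by (simp add: PL_hom[OF W.lin_mult_left, symmetric] PL_hom[OF W.lin_mult_right, symmetric])
    also have "\<dots> = (pull s n gs f \<otimes>\<^bsub>conv n s\<^esub> pull s n gs g) (T as)"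
      unfolding conv_mult_tensor[OF alg P(1)[OF f(1)] P(1)[OF f(2)] as]
      by (rule SWL_cong) (simp add: P(2) f as)
    finally show "pull s n gs (f \<otimes>\<^bsub>conv m s\<^esub> g) (T as)
      = (pull s n gs f \<otimes>\<^bsub>conv n s\<^esub> pull s n gs g) (T as)" .
  qed
qed

lemma pull_one:
  fixes s :: "'k \<Rightarrow> 'w::{ring,monoid_mult} \<Rightarrow> 'w"
  assumes alg: "k_algebra s" and gs: "\<forall>g\<in>set gs. coalgebra_map n g" "length gs = m"
  shows "pull s n gs \<one>\<^bsub>conv m s\<^esub> = \<one>\<^bsub>conv n s\<^esub>"
proof -
  interpret W: k_algebra s by (rule alg)
  note s = W.vector_space_axioms
  note P = pull[OF s conv_one_in[OF alg] gs(1), unfolded gs(2)]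
  show ?thesis
  proof (rule Hom_eqI[OF s P(1) conv_one_in[OF alg]])
    fix as :: "'a list" assume as: "length as = n"
    have "pull s n gs \<one>\<^bsub>conv m s\<^esub> (T as) = PL s gs (\<lambda>l. s (prod_list (map counit l)) 1) as"
      unfolding P(2)[OF as] by (rule PL_cong) (simp add: conv_one_tensor[OF alg] gs)
    then show "pull s n gs \<one>\<^bsub>conv m s\<^esub> (T as) = \<one>\<^bsub>conv n s\<^esub> (T as)"
      using PL_counit[OF s, of gs as 1] gs as by (simp add: conv_one_tensor[OF alg])
  qed
qed

subsection \<open>The braiding\<close>

lemma braid_multilinear:
  assumes s: "vector_space s" and f: "multilinear scale s (Suc (Suc (p + q))) f"
  shows "multilinear scale s (Suc (Suc (p + q)))
     (\<lambda>l. SW (l ! Suc p) (\<lambda>u v. f (take p l @ [u, ad v (l ! p)] @ drop (Suc (Suc p)) l)))"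
  using f
proof (induct p arbitrary: f)
  case 0
  have f1: "lin scale s (\<lambda>a. f (a # b # l))" "lin scale s (\<lambda>b. f (a # b # l))" if "length l = q" for a b l
    using 0 that by (simp_all add: multilinear_Suc)
  have f2: "multilinear scale s q (\<lambda>l. f (a # b # l))" for a b
    using 0 by (simp add: multilinear_Suc)
  have "multilinear scale s q (\<lambda>l. SW b (\<lambda>u v. f (u # ad v a # l)))" for a b
    using f2 unfolding multilinear_def by (auto intro!: lin_SW vs s)
  moreover have "lin scale s (\<lambda>a. SW b (\<lambda>u v. f (u # ad v a # l)))" "lin scale s (\<lambda>b. SW b (\<lambda>u v. f (u # ad v a # l)))"
    if "length l = q" for l a b
    by (intro lin_SW lin_SW_arg vs s lin_comp[OF lin_ad(2)] lin_comp[OF lin_ad(1)] f1 that)+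
  ultimately show ?case
    by (simp, intro multilinear_SucI) (auto simp: length_Suc_conv)
next
  case (Suc p)
  have f': "multilinear scale s (Suc (Suc (p + q))) (\<lambda>l. f (a # l))" for a
    using Suc(2) by (simp add: multilinear_Suc)
  have f1: "lin scale s (\<lambda>a. f (a # l))" if "length l = Suc (Suc (p + q))" for l
    using Suc(2) that by (simp add: multilinear_Suc)
  show ?case
    unfolding add_Suc
  proof (rule multilinear_SucI)
    fix as :: "'a list" assume "length as = Suc (Suc (p + q))"
    then show "lin scale s (\<lambda>a. SW ((a # as) ! Suc (Suc p))
        (\<lambda>u v. f (take (Suc p) (a # as) @ [u, ad v ((a # as) ! Suc p)] @ drop (Suc (Suc (Suc p))) (a # as))))"
      by simp (intro lin_SW vs s f1, simp)
  next
    fix a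
    show "multilinear scale s (Suc (Suc (p + q))) (\<lambda>as. SW ((a # as) ! Suc (Suc p))
        (\<lambda>u v. f (take (Suc p) (a # as) @ [u, ad v ((a # as) ! Suc p)] @ drop (Suc (Suc (Suc p))) (a # as))))"
      using Suc(1)[OF f', of a] by simp
  qed
qed

lemma braiding_tensor: "braiding (T [x, y]) = SW y (\<lambda>u v. T [u, ad v x])"
proof -
  let ?f = "fscale (*) :: 'k \<Rightarrow> ('a, 'k) tens \<Rightarrow> _"
  have "multilinear scale ?f 2 T" by (rule multilinear_tensor[OF vs])
  then have t: "lin scale ?f (\<lambda>x. T [x, y])" "lin scale ?f (\<lambda>y. T [x, y])" for x y
    by (simp_all add: multilinear_2)
  have e: "sweedler ?f [(2, y)] (\<lambda>c. T [c ! 0 ! 0, ad (c ! 0 ! 1) x]) = SW y (\<lambda>u v. T [u, ad v x])" for x y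
    by (subst sweedler_2[OF vector_space_tens2]) (simp_all add: t lin_comp[OF lin_ad(1) t(2)])
  have m: "multilinear scale ?f 2 (\<lambda>xs. sweedler ?f [(2, xs ! 1)] (\<lambda>c. T [c ! 0 ! 0, ad (c ! 0 ! 1) (xs ! 0)]))"
    unfolding multilinear_2 e
    by (auto simp: e intro!: lin_SW lin_SW_arg vs vector_space_tens2 t lin_comp[OF lin_ad(1) t(2)] lin_comp[OF lin_ad(2) t(2)])
  show ?thesis unfolding braiding_def using lift_tensor[OF vs vector_space_tens2 m, of "[x, y]"] e by simp
qed

lemma tprod_SW_left:
  assumes "\<And>u v. length (h u v) = m" "length ys = n"
  shows "tprod scale m n (SW a (\<lambda>u v. T (h u v))) (T ys) = SW a (\<lambda>u v. T (h u v @ ys))"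
proof -
  let ?f = "fscale (*) :: 'k \<Rightarrow> ('a, 'k) tens \<Rightarrow> _"
  have t: "multilinear scale ?f (m + n) T" by (rule multilinear_tensor[OF vs])
  have e: "lift scale ?f n (\<lambda>ys. T (xs @ ys)) (T ys) = T (xs @ ys)" if "length xs = m" for xs
    using t that assms(2) unfolding multilinear_append by (intro lift_tensor[OF vs vector_space_tens2]) auto
  have "multilinear scale ?f m (\<lambda>xs. lift scale ?f n (\<lambda>ys. T (xs @ ys)) (T ys)) = multilinear scale ?f m (\<lambda>xs. T (xs @ ys))"
    by (rule multilinear_cong) (rule e)
  then have ml: "multilinear scale ?f m (\<lambda>xs. lift scale ?f n (\<lambda>ys. T (xs @ ys)) (T ys))"
    using t assms(2) unfolding multilinear_append by simp
  show ?thesis unfolding tprod_def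
    by (subst linear_maps_SW[OF lift_in[OF vs vector_space_tens2 ml]])
      (simp_all add: tensor_in assms lift_tensor[OF vs vector_space_tens2 ml] e)
qed

lemma tprod_SW_right:
  assumes "\<And>u v. length (h u v) = n" "length xs = m"
  shows "tprod scale m n (T xs) (SW a (\<lambda>u v. T (h u v))) = SW a (\<lambda>u v. T (xs @ h u v))"
proof -
  let ?f = "fscale (*) :: 'k \<Rightarrow> ('a, 'k) tens \<Rightarrow> _"
  have t: "multilinear scale ?f (m + n) T" by (rule multilinear_tensor[OF vs])
  then have ml: "multilinear scale ?f n (\<lambda>ys. T (xs @ ys))"
    using assms(2) unfolding multilinear_append by simp
  show ?thesis unfolding tprod_right[OF vs assms(2)]
    by (subst linear_maps_SW[OF lift_in[OF vs vector_space_tens2 ml]])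
      (simp_all add: tensor_in assms lift_tensor[OF vs vector_space_tens2 ml])
qed

lemma braid:
  assumes n: "n = Suc (Suc (p + q))"
  shows "braid n (Suc p) \<in> linear_maps scale (fscale (*)) n (tensor_power scale n)"
    "length xs = n \<Longrightarrow> braid n (Suc p) (T xs)
      = SW (xs ! Suc p) (\<lambda>u v. T (take p xs @ [u, ad v (xs ! p)] @ drop (Suc (Suc p)) xs))"
proof -
  let ?f = "fscale (*) :: 'k \<Rightarrow> ('a, 'k) tens \<Rightarrow> _"
  let ?F = "\<lambda>l. SW (l ! Suc p) (\<lambda>u v. T (take p l @ [u, ad v (l ! p)] @ drop (Suc (Suc p)) l))"
  have m: "multilinear scale ?f n ?F"
    unfolding n by (rule braid_multilinear[OF vector_space_tens2 multilinear_tensor[OF vs]])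
  have "tprod scale p (Suc (Suc q)) (T (take p xs)) (tprod scale 2 q (braiding (T [xs ! p, xs ! Suc p])) (T (drop (Suc (Suc p)) xs))) = ?F xs"
    if "length xs = n" for xs
    using that by (simp add: braiding_tensor tprod_SW_left tprod_SW_right n)
  then have b: "braid n (Suc p) = lift scale ?f n ?F"
    unfolding braid_def by (intro lift_cong) (simp add: n)
  show 1: "length xs = n \<Longrightarrow> braid n (Suc p) (T xs)
      = SW (xs ! Suc p) (\<lambda>u v. T (take p xs @ [u, ad v (xs ! p)] @ drop (Suc (Suc p)) xs))" for xs
    unfolding b by (rule lift_tensor[OF vs vector_space_tens2 m])
  have L: "braid n (Suc p) \<in> linear_maps scale ?f n UNIV" unfolding b by (rule lift_in[OF vs vector_space_tens2 m])
  have F: "?F xs \<in> tensor_power scale n" if "length xs = n" for xs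
    using that by (intro SW_tensor_power tensor_in) (simp add: n)
  have "braid n (Suc p) t \<in> tensor_power scale n" if "t \<in> tensor_power scale n" for t
    using that
  proof (induct rule: tensor_power_induct)
    case zero
    show ?case unfolding linear_maps_zero[OF L] by (rule tensor_power_zero)
  next
    case (step c xs y)
    have "braid n (Suc p) (?f c (T xs) + y) = ?f c (braid n (Suc p) (T xs)) + braid n (Suc p) y"
      unfolding linear_maps_add[OF L tensor_power_scale[OF tensor_in[OF step(1)]] step(2)] linear_maps_scale[OF L tensor_in[OF step(1)]] ..
    then show ?case using step F by (simp only: tensor_power_add tensor_power_scale 1)
  qed
  then show "braid n (Suc p) \<in> linear_maps scale ?f n (tensor_power scale n)"
    using L unfolding linear_maps_def by blast
qed

text \<open>\<open>f\<close> is linear on the tensor power only, with value \<open>0\<close>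
  outside, so the composite needs a \<open>b\<close> that takes its values inside.\<close>

lemma linear_maps_compose:
  assumes "f \<in> Hom n s" "b \<in> linear_maps scale (fscale (*)) n (tensor_power scale n)"
  shows "f \<circ> b \<in> Hom n s"
proof -
  have 0: "f 0 = 0" by (rule linear_maps_zero[OF assms(1)])
  have b: "b t \<in> tensor_power scale n" if "t \<in> tensor_power scale n" for t
    using assms(2) that unfolding linear_maps_def by blast
  show ?thesis
    using linear_maps_add[OF assms(1) b b] linear_maps_scale[OF assms(1) b] linear_maps_add[OF assms(2)]
      linear_maps_scale[OF assms(2)] linear_maps_outside[OF assms(2)] 0
    unfolding linear_maps_def by simp
qed

lemma pull_braid:
  assumes s: "vector_space s" and gs: "\<forall>g\<in>set (pre @ g # h # post). coalgebra_map m g"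
    and n: "n = Suc (Suc (length pre + length post))" and f: "f \<in> Hom n s"
  shows "f \<circ> braid n (Suc (length pre)) \<in> Hom n s"
    "pull s m (pre @ g # h # post) (f \<circ> braid n (Suc (length pre))) = pull s m (pre @ h # conj_map m h g # post) f"
proof -
  note b = braid[OF n]
  show fb: "f \<circ> braid n (Suc (length pre)) \<in> Hom n s"
    by (rule linear_maps_compose[OF f b(1)])
  have v: "(f \<circ> braid n (Suc (length pre))) (T l) = SW (l ! Suc (length pre))
       (\<lambda>u v. f (T (take (length pre) l @ [u, ad v (l ! length pre)] @ drop (Suc (Suc (length pre))) l)))"
    if "length l = n" for l
    using that by (simp add: b(2), subst linear_maps_SW[OF f]) (auto intro!: tensor_in simp: n)
  have gs': "\<forall>g\<in>set (pre @ h # conj_map m h g # post). coalgebra_map m g"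
    using gs coalgebra_map_conj by auto
  have l: "length (pre @ g # h # post) = n" "length (pre @ h # conj_map m h g # post) = n" by (simp_all add: n)
  note P = pull[OF s _ gs, unfolded l, OF fb] pull[OF s _ gs', unfolded l, OF f]
  show "pull s m (pre @ g # h # post) (f \<circ> braid n (Suc (length pre))) = pull s m (pre @ h # conj_map m h g # post) f"
  proof (rule Hom_eqI[OF s P(1,3)])
    fix as :: "'a list" assume as: "length as = m"
    have "pull s m (pre @ g # h # post) (f \<circ> braid n (Suc (length pre))) (T as)
       = PL s (pre @ g # h # post) (\<lambda>l. SW (l ! Suc (length pre))
       (\<lambda>u v. f (T (take (length pre) l @ [u, ad v (l ! length pre)] @ drop (Suc (Suc (length pre))) l)))) as"
      unfolding P(2)[OF as] by (rule PL_cong, rule v) (simp add: n)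
    also have "\<dots> = PL s (pre @ h # conj_map m h g # post) (\<lambda>l. f (T l)) as"
      using gs as Hom_multilinear[OF s f] PL_braid[OF s, of pre g h post as "\<lambda>l. f (T l)"] by (simp add: n)
    finally show "pull s m (pre @ g # h # post) (f \<circ> braid n (Suc (length pre))) (T as)
      = pull s m (pre @ h # conj_map m h g # post) f (T as)"
      unfolding P(4)[OF as] .
  qed
qed

end

subsection \<open>Shuffle permutations\<close>

text \<open>Positions count from 1 as in \<open>braid\<close>, so letter \<open>i\<close> and its
  successor have list indices \<open>i - 1\<close> and \<open>i\<close>.\<close>

definition braid_act :: "nat \<Rightarrow> 'g::group_add list \<Rightarrow> 'g list"
  where "braid_act i gs = gs[i - 1 := gs ! i, i := conjg (gs ! i) (gs ! (i - 1))]"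

definition swap_at :: "nat \<Rightarrow> 'b list \<Rightarrow> 'b list"
  where "swap_at i s = s[i - 1 := s ! i, i := s ! (i - 1)]"

text \<open>
  A shuffle is encoded by the word in the letters \<open>True\<close> and \<open>False\<close> that records which of the two
  blocks each position of the result comes from.
\<close>

fun merge :: "bool list \<Rightarrow> 'g::group_add list \<Rightarrow> 'g list \<Rightarrow> 'g list"
  where
    "merge (True # s) (a # as) bs = a # merge s as bs"
  | "merge (False # s) as (b # bs) = b # merge s (map (conjg b) as) bs"
  | "merge _ _ _ = []"

fun inversions :: "bool list \<Rightarrow> nat"
  where
    "inversions [] = 0"
  | "inversions (True # s) = inversions s"
  | "inversions (False # s) = count_list s True + inversions s"

lemma swap_at_append [simp]: "swap_at (Suc (length s)) (s @ x # y # t) = s @ y # x # t"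
  by (simp add: swap_at_def nth_append list_update_append)

lemma braid_act_append [simp]: "braid_act (Suc (length s)) (s @ x # y # t) = s @ y # conjg y x # t"
  by (simp add: braid_act_def nth_append list_update_append)

lemma two_positions:
  assumes "1 \<le> i" "i < length s"
  obtains s1 x y s2 where "s = s1 @ x # y # s2" "i = Suc (length s1)"
proof
  show "s = take (i - 1) s @ s ! (i - 1) # s ! i # drop (Suc i) s"
    using assms by (metis Cons_nth_drop_Suc One_nat_def Suc_diff_le Suc_lessD append_take_drop_id diff_Suc_Suc
        less_imp_diff_less minus_nat.diff_0)
  show "i = Suc (length (take (i - 1) s))" using assms by simp
qed

lemma length_swap_at [simp]: "length (swap_at i s) = length s"
  by (simp add: swap_at_def)

lemma inversions_append_TF: "inversions (s @ False # True # t) = Suc (inversions (s @ True # False # t))"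
  by (induct s rule: inversions.induct) auto

text \<open>The case of equality recognises, swap by swap, that a word is reduced.\<close>

lemma inversions_swap_at:
  assumes "1 \<le> i" "i < length s"
  shows "inversions (swap_at i s) \<le> Suc (inversions s)"
    "inversions (swap_at i s) = Suc (inversions s) \<Longrightarrow> \<exists>s1 s2. s = s1 @ True # False # s2 \<and> i = Suc (length s1)"
proof -
  obtain s1 x y s2 where s: "s = s1 @ x # y # s2" "i = Suc (length s1)"
    using two_positions[OF assms] .
  show "inversions (swap_at i s) \<le> Suc (inversions s)"
    "inversions (swap_at i s) = Suc (inversions s) \<Longrightarrow> \<exists>s1 s2. s = s1 @ True # False # s2 \<and> i = Suc (length s1)"
    using inversions_append_TF[of s1 s2] by (cases x; cases y; auto simp: s)+
qed

text \<open>At a neighbouring \<open>True False\<close> the next letter of the second block is about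
  to follow the next of the first; exchanging the two marks makes it cross, which is one braid move.
  The hypotheses on counts keep \<open>merge\<close> from running out of letters.\<close>

lemma braid_act_merge:
  assumes "count_list (s1 @ True # False # s2) True = length as" "count_list (s1 @ True # False # s2) False = length bs"
  shows "braid_act (Suc (length s1)) (merge (s1 @ True # False # s2) as bs) = merge (s1 @ False # True # s2) as bs"
proof -
  have "\<exists>l x y r. length l = length s1 \<and> merge (s1 @ True # False # s2) as bs = l @ x # y # r
      \<and> merge (s1 @ False # True # s2) as bs = l @ y # conjg y x # r"
    using assms
  proof (induct s1 as bs rule: merge.induct)
    case (1 s a as bs)
    then obtain l x y r where *: "length l = length s" "merge (s @ True # False # s2) as bs = l @ x # y # r"
      "merge (s @ False # True # s2) as bs = l @ y # conjg y x # r" by auto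
    then show ?case by (intro exI[of _ "a # l"] exI) simp
  next
    case (2 s as b bs)
    then obtain l x y r where *: "length l = length s" "merge (s @ True # False # s2) (map (conjg b) as) bs = l @ x # y # r"
      "merge (s @ False # True # s2) (map (conjg b) as) bs = l @ y # conjg y x # r" by auto
    then show ?case by (intro exI[of _ "b # l"] exI) simp
  next
    case ("3_1" as bs)
    then obtain a as' b bs' where "as = a # as'" "bs = b # bs'" by (cases as; cases bs) auto
    then show ?case by simp
  qed auto
  then show ?thesis by (metis braid_act_append)
qed

lemma count_list_swap_at:
  assumes "1 \<le> i" "i < length s"
  shows "count_list (swap_at i s) x = count_list s x"
proof -
  obtain s1 u v s2 where "s = s1 @ u # v # s2" "i = Suc (length s1)" using two_positions[OF assms] .
  then show ?thesis by simp
qed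

lemma length_foldr_swap_at [simp]: "length (foldr swap_at is s) = length s"
  by (induct "is") auto

lemma count_list_foldr:
  "set is \<subseteq> {1..<length s} \<Longrightarrow> count_list (foldr swap_at is s) x = count_list s x"
  by (induct "is") (auto simp: count_list_swap_at)

lemma merge_initial:
  "merge (replicate (length as) True @ replicate (length bs) False) as bs = as @ bs"
proof (induct as)
  case Nil
  show ?case by (induct bs) auto
qed auto

lemma inversions_initial [simp]: "inversions (replicate p True @ replicate q False) = 0"
proof (induct p)
  case 0
  have "count_list (replicate q False) True = 0" for q by (induct q) auto
  then show ?case by (induct q) auto
qed auto

lemma inversions_foldr:
  assumes "set is \<subseteq> {1..<p + q}"
  shows "inversions (foldr swap_at is (replicate p True @ replicate q False)) \<le> length is"
  using assms
proof (induct "is")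
  case (Cons i "is")
  then show ?case
    using inversions_swap_at(1)[of i "foldr swap_at is (replicate p True @ replicate q False)"] by auto
qed auto

text \<open>Each swap adds at most one inversion, so a word as long as the inversions it produces
  consists of swaps that create one. Each of these is a braid move by
  \<open>braid_act_merge\<close>.\<close>

lemma foldr_braid_act:
  assumes "set is \<subseteq> {1..<length as + length bs}"
    and "length is = inversions (foldr swap_at is (replicate (length as) True @ replicate (length bs) False))"
  shows "foldr braid_act is (as @ bs)
    = merge (foldr swap_at is (replicate (length as) True @ replicate (length bs) False)) as bs"
  using assms
proof (induct "is")
  case Nil
  show ?case by (simp add: merge_initial)
next
  case (Cons i "is")
  let ?init = "replicate (length as) True @ replicate (length bs) False"
  let ?s = "foldr swap_at is ?init"
  have i: "1 \<le> i" "i < length ?s" using Cons(2) by auto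
  have "inversions ?s \<le> length is" using Cons(2) by (intro inversions_foldr) auto
  with inversions_swap_at(1)[OF i] Cons(3)
  have eq: "inversions ?s = length is" "inversions (swap_at i ?s) = Suc (inversions ?s)" by auto
  obtain s1 s2 where s: "?s = s1 @ True # False # s2" "i = Suc (length s1)"
    using inversions_swap_at(2)[OF i eq(2)] by auto
  have c: "count_list ?s x = count_list ?init x" for x using Cons(2) by (simp add: count_list_foldr)
  have r: "count_list (replicate k x) y = (if x = y then k else 0)" for k and x y :: bool by (induct k) auto
  have "count_list ?s True = length as" "count_list ?s False = length bs"
    using c[of True] c[of False] by (simp_all add: r)
  then have "braid_act i (merge ?s as bs) = merge (swap_at i ?s) as bs"
    unfolding s using braid_act_merge[of s1 s2 as bs] by simp
  then show ?case using Cons eq(1) by simp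
qed

definition shuffle_words :: "nat \<Rightarrow> nat \<Rightarrow> bool list set"
  where "shuffle_words p q = {s. count_list s True = p \<and> count_list s False = q}"

lemma length_bool_list: "length s = count_list s True + count_list s False"
  by (induct s) auto

lemma finite_shuffle_words: "finite (shuffle_words p q)"
  by (rule finite_subset[OF _ finite_lists_length_eq[of UNIV "p + q"]])
    (auto simp: shuffle_words_def length_bool_list)

lemma shuffle_words_0: "shuffle_words 0 q = {replicate q False}" "shuffle_words p 0 = {replicate p True}"
proof -
  have r: "count_list (replicate k x) y = (if x = y then k else 0)" for k and x y :: bool by (induct k) auto
  have 1: "count_list s True = 0 \<Longrightarrow> s = replicate (count_list s False) False" for s
    by (induct s) (auto split: if_splits)
  have 2: "count_list s False = 0 \<Longrightarrow> s = replicate (count_list s True) True" for s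
    by (induct s) (auto split: if_splits)
  show "shuffle_words 0 q = {replicate q False}" "shuffle_words p 0 = {replicate p True}"
    using 1 2 by (auto simp: shuffle_words_def r)
qed

lemma shuffle_words_Suc:
  "shuffle_words (Suc p) (Suc q) = (#) True ` shuffle_words p (Suc q) \<union> (#) False ` shuffle_words (Suc p) q"
proof -
  have "s \<in> (#) True ` shuffle_words p (Suc q) \<union> (#) False ` shuffle_words (Suc p) q" if "s \<in> shuffle_words (Suc p) (Suc q)" for s
  proof (cases s)
    case (Cons x t)
    then show ?thesis using that by (cases x) (auto simp: shuffle_words_def)
  qed (use that in \<open>auto simp: shuffle_words_def\<close>)
  then show ?thesis by (auto simp: shuffle_words_def)
qed

text \<open>Splitting the words by their first letter gives the recursion of \<open>Sh\<close>; a
  leading \<open>False\<close> contributes one inversion for each \<open>True\<close> behind it,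
  which is the sign of the crossing.\<close>

lemma sum_shuffle_words:
  "(\<Sum>s\<in>shuffle_words (length as) (length bs). sg (inversions s) (f (merge s as bs))) = Sh f as bs"
proof (induct f as bs rule: Sh.induct)
  case (1 f bs)
  show ?case
    using merge_initial[of "[]" bs] inversions_initial[of 0] by (simp add: shuffle_words_0)
next
  case (2 f a as)
  show ?case
    using merge_initial[of "a # as" "[]"] inversions_initial[of "Suc (length as)" 0] by (simp add: shuffle_words_0)
next
  case (3 f a as b bs)
  have "(\<Sum>s\<in>shuffle_words (length (a # as)) (length (b # bs)). sg (inversions s) (f (merge s (a # as) (b # bs))))
    = (\<Sum>s\<in>shuffle_words (length as) (length (b # bs)). sg (inversions s) (f (a # merge s as (b # bs))))
      + (\<Sum>s\<in>shuffle_words (length (a # as)) (length bs). sg (length (a # as) + inversions s) (f (b # merge s (map (conjg b) (a # as)) bs)))"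
    unfolding list.size shuffle_words_Suc add_Suc_right add_0_right
    by (subst sum.union_disjoint) (auto simp: finite_shuffle_words sum.reindex intro!: arg_cong2[where f = "(+)"] sum.cong, simp add: shuffle_words_def)
  also have "(\<Sum>s\<in>shuffle_words (length (a # as)) (length bs). sg (length (a # as) + inversions s) (f (b # merge s (map (conjg b) (a # as)) bs)))
    = sg (length (a # as)) (\<Sum>s\<in>shuffle_words (length (a # as)) (length bs). sg (inversions s) (f (b # merge s (map (conjg b) (a # as)) bs)))"
    by (simp add: additive.sum[OF additive.intro[of "sg k" for k, OF sg_add]] sg_sg)
  finally show ?case using 3 by simp
qed

lemma inversions_0: "inversions s = 0 \<Longrightarrow> s = replicate (count_list s True) True @ replicate (count_list s False) False"
proof (induct s rule: inversions.induct)
  case (3 s)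
  then have "count_list s True = 0" "s = replicate (count_list s True) True @ replicate (count_list s False) False" by auto
  moreover have "False # t = replicate a True @ replicate (Suc c) False" if "a = 0" "t = replicate a True @ replicate c False" for a c t
    using that by simp
  ultimately show ?case by simp
qed auto

lemma inversions_pos:
  "inversions s > 0 \<Longrightarrow> \<exists>s1 s2. s = s1 @ False # True # s2"
proof (induct s rule: inversions.induct)
  case (2 s)
  then obtain s1 s2 where "s = s1 @ False # True # s2" by auto
  then have "True # s = (True # s1) @ False # True # s2" by simp
  then show ?case by blast
next
  case (3 s)
  show ?case
  proof (cases s)
    case Nil
    then show ?thesis using 3 by simp
  next
    case (Cons x t)
    show ?thesis
    proof (cases x)
      case True
      then have "False # s = [] @ False # True # t" by (simp add: Cons)
      then show ?thesis by blast
    next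
      case False
      then have "inversions s > 0" using 3 Cons by auto
      then obtain s1 s2 where "s = s1 @ False # True # s2" using 3 by auto
      then have "False # s = (False # s1) @ False # True # s2" by simp
      then show ?thesis by blast
    qed
  qed
qed auto

text \<open>Index \<open>k\<close> tells whether position \<open>Suc k\<close> of the result is
  filled from the first block, which is a question about the inverse of \<open>w\<close>.\<close>

definition perm_word :: "nat \<Rightarrow> nat \<Rightarrow> (nat \<Rightarrow> nat) \<Rightarrow> bool list"
  where "perm_word p n w = map (\<lambda>k. inv_into UNIV w (Suc k) \<le> p) [0..<n]"

text \<open>Composing with a transposition on the left permutes the values of \<open>w\<close>, that
  is, the positions of the word.\<close>

lemma perm_word_transpose:
  assumes "bij w" "1 \<le> i" "i < n"
  shows "perm_word p n (transpose i (Suc i) \<circ> w) = swap_at i (perm_word p n w)"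
proof (rule nth_equalityI)
  fix k assume "k < length (perm_word p n (transpose i (Suc i) \<circ> w))"
  then have k: "k < n" by (simp add: perm_word_def)
  have "inv_into UNIV (transpose i (Suc i) \<circ> w) = inv_into UNIV w \<circ> transpose i (Suc i)"
    using assms(1) by (simp add: o_inv_distrib)
  then show "perm_word p n (transpose i (Suc i) \<circ> w) ! k = swap_at i (perm_word p n w) ! k"
    using k assms(2,3) by (auto simp: perm_word_def swap_at_def nth_list_update transpose_def)
qed (simp add: perm_word_def)

context cocommutative_hopf_algebra
begin

lemma word_perm_simps [simp]:
  "word_perm [] = id" "word_perm (i # is) = transpose i (Suc i) \<circ> word_perm is"
  by (simp_all add: word_perm_def)

lemma word_perm:
  "bij (word_perm is)" "sign (word_perm is) = (-1) ^ length is" "permutation (word_perm is)"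
proof -
  have "bij (word_perm is) \<and> sign (word_perm is) = (-1) ^ length is \<and> permutation (word_perm is)"
  proof (induct "is")
    case Nil
    show ?case unfolding word_perm_simps by (simp only: sign_id permutation_id bij_id) simp
  next
    case (Cons i "is")
    note t = permutation_swap_id[of i "Suc i"]
    have "sign (transpose i (Suc i) \<circ> word_perm is) = - ((-1) ^ length is)"
      using sign_compose[OF t, of "word_perm is"] Cons by (simp only: sign_swap_id) simp
    moreover have "bij (transpose i (Suc i) \<circ> word_perm is)"
      using Cons by (intro bij_comp) simp_all
    moreover have "permutation (transpose i (Suc i) \<circ> word_perm is)"
      using Cons t by (intro permutation_compose) auto
    ultimately show ?case unfolding word_perm_simps by (simp only: list.size power_Suc) simp
  qed
  then show "bij (word_perm is)" "sign (word_perm is) = (-1) ^ length is" "permutation (word_perm is)" by auto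
qed

lemma perm_word_word_perm:
  assumes "set is \<subseteq> {1..<p + q}"
  shows "perm_word p (p + q) (word_perm is) = foldr swap_at is (replicate p True @ replicate q False)"
  using assms
proof (induct "is")
  case Nil
  show ?case by (rule nth_equalityI) (auto simp: perm_word_def nth_append)
next
  case (Cons i "is")
  have "perm_word p (p + q) (word_perm (i # is)) = perm_word p (p + q) (transpose i (Suc i) \<circ> word_perm is)"
    by (rule arg_cong[OF word_perm_simps(2)])
  also have "\<dots> = swap_at i (perm_word p (p + q) (word_perm is))"
    using Cons by (intro perm_word_transpose word_perm) auto
  also have "perm_word p (p + q) (word_perm is) = foldr swap_at is (replicate p True @ replicate q False)"
    using Cons by auto
  finally show ?case by simp
qed

text \<open>Undoing one \<open>False True\<close> lowers the inversions by one. The transposition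
  that restores it keeps both blocks increasing, since the exchanged values come from different
  blocks. The resulting list of transpositions has one entry for each inversion.\<close>

lemma perm_word_surj:
  assumes "s \<in> shuffle_words p q"
  shows "\<exists>is. set is \<subseteq> {1..<p + q} \<and> length is = inversions s \<and> word_perm is \<in> shuffle_perms p (p + q)
     \<and> perm_word p (p + q) (word_perm is) = s"
  using assms
proof (induct "inversions s" arbitrary: s)
  case 0
  then have "s = replicate p True @ replicate q False"
    using inversions_0[of s] by (simp add: shuffle_words_def)
  then show ?case
  proof (intro exI[of _ "[]"] conjI)
    show "word_perm [] \<in> shuffle_perms p (p + q)"
      unfolding word_perm_simps shuffle_perms_def using permutes_id by (simp add: strict_mono_on_def)
    show "perm_word p (p + q) (word_perm []) = s"
      using perm_word_word_perm[of "[]" p q] \<open>s = _\<close> by simp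
  qed (use inversions_initial[of p q] \<open>s = _\<close> in simp_all)
next
  case (Suc k)
  then obtain s1 s2 where s: "s = s1 @ False # True # s2" using inversions_pos[of s] by auto
  let ?t = "s1 @ True # False # s2" and ?i = "Suc (length s1)"
  have "?t \<in> shuffle_words p q" "k = inversions ?t"
    using Suc(2,3) by (simp_all add: s shuffle_words_def inversions_append_TF)
  from Suc(1)[OF this(2,1)] obtain "is" where js: "set is \<subseteq> {1..<p + q}" "length is = inversions ?t"
    "word_perm is \<in> shuffle_perms p (p + q)" "perm_word p (p + q) (word_perm is) = ?t" by blast
  let ?w = "word_perm is"
  have n: "p + q = length s" using Suc(3) by (simp add: shuffle_words_def length_bool_list)
  then have i: "1 \<le> ?i" "?i < p + q" by (simp_all add: s)
  have inv: "inv_into UNIV ?w ?i \<le> p" "\<not> inv_into UNIV ?w (Suc ?i) \<le> p"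
  proof -
    have "perm_word p (p + q) ?w ! length s1" "\<not> perm_word p (p + q) ?w ! Suc (length s1)"
      unfolding js(4) by (simp_all add: nth_append)
    then show "inv_into UNIV ?w ?i \<le> p" "\<not> inv_into UNIV ?w (Suc ?i) \<le> p" using i by (simp_all add: perm_word_def)
  qed
  have iw: "inv_into UNIV ?w (?w x) = x" for x using word_perm(1)[of "is"] by (simp add: bij_is_inj)
  have "transpose ?i (Suc ?i) \<circ> ?w \<in> shuffle_perms p (p + q)"
  proof -
    have sm: "transpose ?i (Suc ?i) (?w x) < transpose ?i (Suc ?i) (?w y)"
      if "?w x < ?w y" "x \<le> p \<longleftrightarrow> y \<le> p" for x y
    proof -
      \<comment> \<open>An increasing pair is destroyed only if it takes exactly the two exchanged
        values; by \<open>inv\<close> these come from different blocks.\<close>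
      have "\<not> (?w x = ?i \<and> ?w y = Suc ?i)" using inv iw[of x] iw[of y] that(2) by auto
      then show ?thesis using that(1) by (auto simp: transpose_def)
    qed
    show ?thesis
      using js(3) i sm unfolding shuffle_perms_def strict_mono_on_def
      by (auto intro!: permutes_compose permutes_swap_id)
  qed
  moreover have "perm_word p (p + q) (transpose ?i (Suc ?i) \<circ> ?w) = s"
    using perm_word_transpose[OF word_perm(1) i, of p "is"] js(4) by (simp add: s)
  ultimately show ?case
    using js i Suc(2) by (intro exI[of _ "?i # is"]) (auto simp: s inversions_append_TF)
qed

text \<open>A shuffle is increasing on each block, so it is determined by the images of the blocks,
  and these are what the word records.\<close>

lemma perm_word_inj: "inj_on (perm_word p n) (shuffle_perms p n)"
proof (rule inj_onI)
  fix w w' assume w: "w \<in> shuffle_perms p n" and w': "w' \<in> shuffle_perms p n" and eq: "perm_word p n w = perm_word p n w'"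
  have eq': "inv_into UNIV w k \<le> p \<longleftrightarrow> inv_into UNIV w' k \<le> p" if "k \<in> {1..n}" for k
  proof -
    from that obtain j where "k = Suc j" "j < n" by (cases k) auto
    then show ?thesis using arg_cong[OF eq, of "\<lambda>s. s ! j"] by (simp add: perm_word_def)
  qed
  \<comment> \<open>\<open>min p n\<close> appears because \<open>p\<close> is not assumed to be at
    most \<open>n\<close>.\<close>
  have img: "v ` {1..min p n} = {k \<in> {1..n}. inv_into UNIV v k \<le> p}" "v ` {Suc p..n} = {k \<in> {1..n}. \<not> inv_into UNIV v k \<le> p}"
    if v: "v \<in> shuffle_perms p n" for v
  proof -
    have p: "v permutes {1..n}" using v by (simp add: shuffle_perms_def)
    have i: "inv_into UNIV v (v x) = x" "v (inv_into UNIV v x) = x" for x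
      using permutes_inverses[OF p] by auto
    have m: "v x \<in> {1..n} \<longleftrightarrow> x \<in> {1..n}" "inv_into UNIV v x \<in> {1..n} \<longleftrightarrow> x \<in> {1..n}" for x
      using permutes_in_image[OF p] permutes_in_image[OF permutes_inv[OF p]] by auto
    show "v ` {1..min p n} = {k \<in> {1..n}. inv_into UNIV v k \<le> p}"
    proof (intro equalityI subsetI)
      fix k assume "k \<in> {k \<in> {1..n}. inv_into UNIV v k \<le> p}"
      then have "inv_into UNIV v k \<in> {1..min p n}" using m(2)[of k] by auto
      then show "k \<in> v ` {1..min p n}" using i(2)[of k] by (metis imageI)
    next
      fix k assume "k \<in> v ` {1..min p n}"
      then obtain x where "x \<in> {1..min p n}" "k = v x" by blast
      then show "k \<in> {k \<in> {1..n}. inv_into UNIV v k \<le> p}" using m(1)[of x] i(1)[of x] by auto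
    qed
    show "v ` {Suc p..n} = {k \<in> {1..n}. \<not> inv_into UNIV v k \<le> p}"
    proof (intro equalityI subsetI)
      fix k assume "k \<in> {k \<in> {1..n}. \<not> inv_into UNIV v k \<le> p}"
      then have "inv_into UNIV v k \<in> {Suc p..n}" using m(2)[of k] by auto
      then show "k \<in> v ` {Suc p..n}" using i(2)[of k] by (metis imageI)
    next
      fix k assume "k \<in> v ` {Suc p..n}"
      then obtain x where "x \<in> {Suc p..n}" "k = v x" by blast
      then show "k \<in> {k \<in> {1..n}. \<not> inv_into UNIV v k \<le> p}" using m(1)[of x] i(1)[of x] by auto
    qed
  qed
  have eqon: "\<forall>x\<in>{a..b}. w x = w' x"
    if "strict_mono_on {a..b} w" "strict_mono_on {a..b} w'" "w ` {a..b} = w' ` {a..b}" for a b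
  proof -
    have s: "sorted (map v [a..<Suc b])" "distinct (map v [a..<Suc b])" if "strict_mono_on {a..b} v" for v :: "nat \<Rightarrow> nat"
    proof -
      show "distinct (map v [a..<Suc b])"
        using strict_mono_on_imp_inj_on[OF that]
        by (simp add: distinct_map atLeastLessThanSuc_atLeastAtMost del: upt_Suc)
      have "v (a + i) \<le> v (a + j)" if "i \<le> j" "a + j \<le> b" for i j
        using \<open>strict_mono_on {a..b} v\<close> that unfolding strict_mono_on_def by (cases "i = j") (auto intro!: less_imp_le)
      then show "sorted (map v [a..<Suc b])"
        by (auto simp: sorted_iff_nth_mono simp del: upt_Suc)
    qed
    \<comment> \<open>Both value lists are sorted and distinct with the same set of entries, hence
      equal.\<close>
    have "map w [a..<Suc b] = map w' [a..<Suc b]"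
      using that(3) by (intro sorted_distinct_set_unique s that) (simp add: atLeastLessThanSuc_atLeastAtMost del: upt_Suc)
    then show ?thesis by (auto simp: atLeastLessThanSuc_atLeastAtMost simp del: upt_Suc)
  qed
  have "w ` {1..min p n} = w' ` {1..min p n}" "w ` {Suc p..n} = w' ` {Suc p..n}"
    unfolding img[OF w] img[OF w'] using eq' by auto
  moreover have "strict_mono_on {1..min p n} w" "strict_mono_on {1..min p n} w'"
     "strict_mono_on {Suc p..n} w" "strict_mono_on {Suc p..n} w'"
    using w w' by (auto simp: shuffle_perms_def strict_mono_on_def)
  ultimately have "\<forall>x\<in>{1..min p n}. w x = w' x" "\<forall>x\<in>{Suc p..n}. w x = w' x"
    using eqon by blast+
  moreover have "w x = w' x" if "x \<notin> {1..n}" for x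
  proof -
    have "w permutes {1..n}" "w' permutes {1..n}" using w w' by (simp_all add: shuffle_perms_def)
    then show ?thesis using that by (metis permutes_not_in)
  qed
  ultimately have "w x = w' x" for x
    by (cases "x \<in> {1..n}"; cases "x \<le> p") auto
  then show "w = w'" by (rule ext)
qed

text \<open>The reduced word is an arbitrary choice, but its length is forced: no word for
  \<open>w\<close> is shorter than the number of inversions, and \<open>perm_word_surj\<close>
  provides one of this length.\<close>

lemma reduced_shuffle:
  assumes w: "w \<in> shuffle_perms p (p + q)"
  defines "js \<equiv> SOME is. reduced_decomposition (p + q) w is"
  shows "set js \<subseteq> {1..<p + q}" "word_perm js = w"
    "perm_word p (p + q) w = foldr swap_at js (replicate p True @ replicate q False)"
    "length js = inversions (perm_word p (p + q) w)"
    "perm_word p (p + q) w \<in> shuffle_words p q"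
proof -
  let ?n = "p + q" and ?s = "perm_word p (p + q) w"
  have permw: "w permutes {1..?n}" using w by (simp add: shuffle_perms_def)
  have c: "?s \<in> shuffle_words p q"
  proof -
    have cl: "count_list (map f [0..<n]) x = card {k \<in> {0..<n}. f k = x}" for f n and x :: bool
    proof (induct n)
      case (Suc n)
      have "{k \<in> {0..<Suc n}. f k = x} = {k \<in> {0..<n}. f k = x} \<union> (if f n = x then {n} else {})" by (auto simp: less_Suc_eq)
      then show ?case using Suc by auto
    qed simp
    \<comment> \<open>The entries \<open>True\<close> mark the images of the first block, shifted by
      one because list indices start at 0.\<close>
    have "bij_betw (\<lambda>k. inv_into UNIV w (Suc k)) {k \<in> {0..<?n}. inv_into UNIV w (Suc k) \<le> p} {1..p}"
    proof (rule bij_betwI[of _ _ _ "\<lambda>k. w k - 1"])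
      have m: "inv_into UNIV w x \<in> {1..?n} \<longleftrightarrow> x \<in> {1..?n}" "w x \<in> {1..?n} \<longleftrightarrow> x \<in> {1..?n}" for x
        using permutes_in_image[OF permutes_inv[OF permw]] permutes_in_image[OF permw] by auto
      note i = permutes_inverses[OF permw]
      show "(\<lambda>k. inv_into UNIV w (Suc k)) \<in> {k \<in> {0..<?n}. inv_into UNIV w (Suc k) \<le> p} \<rightarrow> {1..p}"
      proof
        fix k assume "k \<in> {k \<in> {0..<?n}. inv_into UNIV w (Suc k) \<le> p}"
        then show "inv_into UNIV w (Suc k) \<in> {1..p}" using m(1)[of "Suc k"] by auto
      qed
      have S: "Suc (w y - 1) = w y" if "y \<in> {1..p}" for y using m(2)[of y] that by auto
      show "(\<lambda>k. w k - 1) \<in> {1..p} \<rightarrow> {k \<in> {0..<?n}. inv_into UNIV w (Suc k) \<le> p}"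
      proof
        fix y assume y: "y \<in> {1..p}"
        then show "w y - 1 \<in> {k \<in> {0..<?n}. inv_into UNIV w (Suc k) \<le> p}" using m(2)[of y] S[OF y] i by auto
      qed
      show "inv_into UNIV w (Suc (w y - 1)) = y" if "y \<in> {1..p}" for y using S[OF that] i by simp
    qed (use permutes_inverses[OF permw] in auto)
    then have "count_list ?s True = p" by (simp add: perm_word_def cl bij_betw_same_card)
    moreover have "length ?s = ?n" by (simp add: perm_word_def)
    ultimately show ?thesis by (simp add: shuffle_words_def length_bool_list)
  qed
  obtain "is" where i: "set is \<subseteq> {1..<?n}" "length is = inversions ?s" "word_perm is \<in> shuffle_perms p ?n"
    "perm_word p ?n (word_perm is) = ?s"
    using perm_word_surj[OF c] by blast
  have wi: "word_perm is = w" using perm_word_inj i(3,4) w by (auto dest: inj_onD)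
  have lb: "inversions ?s \<le> length ks" if "set ks \<subseteq> {1..<?n}" "word_perm ks = w" for ks
    using inversions_foldr[OF that(1)] perm_word_word_perm[OF that(1)] that(2) by simp
  have "reduced_decomposition ?n w is"
    unfolding reduced_decomposition_def using i(1) wi lb i(2) by auto
  then have R: "reduced_decomposition ?n w js" unfolding js_def by (rule someI)
  then show 1: "set js \<subseteq> {1..<?n}" "word_perm js = w" by (auto simp: reduced_decomposition_def)
  show "length js = inversions ?s"
    using R i wi lb[OF 1] unfolding reduced_decomposition_def by (metis le_antisym)
  show "?s = foldr swap_at js (replicate p True @ replicate q False)"
    using perm_word_word_perm[OF 1(1)] 1(2) by simp
  show "?s \<in> shuffle_words p q" by (rule c)
qed

lemma bij_betw_perm_word: "bij_betw (perm_word p (p + q)) (shuffle_perms p (p + q)) (shuffle_words p q)"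
  unfolding bij_betw_def
proof (intro conjI perm_word_inj equalityI subsetI)
  fix s assume "s \<in> shuffle_words p q"
  then show "s \<in> perm_word p (p + q) ` shuffle_perms p (p + q)" using perm_word_surj by blast
next
  fix s assume "s \<in> perm_word p (p + q) ` shuffle_perms p (p + q)"
  then show "s \<in> shuffle_words p q" using reduced_shuffle(5) by auto
qed

theorem sum_shuffle_perms:
  assumes "length as = p" "length bs = q"
  shows "(\<Sum>w\<in>shuffle_perms p (p + q). (if sign w = 1 then id else uminus)
      (f (foldr braid_act (SOME is. reduced_decomposition (p + q) w is) (as @ bs)))) = Sh f as bs"
proof -
  have "(if sign w = 1 then id else uminus) (f (foldr braid_act (SOME is. reduced_decomposition (p + q) w is) (as @ bs)))
    = sg (inversions (perm_word p (p + q) w)) (f (merge (perm_word p (p + q) w) as bs))"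
    if w: "w \<in> shuffle_perms p (p + q)" for w
  proof -
    note R = reduced_shuffle[OF w]
    have "sign w = (-1) ^ inversions (perm_word p (p + q) w)"
      using word_perm(2)[of "SOME is. reduced_decomposition (p + q) w is"] unfolding R(2,4) .
    then have "sign w = 1 \<longleftrightarrow> even (inversions (perm_word p (p + q) w))" by (simp add: minus_one_power_iff)
    moreover have "foldr braid_act (SOME is. reduced_decomposition (p + q) w is) (as @ bs) = merge (perm_word p (p + q) w) as bs"
      unfolding R(3) using assms R(1,3,4) by (intro foldr_braid_act[of _ as bs, unfolded assms]) auto
    ultimately show ?thesis by (simp add: sg_def)
  qed
  then have "(\<Sum>w\<in>shuffle_perms p (p + q). (if sign w = 1 then id else uminus)
      (f (foldr braid_act (SOME is. reduced_decomposition (p + q) w is) (as @ bs))))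
    = (\<Sum>w\<in>shuffle_perms p (p + q). (\<lambda>s. sg (inversions s) (f (merge s as bs))) (perm_word p (p + q) w))"
    by (intro sum.cong) auto
  also have "\<dots> = (\<Sum>s\<in>shuffle_words p q. sg (inversions s) (f (merge s as bs)))"
    by (rule sum.reindex_bij_betw[OF bij_betw_perm_word])
  also have "\<dots> = Sh f as bs" using sum_shuffle_words[where as = as and bs = bs and f = f] assms by simp
  finally show ?thesis .
qed

end

text \<open>
  The groups \<open>Reg(A\<^sup>\<otimes>\<^sup>n, M)\<close> have carriers depending on locale parameters, so they are not types.  A type of
  choice functions \<open>N \<mapsto> x\<^sub>N \<in> N\<close>, where \<open>N\<close> runs through all (commutative) groups on the given type,
  is a group type containing each of them, which allows to compute in type classes.
\<close>

typedef 'g group_family = "{\<phi> :: 'g monoid \<Rightarrow> 'g. \<forall>N. if group N then \<phi> N \<in> carrier N else \<phi> N = undefined}"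
  by (rule exI[of _ "\<lambda>N. if group N then \<one>\<^bsub>N\<^esub> else undefined"]) (auto intro: monoid.one_closed group.is_monoid)

typedef 'n abelian_family = "{\<phi> :: 'n monoid \<Rightarrow> 'n. \<forall>N. if comm_group N then \<phi> N \<in> carrier N else \<phi> N = undefined}"
  by (rule exI[of _ "\<lambda>N. if comm_group N then \<one>\<^bsub>N\<^esub> else undefined"])
    (auto intro: monoid.one_closed group.is_monoid simp: comm_group_def)

setup_lifting type_definition_group_family
setup_lifting type_definition_abelian_family

instantiation group_family :: (type) group_add
begin

lift_definition zero_group_family :: "'a group_family" is "\<lambda>N. if group N then \<one>\<^bsub>N\<^esub> else undefined"
  by (auto intro: monoid.one_closed group.is_monoid)

lift_definition plus_group_family :: "'a group_family \<Rightarrow> 'a group_family \<Rightarrow> 'a group_family"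
  is "\<lambda>\<phi> \<psi> N. if group N then \<phi> N \<otimes>\<^bsub>N\<^esub> \<psi> N else undefined"
  by (auto intro: monoid.m_closed group.is_monoid split: if_splits)

lift_definition uminus_group_family :: "'a group_family \<Rightarrow> 'a group_family"
  is "\<lambda>\<phi> N. if group N then inv\<^bsub>N\<^esub> \<phi> N else undefined"
  by (auto intro: group.inv_closed split: if_splits)

definition minus_group_family :: "'a group_family \<Rightarrow> 'a group_family \<Rightarrow> 'a group_family"
  where "minus_group_family x y = x + - y"

instance
proof
  fix x y z :: "'a group_family"
  show "x + y + z = x + (y + z)"
    by transfer (auto simp: fun_eq_iff monoid.m_assoc group.is_monoid)
  show "0 + x = x" "x + 0 = x"
    by (transfer, auto simp: fun_eq_iff monoid.l_one monoid.r_one group.is_monoid)+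
  show "- x + x = 0"
    by transfer (auto simp: fun_eq_iff group.l_inv)
  show "x + - y = x - y" by (simp add: minus_group_family_def)
qed

end

instantiation abelian_family :: (type) ab_group_add
begin

lift_definition zero_abelian_family :: "'a abelian_family" is "\<lambda>N. if comm_group N then \<one>\<^bsub>N\<^esub> else undefined"
  by (auto intro: monoid.one_closed group.is_monoid simp: comm_group_def)

lift_definition plus_abelian_family :: "'a abelian_family \<Rightarrow> 'a abelian_family \<Rightarrow> 'a abelian_family"
  is "\<lambda>\<phi> \<psi> N. if comm_group N then \<phi> N \<otimes>\<^bsub>N\<^esub> \<psi> N else undefined"
  by (auto intro!: monoid.m_closed group.is_monoid comm_group.axioms split: if_splits)

lift_definition uminus_abelian_family :: "'a abelian_family \<Rightarrow> 'a abelian_family"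
  is "\<lambda>\<phi> N. if comm_group N then inv\<^bsub>N\<^esub> \<phi> N else undefined"
  by (auto intro: group.inv_closed comm_group.axioms split: if_splits)

definition minus_abelian_family :: "'a abelian_family \<Rightarrow> 'a abelian_family \<Rightarrow> 'a abelian_family"
  where "minus_abelian_family x y = x + - y"

instance
proof
  fix x y z :: "'a abelian_family"
  show "x + y + z = x + (y + z)"
    by transfer (auto simp: fun_eq_iff monoid.m_assoc group.is_monoid comm_group.axioms)
  show "0 + x = x"
    by transfer (auto simp: fun_eq_iff monoid.l_one group.is_monoid comm_group.axioms)
  show "- x + x = 0"
    by transfer (auto simp: fun_eq_iff group.l_inv comm_group.axioms)
  show "x + y = y + x"
    by transfer (auto simp: fun_eq_iff comm_monoid.m_comm comm_group.axioms)
  show "x - y = x + - y" by (simp add: minus_abelian_family_def)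
qed

end

lift_definition component :: "'g monoid \<Rightarrow> 'g group_family \<Rightarrow> 'g" is "\<lambda>N \<phi>. \<phi> N" .

lemma component:
  assumes "group N"
  shows "component N \<gamma> \<in> carrier N" "component N (\<gamma> + \<gamma>') = component N \<gamma> \<otimes>\<^bsub>N\<^esub> component N \<gamma>'"
    "component N 0 = \<one>\<^bsub>N\<^esub>" "component N (- \<gamma>) = inv\<^bsub>N\<^esub> (component N \<gamma>)"
  using assms by (transfer, auto split: if_splits)+

text \<open>The coordinates can thus be reached by elements of a type, to which the results on
  groups apply.\<close>

lemma component_surj:
  assumes "group N" "g \<in> carrier N"
  shows "\<exists>\<gamma>. component N \<gamma> = g"
proof -
  have "(\<lambda>N'. if N' = N then g else if group N' then \<one>\<^bsub>N'\<^esub> else undefined)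
    \<in> {\<phi>. \<forall>N. if group N then \<phi> N \<in> carrier N else \<phi> N = undefined}"
    using assms by (auto intro: monoid.one_closed group.is_monoid)
  then show ?thesis
    by (intro exI[of _ "Abs_group_family (\<lambda>N'. if N' = N then g else if group N' then \<one>\<^bsub>N'\<^esub> else undefined)"])
      (simp add: component.rep_eq Abs_group_family_inverse)
qed

definition embed :: "'n monoid \<Rightarrow> 'n \<Rightarrow> 'n abelian_family"
  where "embed N x = Abs_abelian_family (\<lambda>N'. if N' = N then x else if comm_group N' then \<one>\<^bsub>N'\<^esub> else undefined)"

text \<open>Extends an endomorphism of \<open>N\<close> by the identity in all other coordinates, so
  that an action on one \<open>Reg\<close> becomes an action on a whole type.\<close>

definition modify :: "'n monoid \<Rightarrow> ('n \<Rightarrow> 'n) \<Rightarrow> 'n abelian_family \<Rightarrow> 'n abelian_family"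
  where "modify N h x = Abs_abelian_family ((Rep_abelian_family x)(N := h (Rep_abelian_family x N)))"

lemma Rep_embed:
  "comm_group N \<Longrightarrow> x \<in> carrier N \<Longrightarrow>
    Rep_abelian_family (embed N x) = (\<lambda>N'. if N' = N then x else if comm_group N' then \<one>\<^bsub>N'\<^esub> else undefined)"
  unfolding embed_def
  by (rule Abs_abelian_family_inverse) (auto intro: monoid.one_closed group.is_monoid comm_group.axioms)

lemma Rep_carrier: "comm_group N \<Longrightarrow> Rep_abelian_family x N \<in> carrier N"
  using Rep_abelian_family[of x] by (auto split: if_splits)

lemma Rep_modify:
  "comm_group N \<Longrightarrow> h \<in> hom N N \<Longrightarrow>
    Rep_abelian_family (modify N h x) = (Rep_abelian_family x)(N := h (Rep_abelian_family x N))"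
  unfolding modify_def
  using Rep_abelian_family[of x] hom_in_carrier[of h N N] by (intro Abs_abelian_family_inverse) (auto split: if_splits)

lemma embed_mult:
  assumes N: "comm_group N" and "x \<in> carrier N" "y \<in> carrier N"
  shows "embed N (x \<otimes>\<^bsub>N\<^esub> y) = embed N x + embed N y"
proof -
  interpret comm_group N by fact
  show ?thesis
    using assms by (auto simp: Rep_embed plus_abelian_family.rep_eq fun_eq_iff Rep_abelian_family_inject[symmetric]
       intro!: monoid.l_one[symmetric] comm_group.axioms group.is_monoid monoid.one_closed)
qed

lemma embed_inv:
  assumes N: "comm_group N" and "x \<in> carrier N"
  shows "embed N (inv\<^bsub>N\<^esub> x) = - embed N x"
proof -
  interpret comm_group N by fact
  show ?thesis
    using assms by (auto simp: Rep_embed uminus_abelian_family.rep_eq fun_eq_iff Rep_abelian_family_inject[symmetric]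
       intro!: group.is_monoid comm_group.axioms monoid.inv_one[symmetric])
qed

lemma embed_one: "comm_group N \<Longrightarrow> embed N \<one>\<^bsub>N\<^esub> = 0"
  by (auto simp: Rep_embed zero_abelian_family.rep_eq fun_eq_iff Rep_abelian_family_inject[symmetric]
      monoid.one_closed group.is_monoid comm_group.axioms)

lemma embed_inj: "comm_group N \<Longrightarrow> x \<in> carrier N \<Longrightarrow> y \<in> carrier N \<Longrightarrow> embed N x = embed N y \<Longrightarrow> x = y"
  using Rep_embed[of N x] Rep_embed[of N y] by (metis (full_types))

lemma modify_add:
  assumes N: "comm_group N" and h: "h \<in> hom N N"
  shows "modify N h (x + y) = modify N h x + modify N h y"
  using assms hom_mult[OF h Rep_carrier[OF N, of x] Rep_carrier[OF N, of y]]
  by (auto simp: Rep_modify plus_abelian_family.rep_eq fun_eq_iff Rep_abelian_family_inject[symmetric])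

lemma modify_embed:
  assumes N: "comm_group N" and h: "h \<in> hom N N" and x: "x \<in> carrier N"
  shows "modify N h (embed N x) = embed N (h x)"
  using assms hom_in_carrier[OF h x]
  by (auto simp: Rep_modify Rep_embed fun_eq_iff Rep_abelian_family_inject[symmetric])

lemma modify_modify:
  assumes N: "comm_group N" and h: "h \<in> hom N N" "h' \<in> hom N N" "k \<in> hom N N"
    and "\<And>x. x \<in> carrier N \<Longrightarrow> h (h' x) = k x"
  shows "modify N h (modify N h' x) = modify N k x"
  using assms Rep_carrier[OF N, of x]
  by (auto simp: Rep_modify fun_eq_iff Rep_abelian_family_inject[symmetric])

abbreviation prod_apply :: "('x \<Rightarrow> 'm::monoid_mult) list \<Rightarrow> 'x list \<Rightarrow> 'm"
  where "prod_apply \<phi>s L \<equiv> prod_list (map2 (\<lambda>\<phi> l. \<phi> l) \<phi>s L)"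

context cocommutative_hopf_algebra
begin

subsection \<open>Sweedler sums as convolution products\<close>

lemma legwise_SucI:
  assumes "\<And>L. length L = k \<Longrightarrow> \<forall>l\<in>set L. length l = n \<Longrightarrow> multilinear scale s n (\<lambda>l. H (l # L))"
    and "\<And>l. length l = n \<Longrightarrow> legwise_multilinear s k n (\<lambda>L. H (l # L))"
  shows "legwise_multilinear s (Suc k) n H"
  unfolding legwise_multilinear_def
proof (intro allI impI)
  fix L :: "'a list list" and i assume L: "length L = Suc k" "\<forall>l\<in>set L. length l = n" "i < Suc k"
  then obtain l L' where l: "L = l # L'" by (cases L) auto
  show "multilinear scale s n (\<lambda>x. H (L[i := x]))"
  proof (cases i)
    case 0
    then show ?thesis using L assms(1)[of L'] by (simp add: l)
  next
    case (Suc j)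
    then show ?thesis using L assms(2)[of l] unfolding legwise_multilinear_def by (simp add: l)
  qed
qed

lemma legwise_0: "legwise_multilinear s 0 n H"
  by (simp add: legwise_multilinear_def)

lemma legwise_prod:
  fixes s :: "'k \<Rightarrow> 'm::{comm_ring,comm_monoid_mult} \<Rightarrow> 'm"
  assumes alg: "k_algebra s" and "\<forall>\<phi>\<in>set \<phi>s. multilinear scale s n \<phi>"
  shows "legwise_multilinear s (length \<phi>s) n (\<lambda>L. prod_apply \<phi>s L)"
proof -
  interpret W: k_algebra s by (rule alg)
  \<comment> \<open>The scalar factor \<open>c\<close> carries the values of the maps already
    applied to earlier legs.\<close>
  have "legwise_multilinear s (length \<phi>s) n (\<lambda>L. c * prod_apply \<phi>s L)" for c
    using assms(2)
  proof (induct \<phi>s arbitrary: c)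
    case Nil
    then show ?case by (simp add: legwise_0)
  next
    case (Cons \<phi> \<phi>s)
    show ?case unfolding list.size add_Suc_right add_0_right
    proof (rule legwise_SucI)
      fix L :: "'a list list"
      have "multilinear scale s n (\<lambda>l. c * (\<phi> l * prod_apply \<phi>s L))"
        using Cons(2) by (intro multilinear_comp[OF lin_comp[OF W.lin_mult_right W.lin_mult_left]]) auto
      then show "multilinear scale s n (\<lambda>l. c * prod_apply (\<phi> # \<phi>s) (l # L))" by simp
    next
      fix l :: "'a list"
      show "legwise_multilinear s (length \<phi>s) n (\<lambda>L. c * prod_apply (\<phi> # \<phi>s) (l # L))"
        using Cons(1)[of "c * \<phi> l"] Cons(2) by (simp add: mult.assoc)
    qed
  qed
  from this[of 1] show ?thesis by simp
qed

lemma foldr_conv_in: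
  fixes s :: "'k \<Rightarrow> 'm::{comm_ring,comm_monoid_mult} \<Rightarrow> 'm"
  assumes alg: "k_algebra s" and "set Fs \<subseteq> Hom n s"
  shows "foldr (\<otimes>\<^bsub>conv n s\<^esub>) Fs \<one>\<^bsub>conv n s\<^esub> \<in> Hom n s"
  using assms(2) by (induct Fs) (auto intro: conv_one_in[OF alg] conv_mult_in[OF alg])

text \<open>One leg for each factor: an iterated convolution product is a product over the legs of
  the iterated coproduct.\<close>

lemma MSL_conv:
  fixes s :: "'k \<Rightarrow> 'm::{comm_ring,comm_monoid_mult} \<Rightarrow> 'm"
  assumes alg: "k_algebra s" and "set Fs \<subseteq> Hom n s" "length as = n"
  shows "MSL s (length Fs) as (\<lambda>L. prod_list (map2 (\<lambda>F l. F (T l)) Fs L))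
    = foldr (\<otimes>\<^bsub>conv n s\<^esub>) Fs \<one>\<^bsub>conv n s\<^esub> (T as)"
  using assms(2,3)
proof (induct Fs arbitrary: as)
  case Nil
  then show ?case by (simp add: conv_one_tensor[OF alg])
next
  case (Cons F Fs)
  interpret W: k_algebra s by (rule alg)
  have "MSL s (length (F # Fs)) as (\<lambda>L. prod_list (map2 (\<lambda>F l. F (T l)) (F # Fs) L))
    = SWL as (\<lambda>x y. F (T x) * foldr (\<otimes>\<^bsub>conv n s\<^esub>) Fs \<one>\<^bsub>conv n s\<^esub> (T y))"
    using Cons by (auto simp: MSL_hom[OF W.lin_mult_left, symmetric] intro!: SWL_cong)
  then show ?case
    using Cons(2,3) foldr_conv_in[OF alg, of Fs n] by (simp add: conv_mult_tensor[OF alg])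
qed

lemma MSL_SWL_swap:
  assumes s: "vector_space s"
  shows "MSL s k y (\<lambda>L. SWL xs (\<lambda>u v. B u v L)) = SWL xs (\<lambda>u v. MSL s k y (B u v))"
  by (induct k arbitrary: y B) (simp_all add: SWL_scale[OF s] SWL_swap[of xs])

text \<open>The coproduct of a concatenation splits both lists simultaneously. The outer sum is over
  the second part of the list because \<open>\<Lambda>\<close> takes the second block first.\<close>

lemma MSL_MSL:
  assumes s: "vector_space s"
  shows "MSL s k as (\<lambda>L. MSL s k xs (H L)) = MSL s k (xs @ as) (\<lambda>M. H (map (drop (length xs)) M) (map (take (length xs)) M))"
proof (induct k arbitrary: as xs H)
  case 0
  then show ?case using s by (simp add: vector_space_def mult.commute)
next
  case (Suc k)
  have "MSL s (Suc k) as (\<lambda>L. MSL s (Suc k) xs (H L))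
     = SWL as (\<lambda>x y. SWL xs (\<lambda>u v. MSL s k y (\<lambda>L. MSL s k v (\<lambda>L'. H (x # L) (u # L')))))"
    by (simp add: MSL_SWL_swap[OF s])
  also have "\<dots> = SWL xs (\<lambda>u v. SWL as (\<lambda>x y. MSL s k (v @ y) (\<lambda>M. H (x # map (drop (length v)) M) (u # map (take (length v)) M))))"
    by (subst SWL_swap) (simp only: Suc)
  also have "\<dots> = SWL xs (\<lambda>u v. SWL as (\<lambda>x y. MSL s k (v @ y)
      (\<lambda>M. H (map (drop (length xs)) ((u @ x) # M)) (map (take (length xs)) ((u @ x) # M)))))"
    by (rule SWL_cong) simp
  finally show ?case by (simp add: SWL_append)
qed

text \<open>Coassociativity at the end of the iterated coproduct: the last two legs are the
  coproduct of one. The base case removes the counit that closes \<open>MSL\<close> and inserts it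
  again one leg earlier.\<close>

lemma MSL_merge_last:
  assumes s: "vector_space s" and "legwise_multilinear s (Suc (Suc k)) (length as) H"
  shows "MSL s (Suc (Suc k)) as H = MSL s (Suc k) as (\<lambda>L. SWL (last L) (\<lambda>u v. H (butlast L @ [u, v])))"
  using assms(2)
proof (induct k arbitrary: as H)
  case 0
  have H2: "multilinear scale s (length as) (\<lambda>v. H [u, v])" "multilinear scale s (length as) (\<lambda>v. H [v, u])"
    if "length u = length as" for u
    using legwise_hd[OF legwise_Cons[OF 0 that], of "[]"] legwise_hd[OF 0, of "[u]"] that by simp_all
  have "MSL s (Suc (Suc 0)) as H = SWL as (\<lambda>x y. SWL y (\<lambda>u v. s (prod_list (map counit v)) (H [x, u])))"
    by simp
  also have "\<dots> = SWL as (\<lambda>x y. H [x, y])"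
    by (rule SWL_cong, rule SWL_counit_right[OF _ s]) (simp add: H2)
  also have "\<dots> = SWL as (\<lambda>x y. s (prod_list (map counit y)) (SWL x (\<lambda>u v. H [u, v])))"
    by (rule SWL_counit_right[symmetric, OF multilinear_SWL[OF s] s]) (simp add: bimultilinear_def H2)
  finally show ?case by simp
next
  case (Suc k)
  have "MSL s (Suc (Suc k)) y (\<lambda>L. H (x # L)) = MSL s (Suc k) y (\<lambda>L. SWL (last (x # L)) (\<lambda>u v. H (butlast (x # L) @ [u, v])))"
    if "length x = length as" "length y = length as" for x y
  proof -
    have "MSL s (Suc (Suc k)) y (\<lambda>L. H (x # L)) = MSL s (Suc k) y (\<lambda>L. SWL (last L) (\<lambda>u v. H (x # butlast L @ [u, v])))"
      using legwise_Cons[OF Suc(2) that(1)] that by (intro Suc(1)) simp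
    also have "\<dots> = MSL s (Suc k) y (\<lambda>L. SWL (last (x # L)) (\<lambda>u v. H (butlast (x # L) @ [u, v])))"
      by (rule MSL_cong) auto
    finally show ?thesis .
  qed
  then show ?case unfolding MSL.simps(2)[of s "Suc (Suc k)"] MSL.simps(2)[of s "Suc k" as] by (rule SWL_cong)
qed

subsection \<open>Face maps\<close>

text \<open>The left face for the letter at index \<open>q\<close>: its first leg acts on the
  values, the remaining ones act by \<open>ad\<close> on the \<open>q\<close> letters before it. For
  \<open>q = 0\<close> this is the Hochschild face.\<close>

definition faceL :: "('k \<Rightarrow> 'm::ab_group_add \<Rightarrow> 'm) \<Rightarrow> ('a \<Rightarrow> 'm \<Rightarrow> 'm) \<Rightarrow> nat \<Rightarrow> nat \<Rightarrow> (('a, 'k) tens \<Rightarrow> 'm) \<Rightarrow> ('a, 'k) tens \<Rightarrow> 'm"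
  where "faceL s \<beta> q m f = lift scale s (Suc m) (\<lambda>l. SW (l ! q)
    (\<lambda>u v. \<beta> u (MS s q v (\<lambda>c. f (T (map2 ad c (take q l) @ drop (Suc q) l))))))"

text \<open>The right face for the letter at index \<open>q\<close>: it acts after conjugation by
  the product of the letters behind it, which are split for this purpose. For \<open>q = m\<close>
  nothing is behind it, and this is the Hochschild face.\<close>

definition faceR :: "('k \<Rightarrow> 'm::ab_group_add \<Rightarrow> 'm) \<Rightarrow> ('a \<Rightarrow> 'm \<Rightarrow> 'm) \<Rightarrow> nat \<Rightarrow> nat \<Rightarrow> (('a, 'k) tens \<Rightarrow> 'm) \<Rightarrow> ('a, 'k) tens \<Rightarrow> 'm"
  where "faceR s \<beta> q m f = lift scale s (Suc m) (\<lambda>l. SWL (drop (Suc q) l)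
    (\<lambda>us vs. \<beta> (ad (prod_list vs) (l ! q)) (f (T (take q l @ us)))))"

definition faceM :: "('k \<Rightarrow> 'm::ab_group_add \<Rightarrow> 'm) \<Rightarrow> nat \<Rightarrow> nat \<Rightarrow> (('a, 'k) tens \<Rightarrow> 'm) \<Rightarrow> ('a, 'k) tens \<Rightarrow> 'm"
  where "faceM s i m f = lift scale s (Suc m) (\<lambda>l. f (T (contract i l)))"

context
  fixes s :: "'k \<Rightarrow> 'm::{comm_ring,comm_monoid_mult} \<Rightarrow> 'm" and \<beta>
  assumes b: "measuring s \<beta>"
begin

interpretation W: vector_space s by (rule measuring_vs[OF b])

lemma alg: "k_algebra s"
  using b by (simp add: measuring_def)

lemma faceL:
  assumes f: "f \<in> Hom m s" and q: "q \<le> m"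
  shows "faceL s \<beta> q m f \<in> Hom (Suc m) s"
    "length l = Suc m \<Longrightarrow> faceL s \<beta> q m f (T l) = SW (l ! q)
      (\<lambda>u v. \<beta> u (MS s q v (\<lambda>c. f (T (map2 ad c (take q l) @ drop (Suc q) l)))))"
proof -
  have "multilinear scale s (Suc m) (\<lambda>l. SW (l ! q) (\<lambda>u v. \<beta> u (MS s q v (\<lambda>c. f (T (map2 ad c (take q l) @ drop (Suc q) l))))))"
    using multilinear_left(1)[OF b, of q "m - q" "\<lambda>l. f (T l)"] Hom_multilinear[OF W.vector_space_axioms f] q by simp
  from lift_in[OF vs W.vector_space_axioms this] lift_tensor[OF vs W.vector_space_axioms this]
  show "faceL s \<beta> q m f \<in> Hom (Suc m) s"
    "length l = Suc m \<Longrightarrow> faceL s \<beta> q m f (T l) = SW (l ! q)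
      (\<lambda>u v. \<beta> u (MS s q v (\<lambda>c. f (T (map2 ad c (take q l) @ drop (Suc q) l)))))"
    by (simp_all add: faceL_def)
qed

lemma faceR:
  assumes f: "f \<in> Hom m s" and q: "q \<le> m"
  shows "faceR s \<beta> q m f \<in> Hom (Suc m) s"
    "length l = Suc m \<Longrightarrow> faceR s \<beta> q m f (T l) = SWL (drop (Suc q) l)
      (\<lambda>us vs. \<beta> (ad (prod_list vs) (l ! q)) (f (T (take q l @ us))))"
proof -
  have "multilinear scale s (Suc m) (\<lambda>l. SWL (drop (Suc q) l) (\<lambda>us vs. \<beta> (ad (prod_list vs) (l ! q)) (f (T (take q l @ us)))))"
    using multilinear_right(1)[OF b, of q "m - q" "\<lambda>l. f (T l)"] Hom_multilinear[OF W.vector_space_axioms f] q by simp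
  from lift_in[OF vs W.vector_space_axioms this] lift_tensor[OF vs W.vector_space_axioms this]
  show "faceR s \<beta> q m f \<in> Hom (Suc m) s"
    "length l = Suc m \<Longrightarrow> faceR s \<beta> q m f (T l) = SWL (drop (Suc q) l)
      (\<lambda>us vs. \<beta> (ad (prod_list vs) (l ! q)) (f (T (take q l @ us))))"
    by (simp_all add: faceR_def)
qed

lemma faceM:
  assumes f: "f \<in> Hom m s" and i: "1 \<le> i" "i \<le> m"
  shows "faceM s i m f \<in> Hom (Suc m) s"
    "length l = Suc m \<Longrightarrow> faceM s i m f (T l) = f (T (contract i l))"
proof -
  have "multilinear scale s (Suc m) (\<lambda>l. f (T (contract i l)))"
    by (rule multilinear_contract[OF Hom_multilinear[OF W.vector_space_axioms f] i])
  from lift_in[OF vs W.vector_space_axioms this] lift_tensor[OF vs W.vector_space_axioms this]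
  show "faceM s i m f \<in> Hom (Suc m) s"
    "length l = Suc m \<Longrightarrow> faceM s i m f (T l) = f (T (contract i l))"
    by (simp_all add: faceM_def)
qed

lemma pull_faceL:
  assumes f: "f \<in> Hom (length hs + length gs) s" and gs: "\<forall>h\<in>set (hs @ g # gs). coalgebra_map n h"
  shows "pull s n (hs @ g # gs) (faceL s \<beta> (length hs) (length hs + length gs) f)
    = act n s \<beta> g (pull s n (map (conj_map n g) hs @ gs) f)"
proof -
  let ?m = "length hs + length gs" and ?hs = "map (conj_map n g) hs"
  note F = faceL[OF f, of "length hs", simplified]
  have F1: "faceL s \<beta> (length hs) ?m f \<in> Hom (length (hs @ g # gs)) s" using F(1) by simp
  have gs': "\<forall>h\<in>set (?hs @ gs). coalgebra_map n h" using gs by (auto intro: coalgebra_map_conj)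
  have f': "f \<in> Hom (length (?hs @ gs)) s" using f by simp
  have g: "coalgebra_map n g" using gs by simp
  note P = pull[OF W.vector_space_axioms F1 gs] and P' = pull[OF W.vector_space_axioms f' gs']
  show ?thesis
  proof (rule Hom_eqI[OF W.vector_space_axioms P(1) act_in[OF b coalgebra_map_Hom[OF g] P'(1)]])
    fix as :: "'a list" assume as: "length as = n"
    have "pull s n (hs @ g # gs) (faceL s \<beta> (length hs) ?m f) (T as)
      = PL s (hs @ g # gs) (\<lambda>l. SW (l ! length hs) (\<lambda>u v. \<beta> u (MS s (length hs) v
       (\<lambda>c. f (T (map2 ad c (take (length hs) l) @ drop (Suc (length hs)) l)))))) as"
      unfolding P(2)[OF as] by (rule PL_cong, rule F(2)) simp
    also have "\<dots> = SWL as (\<lambda>x y. \<beta> (g (T x)) (PL s (?hs @ gs) (\<lambda>l. f (T l)) y))"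
      using PL_left[OF b, of hs as gs g "\<lambda>l. f (T l)"] gs as Hom_multilinear[OF W.vector_space_axioms f] by simp
    also have "\<dots> = act n s \<beta> g (pull s n (?hs @ gs) f) (T as)"
      unfolding act_tensor[OF b coalgebra_map_Hom[OF g] P'(1) as] by (rule SWL_cong) (simp add: P'(2) as)
    finally show "pull s n (hs @ g # gs) (faceL s \<beta> (length hs) ?m f) (T as) = act n s \<beta> g (pull s n (?hs @ gs) f) (T as)" .
  qed
qed

lemma pull_faceR:
  assumes f: "f \<in> Hom (length hs + length gs) s" and gs: "\<forall>h\<in>set (hs @ h # gs). coalgebra_map n h"
  shows "pull s n (hs @ h # gs) (faceR s \<beta> (length hs) (length hs + length gs) f)
    = act n s \<beta> (conj_map n (foldr (\<otimes>\<^bsub>conv n scale\<^esub>) gs \<one>\<^bsub>conv n scale\<^esub>) h) (pull s n (hs @ gs) f)"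
proof -
  let ?m = "length hs + length gs" and ?P = "foldr (\<otimes>\<^bsub>conv n scale\<^esub>) gs \<one>\<^bsub>conv n scale\<^esub>"
  note F = faceR[OF f, of "length hs", simplified]
  have F1: "faceR s \<beta> (length hs) ?m f \<in> Hom (length (hs @ h # gs)) s" using F(1) by simp
  have gs': "\<forall>h\<in>set (hs @ gs). coalgebra_map n h" using gs by auto
  have f': "f \<in> Hom (length (hs @ gs)) s" using f by simp
  have h: "coalgebra_map n (conj_map n ?P h)" using gs by (intro coalgebra_map_conj coalgebra_map_foldr) auto
  note P = pull[OF W.vector_space_axioms F1 gs] and P' = pull[OF W.vector_space_axioms f' gs']
  show ?thesis
  proof (rule Hom_eqI[OF W.vector_space_axioms P(1) act_in[OF b coalgebra_map_Hom[OF h] P'(1)]])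
    fix as :: "'a list" assume as: "length as = n"
    have "pull s n (hs @ h # gs) (faceR s \<beta> (length hs) ?m f) (T as)
      = PL s (hs @ h # gs) (\<lambda>l. SWL (drop (Suc (length hs)) l) (\<lambda>us vs. \<beta> (ad (prod_list vs) (l ! length hs)) (f (T (take (length hs) l @ us))))) as"
      unfolding P(2)[OF as] by (rule PL_cong, rule F(2)) simp
    also have "\<dots> = SWL as (\<lambda>x y. \<beta> (conj_map n ?P h (T y)) (PL s (hs @ gs) (\<lambda>l. f (T l)) x))"
      using PL_right[OF b, of hs as gs h "\<lambda>l. f (T l)"] gs as Hom_multilinear[OF W.vector_space_axioms f] by simp
    also have "\<dots> = SWL as (\<lambda>x y. \<beta> (conj_map n ?P h (T y)) (pull s n (hs @ gs) f (T x)))"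
      by (rule SWL_cong) (simp add: P'(2) as)
    also have "\<dots> = act n s \<beta> (conj_map n ?P h) (pull s n (hs @ gs) f) (T as)"
      unfolding act_tensor[OF b coalgebra_map_Hom[OF h] P'(1) as]
      using act_bimultilinear[OF b coalgebra_map_Hom[OF h] P'(1)] as by (intro SWL_cocomm[OF W.vector_space_axioms]) simp
    finally show "pull s n (hs @ h # gs) (faceR s \<beta> (length hs) ?m f) (T as) = act n s \<beta> (conj_map n ?P h) (pull s n (hs @ gs) f) (T as)" .
  qed
qed

lemma pull_faceM:
  assumes f: "f \<in> Hom (Suc (length pre + length post)) s" and gs: "\<forall>h\<in>set (pre @ g # h # post). coalgebra_map n h"
  shows "pull s n (pre @ g # h # post) (faceM s (Suc (length pre)) (Suc (length pre + length post)) f)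
    = pull s n (pre @ (g \<otimes>\<^bsub>conv n scale\<^esub> h) # post) f"
proof -
  let ?m = "Suc (length pre + length post)" and ?gs = "pre @ (g \<otimes>\<^bsub>conv n scale\<^esub> h) # post"
  note F = faceM[OF f, of "Suc (length pre)", simplified]
  have F1: "faceM s (Suc (length pre)) ?m f \<in> Hom (length (pre @ g # h # post)) s" using F(1) by simp
  have gs': "\<forall>h\<in>set ?gs. coalgebra_map n h" using gs by (auto intro: coalgebra_map_mult)
  have f': "f \<in> Hom (length ?gs) s" using f by simp
  note P = pull[OF W.vector_space_axioms F1 gs] and P' = pull[OF W.vector_space_axioms f' gs']
  show ?thesis
  proof (rule Hom_eqI[OF W.vector_space_axioms P(1) P'(1)])
    fix as :: "'a list" assume as: "length as = n"
    have "pull s n (pre @ g # h # post) (faceM s (Suc (length pre)) ?m f) (T as)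
      = PL s (pre @ g # h # post) (\<lambda>l. f (T (contract (Suc (length pre)) l))) as"
      unfolding P(2)[OF as] by (rule PL_cong, rule F(2)) simp
    also have "\<dots> = PL s ?gs (\<lambda>l. f (T l)) as"
      using PL_contract[OF W.vector_space_axioms, of pre g h post as "\<lambda>l. f (T l)"] gs as
        Hom_multilinear[OF W.vector_space_axioms f] by (auto intro: coalgebra_map_Hom)
    finally show "pull s n (pre @ g # h # post) (faceM s (Suc (length pre)) ?m f) (T as) = pull s n ?gs f (T as)"
      unfolding P'(2)[OF as] .
  qed
qed

end

subsection \<open>Regular maps\<close>

definition regular :: "nat \<Rightarrow> ('k \<Rightarrow> 'm::{comm_ring,comm_monoid_mult} \<Rightarrow> 'm) \<Rightarrow> (('a, 'k) tens \<Rightarrow> 'm) monoid"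
  where "regular n s = units_of (conv n s)"

lemma comm_group_regular: "k_algebra s \<Longrightarrow> comm_group (regular n s)"
  unfolding regular_def by (intro comm_monoid.units_comm_group conv_comm_monoid)

lemma regular_simps:
  "monoid.mult (regular n s) = monoid.mult (conv n s)"
  "one (regular n s) = one (conv n s)"
  by (simp_all add: regular_def units_of_def)

lemma regular_Hom: "k_algebra s \<Longrightarrow> f \<in> carrier (regular n s) \<Longrightarrow> f \<in> Hom n s"
  by (simp add: regular_def units_of_carrier Units_def conv_carrier)

definition conv_hom :: "nat \<Rightarrow> nat \<Rightarrow> ('k \<Rightarrow> 'm::{comm_ring,comm_monoid_mult} \<Rightarrow> 'm) \<Rightarrow>
    ((('a, 'k) tens \<Rightarrow> 'm) \<Rightarrow> ('a, 'k) tens \<Rightarrow> 'm) \<Rightarrow> bool"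
  where "conv_hom m n s h \<longleftrightarrow> (\<forall>f\<in>Hom m s. h f \<in> Hom n s)
    \<and> (\<forall>f\<in>Hom m s. \<forall>g\<in>Hom m s. h (f \<otimes>\<^bsub>conv m s\<^esub> g) = h f \<otimes>\<^bsub>conv n s\<^esub> h g)
    \<and> h \<one>\<^bsub>conv m s\<^esub> = \<one>\<^bsub>conv n s\<^esub>"

lemma conv_hom_comp: "conv_hom m n s h \<Longrightarrow> conv_hom n k s h' \<Longrightarrow> conv_hom m k s (\<lambda>f. h' (h f))"
  by (auto simp: conv_hom_def)

lemma conv_hom_cong: "conv_hom m n s h \<Longrightarrow> k_algebra s \<Longrightarrow> (\<And>f. f \<in> Hom m s \<Longrightarrow> h' f = h f) \<Longrightarrow> conv_hom m n s h'"
  by (auto simp: conv_hom_def conv_mult_in conv_one_in)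

lemma conv_hom_regular:
  assumes alg: "k_algebra s" and h: "conv_hom m n s h"
  shows "h \<in> hom (regular m s) (regular n s)"
proof (rule homI)
  fix f g assume f: "f \<in> carrier (regular m s)" and g: "g \<in> carrier (regular m s)"
  show "h (f \<otimes>\<^bsub>regular m s\<^esub> g) = h f \<otimes>\<^bsub>regular n s\<^esub> h g"
    using h regular_Hom[OF alg f] regular_Hom[OF alg g] by (simp add: regular_simps conv_hom_def)
next
  fix f assume f: "f \<in> carrier (regular m s)"
  then obtain f' where f': "f' \<in> Hom m s" "f \<otimes>\<^bsub>conv m s\<^esub> f' = \<one>\<^bsub>conv m s\<^esub>"
    "f' \<otimes>\<^bsub>conv m s\<^esub> f = \<one>\<^bsub>conv m s\<^esub>"
    by (auto simp: regular_def units_of_carrier Units_def conv_carrier[OF alg])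
  have "h f \<otimes>\<^bsub>conv n s\<^esub> h f' = \<one>\<^bsub>conv n s\<^esub>"
    "h f' \<otimes>\<^bsub>conv n s\<^esub> h f = \<one>\<^bsub>conv n s\<^esub>"
    using h f' regular_Hom[OF alg f] unfolding conv_hom_def by metis+
  then show "h f \<in> carrier (regular n s)"
    using h f' regular_Hom[OF alg f] unfolding conv_hom_def
    by (auto simp: regular_def units_of_carrier Units_def conv_carrier[OF alg])
qed

lemma conv_hom_pull:
  "k_algebra s \<Longrightarrow> \<forall>g\<in>set gs. coalgebra_map n g \<Longrightarrow> length gs = m \<Longrightarrow> conv_hom m n s (pull s n gs)"
  using pull(1)[of s _ gs n] by (auto simp: conv_hom_def pull_mult pull_one k_algebra_def)

lemma conv_hom_act: "measuring s \<beta> \<Longrightarrow> coalgebra_map n g \<Longrightarrow> conv_hom n n s (act n s \<beta> g)"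
  by (auto simp: conv_hom_def act_in coalgebra_map_Hom act_mult act_one)

lemma coords_split:
  assumes "q \<le> m"
  shows "\<exists>hs g gs. coords (Suc m) = hs @ g # gs \<and> length hs = q \<and> length gs = m - q"
proof (intro exI conjI)
  show "coords (Suc m) = take q (coords (Suc m)) @ coords (Suc m) ! q # drop (Suc q) (coords (Suc m))"
    using assms by (intro id_take_nth_drop) (simp del: coords.simps)
qed (use assms in \<open>simp_all del: coords.simps\<close>)

text \<open>Multiplicativity is not computed from the formula: at the coordinates the face is a
  pullback followed by an action, and both are convolution homomorphisms.\<close>

lemma conv_hom_faceL:
  assumes b: "measuring s \<beta>" and q: "q \<le> m"
  shows "conv_hom m (Suc m) s (faceL s \<beta> q m)"
proof -
  note s = measuring_vs[OF b]
  obtain hs g gs where c: "coords (Suc m) = hs @ g # gs" "length hs = q" "length gs = m - q"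
    using coords_split[OF q] by blast
  have C: "\<forall>h\<in>set (hs @ g # gs). coalgebra_map (Suc m) h" using coalgebra_map_coords[of "Suc m"] unfolding c(1) .
  have "conv_hom m (Suc m) s (\<lambda>f. act (Suc m) s \<beta> g (pull s (Suc m) (map (conj_map (Suc m) g) hs @ gs) f))"
    using C c q by (intro conv_hom_comp[OF conv_hom_pull[OF alg[OF b]] conv_hom_act[OF b]]) (auto intro: coalgebra_map_conj)
  then show ?thesis
  proof (rule conv_hom_cong[OF _ alg[OF b]])
    fix f assume f: "f \<in> Hom m s"
    have "faceL s \<beta> q m f = pull s (Suc m) (coords (Suc m)) (faceL s \<beta> q m f)"
      by (rule pull_coords[OF s faceL(1)[OF b f q], symmetric])
    also have "\<dots> = act (Suc m) s \<beta> g (pull s (Suc m) (map (conj_map (Suc m) g) hs @ gs) f)"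
      using pull_faceL[OF b, of f hs gs g "Suc m"] C c q f by simp
    finally show "faceL s \<beta> q m f = \<dots>" .
  qed
qed

lemma conv_hom_faceR:
  assumes b: "measuring s \<beta>" and q: "q \<le> m"
  shows "conv_hom m (Suc m) s (faceR s \<beta> q m)"
proof -
  note s = measuring_vs[OF b]
  obtain hs g gs where c: "coords (Suc m) = hs @ g # gs" "length hs = q" "length gs = m - q"
    using coords_split[OF q] by blast
  have C: "\<forall>h\<in>set (hs @ g # gs). coalgebra_map (Suc m) h" using coalgebra_map_coords[of "Suc m"] unfolding c(1) .
  let ?P = "foldr (\<otimes>\<^bsub>conv (Suc m) scale\<^esub>) gs \<one>\<^bsub>conv (Suc m) scale\<^esub>"
  have "conv_hom m (Suc m) s (\<lambda>f. act (Suc m) s \<beta> (conj_map (Suc m) ?P g) (pull s (Suc m) (hs @ gs) f))"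
    using C c q by (intro conv_hom_comp[OF conv_hom_pull[OF alg[OF b]] conv_hom_act[OF b]])
      (auto intro: coalgebra_map_conj coalgebra_map_foldr)
  then show ?thesis
  proof (rule conv_hom_cong[OF _ alg[OF b]])
    fix f assume f: "f \<in> Hom m s"
    have "faceR s \<beta> q m f = pull s (Suc m) (coords (Suc m)) (faceR s \<beta> q m f)"
      by (rule pull_coords[OF s faceR(1)[OF b f q], symmetric])
    also have "\<dots> = act (Suc m) s \<beta> (conj_map (Suc m) ?P g) (pull s (Suc m) (hs @ gs) f)"
      using pull_faceR[OF b, of f hs gs g "Suc m"] C c q f by simp
    finally show "faceR s \<beta> q m f = \<dots>" .
  qed
qed

lemma conv_hom_faceM:
  assumes b: "measuring s \<beta>" and i: "1 \<le> i" "i \<le> m"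
  shows "conv_hom m (Suc m) s (faceM s i m)"
proof -
  note s = measuring_vs[OF b]
  obtain k where k: "i = Suc k" using i by (cases i) auto
  obtain hs g gs where c: "coords (Suc m) = hs @ g # gs" "length hs = k" "length gs = m - k"
    using coords_split[of k m] i k by auto
  then obtain h gs' where gs: "gs = h # gs'" "m = Suc (length hs + length gs')" using i k by (cases gs) auto
  have C: "\<forall>h\<in>set (hs @ g # h # gs'). coalgebra_map (Suc m) h" using coalgebra_map_coords[of "Suc m"] unfolding c(1) gs(1) .
  have "conv_hom m (Suc m) s (pull s (Suc m) (hs @ (g \<otimes>\<^bsub>conv (Suc m) scale\<^esub> h) # gs'))"
    using C gs by (intro conv_hom_pull[OF alg[OF b]]) (auto intro: coalgebra_map_mult)
  then show ?thesis
  proof (rule conv_hom_cong[OF _ alg[OF b]])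
    fix f assume f: "f \<in> Hom m s"
    have "faceM s i m f = pull s (Suc m) (coords (Suc m)) (faceM s i m f)"
      by (rule pull_coords[OF s faceM(1)[OF b f i], symmetric])
    also have "\<dots> = pull s (Suc m) (hs @ (g \<otimes>\<^bsub>conv (Suc m) scale\<^esub> h) # gs') f"
      using pull_faceM[OF b, of f hs gs' g h "Suc m"] C c gs f k by simp
    finally show "faceM s i m f = \<dots>" .
  qed
qed

end

subsection \<open>Evaluation on group elements\<close>

definition fuse :: "nat \<Rightarrow> 'g::group_add list \<Rightarrow> 'g list"
  where "fuse i l = take (i - 1) l @ [l ! (i - 1) + l ! i] @ drop (i + 1) l"

text \<open>The form in which the inner faces occur in the differentials, namely indexed by the
  place of contraction.\<close>

lemma bd_sum: "bd f l = (\<Sum>i\<leftarrow>[1..<length l]. sg i (f (fuse i l)))"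
proof (induct l arbitrary: f rule: induct_list012)
  case (3 x y zs)
  have F: "fuse (Suc (Suc k)) (x # l) = x # fuse (Suc k) l" for k l
    by (simp add: fuse_def)
  have u: "[1..<length (x # y # zs)] = 1 # map Suc [1..<length (y # zs)]"
    by (simp add: upt_conv_Cons map_Suc_upt del: upt_Suc)
  have "(\<Sum>i\<leftarrow>map Suc [1..<length (y # zs)]. sg i (f (fuse i (x # y # zs))))
    = - (\<Sum>i\<leftarrow>[1..<length (y # zs)]. sg i (f (x # fuse i (y # zs))))"
  proof -
    have "(\<Sum>i\<leftarrow>map Suc [1..<length (y # zs)]. sg i (f (fuse i (x # y # zs))))
       = (\<Sum>i\<leftarrow>[1..<length (y # zs)]. - sg i (f (x # fuse i (y # zs))))"
      unfolding map_map o_def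
    proof (rule arg_cong[where f = sum_list], rule map_cong[OF refl])
      fix i assume "i \<in> set [1..<length (y # zs)]"
      then have "1 \<le> i" by (simp del: upt_Suc)
      then obtain k where "i = Suc k" by (cases i) auto
      then show "sg (Suc i) (f (fuse (Suc i) (x # y # zs))) = - sg i (f (x # fuse i (y # zs)))"
        by (simp only: F sg_Suc)
    qed
    also have "\<dots> = - (\<Sum>i\<leftarrow>[1..<length (y # zs)]. sg i (f (x # fuse i (y # zs))))"
      by (rule additive_sum_list[symmetric]) (simp add: additive_def)
    finally show ?thesis .
  qed
  moreover have "fuse 1 (x # y # zs) = (x + y) # zs" by (simp add: fuse_def)
  ultimately show ?case
    using 3(2)[of "\<lambda>l. f (x # l)"] unfolding u by (simp add: sg_Suc del: upt_Suc)
qed auto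

lemma length_foldr_braid_act: "length (foldr braid_act is \<gamma>s) = length \<gamma>s"
  by (induct "is") (auto simp: braid_act_def)

context commutative_bimodule_algebra
begin

abbreviation ractl :: "'a \<Rightarrow> 'm \<Rightarrow> 'm" where "ractl a m \<equiv> m \<leftharpoonup> a"

lemma measuring_lact: "measuring scaleM lact"
  unfolding measuring_def
proof (intro conjI allI)
  show "k_algebra scaleM" by (rule M.k_algebra_axioms)
  fix a m m'
  have "lin scaleA scaleM (\<lambda>x. (x \<rightharpoonup> m) * c)" for c by (rule lin_comp[OF lact_linear_left M.lin_mult_right])
  moreover have "lin scaleA scaleM (\<lambda>x. c * (x \<rightharpoonup> m'))" for c by (rule lin_comp[OF lact_linear_left M.lin_mult_left])
  ultimately show "a \<rightharpoonup> (m * m') = SW a (\<lambda>x y. (x \<rightharpoonup> m) * (y \<rightharpoonup> m'))"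
    unfolding lact_prod by (subst sweedler_2[OF M.vector_space_axioms]) auto
qed (rule lact_linear_left lact_linear_right lact_unit)+

lemma measuring_ract: "measuring scaleM ractl"
  unfolding measuring_def
proof (intro conjI allI)
  show "k_algebra scaleM" by (rule M.k_algebra_axioms)
  fix a m m'
  have "lin scaleA scaleM (\<lambda>x. (m \<leftharpoonup> x) * c)" for c by (rule lin_comp[OF ract_linear_right M.lin_mult_right])
  moreover have "lin scaleA scaleM (\<lambda>x. c * (m' \<leftharpoonup> x))" for c by (rule lin_comp[OF ract_linear_right M.lin_mult_left])
  ultimately show "(m * m') \<leftharpoonup> a = SW a (\<lambda>x y. (m \<leftharpoonup> x) * (m' \<leftharpoonup> y))"
    unfolding ract_prod by (subst sweedler_2[OF M.vector_space_axioms]) auto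
qed (rule ract_linear_left ract_linear_right ract_unit)+

lemma M_monoid: "M_monoid = alg_monoid"
  by (simp add: M_monoid_def alg_monoid_def)

lemma Reg: "Reg n = regular n scaleM"
  by (simp add: Reg_def regular_def M_monoid)

lemma algM: "k_algebra scaleM"
  by (rule M.k_algebra_axioms)

lemma vsM: "vector_space scaleM"
  by (rule M.vector_space_axioms)

lemma comm_group_Reg: "comm_group (Reg n)"
  unfolding Reg by (rule comm_group_regular[OF algM])

lemma group_Reg: "group (Reg n)"
  using comm_group_Reg by (simp add: comm_group_def)

lemma Reg_Hom: "f \<in> carrier (Reg n) \<Longrightarrow> f \<in> Hom n scaleM"
  unfolding Reg by (rule regular_Hom[OF algM])

lemma conv_hom_Reg: "conv_hom m n scaleM h \<Longrightarrow> h \<in> hom (Reg m) (Reg n)"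
  unfolding Reg by (rule conv_hom_regular[OF algM])

abbreviation CM :: "nat \<Rightarrow> (('a, 'k) tens \<Rightarrow> 'a) monoid"
  where "CM \<equiv> coalgebra_maps"

definition La :: "nat \<Rightarrow> (('a, 'k) tens \<Rightarrow> 'a) group_family \<Rightarrow> (('a, 'k) tens \<Rightarrow> 'm) abelian_family \<Rightarrow> (('a, 'k) tens \<Rightarrow> 'm) abelian_family"
  where "La n \<gamma> = modify (Reg n) (act n scaleM lact (component (CM n) \<gamma>))"

definition Ra :: "nat \<Rightarrow> (('a, 'k) tens \<Rightarrow> 'a) group_family \<Rightarrow> (('a, 'k) tens \<Rightarrow> 'm) abelian_family \<Rightarrow> (('a, 'k) tens \<Rightarrow> 'm) abelian_family"
  where "Ra n \<gamma> = modify (Reg n) (act n scaleM ractl (component (CM n) \<gamma>))"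

lemma component_CM: "coalgebra_map n (component (CM n) \<gamma>)"
  using component(1)[OF group_coalgebra_maps, of n \<gamma>] by simp

lemma act_hom: "measuring scaleM \<beta> \<Longrightarrow> act n scaleM \<beta> (component (CM n) \<gamma>) \<in> hom (Reg n) (Reg n)"
  by (intro conv_hom_Reg conv_hom_act component_CM)

text \<open>In the component \<open>Reg n\<close> the laws come from those of the bimodule, with the
  second form of \<open>act_act_tensor\<close> supplying the reversed order of the right action. All
  other components are left unchanged.\<close>

lemma bimodule_action_Reg: "bimodule_action (La n) (Ra n)"
proof
  fix g h :: "(('a, 'k) tens \<Rightarrow> 'a) group_family" and x y :: "(('a, 'k) tens \<Rightarrow> 'm) abelian_family"
  let ?g = "component (CM n) g" and ?h = "component (CM n) h"
  note G = component_CM[of n g] component_CM[of n h]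
  note H = coalgebra_map_Hom[OF G(1)] coalgebra_map_Hom[OF G(2)]
  note N = comm_group_Reg[of n]
  note l = act_hom[OF measuring_lact, of n] and r = act_hom[OF measuring_ract, of n]
  note hl = linear_maps_def
  show "La n g (x + y) = La n g x + La n g y" unfolding La_def by (rule modify_add[OF N l])
  show "Ra n g (x + y) = Ra n g x + Ra n g y" unfolding Ra_def by (rule modify_add[OF N r])
  have c: "component (CM n) (g + h) = component (CM n) g \<otimes>\<^bsub>conv n scaleA\<^esub> component (CM n) h" for g h
    using component(2)[OF group_coalgebra_maps, of n g h] by simp
  show "La n g (La n h x) = La n (g + h) x"
    unfolding La_def
  proof (rule modify_modify[OF N l l l])
    fix f assume "f \<in> carrier (Reg n)"
    then have f: "f \<in> Hom n scaleM" by (rule Reg_Hom)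
    show "act n scaleM lact ?g (act n scaleM lact ?h f) = act n scaleM lact (component (CM n) (g + h)) f"
      unfolding c
      by (rule Hom_eqI[OF vsM act_in[OF measuring_lact H(1) act_in[OF measuring_lact H(2) f]]
            act_in[OF measuring_lact conv_mult_in[OF k_algebra_scale H] f]])
        (simp add: act_act_tensor(1)[OF measuring_lact measuring_lact H f] act_mult_tensor[OF measuring_lact H f] lact_mult)
  qed
  show "Ra n g (Ra n h x) = Ra n (h + g) x"
    unfolding Ra_def
  proof (rule modify_modify[OF N r r r])
    fix f assume "f \<in> carrier (Reg n)"
    then have f: "f \<in> Hom n scaleM" by (rule Reg_Hom)
    show "act n scaleM ractl ?g (act n scaleM ractl ?h f) = act n scaleM ractl (component (CM n) (h + g)) f"
      unfolding c
      by (rule Hom_eqI[OF vsM act_in[OF measuring_ract H(1) act_in[OF measuring_ract H(2) f]]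
            act_in[OF measuring_ract conv_mult_in[OF k_algebra_scale H(2,1)] f]])
        (simp add: act_act_tensor(2)[OF measuring_ract measuring_ract H f] act_mult_tensor[OF measuring_ract H(2,1) f] ract_mult)
  qed
  have lr: "act n scaleM lact ?g (act n scaleM ractl ?h f) = act n scaleM ractl ?h (act n scaleM lact ?g f)"
    if "f \<in> carrier (Reg n)" for f
  proof -
    have f: "f \<in> Hom n scaleM" using that by (rule Reg_Hom)
    show ?thesis
      by (rule Hom_eqI[OF vsM act_in[OF measuring_lact H(1) act_in[OF measuring_ract H(2) f]]
            act_in[OF measuring_ract H(2) act_in[OF measuring_lact H(1) f]]])
        (simp add: act_act_tensor(1)[OF measuring_lact measuring_ract H f]
          act_act_tensor(2)[OF measuring_ract measuring_lact H(2,1) f] lact_ract)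
  qed
  have k: "(\<lambda>f. act n scaleM lact ?g (act n scaleM ractl ?h f)) \<in> hom (Reg n) (Reg n)"
    by (rule conv_hom_Reg[OF conv_hom_comp[OF conv_hom_act[OF measuring_ract G(2)] conv_hom_act[OF measuring_lact G(1)]]])
  show "La n g (Ra n h x) = Ra n h (La n g x)"
    unfolding La_def Ra_def
  proof (rule trans)
    show "modify (Reg n) (act n scaleM lact ?g) (modify (Reg n) (act n scaleM ractl ?h) x)
      = modify (Reg n) (\<lambda>f. act n scaleM lact ?g (act n scaleM ractl ?h f)) x"
      by (rule modify_modify[OF N l r k]) (rule refl)
    show "\<dots> = modify (Reg n) (act n scaleM ractl ?h) (modify (Reg n) (act n scaleM lact ?g) x)"
      by (rule modify_modify[OF N r l k, symmetric]) (rule lr[symmetric])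
  qed
qed

text \<open>The value at a tuple of group elements, placed into a type with class operations.
  \<open>n\<close> is the tensor power on which the group elements live; it is independent of the
  degree of \<open>f\<close>.\<close>

definition Ev :: "nat \<Rightarrow> (('a, 'k) tens \<Rightarrow> 'm) \<Rightarrow> (('a, 'k) tens \<Rightarrow> 'a) group_family list \<Rightarrow> (('a, 'k) tens \<Rightarrow> 'm) abelian_family"
  where "Ev n f \<gamma>s = embed (Reg n) (pull scaleM n (map (component (CM n)) \<gamma>s) f)"

lemma pull_hom: "length \<gamma>s = m \<Longrightarrow> pull scaleM n (map (component (CM n)) \<gamma>s) \<in> hom (Reg m) (Reg n)"
  by (intro conv_hom_Reg conv_hom_pull algM) (auto simp: component_CM)

lemma pull_in_Reg:
  "f \<in> carrier (Reg m) \<Longrightarrow> length \<gamma>s = m \<Longrightarrow> pull scaleM n (map (component (CM n)) \<gamma>s) f \<in> carrier (Reg n)"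
  by (rule hom_in_carrier[OF pull_hom])

lemma Ev_mult:
  "f \<in> carrier (Reg m) \<Longrightarrow> g \<in> carrier (Reg m) \<Longrightarrow> length \<gamma>s = m \<Longrightarrow>
    Ev n (f \<otimes>\<^bsub>Reg m\<^esub> g) \<gamma>s = Ev n f \<gamma>s + Ev n g \<gamma>s"
  by (simp add: Ev_def hom_mult[OF pull_hom] embed_mult[OF comm_group_Reg] pull_in_Reg)

lemma Ev_one: "length \<gamma>s = m \<Longrightarrow> Ev n \<one>\<^bsub>Reg m\<^esub> \<gamma>s = 0"
  using hom_one[OF pull_hom group_Reg group_Reg, of \<gamma>s m n] by (simp add: Ev_def embed_one[OF comm_group_Reg])

lemma Ev_inv:
  assumes "f \<in> carrier (Reg m)" "length \<gamma>s = m"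
  shows "Ev n (inv\<^bsub>Reg m\<^esub> f) \<gamma>s = - Ev n f \<gamma>s"
proof -
  have "pull scaleM n (map (component (CM n)) \<gamma>s) (inv\<^bsub>Reg m\<^esub> f) = inv\<^bsub>Reg n\<^esub> (pull scaleM n (map (component (CM n)) \<gamma>s) f)"
    using group_hom.hom_inv[of "Reg m" "Reg n" "pull scaleM n (map (component (CM n)) \<gamma>s)" f] assms pull_hom[of \<gamma>s m n]
    by (simp add: group_hom_def group_hom_axioms_def group_Reg)
  then show ?thesis using assms by (simp add: Ev_def embed_inv[OF comm_group_Reg] pull_in_Reg)
qed

lemma Reg_pow_in: "f \<in> carrier (Reg m) \<Longrightarrow> f [^]\<^bsub>Reg m\<^esub> (k::int) \<in> carrier (Reg m)"
  by (rule group.int_pow_closed[OF group_Reg])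

lemma Reg_pow_sign:
  assumes "f \<in> carrier (Reg m)"
  shows "f [^]\<^bsub>Reg m\<^esub> ((-1) ^ i :: int) = (if even i then f else inv\<^bsub>Reg m\<^esub> f)"
  using assms group.int_pow_neg[OF group_Reg assms, of 1] group.int_pow_1[OF group_Reg assms]
  by (simp add: minus_one_power_iff)

lemma Ev_pow:
  "f \<in> carrier (Reg m) \<Longrightarrow> length \<gamma>s = m \<Longrightarrow> Ev n (f [^]\<^bsub>Reg m\<^esub> ((-1) ^ i :: int)) \<gamma>s = sg i (Ev n f \<gamma>s)"
  by (simp add: Reg_pow_sign Ev_inv sg_def)

lemma foldr_Reg_in:
  "set Fs \<subseteq> carrier (Reg m) \<Longrightarrow> foldr (\<otimes>\<^bsub>Reg m\<^esub>) Fs \<one>\<^bsub>Reg m\<^esub> \<in> carrier (Reg m)"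
  using group_Reg[of m] by (induct Fs) (auto intro!: monoid.m_closed monoid.one_closed group.is_monoid)

lemma Ev_foldr:
  "set Fs \<subseteq> carrier (Reg m) \<Longrightarrow> length \<gamma>s = m \<Longrightarrow>
    Ev n (foldr (\<otimes>\<^bsub>Reg m\<^esub>) Fs \<one>\<^bsub>Reg m\<^esub>) \<gamma>s = (\<Sum>F\<leftarrow>Fs. Ev n F \<gamma>s)"
  by (induct Fs) (auto simp: Ev_one Ev_mult foldr_Reg_in)

lemma Ev_finprod:
  assumes "finite A" "h \<in> A \<rightarrow> carrier (Reg m)" "length \<gamma>s = m"
  shows "Ev n (finprod (Reg m) h A) \<gamma>s = (\<Sum>a\<in>A. Ev n (h a) \<gamma>s)"
proof -
  interpret comm_group "Reg m" by (rule comm_group_Reg)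
  show ?thesis
    using assms
  proof (induct A rule: finite_induct)
    case empty
    then show ?case by (simp add: Ev_one)
  next
    case (insert a A)
    then show ?case by (simp add: Ev_mult finprod_closed)
  qed
qed

lemma coords_component: "\<exists>\<gamma>s. length \<gamma>s = n \<and> map (component (CM n)) \<gamma>s = coords n"
proof -
  have "\<forall>g\<in>set (coords n). \<exists>\<gamma>. component (CM n) \<gamma> = g"
    using coalgebra_map_coords[of n] by (auto intro!: component_surj group_coalgebra_maps)
  then obtain c where "\<forall>g\<in>set (coords n). component (CM n) (c g) = g" by metis
  then have "map (component (CM n)) (map c (coords n)) = coords n" by (simp add: map_idI)
  then show ?thesis by (intro exI[of _ "map c (coords n)"]) simp
qed

text \<open>One tuple suffices: at the coordinates the pullback is the identity, and
  \<open>embed\<close> is injective. For this the group elements must live on the tensor power that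
  matches the degree.\<close>

lemma Ev_eqI:
  assumes f: "f \<in> carrier (Reg n)" "g \<in> carrier (Reg n)" and eq: "\<And>\<gamma>s. length \<gamma>s = n \<Longrightarrow> Ev n f \<gamma>s = Ev n g \<gamma>s"
  shows "f = g"
proof -
  obtain \<gamma>s where \<gamma>: "length \<gamma>s = n" "map (component (CM n)) \<gamma>s = coords n" using coords_component by blast
  have p: "pull scaleM n (map (component (CM n)) \<gamma>s) h = h" if "h \<in> carrier (Reg n)" for h
    unfolding \<gamma>(2) by (rule pull_coords[OF vsM Reg_Hom[OF that]])
  from eq[OF \<gamma>(1)] show ?thesis
    unfolding Ev_def p[OF f(1)] p[OF f(2)] by (rule embed_inj[OF comm_group_Reg f])
qed

lemma component_conj: "component (CM n) (conjg b a) = conj_map n (component (CM n) b) (component (CM n) a)"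
  by (simp add: conjg_def conj_map_def component[OF group_coalgebra_maps] inv_coalgebra_maps component_CM)

lemma component_sum_list:
  "component (CM n) (sum_list bs)
    = foldr (\<otimes>\<^bsub>conv n scaleA\<^esub>) (map (component (CM n)) bs) \<one>\<^bsub>conv n scaleA\<^esub>"
  by (induct bs) (simp_all add: component[OF group_coalgebra_maps])

lemma Ev_faceL:
  assumes "f \<in> carrier (Reg m)" "m = length xs + length bs"
  shows "Ev n (faceL scaleM lact (length xs) m f) (xs @ b # bs) = La n b (Ev n f (map (conjg b) xs @ bs))"
proof -
  have C: "\<forall>h\<in>set (map (component (CM n)) xs @ component (CM n) b # map (component (CM n)) bs). coalgebra_map n h"
    by (auto simp: component_CM)
  have "pull scaleM n (map (component (CM n)) (xs @ b # bs)) (faceL scaleM lact (length xs) m f)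
    = act n scaleM lact (component (CM n) b) (pull scaleM n (map (component (CM n)) (map (conjg b) xs @ bs)) f)"
    using pull_faceL[OF measuring_lact _ C, of f] Reg_Hom[OF assms(1)] assms(2)
    by (simp add: component_CM component_conj o_def)
  then show ?thesis
    unfolding Ev_def La_def
    using modify_embed[OF comm_group_Reg act_hom[OF measuring_lact]
        pull_in_Reg[OF assms(1), of "map (conjg b) xs @ bs" n], of b] assms(2)
    by (simp only: length_append length_map)
qed

lemma Ev_faceR:
  assumes "f \<in> carrier (Reg m)" "m = length xs + length bs"
  shows "Ev n (faceR scaleM ractl (length xs) m f) (xs @ b # bs) = Ra n (conjg (sum_list bs) b) (Ev n f (xs @ bs))"
proof -
  have C: "\<forall>h\<in>set (map (component (CM n)) xs @ component (CM n) b # map (component (CM n)) bs). coalgebra_map n h"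
    by (auto simp: component_CM)
  have "pull scaleM n (map (component (CM n)) (xs @ b # bs)) (faceR scaleM ractl (length xs) m f)
    = act n scaleM ractl (component (CM n) (conjg (sum_list bs) b)) (pull scaleM n (map (component (CM n)) (xs @ bs)) f)"
    using pull_faceR[OF measuring_ract _ C, of f] Reg_Hom[OF assms(1)] assms(2)
    by (simp add: component_CM component_conj component_sum_list)
  then show ?thesis
    unfolding Ev_def Ra_def
    using modify_embed[OF comm_group_Reg act_hom[OF measuring_ract]
        pull_in_Reg[OF assms(1), of "xs @ bs" n], of "conjg (sum_list bs) b"] assms(2)
    by (simp only: length_append)
qed

lemma Ev_faceM:
  assumes "f \<in> carrier (Reg m)" "length \<gamma>s = Suc m" "1 \<le> i" "i \<le> m"
  shows "Ev n (faceM scaleM i m f) \<gamma>s = Ev n f (fuse i \<gamma>s)"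
proof -
  obtain k where k: "i = Suc k" using assms(3) by (cases i) auto
  define pre x y post where "pre = take k \<gamma>s" and "x = \<gamma>s ! k" and "y = \<gamma>s ! Suc k" and "post = drop (Suc (Suc k)) \<gamma>s"
  have \<gamma>s: "\<gamma>s = pre @ x # y # post" and l: "length pre = k" "Suc (length pre + length post) = m"
    using assms k by (simp_all add: pre_def x_def y_def post_def Cons_nth_drop_Suc id_take_nth_drop)
  have C: "\<forall>h\<in>set (map (component (CM n)) pre @ component (CM n) x # component (CM n) y # map (component (CM n)) post). coalgebra_map n h"
    by (auto simp: component_CM)
  have "pull scaleM n (map (component (CM n)) \<gamma>s) (faceM scaleM i m f) = pull scaleM n (map (component (CM n)) (fuse i \<gamma>s)) f"
    using pull_faceM[OF measuring_lact _ C, of f] Reg_Hom[OF assms(1)] l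
    by (simp add: k \<gamma>s fuse_def component_CM nth_append component[OF group_coalgebra_maps])
  then show ?thesis by (simp add: Ev_def)
qed

lemma faceL_in: "q \<le> m \<Longrightarrow> f \<in> carrier (Reg m) \<Longrightarrow> faceL scaleM lact q m f \<in> carrier (Reg (Suc m))"
  by (rule hom_in_carrier[OF conv_hom_Reg[OF conv_hom_faceL[OF measuring_lact]]])

lemma faceR_in: "q \<le> m \<Longrightarrow> f \<in> carrier (Reg m) \<Longrightarrow> faceR scaleM ractl q m f \<in> carrier (Reg (Suc m))"
  by (rule hom_in_carrier[OF conv_hom_Reg[OF conv_hom_faceR[OF measuring_ract]]])

lemma faceM_in: "1 \<le> i \<Longrightarrow> i \<le> m \<Longrightarrow> f \<in> carrier (Reg m) \<Longrightarrow> faceM scaleM i m f \<in> carrier (Reg (Suc m))"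
  by (rule hom_in_carrier[OF conv_hom_Reg[OF conv_hom_faceM[OF measuring_lact]]])

text \<open>The factors for a new letter in the first block, which grows from \<open>q\<close> to
  \<open>q + 1\<close> letters; \<open>m\<close> is the total degree of \<open>f\<close>. The order
  is that of the factors in \<open>\<d>\<close>.\<close>

definition facesX :: "nat \<Rightarrow> nat \<Rightarrow> (('a, 'k) tens \<Rightarrow> 'm) \<Rightarrow> (('a, 'k) tens \<Rightarrow> 'm) list"
  where "facesX q m f = faceL scaleM lact 0 m f
    # map (\<lambda>i. faceM scaleM i m (f [^]\<^bsub>Reg m\<^esub> ((-1) ^ i :: int))) [1..<Suc q]
    @ [faceR scaleM ractl q m (f [^]\<^bsub>Reg m\<^esub> ((-1) ^ (q + 1) :: int))]"

text \<open>The factors for a new letter in the second block, behind \<open>q\<close> letters, in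
  the order of \<open>\<D>\<close>. The exponents contain the sign (-1)^q that \<open>dtot\<close>
  puts in front of \<open>dy\<close>.\<close>

definition facesY :: "nat \<Rightarrow> nat \<Rightarrow> (('a, 'k) tens \<Rightarrow> 'm) \<Rightarrow> (('a, 'k) tens \<Rightarrow> 'm) list"
  where "facesY q p f = faceL scaleM lact q (q + p) (f [^]\<^bsub>Reg (q + p)\<^esub> ((-1) ^ q :: int))
    # map (\<lambda>i. faceM scaleM (q + i) (q + p) (f [^]\<^bsub>Reg (q + p)\<^esub> ((-1) ^ (q + i) :: int))) [1..<Suc p]
    @ [faceR scaleM ractl (q + p) (q + p) (f [^]\<^bsub>Reg (q + p)\<^esub> ((-1) ^ (q + p + 1) :: int))]"

definition DX :: "nat \<Rightarrow> nat \<Rightarrow> (('a, 'k) tens \<Rightarrow> 'm) \<Rightarrow> ('a, 'k) tens \<Rightarrow> 'm"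
  where "DX q m f = foldr (\<otimes>\<^bsub>Reg (Suc m)\<^esub>) (facesX q m f) \<one>\<^bsub>Reg (Suc m)\<^esub>"

definition DY :: "nat \<Rightarrow> nat \<Rightarrow> (('a, 'k) tens \<Rightarrow> 'm) \<Rightarrow> ('a, 'k) tens \<Rightarrow> 'm"
  where "DY q p f = foldr (\<otimes>\<^bsub>Reg (Suc (q + p))\<^esub>) (facesY q p f) \<one>\<^bsub>Reg (Suc (q + p))\<^esub>"

lemma facesX_in: "f \<in> carrier (Reg m) \<Longrightarrow> q \<le> m \<Longrightarrow> set (facesX q m f) \<subseteq> carrier (Reg (Suc m))"
  by (auto simp: facesX_def simp del: upt_Suc intro!: faceL_in faceR_in faceM_in Reg_pow_in)

lemma facesY_in: "f \<in> carrier (Reg (q + p)) \<Longrightarrow> set (facesY q p f) \<subseteq> carrier (Reg (Suc (q + p)))"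
  by (auto simp: facesY_def simp del: upt_Suc intro!: faceL_in faceR_in faceM_in Reg_pow_in)

lemma DX_in: "f \<in> carrier (Reg m) \<Longrightarrow> q \<le> m \<Longrightarrow> DX q m f \<in> carrier (Reg (Suc m))"
  unfolding DX_def by (intro foldr_Reg_in facesX_in)

lemma DY_in: "f \<in> carrier (Reg (q + p)) \<Longrightarrow> DY q p f \<in> carrier (Reg (Suc (q + p)))"
  unfolding DY_def by (intro foldr_Reg_in facesY_in)

lemma Ev_DX:
  assumes f: "f \<in> carrier (Reg m)" and m: "m = q + length bs" and xs: "length xs = Suc q"
  shows "Ev n (DX q m f) (xs @ bs) = bimodule_action.dx (La n) (Ra n) (\<lambda>xs bs. Ev n f (xs @ bs)) xs bs"
proof -
  interpret B: bimodule_action "La n" "Ra n" by (rule bimodule_action_Reg)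
  obtain x xs' where x: "xs = x # xs'" "length xs' = q" using xs by (cases xs) auto
  obtain ys y where y: "xs = ys @ [y]" "length ys = q" using xs by (cases xs rule: rev_cases) auto
  have l: "length (xs @ bs) = Suc m" using m xs by simp
  have "Ev n (DX q m f) (xs @ bs) = (\<Sum>F\<leftarrow>facesX q m f. Ev n F (xs @ bs))"
    unfolding DX_def using f m by (intro Ev_foldr facesX_in l) auto
  also have "\<dots> = La n x (Ev n f (xs' @ bs))
     + (\<Sum>i\<leftarrow>[1..<Suc q]. Ev n (faceM scaleM i m (f [^]\<^bsub>Reg m\<^esub> ((-1) ^ i :: int))) (xs @ bs))
     + sg (Suc q) (Ra n (conjg (sum_list bs) y) (Ev n f (ys @ bs)))"
  proof -
    have "Ev n (faceL scaleM lact 0 m f) (xs @ bs) = La n x (Ev n f (xs' @ bs))"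
      using Ev_faceL[of f m "[]" "xs' @ bs" n x] f m x by simp
    moreover have "Ev n (faceR scaleM ractl q m (f [^]\<^bsub>Reg m\<^esub> ((-1) ^ (q + 1) :: int))) (xs @ bs)
      = sg (Suc q) (Ra n (conjg (sum_list bs) y) (Ev n f (ys @ bs)))"
      using Ev_faceR[OF Reg_pow_in[OF f, of "(-1) ^ (q + 1)"], of ys bs n y] Ev_pow[OF f, of "ys @ bs" n "q + 1"] m y
      by (simp add: additive_sg[OF B.additive_ra])
    ultimately show ?thesis by (simp add: facesX_def add.assoc o_def del: upt_Suc)
  qed
  also have "(\<Sum>i\<leftarrow>[1..<Suc q]. Ev n (faceM scaleM i m (f [^]\<^bsub>Reg m\<^esub> ((-1) ^ i :: int))) (xs @ bs))
    = (\<Sum>i\<leftarrow>[1..<length xs]. sg i (Ev n f (fuse i xs @ bs)))"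
    unfolding xs
  proof (rule arg_cong[where f = sum_list], rule map_cong[OF refl])
    fix i assume "i \<in> set [1..<Suc q]"
    then have i: "1 \<le> i" "i \<le> q" by auto
    then have fu: "fuse i (xs @ bs) = fuse i xs @ bs" using xs by (auto simp: fuse_def nth_append)
    have "Ev n (faceM scaleM i m (f [^]\<^bsub>Reg m\<^esub> ((-1) ^ i :: int))) (xs @ bs) = Ev n (f [^]\<^bsub>Reg m\<^esub> ((-1) ^ i :: int)) (fuse i (xs @ bs))"
      using i m by (intro Ev_faceM Reg_pow_in f l) auto
    also have "\<dots> = sg i (Ev n f (fuse i xs @ bs))"
      unfolding fu using i xs m by (intro Ev_pow f) (auto simp: fuse_def)
    finally show "Ev n (faceM scaleM i m (f [^]\<^bsub>Reg m\<^esub> ((-1) ^ i :: int))) (xs @ bs) = sg i (Ev n f (fuse i xs @ bs))" .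
  qed
  also have "(\<Sum>i\<leftarrow>[1..<length xs]. sg i (Ev n f (fuse i xs @ bs))) = bd (\<lambda>xs. Ev n f (xs @ bs)) xs"
    by (rule bd_sum[symmetric])
  finally have S: "Ev n (DX q m f) (xs @ bs) = La n x (Ev n f (xs' @ bs)) + bd (\<lambda>xs. Ev n f (xs @ bs)) xs
    + sg (Suc q) (Ra n (conjg (sum_list bs) y) (Ev n f (ys @ bs)))" .
  have "last xs = y" "butlast xs = ys" by (simp_all add: y(1))
  moreover have "hd xs = x" "tl xs = xs'" by (simp_all add: x(1))
  ultimately show ?thesis unfolding B.dx_def S xs by simp
qed

lemma Ev_DY:
  assumes f: "f \<in> carrier (Reg (q + p))" and xs: "length xs = q" "length bs = Suc p"
  shows "Ev n (DY q p f) (xs @ bs) = sg q (bimodule_action.dy (La n) (Ra n) (\<lambda>xs bs. Ev n f (xs @ bs)) xs bs)"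
proof -
  interpret B: bimodule_action "La n" "Ra n" by (rule bimodule_action_Reg)
  let ?m = "q + p"
  obtain b bs' where b: "bs = b # bs'" "length bs' = p" using xs by (cases bs) auto
  obtain cs c where c: "bs = cs @ [c]" "length cs = p" using xs by (cases bs rule: rev_cases) auto
  have l: "length (xs @ bs) = Suc ?m" using xs by simp
  have "Ev n (DY q p f) (xs @ bs) = (\<Sum>F\<leftarrow>facesY q p f. Ev n F (xs @ bs))"
    unfolding DY_def using f by (intro Ev_foldr facesY_in l) auto
  also have "\<dots> = sg q (La n b (Ev n f (map (conjg b) xs @ bs')))
     + (\<Sum>i\<leftarrow>[1..<Suc p]. Ev n (faceM scaleM (q + i) ?m (f [^]\<^bsub>Reg ?m\<^esub> ((-1) ^ (q + i) :: int))) (xs @ bs))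
     + sg (q + Suc p) (Ra n c (Ev n f (xs @ cs)))"
  proof -
    have "Ev n (faceL scaleM lact q ?m (f [^]\<^bsub>Reg ?m\<^esub> ((-1) ^ q :: int))) (xs @ bs) = sg q (La n b (Ev n f (map (conjg b) xs @ bs')))"
      using Ev_faceL[OF Reg_pow_in[OF f, of "(-1) ^ q"], of xs bs' n b] Ev_pow[OF f, of "map (conjg b) xs @ bs'" n q] xs b
      by (simp add: additive_sg[OF B.additive_la])
    moreover have "Ev n (faceR scaleM ractl ?m ?m (f [^]\<^bsub>Reg ?m\<^esub> ((-1) ^ (q + p + 1) :: int))) (xs @ bs)
      = sg (q + Suc p) (Ra n c (Ev n f (xs @ cs)))"
      using Ev_faceR[OF Reg_pow_in[OF f, of "(-1) ^ (q + p + 1)"], of "xs @ cs" "[]" n c] Ev_pow[OF f, of "xs @ cs" n "q + p + 1"] xs c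
      by (simp add: additive_sg[OF B.additive_ra])
    ultimately show ?thesis by (simp add: facesY_def add.assoc o_def del: upt_Suc)
  qed
  also have "(\<Sum>i\<leftarrow>[1..<Suc p]. Ev n (faceM scaleM (q + i) ?m (f [^]\<^bsub>Reg ?m\<^esub> ((-1) ^ (q + i) :: int))) (xs @ bs))
    = (\<Sum>i\<leftarrow>[1..<length bs]. sg q (sg i (Ev n f (xs @ fuse i bs))))"
    unfolding xs(2)
  proof (rule arg_cong[where f = sum_list], rule map_cong[OF refl])
    fix i assume "i \<in> set [1..<Suc p]"
    then have i: "1 \<le> i" "i \<le> p" by auto
    then have fu: "fuse (q + i) (xs @ bs) = xs @ fuse i bs" using xs by (auto simp: fuse_def nth_append)
    have "Ev n (faceM scaleM (q + i) ?m (f [^]\<^bsub>Reg ?m\<^esub> ((-1) ^ (q + i) :: int))) (xs @ bs)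
       = Ev n (f [^]\<^bsub>Reg ?m\<^esub> ((-1) ^ (q + i) :: int)) (fuse (q + i) (xs @ bs))"
      using i by (intro Ev_faceM Reg_pow_in f l) auto
    also have "\<dots> = sg (q + i) (Ev n f (xs @ fuse i bs))"
      unfolding fu using i xs by (intro Ev_pow f) (auto simp: fuse_def)
    finally show "Ev n (faceM scaleM (q + i) ?m (f [^]\<^bsub>Reg ?m\<^esub> ((-1) ^ (q + i) :: int))) (xs @ bs) = sg q (sg i (Ev n f (xs @ fuse i bs)))"
      by (simp only: sg_sg)
  qed
  also have "\<dots> = sg q (bd (\<lambda>bs. Ev n f (xs @ bs)) bs)"
    unfolding bd_sum by (rule additive_sum_list[symmetric]) (rule additive.intro[OF sg_add])
  finally have S: "Ev n (DY q p f) (xs @ bs) = sg q (La n b (Ev n f (map (conjg b) xs @ bs')))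
    + sg q (bd (\<lambda>bs. Ev n f (xs @ bs)) bs) + sg (q + Suc p) (Ra n c (Ev n f (xs @ cs)))" .
  have "last bs = c" "butlast bs = cs" by (simp_all add: c(1))
  moreover have "hd bs = b" "tl bs = bs'" by (simp_all add: b(1))
  ultimately show ?thesis unfolding B.dy_def S xs by (simp add: sg_add sg_sg)
qed

subsection \<open>The operators \<open>T\<^sub>\<sigma>\<close>\<close>

text \<open>The first braid of the word is absorbed into \<open>f\<close>, and the rest is moved to
  the group elements before it. Hence the induction ranges over all \<open>f\<close>.\<close>

lemma pull_braids:
  assumes "length \<gamma>s = n"
  shows "set js \<subseteq> {1..<n} \<Longrightarrow> f \<in> Hom n scaleM \<Longrightarrow>
    f \<circ> foldr (\<lambda>i t. braid n i \<circ> t) js id \<in> Hom n scaleM \<and>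
    pull scaleM k (map (component (CM k)) \<gamma>s) (f \<circ> foldr (\<lambda>i t. braid n i \<circ> t) js id)
      = pull scaleM k (map (component (CM k)) (foldr braid_act js \<gamma>s)) f"
proof -
  define Q where "Q js f \<longleftrightarrow> (f \<circ> foldr (\<lambda>i t. braid n i \<circ> t) js id \<in> Hom n scaleM \<and>
    pull scaleM k (map (component (CM k)) \<gamma>s) (f \<circ> foldr (\<lambda>i t. braid n i \<circ> t) js id)
      = pull scaleM k (map (component (CM k)) (foldr braid_act js \<gamma>s)) f)" for js f
  have "Q js f" if "set js \<subseteq> {1..<n}" "f \<in> Hom n scaleM" for js f
    using that
  proof (induct js arbitrary: f)
    case Nil
    then show ?case by (simp add: Q_def)
  next
    case (Cons i js)
    let ?t = "foldr (\<lambda>i t. braid n i \<circ> t) js id" and ?\<gamma> = "foldr braid_act js \<gamma>s"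
    have l: "length ?\<gamma> = n" using assms by (simp add: length_foldr_braid_act)
    have "1 \<le> i" "i < length ?\<gamma>" using Cons(2) l by auto
    then obtain pre x y post where s: "?\<gamma> = pre @ x # y # post" "i = Suc (length pre)"
      using two_positions[of i ?\<gamma>] by metis
    have C: "\<forall>g\<in>set (map (component (CM k)) pre @ component (CM k) x # component (CM k) y # map (component (CM k)) post). coalgebra_map k g"
      by (auto simp: component_CM)
    have n: "n = Suc (Suc (length (map (component (CM k)) pre) + length (map (component (CM k)) post)))" using l s by simp
    note P = pull_braid[OF vsM C n Cons(3)]
    have fb: "f \<circ> braid n i \<in> Hom n scaleM" using P(1) s by simp
    have "Q js (f \<circ> braid n i)" by (rule Cons(1)[OF _ fb]) (use Cons(2) in auto)
    moreover have "pull scaleM k (map (component (CM k)) ?\<gamma>) (f \<circ> braid n i) = pull scaleM k (map (component (CM k)) (braid_act i ?\<gamma>)) f"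
      using P(2) by (simp add: s component_conj)
    ultimately show ?case by (simp add: Q_def o_assoc)
  qed
  then show "set js \<subseteq> {1..<n} \<Longrightarrow> f \<in> Hom n scaleM \<Longrightarrow>
    f \<circ> foldr (\<lambda>i t. braid n i \<circ> t) js id \<in> Hom n scaleM \<and>
    pull scaleM k (map (component (CM k)) \<gamma>s) (f \<circ> foldr (\<lambda>i t. braid n i \<circ> t) js id)
      = pull scaleM k (map (component (CM k)) (foldr braid_act js \<gamma>s)) f"
    by (simp only: Q_def)
qed

text \<open>At the coordinates the composite with a product of braids is a pullback of
  \<open>f\<close>, which is why it stays in \<open>Reg\<close>.\<close>

lemma Ev_T\<sigma>:
  assumes w: "w \<in> shuffle_perms p (p + q)" and f: "f \<in> carrier (Reg (p + q))"
  shows "f \<circ> T\<^sub>\<sigma> (p + q) w \<in> carrier (Reg (p + q))"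
    "length \<gamma>s = p + q \<Longrightarrow> Ev k (f \<circ> T\<^sub>\<sigma> (p + q) w) \<gamma>s = Ev k f (foldr braid_act (SOME is. reduced_decomposition (p + q) w is) \<gamma>s)"
proof -
  let ?n = "p + q" and ?is = "SOME is. reduced_decomposition (p + q) w is"
  note R = reduced_shuffle(1)[OF w]
  obtain \<gamma>s where \<gamma>: "length \<gamma>s = ?n" "map (component (CM ?n)) \<gamma>s = coords ?n" using coords_component by blast
  note P = pull_braids[OF _ R Reg_Hom[OF f]]
  have "f \<circ> T\<^sub>\<sigma> ?n w = pull scaleM ?n (coords ?n) (f \<circ> T\<^sub>\<sigma> ?n w)"
    unfolding T\<^sub>\<sigma>_def by (rule pull_coords[OF vsM conjunct1[OF P[OF \<gamma>(1)]], symmetric])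
  also have "\<dots> = pull scaleM ?n (map (component (CM ?n)) (foldr braid_act ?is \<gamma>s)) f"
    unfolding T\<^sub>\<sigma>_def \<gamma>(2)[symmetric] by (rule conjunct2[OF P[OF \<gamma>(1)]])
  also have "\<dots> \<in> carrier (Reg ?n)"
  proof (rule pull_in_Reg[OF f])
    show "length (foldr braid_act ?is \<gamma>s) = ?n"
      using \<gamma>(1) by (simp add: length_foldr_braid_act)
  qed
  finally show "f \<circ> T\<^sub>\<sigma> ?n w \<in> carrier (Reg ?n)" .
  show "Ev k (f \<circ> T\<^sub>\<sigma> ?n w) \<gamma>s = Ev k f (foldr braid_act ?is \<gamma>s)" if "length \<gamma>s = ?n" for \<gamma>s
    unfolding Ev_def T\<^sub>\<sigma>_def conjunct2[OF P[OF that]] ..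
qed

lemma \<phi>\<^sub>\<sigma>:
  assumes f: "f \<in> carrier (Reg (p + q))"
  shows "\<phi>\<^sub>\<sigma> (p + q) f p \<in> carrier (Reg (p + q))"
    "length as = p \<Longrightarrow> length bs = q \<Longrightarrow> Ev k (\<phi>\<^sub>\<sigma> (p + q) f p) (as @ bs) = Sh (Ev k f) as bs"
proof -
  let ?n = "p + q"
  interpret comm_group "Reg ?n" by (rule comm_group_Reg)
  let ?h = "\<lambda>w. (f [^]\<^bsub>Reg ?n\<^esub> sign w) \<circ> T\<^sub>\<sigma> ?n w"
  have fin: "finite (shuffle_perms p ?n)"
    by (rule finite_subset[OF _ finite_permutations[of "{1..?n}"]]) (auto simp: shuffle_perms_def)
  have h: "?h \<in> shuffle_perms p ?n \<rightarrow> carrier (Reg ?n)"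
    using f by (auto intro!: Ev_T\<sigma>(1) Reg_pow_in)
  have \<phi>: "\<phi>\<^sub>\<sigma> ?n f p = finprod (Reg ?n) ?h (shuffle_perms p ?n)"
    by (simp add: \<phi>\<^sub>\<sigma>_def)
  show "\<phi>\<^sub>\<sigma> ?n f p \<in> carrier (Reg ?n)" unfolding \<phi> by (rule finprod_closed[OF h])
  assume l: "length as = p" "length bs = q"
  have "Ev k (?h w) (as @ bs) = (if sign w = 1 then id else uminus)
     (Ev k f (foldr braid_act (SOME is. reduced_decomposition ?n w is) (as @ bs)))" if w: "w \<in> shuffle_perms p ?n" for w
  proof -
    have s: "sign w = 1 \<or> sign w = (-1::int)" by (simp add: sign_def)
    have "Ev k (?h w) (as @ bs) = Ev k (f [^]\<^bsub>Reg ?n\<^esub> sign w) (foldr braid_act (SOME is. reduced_decomposition ?n w is) (as @ bs))"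
      using l by (intro Ev_T\<sigma>(2)[OF w Reg_pow_in[OF f]]) simp
    then show ?thesis
      using s Ev_pow[OF f, of "foldr braid_act (SOME is. reduced_decomposition ?n w is) (as @ bs)" k 0]
        Ev_pow[OF f, of "foldr braid_act (SOME is. reduced_decomposition ?n w is) (as @ bs)" k 1] l
      by (auto simp: length_foldr_braid_act sg_def)
  qed
  then show "Ev k (\<phi>\<^sub>\<sigma> ?n f p) (as @ bs) = Sh (Ev k f) as bs"
    unfolding \<phi> using l by (simp add: Ev_finprod[OF fin h] sum_shuffle_perms[OF l, symmetric])
qed

end

subsection \<open>The differential \<open>\<delta>\<close>\<close>

lemma prod_list_ends:
  fixes f :: "'x \<Rightarrow> 'y \<Rightarrow> 'm::comm_monoid_mult"
  assumes "length L = q + 2"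
  shows "prod_list (map2 f (A # map h [1..<Suc q] @ [B]) L)
    = f A (L ! 0) * (\<Prod>i=1..q. f (h i) (L ! i)) * f B (L ! (q + 1))"
proof -
  obtain x L' where L: "L = x # L'" "length L' = q + 1" using assms by (cases L) auto
  obtain L'' y where L': "L' = L'' @ [y]" "length L'' = q" using L(2) by (cases L' rule: rev_cases) auto
  have "map2 f (map h [1..<Suc q]) L'' = map (\<lambda>i. f (h i) (L ! i)) [1..<Suc q]"
    by (rule nth_equalityI) (simp_all add: L L' nth_append del: upt_Suc)
  moreover have "(\<Prod>i=1..q. f (h i) (L ! i)) = prod_list (map (\<lambda>i. f (h i) (L ! i)) [1..<Suc q])"
    by (subst prod.distinct_set_conv_list[symmetric]) (auto simp: atLeastLessThanSuc_atLeastAtMost simp del: upt_Suc)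
  ultimately show ?thesis
    using L' by (simp add: L nth_append mult.assoc del: upt_Suc)
qed

context coalgebra
begin

lemma legs_nth: "i < k \<Longrightarrow> legs k \<alpha> ! i = leg (Suc i) \<alpha>"
  by (simp add: legs_def)

lemma length_legs [simp]: "length (legs k \<alpha>) = k"
  by (simp add: legs_def)

lemma length_leg [simp]: "length (leg i \<alpha>) = length \<alpha>"
  by (simp add: leg_def)

lemma set_legs: "l \<in> set (legs k \<alpha>) \<Longrightarrow> length l = length \<alpha>"
  by (auto simp: legs_def)

lemma sweedler_cong:
  "(\<And>\<alpha>. map length \<alpha> = map fst xs \<Longrightarrow> g \<alpha> = g' \<alpha>) \<Longrightarrow> sweedler s xs g = sweedler s xs g'"
proof (induct xs arbitrary: g g')
  case (Cons x xs)
  have "lift scale s (fst x) (\<lambda>c. sweedler s xs (\<lambda>cs. g (c # cs))) = lift scale s (fst x) (\<lambda>c. sweedler s xs (\<lambda>cs. g' (c # cs)))"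
    by (rule lift_cong, rule Cons.hyps, rule Cons.prems) simp
  then show ?case by simp
qed simp

lemma lin_MSL_param:
  assumes "vector_space s1" "vector_space s"
    and "\<And>L. length L = k \<Longrightarrow> (\<forall>l\<in>set L. length l = length as) \<Longrightarrow> lin s1 s (\<lambda>z. H z L)"
  shows "lin s1 s (\<lambda>z. MSL s k as (H z))"
  using assms(3)
proof (induct k arbitrary: as H)
  case 0
  then show ?case by (simp add: lin_comp[OF _ lin_scale[OF assms(2)]])
next
  case (Suc k)
  show ?case
    unfolding MSL.simps by (rule lin_SWL[OF assms(1,2)], rule Suc.hyps, rule Suc.prems) auto
qed

lemma legwise_MSL_param:
  assumes "vector_space s"
    and "\<And>X. length X = k \<Longrightarrow> (\<forall>l\<in>set X. length l = length xs) \<Longrightarrow> legwise_multilinear s j n (\<lambda>N. H N X)"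
  shows "legwise_multilinear s j n (\<lambda>N. MSL s k xs (H N))"
  unfolding legwise_multilinear_def
  by (intro allI impI multilinear_MSL_param vs assms(1)) (use assms(2) in \<open>simp add: legwise_multilinear_def\<close>)

lemma sweedler_sweedler_legs:
  assumes s: "vector_space s"
    and X: "\<And>X. length X = k \<Longrightarrow> (\<forall>l\<in>set X. length l = length xs) \<Longrightarrow> legwise_multilinear s j (length as) (\<lambda>N. H N X)"
    and N: "\<And>N. length N = j \<Longrightarrow> (\<forall>l\<in>set N. length l = length as) \<Longrightarrow> legwise_multilinear s k (length xs) (H N)"
  shows "sweedler s (map (Pair j) as) (\<lambda>\<alpha>. sweedler s (map (Pair k) xs) (\<lambda>\<xi>. H (legs j \<alpha>) (legs k \<xi>)))
    = MSL s j as (\<lambda>N. MSL s k xs (H N))"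
proof -
  have "sweedler s (map (Pair j) as) (\<lambda>\<alpha>. sweedler s (map (Pair k) xs) (\<lambda>\<xi>. H (legs j \<alpha>) (legs k \<xi>)))
     = sweedler s (map (Pair j) as) (\<lambda>\<alpha>. MSL s k xs (H (legs j \<alpha>)))"
  proof (rule sweedler_cong)
    fix \<alpha> :: "'a list list" assume "map length \<alpha> = map fst (map (Pair j) as)"
    then have "length \<alpha> = length as" by (metis length_map)
    then show "sweedler s (map (Pair k) xs) (\<lambda>\<xi>. H (legs j \<alpha>) (legs k \<xi>)) = MSL s k xs (H (legs j \<alpha>))"
      by (intro sweedler_legs s N) (auto dest: set_legs)
  qed
  also have "\<dots> = MSL s j as (\<lambda>N. MSL s k xs (H N))"
    by (intro sweedler_legs s legwise_MSL_param X) auto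
  finally show ?thesis .
qed

end

context cocommutative_hopf_algebra
begin

lemma sweedler_conv:
  fixes s :: "'k \<Rightarrow> 'm::{comm_ring,comm_monoid_mult} \<Rightarrow> 'm"
  assumes alg: "k_algebra s" and Fs: "set Fs \<subseteq> Hom n s" "length as = n"
  shows "sweedler s (map (Pair (length Fs)) as) (\<lambda>\<alpha>. prod_list (map2 (\<lambda>F l. F (T l)) Fs (legs (length Fs) \<alpha>)))
    = foldr (\<otimes>\<^bsub>conv n s\<^esub>) Fs \<one>\<^bsub>conv n s\<^esub> (T as)"
proof -
  have s: "vector_space s" using alg by (simp add: k_algebra_def)
  have eq: "prod_list (map2 (\<lambda>F l. F (T l)) Fs L) = prod_apply (map (\<lambda>F l. F (T l)) Fs) L" for L
    unfolding zip_map1 map_map by (rule arg_cong[where f = prod_list], rule map_cong) auto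
  have "legwise_multilinear s (length (map (\<lambda>F l. F (T l)) Fs)) n
     (\<lambda>L. prod_apply (map (\<lambda>F l. F (T l)) Fs) L)"
    using Fs by (intro legwise_prod alg) (auto intro: Hom_multilinear[OF s])
  then have "legwise_multilinear s (length Fs) (length as) (\<lambda>L. prod_list (map2 (\<lambda>F l. F (T l)) Fs L))"
    unfolding eq by (simp add: Fs)
  from sweedler_legs[OF s this] show ?thesis by (simp add: MSL_conv[OF alg Fs])
qed

text \<open>Serves the right face at the last index, where the conjugating product is empty.\<close>

lemma ad_one: "ad 1 x = x"
proof -
  have "ad 1 x = SW 1 (\<lambda>u v. antipode u * x * v)" by (rule ad_SW)
  also have "\<dots> = antipode 1 * x * 1"
    by (rule SW_one[OF vs]) (intro lin_comp[OF lin_comp[OF antipode_linear lin_mult_right] lin_mult_right] lin_mult_left)+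
  also have "antipode 1 = 1"
  proof -
    have "SW 1 (\<lambda>u v. antipode u * v) = antipode 1 * 1"
      by (rule SW_one[OF vs]) (intro lin_comp[OF antipode_linear lin_mult_right] lin_mult_left)+
    moreover have "scale 1 1 = (1 :: 'a)" using vs by (simp add: vector_space_def)
    ultimately show ?thesis using antipode_left'[of 1] by (simp add: counit_one)
  qed
  finally show ?thesis by simp
qed

end

context commutative_bimodule_algebra
begin

lemma face_values:
  assumes "f \<in> carrier (Reg m)"
  shows "length l = Suc m \<Longrightarrow> faceL scaleM lact 0 m f (tens l) = hd l \<rightharpoonup> f (tens (tl l))"
    "length l = Suc m \<Longrightarrow> faceR scaleM ractl m m f (tens l) = f (tens (butlast l)) \<leftharpoonup> last l"
    "length l = Suc m \<Longrightarrow> 1 \<le> i \<Longrightarrow> i \<le> m \<Longrightarrow> faceM scaleM i m f (tens l) = f (tens (contract i l))"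
proof -
  note f = Reg_Hom[OF assms]
  show "faceL scaleM lact 0 m f (tens l) = hd l \<rightharpoonup> f (tens (tl l))" if l: "length l = Suc m"
  proof -
    have "faceL scaleM lact 0 m f (tens l) = SW (l ! 0) (\<lambda>u v. u \<rightharpoonup> scaleM (counit v) (f (tens (drop 1 l))))"
      using faceL(2)[OF measuring_lact f _ l, of 0] by simp
    also have "\<dots> = SW (l ! 0) (\<lambda>u v. scaleM (counit v) (u \<rightharpoonup> f (tens (drop 1 l))))"
      using lact_linear_right by (simp add: lin_iff)
    also have "\<dots> = l ! 0 \<rightharpoonup> f (tens (drop 1 l))"
      by (rule SW_counit_right) (rule lact_linear_left)
    finally show ?thesis using l by (cases l) auto
  qed
  show "faceR scaleM ractl m m f (tens l) = f (tens (butlast l)) \<leftharpoonup> last l" if l: "length l = Suc m"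
  proof -
    have "last l = l ! m" "butlast l = take m l" using l by (cases l rule: rev_cases; simp add: nth_append)+
    then show ?thesis using faceR(2)[OF measuring_ract f _ l, of m] l by (simp add: ad_one)
  qed
  show "faceM scaleM i m f (tens l) = f (tens (contract i l))" if "length l = Suc m" "1 \<le> i" "i \<le> m"
    using faceM(2)[OF measuring_lact f that(2,3,1)] .
qed

lemma Reg_foldr: "foldr (\<otimes>\<^bsub>Reg n\<^esub>) Fs \<one>\<^bsub>Reg n\<^esub>
    = foldr (\<otimes>\<^bsub>conv n scaleM\<^esub>) Fs \<one>\<^bsub>conv n scaleM\<^esub>"
  by (simp add: Reg regular_simps)

text \<open>With an empty second block the twist disappears, and the factors of
  \<open>\<delta>\<close> are the faces of \<open>facesX\<close>.\<close>

lemma \<delta>_DX: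
  assumes f: "f \<in> carrier (Reg m)"
  shows "\<delta> m f = DX m m f"
  unfolding \<delta>_def
proof (rule lift_eq[OF vs vsM Reg_Hom])
  show "DX m m f \<in> carrier (Reg (m + 1))" using DX_in[OF f, of m] by simp
  fix as :: "'a list" assume as: "length as = m + 1"
  let ?Fs = "facesX m m f"
  have k: "length ?Fs = m + 2" by (simp add: facesX_def)
  have Fs: "set ?Fs \<subseteq> Hom (m + 1) scaleM" using facesX_in[OF f, of m] Reg_Hom by fastforce
  have "DX m m f (tens as) = sweedler scaleM (map (Pair (m + 2)) as)
      (\<lambda>\<alpha>. prod_list (map2 (\<lambda>F l. F (tens l)) ?Fs (legs (m + 2) \<alpha>)))"
    using sweedler_conv[OF algM Fs as] by (simp add: k DX_def Reg_foldr)
  also have "\<dots> = sweedler scaleM (map (Pair (m + 2)) as) (\<lambda>\<alpha>.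
      (hd (leg 1 \<alpha>) \<rightharpoonup> f (tens (tl (leg 1 \<alpha>)))) *
      (\<Prod>i=1..m. (f [^]\<^bsub>Reg m\<^esub> ((-1) ^ i :: int)) (tens (contract i (leg (i + 1) \<alpha>)))) *
      ((f [^]\<^bsub>Reg m\<^esub> ((-1) ^ (m + 1) :: int)) (tens (butlast (leg (m + 2) \<alpha>))) \<leftharpoonup> last (leg (m + 2) \<alpha>)))"
  proof (rule sweedler_cong)
    fix \<alpha> :: "'a list list" assume "map length \<alpha> = map fst (map (Pair (m + 2)) as)"
    then have "length \<alpha> = length as" by (metis length_map)
    then have \<alpha>: "length \<alpha> = Suc m" using as by simp
    show "prod_list (map2 (\<lambda>F l. F (tens l)) ?Fs (legs (m + 2) \<alpha>)) =
      (hd (leg 1 \<alpha>) \<rightharpoonup> f (tens (tl (leg 1 \<alpha>)))) *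
      (\<Prod>i=1..m. (f [^]\<^bsub>Reg m\<^esub> ((-1) ^ i :: int)) (tens (contract i (leg (i + 1) \<alpha>)))) *
      ((f [^]\<^bsub>Reg m\<^esub> ((-1) ^ (m + 1) :: int)) (tens (butlast (leg (m + 2) \<alpha>))) \<leftharpoonup> last (leg (m + 2) \<alpha>))"
      unfolding facesX_def
      by (subst prod_list_ends) (simp_all add: legs_nth \<alpha> face_values f Reg_pow_in del: upt_Suc)
  qed
  finally show "DX m m f (tens as) = \<dots>" .
qed

end

subsection \<open>The isomorphism \<open>\<Lambda>\<close>\<close>

lemma linear_maps_UNIV: "f \<in> linear_maps sV sW n W \<Longrightarrow> f \<in> linear_maps sV sW n UNIV"
  by (auto simp: linear_maps_def)

lemma linear_maps_into:
  "f \<in> linear_maps sV sW n UNIV \<Longrightarrow> (\<And>t. t \<in> tensor_power sV n \<Longrightarrow> f t \<in> W) \<Longrightarrow> f \<in> linear_maps sV sW n W"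
  by (auto simp: linear_maps_def)

lemma lin_fscale:
  "vector_space s1 \<Longrightarrow> vector_space s \<Longrightarrow> (\<And>t. lin s1 s (\<lambda>z. f z t)) \<Longrightarrow> lin s1 (fscale s) f"
  by (simp add: lin_iff vector_space_fscale fun_eq_iff) (simp add: fscale_def)

lemma lin_eval: "vector_space s \<Longrightarrow> lin (fscale s) s (\<lambda>f. f t)"
  by (simp add: lin_iff vector_space_fscale) (simp add: fscale_def)

lemma linear_maps_closed_zero: "vector_space sW \<Longrightarrow> 0 \<in> linear_maps sV sW n UNIV"
  by (simp add: linear_maps_def scale_zero_right)

lemma linear_maps_closed_add:
  "vector_space sW \<Longrightarrow> f \<in> linear_maps sV sW n UNIV \<Longrightarrow> g \<in> linear_maps sV sW n UNIV \<Longrightarrow> f + g \<in> linear_maps sV sW n UNIV"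
  by (simp add: linear_maps_def vector_space_def algebra_simps)

lemma linear_maps_closed_scale:
  assumes "vector_space sW" "f \<in> linear_maps sV sW n UNIV"
  shows "fscale sW c f \<in> linear_maps sV sW n UNIV"
proof -
  have "lin sW sW (sW c)" using assms(1) by (rule lin_scale)
  then show ?thesis using linear_maps_comp[OF _ assms(2)] by (simp add: fscale_def)
qed

context
  fixes s :: "'k::field \<Rightarrow> 'v::ab_group_add \<Rightarrow> 'v"
  assumes s: "vector_space s"
begin

lemma tprod_left:
  "t \<in> tensor_power s m \<Longrightarrow> t' \<in> tensor_power s m \<Longrightarrow> tprod s m n (t + t') u = tprod s m n t u + tprod s m n t' u"
  "t \<in> tensor_power s m \<Longrightarrow> tprod s m n (fscale (*) c t) u = fscale (*) c (tprod s m n t u)"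
  using lift_in[OF s vector_space_tens2 multilinear_tprod(1)[OF s, of m n u]]
  by (simp_all add: tprod_def linear_maps_add linear_maps_scale)

lemma tprod_right_linear:
  assumes "t \<in> tensor_power s m"
  shows "tprod s m n t \<in> linear_maps s (fscale (*)) n (tensor_power s (m + n))"
  using assms
proof (induct rule: tensor_power_induct)
  case zero
  have z: "tprod s m n 0 u = 0" for u
    using lift_in[OF s vector_space_tens2 multilinear_tprod(1)[OF s, of m n u]] by (simp add: tprod_def linear_maps_zero)
  show ?case
    unfolding linear_maps_def z by (intro CollectI conjI ballI allI impI tensor_power_zero)
      (simp_all only: scale_zero_right[OF vector_space_tens2] add_0_right)
next
  case (step c xs y)
  let ?f = "lift s (fscale (*)) n (\<lambda>ys. tensor s (xs @ ys))"
  note xs = step(1) and x = tensor_in[OF step(1), of s]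
  note f = lift_in[OF s vector_space_tens2 multilinear_tprod(2)[OF s step(1), of n]]
  have e: "tprod s m n (fscale (*) c (tensor s xs) + y) u = fscale (*) c (?f u) + tprod s m n y u" for u
    using tprod_left(1)[OF tensor_power_scale[OF x] step(2)] tprod_left(2)[OF x] tprod_right[OF s step(1)] by simp
  have i: "?f u \<in> tensor_power s (m + n)" if "u \<in> tensor_power s n" for u
    using that
  proof (induct rule: tensor_power_induct)
    case zero
    show ?case unfolding linear_maps_zero[OF f] by (rule tensor_power_zero)
  next
    case (step c ys z)
    note ys = tensor_in[OF step(1), of s]
    have "?f (fscale (*) c (tensor s ys) + z) = fscale (*) c (tensor s (xs @ ys)) + ?f z"
      using lift_tensor[OF s vector_space_tens2 multilinear_tprod(2)[OF s xs] step(1)]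
      by (simp only: linear_maps_add[OF f tensor_power_scale[OF ys] step(2)] linear_maps_scale[OF f ys])
    then show ?case
      by (simp only:) (intro tensor_power_add tensor_power_scale tensor_in step(3), simp add: step(1) xs)
  qed
  have g: "(\<lambda>u. fscale (*) c (?f u)) + tprod s m n y \<in> linear_maps s (fscale (*)) n UNIV"
    by (intro linear_maps_closed_add vector_space_tens2 linear_maps_comp[OF lin_scale f] linear_maps_UNIV[OF step(3)])
  have y: "tprod s m n y u \<in> tensor_power s (m + n)" if "u \<in> tensor_power s n" for u
    using step(3) that by (simp add: linear_maps_def)
  have "(\<lambda>u. fscale (*) c (?f u)) + tprod s m n y \<in> linear_maps s (fscale (*)) n (tensor_power s (m + n))"
  proof (rule linear_maps_into[OF g])
    fix u assume "u \<in> tensor_power s n"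
    then show "((\<lambda>u. fscale (*) c (?f u)) + tprod s m n y) u \<in> tensor_power s (m + n)"
      unfolding plus_fun_apply[of _ _ u] by (intro tensor_power_add tensor_power_scale i y)
  qed
  moreover have "tprod s m n (fscale (*) c (tensor s xs) + y) = (\<lambda>u. fscale (*) c (?f u)) + tprod s m n y"
    by (rule ext) (simp only: e plus_fun_apply)
  ultimately show ?case by (simp only:)
qed

lemma tprod_in: "t \<in> tensor_power s m \<Longrightarrow> u \<in> tensor_power s n \<Longrightarrow> tprod s m n t u \<in> tensor_power s (m + n)"
  using tprod_right_linear[of t m n] by (simp add: linear_maps_def)

end

context commutative_bimodule_algebra
begin

abbreviation W :: "nat \<Rightarrow> (('a, 'k) tens \<Rightarrow> 'm) monoid"
  where "W p \<equiv> conv p scaleM"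

abbreviation E :: "nat \<Rightarrow> nat \<Rightarrow> (('a, 'k) tens \<Rightarrow> ('a, 'k) tens \<Rightarrow> 'm) monoid"
  where "E q p \<equiv> conv_monoid q (fscale scaleM) (W p)"

lemma vsW: "vector_space (fscale scaleM)"
  by (rule vector_space_fscale[OF vsM])

lemma C_units: "C q p = units_of (E q p)"
  by (simp add: C_def M_monoid)

lemma \<Lambda>_tens: "length a = p \<Longrightarrow> length b = q \<Longrightarrow> \<Lambda> p q F (tens b) (tens a) = F (tens (a @ b))"
  by (simp add: \<Lambda>_def tensor_in tprod_tensor[OF vs])

lemma \<Lambda>_Hom:
  assumes F: "F \<in> Hom (p + q) scaleM"
  shows "\<Lambda> p q F b \<in> Hom p scaleM"
proof (cases "b \<in> tensor_power scaleA q")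
  case True
  have e: "\<Lambda> p q F b a = (if a \<in> tensor_power scaleA p then F (tprod scaleA p q a b) else 0)" for a
    using True by (simp add: \<Lambda>_def)
  show ?thesis
    unfolding linear_maps_def e
    using True by (auto simp: tensor_power_add tensor_power_scale tprod_left[OF vs]
        linear_maps_add[OF F] linear_maps_scale[OF F] tprod_in[OF vs])
next
  case False
  then have "\<Lambda> p q F b = 0" by (auto simp: \<Lambda>_def)
  then show ?thesis by (simp only: linear_maps_closed_zero[OF vsM])
qed

lemma \<Lambda>_in:
  assumes F: "F \<in> Hom (p + q) scaleM"
  shows "\<Lambda> p q F \<in> carrier (E q p)"
proof -
  note R = tprod_right_linear[OF vs, of _ p q]
  have "\<Lambda> p q F (b + b') = \<Lambda> p q F b + \<Lambda> p q F b'" if b: "b \<in> tensor_power scaleA q" "b' \<in> tensor_power scaleA q" for b b'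
  proof (rule ext)
    fix a
    show "\<Lambda> p q F (b + b') a = (\<Lambda> p q F b + \<Lambda> p q F b') a"
    proof (cases "a \<in> tensor_power scaleA p")
      case True
      then show ?thesis
        using b linear_maps_add[OF R[OF True] b] linear_maps_add[OF F tprod_in[OF vs True b(1)] tprod_in[OF vs True b(2)]]
        by (simp add: \<Lambda>_def tensor_power_add)
    qed (simp add: \<Lambda>_def)
  qed
  moreover have "\<Lambda> p q F (fscale (*) c b) = fscale scaleM c (\<Lambda> p q F b)" if b: "b \<in> tensor_power scaleA q" for b c
  proof (rule ext)
    fix a
    show "\<Lambda> p q F (fscale (*) c b) a = fscale scaleM c (\<Lambda> p q F b) a"
    proof (cases "a \<in> tensor_power scaleA p")
      case True
      then show ?thesis
        using b linear_maps_scale[OF R[OF True] b] linear_maps_scale[OF F tprod_in[OF vs True b]]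
        by (simp add: \<Lambda>_def tensor_power_scale fscale_def[of scaleM])
    qed (simp add: \<Lambda>_def fscale_def[of scaleM])
  qed
  moreover have "\<Lambda> p q F b = 0" if "b \<notin> tensor_power scaleA q" for b
    using that by (auto simp: \<Lambda>_def)
  moreover have "carrier (E q p) = linear_maps scaleA (fscale scaleM) q (Hom p scaleM)"
    by (simp add: conv_monoid_def)
  ultimately show ?thesis using \<Lambda>_Hom[OF F] by (simp add: linear_maps_def)
qed

lemma E_UNIV: "f \<in> carrier (E q p) \<Longrightarrow> f \<in> Hom q (fscale scaleM)"
  by (simp add: conv_monoid_def linear_maps_UNIV)

lemma E_Hom: "f \<in> carrier (E q p) \<Longrightarrow> b \<in> tensor_power scaleA q \<Longrightarrow> f b \<in> Hom p scaleM"
  by (simp add: conv_monoid_def linear_maps_def)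

lemma \<Lambda>_inj:
  assumes "F \<in> Hom (p + q) scaleM" "G \<in> Hom (p + q) scaleM" "\<Lambda> p q F = \<Lambda> p q G"
  shows "F = G"
proof (rule Hom_eqI[OF vsM assms(1,2)])
  fix l :: "'a list" assume l: "length l = p + q"
  have "F (tens (take p l @ drop p l)) = G (tens (take p l @ drop p l))"
    using \<Lambda>_tens[of "take p l" p "drop p l" q] l assms(3) by (metis add_diff_cancel_left' length_drop length_take min.absorb2 le_add1)
  then show "F (tens l) = G (tens l)" by simp
qed

text \<open>The preimage is prescribed on pure tensors by cutting them after \<open>p\<close>
  letters; multilinearity can be checked on the two blocks separately.\<close>

lemma \<Lambda>_surj:
  assumes f: "f \<in> carrier (E q p)"
  shows "\<exists>F\<in>Hom (p + q) scaleM. \<Lambda> p q F = f"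
proof -
  let ?g = "\<lambda>l. f (tens (drop p l)) (tens (take p l))"
  have m: "multilinear scaleA scaleM (p + q) ?g"
    unfolding multilinear_append
  proof (intro conjI allI impI)
    fix ys :: "'a list" assume ys: "length ys = q"
    have "multilinear scaleA scaleM p (\<lambda>xs. f (tens ys) (tens xs))"
      by (rule Hom_multilinear[OF vsM E_Hom[OF f tensor_in[OF ys]]])
    then show "multilinear scaleA scaleM p (\<lambda>xs. ?g (xs @ ys))"
      by (rule iffD1[OF multilinear_cong, rotated]) simp
  next
    fix xs :: "'a list" assume xs: "length xs = p"
    show "multilinear scaleA scaleM q (\<lambda>ys. ?g (xs @ ys))"
      using multilinear_comp[OF lin_eval[OF vsM] Hom_multilinear[OF vsW E_UNIV[OF f]], of "tens xs"] xs by simp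
  qed
  note F = lift_in[OF vs vsM m]
  have "\<Lambda> p q (lift scaleA scaleM (p + q) ?g) = f"
  proof (rule Hom_eqI[OF vsW E_UNIV[OF \<Lambda>_in[OF F]] E_UNIV[OF f]])
    fix bs :: "'a list" assume bs: "length bs = q"
    show "\<Lambda> p q (lift scaleA scaleM (p + q) ?g) (tens bs) = f (tens bs)"
    proof (rule Hom_eqI[OF vsM \<Lambda>_Hom[OF F] E_Hom[OF f tensor_in[OF bs]]])
      fix as :: "'a list" assume as: "length as = p"
      show "\<Lambda> p q (lift scaleA scaleM (p + q) ?g) (tens bs) (tens as) = f (tens bs) (tens as)"
        by (simp add: \<Lambda>_tens[OF as bs] lift_tensor[OF vs vsM m] as bs)
    qed
  qed
  then show ?thesis using F by blast
qed

lemma SWL_eval: "SWL as B t = SWL as (\<lambda>x y. B x y t)"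
  using SWL_additive[of "\<lambda>f. f t" as B] by (simp add: additive_def)

lemma SWL_Hom:
  assumes "\<And>x y. B x y \<in> Hom n scaleM"
  shows "SWL as B \<in> Hom n scaleM"
  using assms
proof (induct as arbitrary: B)
  case (Cons a as)
  have "(\<Sum>(x, y)\<leftarrow>ps. h x y) \<in> Hom n scaleM" if "\<And>x y. h x y \<in> Hom n scaleM" for ps :: "('a \<times> 'a) list" and h
    using that by (induct ps) (auto simp del: zero_fun_def simp: linear_maps_closed_zero[OF vsM] linear_maps_closed_add[OF vsM])
  then show ?case using Cons by (simp add: SW_def)
qed simp

text \<open>The algebra of linear maps from the tensor power is given by a carrier and is not a
  type-class algebra, so the results on \<open>conv\<close> do not apply to \<open>E\<close>; its
  product is examined pointwise instead.\<close>

lemma \<Lambda>_conv_bimultilinear: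
  assumes f: "f \<in> carrier (E q p)" and g: "g \<in> carrier (E q p)"
  shows "bimultilinear q (fscale scaleM) (\<lambda>x y. f (tens x) \<otimes>\<^bsub>W p\<^esub> g (tens y))"
proof -
  have eval: "lin scaleA scaleM (\<lambda>z. h (tens (x[i := z])) t)" if "h \<in> carrier (E q p)" "length x = q" "i < q" for h x i t
    using multilinear_comp[OF lin_eval[OF vsM] Hom_multilinear[OF vsW E_UNIV[OF that(1)]], of t] that(2,3)
    by (simp add: multilinear_def)
  have eq: "f (tens x) \<otimes>\<^bsub>W p\<^esub> g (tens y) = lift scaleA scaleM p (\<lambda>as. SWL as (\<lambda>u v. f (tens x) (tens u) * g (tens y) (tens v)))"
    and ml: "multilinear scaleA scaleM p (\<lambda>as. SWL as (\<lambda>u v. f (tens x) (tens u) * g (tens y) (tens v)))"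
    if "length x = q" "length y = q" for x y
    using E_Hom[OF f tensor_in[OF that(1)]] E_Hom[OF g tensor_in[OF that(2)]]
    by (simp_all add: conv_mult_eq[OF algM] multilinear_SWL[OF vsM] conv_bimultilinear[OF algM])
  show ?thesis
    unfolding bimultilinear_def
  proof (intro conjI allI impI)
    fix y :: "'a list" assume y: "length y = q"
    show "multilinear scaleA (fscale scaleM) q (\<lambda>x. f (tens x) \<otimes>\<^bsub>W p\<^esub> g (tens y))"
      unfolding multilinear_def
    proof (intro allI impI lin_fscale vs vsM)
      fix x :: "'a list" and i t assume x: "length x = q" "i < q"
      have "lin scaleA scaleM (\<lambda>z. lift scaleA scaleM p (\<lambda>as. SWL as (\<lambda>u v. f (tens (x[i := z])) (tens u) * g (tens y) (tens v))) t)"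
        using x y by (intro lift_param_lin vs vsM ml lin_SWL lin_comp[OF eval[OF f] M.lin_mult_right]) auto
      then show "lin scaleA scaleM (\<lambda>z. (f (tens (x[i := z])) \<otimes>\<^bsub>W p\<^esub> g (tens y)) t)"
        using x y by (simp add: eq)
    qed
  next
    fix x :: "'a list" assume x: "length x = q"
    show "multilinear scaleA (fscale scaleM) q (\<lambda>y. f (tens x) \<otimes>\<^bsub>W p\<^esub> g (tens y))"
      unfolding multilinear_def
    proof (intro allI impI lin_fscale vs vsM)
      fix y :: "'a list" and i t assume y: "length y = q" "i < q"
      have "lin scaleA scaleM (\<lambda>z. lift scaleA scaleM p (\<lambda>as. SWL as (\<lambda>u v. f (tens x) (tens u) * g (tens (y[i := z])) (tens v))) t)"
        using x y by (intro lift_param_lin vs vsM ml lin_SWL lin_comp[OF eval[OF g] M.lin_mult_left]) auto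
      then show "lin scaleA scaleM (\<lambda>z. (f (tens x) \<otimes>\<^bsub>W p\<^esub> g (tens (y[i := z]))) t)"
        using x y by (simp add: eq)
    qed
  qed
qed

text \<open>The coproduct of a concatenation splits the two blocks independently, so both sides are
  the same double sum up to the order of summation.\<close>

lemma \<Lambda>_mult:
  assumes F: "F \<in> Hom (p + q) scaleM" and G: "G \<in> Hom (p + q) scaleM"
  shows "\<Lambda> p q (F \<otimes>\<^bsub>W (p + q)\<^esub> G) = \<Lambda> p q F \<otimes>\<^bsub>E q p\<^esub> \<Lambda> p q G"
proof -
  note FG = conv_mult_in[OF algM F G]
  note bm = \<Lambda>_conv_bimultilinear[OF \<Lambda>_in[OF F] \<Lambda>_in[OF G]]
  have "\<Lambda> p q F \<otimes>\<^bsub>E q p\<^esub> \<Lambda> p q G = lift scaleA (fscale scaleM) q (\<lambda>bs. sweedler (fscale scaleM) (map (Pair 2) bs)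
      (\<lambda>\<alpha>. \<Lambda> p q F (tens (leg 1 \<alpha>)) \<otimes>\<^bsub>W p\<^esub> \<Lambda> p q G (tens (leg 2 \<alpha>))))"
    by (simp add: conv_monoid_def[of q])
  also have "\<dots> = lift scaleA (fscale scaleM) q (\<lambda>bs. SWL bs (\<lambda>x y. \<Lambda> p q F (tens x) \<otimes>\<^bsub>W p\<^esub> \<Lambda> p q G (tens y)))"
    by (rule lift_cong, rule sweedler_leg2[OF vsW]) (use bm in simp)
  also have "\<dots> = \<Lambda> p q (F \<otimes>\<^bsub>W (p + q)\<^esub> G)"
  proof (rule lift_eq[OF vs vsW E_UNIV[OF \<Lambda>_in[OF FG]]])
    fix bs :: "'a list" assume bs: "length bs = q"
    show "\<Lambda> p q (F \<otimes>\<^bsub>W (p + q)\<^esub> G) (tens bs) = SWL bs (\<lambda>x y. \<Lambda> p q F (tens x) \<otimes>\<^bsub>W p\<^esub> \<Lambda> p q G (tens y))"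
    proof (rule Hom_eqI[OF vsM \<Lambda>_Hom[OF FG] SWL_Hom[OF conv_mult_in[OF algM \<Lambda>_Hom[OF F] \<Lambda>_Hom[OF G]]]])
      fix as :: "'a list" assume as: "length as = p"
      have "\<Lambda> p q (F \<otimes>\<^bsub>W (p + q)\<^esub> G) (tens bs) (tens as)
         = SWL as (\<lambda>u v. SWL bs (\<lambda>x y. F (tens (u @ x)) * G (tens (v @ y))))"
        by (simp add: \<Lambda>_tens[OF as bs] conv_mult_tensor[OF algM F G] as bs SWL_append)
      also have "\<dots> = SWL bs (\<lambda>x y. SWL as (\<lambda>u v. F (tens (u @ x)) * G (tens (v @ y))))"
        by (rule SWL_swap)
      also have "\<dots> = SWL bs (\<lambda>x y. (\<Lambda> p q F (tens x) \<otimes>\<^bsub>W p\<^esub> \<Lambda> p q G (tens y)) (tens as))"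
        by (rule SWL_cong, subst conv_mult_tensor[OF algM \<Lambda>_Hom[OF F] \<Lambda>_Hom[OF G] as], rule SWL_cong)
          (simp add: \<Lambda>_tens as bs)
      finally show "\<Lambda> p q (F \<otimes>\<^bsub>W (p + q)\<^esub> G) (tens bs) (tens as)
        = SWL bs (\<lambda>x y. \<Lambda> p q F (tens x) \<otimes>\<^bsub>W p\<^esub> \<Lambda> p q G (tens y)) (tens as)"
        unfolding SWL_eval .
    qed
  qed
  finally show ?thesis ..
qed

lemma \<Lambda>_one: "\<Lambda> p q \<one>\<^bsub>W (p + q)\<^esub> = \<one>\<^bsub>E q p\<^esub>"
proof -
  note one = conv_one_in[OF algM, of "p + q"]
  have "\<one>\<^bsub>E q p\<^esub> = lift scaleA (fscale scaleM) q (\<lambda>bs. fscale scaleM (prod_list (map counit bs)) \<one>\<^bsub>W p\<^esub>)"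
    unfolding conv_monoid_def[of q] by simp
  also have "\<dots> = \<Lambda> p q \<one>\<^bsub>W (p + q)\<^esub>"
  proof (rule lift_eq[OF vs vsW E_UNIV[OF \<Lambda>_in[OF one]]])
    fix bs :: "'a list" assume bs: "length bs = q"
    show "\<Lambda> p q \<one>\<^bsub>W (p + q)\<^esub> (tens bs) = fscale scaleM (prod_list (map counit bs)) \<one>\<^bsub>W p\<^esub>"
    proof (rule Hom_eqI[OF vsM \<Lambda>_Hom[OF one] linear_maps_closed_scale[OF vsM conv_one_in[OF algM]]])
      fix as :: "'a list" assume as: "length as = p"
      show "\<Lambda> p q \<one>\<^bsub>W (p + q)\<^esub> (tens bs) (tens as) = fscale scaleM (prod_list (map counit bs)) \<one>\<^bsub>W p\<^esub> (tens as)"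
        by (simp add: \<Lambda>_tens[OF as bs] conv_one_tensor[OF algM] as bs fscale_def[of scaleM] mult.commute)
    qed
  qed
  finally show ?thesis ..
qed

lemma Reg_E_simps:
  "monoid.mult (C q p) = monoid.mult (E q p)" "one (C q p) = one (E q p)"
  "monoid.mult (Reg n) = monoid.mult (W n)" "one (Reg n) = one (W n)"
  by (simp_all add: C_units units_of_def Reg regular_def)

lemma \<Lambda>_image: "\<Lambda> p q ` carrier (Reg (p + q)) = carrier (C q p)"
proof (intro equalityI subsetI)
  fix f assume "f \<in> \<Lambda> p q ` carrier (Reg (p + q))"
  then obtain F where f: "f = \<Lambda> p q F" and F: "F \<in> carrier (Reg (p + q))" by blast
  then obtain F' where F': "F' \<in> Hom (p + q) scaleM" "F \<otimes>\<^bsub>W (p + q)\<^esub> F' = \<one>\<^bsub>W (p + q)\<^esub>" "F' \<otimes>\<^bsub>W (p + q)\<^esub> F = \<one>\<^bsub>W (p + q)\<^esub>"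
    by (auto simp: Reg regular_def units_of_carrier Units_def conv_carrier[OF algM])
  note FH = Reg_Hom[OF F]
  have "\<Lambda> p q F' \<otimes>\<^bsub>E q p\<^esub> \<Lambda> p q F = \<one>\<^bsub>E q p\<^esub>" "\<Lambda> p q F \<otimes>\<^bsub>E q p\<^esub> \<Lambda> p q F' = \<one>\<^bsub>E q p\<^esub>"
    using F' by (simp_all add: \<Lambda>_mult[OF FH F'(1), symmetric] \<Lambda>_mult[OF F'(1) FH, symmetric] \<Lambda>_one)
  then show "f \<in> carrier (C q p)"
    unfolding C_units units_of_carrier Units_def f using \<Lambda>_in[OF FH] \<Lambda>_in[OF F'(1)] by blast
next
  fix f assume "f \<in> carrier (C q p)"
  then obtain g where fg: "f \<in> carrier (E q p)" "g \<in> carrier (E q p)" "f \<otimes>\<^bsub>E q p\<^esub> g = \<one>\<^bsub>E q p\<^esub>" "g \<otimes>\<^bsub>E q p\<^esub> f = \<one>\<^bsub>E q p\<^esub>"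
    by (auto simp: C_units units_of_carrier Units_def)
  obtain F G where F: "F \<in> Hom (p + q) scaleM" "\<Lambda> p q F = f" and G: "G \<in> Hom (p + q) scaleM" "\<Lambda> p q G = g"
    using \<Lambda>_surj[OF fg(1)] \<Lambda>_surj[OF fg(2)] by blast
  have "F \<otimes>\<^bsub>W (p + q)\<^esub> G = \<one>\<^bsub>W (p + q)\<^esub>" "G \<otimes>\<^bsub>W (p + q)\<^esub> F = \<one>\<^bsub>W (p + q)\<^esub>"
    using fg F G by (auto intro!: \<Lambda>_inj conv_mult_in algM conv_one_in simp: \<Lambda>_mult \<Lambda>_one)
  then have "F \<in> carrier (Reg (p + q))"
    unfolding Reg regular_def units_of_carrier Units_def conv_carrier[OF algM] using F(1) G(1) by blast
  then show "f \<in> \<Lambda> p q ` carrier (Reg (p + q))" using F(2) by blast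
qed

lemma \<Lambda>_hom: "\<Lambda> p q \<in> hom (Reg (p + q)) (C q p)"
  by (rule homI) (use \<Lambda>_image[of p q] in \<open>auto simp: Reg_E_simps \<Lambda>_mult Reg_Hom\<close>)

lemma inj_\<Lambda>: "inj_on (\<Lambda> p q) (carrier (Reg (p + q)))"
  by (rule inj_onI) (auto intro: \<Lambda>_inj Reg_Hom)

text \<open>The group laws are transported: \<open>C q p\<close> is the image of the group
  \<open>Reg (p + q)\<close> under the homomorphism \<open>\<Lambda>\<close>.\<close>

lemma group_C: "group (C q p)"
proof -
  have "C q p = (C q p)\<lparr>carrier := \<Lambda> p q ` carrier (Reg (p + q)), one := \<Lambda> p q \<one>\<^bsub>Reg (p + q)\<^esub>\<rparr>"
    by (simp add: \<Lambda>_image Reg_E_simps \<Lambda>_one flip: Reg_E_simps(2))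
  then show ?thesis using group.hom_imp_img_group[OF group_Reg \<Lambda>_hom, of p q] by simp
qed

lemma \<Lambda>_pow: "F \<in> carrier (Reg (p + q)) \<Longrightarrow> \<Lambda> p q F [^]\<^bsub>C q p\<^esub> (k::int) = \<Lambda> p q (F [^]\<^bsub>Reg (p + q)\<^esub> k)"
  by (rule hom_int_pow[OF \<Lambda>_hom _ group_Reg group_C, symmetric])

end

subsection \<open>The differentials \<open>\<D>\<close> and \<open>\<d>\<close>\<close>

lemma prod_map2_append:
  "prod_apply \<phi>s (map2 (@) X N) = prod_apply (map2 (\<lambda>\<phi> x l. \<phi> (x @ l)) \<phi>s X) N"
  "prod_apply \<phi>s (map2 (@) X N) = prod_apply (map2 (\<lambda>\<phi> u l. \<phi> (l @ u)) \<phi>s N) X"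
proof -
  show "prod_apply \<phi>s (map2 (@) X N) = prod_apply (map2 (\<lambda>\<phi> x l. \<phi> (x @ l)) \<phi>s X) N"
  proof (induct \<phi>s arbitrary: X N)
    case (Cons \<phi> \<phi>s)
    then show ?case by (cases X; cases N) auto
  qed simp
  show "prod_apply \<phi>s (map2 (@) X N) = prod_apply (map2 (\<lambda>\<phi> u l. \<phi> (l @ u)) \<phi>s N) X"
  proof (induct \<phi>s arbitrary: X N)
    case (Cons \<phi> \<phi>s)
    then show ?case by (cases X; cases N) auto
  qed simp
qed

context coalgebra
begin

lemma legwise_append:
  assumes H: "legwise_multilinear s k (q + n) H"
  shows "length X = k \<Longrightarrow> \<forall>l\<in>set X. length l = q \<Longrightarrow> legwise_multilinear s k n (\<lambda>N. H (map2 (@) X N))"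
    and "length N = k \<Longrightarrow> \<forall>l\<in>set N. length l = n \<Longrightarrow> legwise_multilinear s k q (\<lambda>X. H (map2 (@) X N))"
proof -
  have len: "length (map2 (@) X N) = k" "\<forall>l\<in>set (map2 (@) X N). length l = q + n"
    if "length X = k" "\<forall>l\<in>set X. length l = q" "length N = k" "\<forall>l\<in>set N. length l = n" for X N :: "'a list list"
    using that by (auto simp: set_zip all_set_conv_all_nth)
  have upd: "map2 (@) X (N[i := l]) = (map2 (@) X N)[i := X ! i @ l]" "map2 (@) (X[i := l]) N = (map2 (@) X N)[i := l @ N ! i]"
    if "length X = k" "length N = k" for X N :: "'a list list" and i l
    using zip_update[of X i "X ! i" N l] zip_update[of X i l N "N ! i"] by (simp_all add: map_update)
  show "legwise_multilinear s k n (\<lambda>N. H (map2 (@) X N))" if X: "length X = k" "\<forall>l\<in>set X. length l = q"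
    unfolding legwise_multilinear_def
  proof (intro allI impI)
    fix N :: "'a list list" and i assume N: "length N = k" "\<forall>l\<in>set N. length l = n" and i: "i < k"
    have "multilinear scale s (q + n) (\<lambda>l. H ((map2 (@) X N)[i := l]))"
      using H len[OF X N] i by (auto simp: legwise_multilinear_def)
    then show "multilinear scale s n (\<lambda>l. H (map2 (@) X (N[i := l])))"
      unfolding upd[OF X(1) N(1)] multilinear_append using X i by auto
  qed
  show "legwise_multilinear s k q (\<lambda>X. H (map2 (@) X N))" if N: "length N = k" "\<forall>l\<in>set N. length l = n"
    unfolding legwise_multilinear_def
  proof (intro allI impI)
    fix X :: "'a list list" and i assume X: "length X = k" "\<forall>l\<in>set X. length l = q" and i: "i < k"
    have "multilinear scale s (q + n) (\<lambda>l. H ((map2 (@) X N)[i := l]))"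
      using H len[OF X N] i by (auto simp: legwise_multilinear_def)
    then show "multilinear scale s q (\<lambda>l. H (map2 (@) (X[i := l]) N))"
      unfolding upd[OF X(1) N(1)] multilinear_append using N i by auto
  qed
qed

lemma legwise_multilinear_cong:
  "(\<And>L. length L = k \<Longrightarrow> \<forall>l\<in>set L. length l = n \<Longrightarrow> H L = H' L) \<Longrightarrow> legwise_multilinear s k n H \<Longrightarrow> k = k' \<Longrightarrow> legwise_multilinear s k' n H'"
  unfolding legwise_multilinear_def
proof (intro allI impI)
  fix L :: "'a list list" and i
  assume eq: "\<And>L. length L = k \<Longrightarrow> \<forall>l\<in>set L. length l = n \<Longrightarrow> H L = H' L" and k: "k = k'"
    and H: "\<forall>L i. length L = k \<longrightarrow> (\<forall>l\<in>set L. length l = n) \<longrightarrow> i < k \<longrightarrow> multilinear scale s n (\<lambda>l. H (L[i := l]))"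
    and L: "length L = k'" "\<forall>l\<in>set L. length l = n" "i < k'"
  have "H (L[i := l]) = H' (L[i := l])" if "length l = n" for l
    using L that k by (intro eq) (auto dest!: set_update_subset_insert[THEN subsetD])
  then show "multilinear scale s n (\<lambda>l. H' (L[i := l]))"
    using H[rule_format, of L i] L k by (simp add: multilinear_cong[of n "\<lambda>l. H' (L[i := l])" "\<lambda>l. H (L[i := l])"])
qed

lemma legwise_comp:
  assumes h: "lin s s' h" and H: "legwise_multilinear s k n H"
  shows "legwise_multilinear s' k n (\<lambda>L. h (H L))"
  unfolding legwise_multilinear_def
proof (intro allI impI)
  fix L :: "'a list list" and i
  assume L: "length L = k" "\<forall>l\<in>set L. length l = n" "i < k"
  show "multilinear scale s' n (\<lambda>l. h (H (L[i := l])))"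
    by (rule multilinear_comp[OF h H[unfolded legwise_multilinear_def, rule_format, OF L(1) _ L(3)]]) (use L in auto)
qed

lemma multilinear_slot_lin:
  assumes "multilinear s1 s n g" "n = length pre + Suc (length post)"
  shows "lin s1 s (\<lambda>w. g (pre @ w # post))"
proof -
  have "lin s1 s (\<lambda>w. g ((pre @ 0 # post)[length pre := w]))"
    using assms(1)[unfolded multilinear_def, rule_format, of "pre @ 0 # post" "length pre"] assms(2) by simp
  then show ?thesis by simp
qed

lemma linear_maps_MS:
  assumes f: "f \<in> linear_maps sV sW n UNIV" and h: "\<And>c. length c = k \<Longrightarrow> h c \<in> tensor_power sV n"
  shows "f (MS (fscale (*)) k a h) = MS sW k a (\<lambda>c. f (h c)) \<and> MS (fscale (*)) k a h \<in> tensor_power sV n"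
  using h
proof (induct k arbitrary: a h)
  case 0
  then show ?case by (simp add: linear_maps_scale[OF f] tensor_power_scale)
next
  case (Suc k)
  have "f (MS (fscale (*)) k y (\<lambda>c. h (x # c))) = MS sW k y (\<lambda>c. f (h (x # c)))
     \<and> MS (fscale (*)) k y (\<lambda>c. h (x # c)) \<in> tensor_power sV n" for x y
    by (rule Suc.hyps) (simp add: Suc.prems)
  then show ?case by (simp add: linear_maps_SW[OF f] SW_tensor_power)
qed

end

context cocommutative_hopf_algebra
begin

lemma legwise_prod_end:
  fixes s :: "'k \<Rightarrow> 'm::{comm_ring,comm_monoid_mult} \<Rightarrow> 'm"
  assumes alg: "k_algebra s" and "\<forall>\<phi>\<in>set \<phi>s. multilinear scale s n \<phi>" and G: "legwise_multilinear s j n G"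
  shows "legwise_multilinear s (length \<phi>s + j) n (\<lambda>L. prod_apply \<phi>s L * G (drop (length \<phi>s) L))"
  using assms(2)
proof (induct \<phi>s)
  case Nil
  then show ?case using G by simp
next
  case (Cons \<phi> \<phi>s)
  note lin_mult_left = k_algebra.lin_mult_left[OF alg] and lin_mult_right = k_algebra.lin_mult_right[OF alg]
  have "legwise_multilinear s (Suc (length \<phi>s + j)) n (\<lambda>L. prod_apply (\<phi> # \<phi>s) L * G (drop (Suc (length \<phi>s)) L))"
  proof (rule legwise_SucI)
    fix L :: "'a list list"
    show "multilinear scale s n (\<lambda>l. prod_apply (\<phi> # \<phi>s) (l # L) * G (drop (Suc (length \<phi>s)) (l # L)))"
      using multilinear_comp[OF lin_mult_right, of scale n \<phi>] Cons(2) by (simp add: mult.assoc)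
  next
    fix l :: "'a list"
    show "legwise_multilinear s (length \<phi>s + j) n (\<lambda>L. prod_apply (\<phi> # \<phi>s) (l # L) * G (drop (Suc (length \<phi>s)) (l # L)))"
      using legwise_comp[OF lin_mult_left Cons(1)] Cons(2) by (simp add: mult.assoc)
  qed
  then show ?case by simp
qed

text \<open>The shape of \<open>\<D>\<close>: the letter \<open>a\<close> has one leg more than the
  others, and this extra leg acts. By coassociativity it forms, with the next leg, the coproduct of
  a single leg, so the first factor becomes a function of one leg of
  \<open>xs @ a # as\<close>.\<close>

lemma split_sweedler:
  fixes s :: "'k \<Rightarrow> 'm::{comm_ring,comm_monoid_mult} \<Rightarrow> 'm"
  assumes alg: "k_algebra s"
    and P: "\<And>l. length l = q + Suc p \<Longrightarrow> lin scale s (\<lambda>u. P u l)" "\<And>u. multilinear scale s (q + Suc p) (P u)"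
    and \<phi>s: "\<forall>\<phi>\<in>set \<phi>s. multilinear scale s (q + Suc p) \<phi>"
    and l: "length xs = q" "length as = p" and k: "k = Suc (length \<phi>s)"
  shows "sweedler s ((Suc k, a) # map (Pair k) as) (\<lambda>\<alpha>. sweedler s (map (Pair k) xs) (\<lambda>\<xi>.
      prod_apply (P (hd (hd \<alpha>)) # \<phi>s) (map2 (@) (legs k \<xi>) (legs k (tl (hd \<alpha>) # tl \<alpha>)))))
    = MSL s k (xs @ a # as) (\<lambda>M. prod_apply ((\<lambda>l. SW (l ! q) (\<lambda>u v. P u (l[q := v]))) # \<phi>s) M)"
proof -
  have s: "vector_space s" using alg by (simp add: k_algebra_def)
  note lin_mult_left = k_algebra.lin_mult_left[OF alg] and lin_mult_right = k_algebra.lin_mult_right[OF alg]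
  define H where "H u M = prod_apply (P u # \<phi>s) M" for u M
  define G where "G u N = MSL s k xs (\<lambda>X. H u (map2 (@) X N))" for u N
  define R where "R r = MSL s (length \<phi>s) r (\<lambda>L. prod_apply \<phi>s L)" for r
  have H: "legwise_multilinear s k (q + Suc p) (H u)" for u
    using legwise_prod[OF alg, of "P u # \<phi>s"] P(2) \<phi>s unfolding H_def k by simp
  have Hlin: "lin scale s (\<lambda>u. H u M)" if "length M = k" "\<forall>l\<in>set M. length l = q + Suc p" for M
  proof -
    from that k obtain m M' where M: "M = m # M'" by (cases M) auto
    show ?thesis using that lin_comp[OF P(1) lin_mult_right, of m] by (simp add: H_def M)
  qed
  have G: "legwise_multilinear s k (Suc p) (G u)" for u
    unfolding G_def using legwise_append(1)[OF H] l by (intro legwise_MSL_param s) auto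
  have Rm: "multilinear scale s (q + Suc p) R"
    unfolding R_def by (rule multilinear_MSL[OF s legwise_prod[OF alg \<phi>s]])
  have inner: "sweedler s (map (Pair k) xs) (\<lambda>\<xi>. H u (map2 (@) (legs k \<xi>) (legs k \<beta>))) = G u (legs k \<beta>)"
    if "length \<beta> = Suc p" for u \<beta>
  proof -
    have "\<forall>l\<in>set (legs k \<beta>). length l = Suc p" using that by (auto dest: set_legs)
    then have "legwise_multilinear s k (length xs) (\<lambda>X. H u (map2 (@) X (legs k \<beta>)))"
      unfolding l by (intro legwise_append(2)[OF H]) simp_all
    then show ?thesis unfolding G_def by (rule sweedler_legs[OF s])
  qed
  have slot: "sweedler s (map (Pair k) as) (\<lambda>cs. G u (legs k (c # cs))) = MSL s k as (\<lambda>L. G u (map2 (#) c L))"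
    if "length c = k" for u c
    unfolding legs_Cons[OF that] using multilinear_slot(1)[OF s G that] l by (intro sweedler_legs s) auto
  have "sweedler s ((Suc k, a) # map (Pair k) as) (\<lambda>\<alpha>. sweedler s (map (Pair k) xs) (\<lambda>\<xi>.
      prod_apply (P (hd (hd \<alpha>)) # \<phi>s) (map2 (@) (legs k \<xi>) (legs k (tl (hd \<alpha>) # tl \<alpha>)))))
    = sweedler s ((Suc k, a) # map (Pair k) as) (\<lambda>\<alpha>. G (hd (hd \<alpha>)) (legs k (tl (hd \<alpha>) # tl \<alpha>)))"
  proof (rule sweedler_cong, fold H_def, rule inner)
    fix \<alpha> :: "'a list list" assume "map length \<alpha> = map fst ((Suc k, a) # map (Pair k) as)"
    then have "length \<alpha> = length ((Suc k, a) # map (Pair k) as)" by (metis length_map)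
    then show "length (tl (hd \<alpha>) # tl \<alpha>) = Suc p" using l by simp
  qed
  also have "\<dots> = SW a (\<lambda>x y. sweedler s ((k, y) # map (Pair k) as) (\<lambda>\<alpha>. G x (legs k (hd \<alpha> # tl \<alpha>))))"
  proof -
    have "multilinear scale s (Suc k) (\<lambda>c. sweedler s (map (Pair k) as) (\<lambda>cs. G (hd c) (legs k (tl c # cs))))"
    proof (rule multilinear_SucI)
      fix c :: "'a list" assume c: "length c = k"
      have "lin scale s (\<lambda>u. MSL s k as (\<lambda>L. G u (map2 (#) c L)))"
        unfolding G_def
      proof (intro lin_MSL_param vs s Hlin)
        fix L X :: "'a list list"
        assume L: "length L = k" "\<forall>l\<in>set L. length l = length as" and X: "length X = k" "\<forall>l\<in>set X. length l = length xs"
        show "length (map2 (@) X (map2 (#) c L)) = k" using L X c by simp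
        show "\<forall>l\<in>set (map2 (@) X (map2 (#) c L)). length l = q + Suc p"
          using L X c l by (auto simp: set_zip all_set_conv_all_nth)
      qed
      then show "lin scale s (\<lambda>u. sweedler s (map (Pair k) as) (\<lambda>cs. G (hd (u # c)) (legs k (tl (u # c) # cs))))"
        by (simp add: slot[OF c])
    next
      fix u
      show "multilinear scale s k (\<lambda>c. sweedler s (map (Pair k) as) (\<lambda>cs. G (hd (u # c)) (legs k (tl (u # c) # cs))))"
        using multilinear_slot(2)[OF s G l(2), of u]
        by (rule multilinear_cong[THEN iffD1, rotated]) (simp add: slot)
    qed
    then show ?thesis by (subst sweedler_Cons_Suc[OF s]) simp_all
  qed
  also have "\<dots> = SW a (\<lambda>x y. MSL s k (y # as) (G x))"
  proof (rule arg_cong[where f = "SW a"], intro ext)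
    fix x y
    have "sweedler s ((k, y) # map (Pair k) as) (\<lambda>\<alpha>. G x (legs k (hd \<alpha> # tl \<alpha>)))
      = sweedler s (map (Pair k) (y # as)) (\<lambda>\<alpha>. G x (legs k \<alpha>))"
      unfolding list.map
    proof (rule sweedler_cong)
      fix \<alpha> :: "'a list list" assume "map length \<alpha> = map fst ((k, y) # map (Pair k) as)"
      then have "hd \<alpha> # tl \<alpha> = \<alpha>" by (cases \<alpha>) auto
      then show "G x (legs k (hd \<alpha> # tl \<alpha>)) = G x (legs k \<alpha>)" by simp
    qed
    also have "\<dots> = MSL s k (y # as) (G x)"
      using G l by (intro sweedler_legs s) simp
    finally show "sweedler s ((k, y) # map (Pair k) as) (\<lambda>\<alpha>. G x (legs k (hd \<alpha> # tl \<alpha>))) = MSL s k (y # as) (G x)" .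
  qed
  also have "\<dots> = SW a (\<lambda>x y. MSL s k (xs @ y # as) (H x))"
  proof (rule arg_cong[where f = "SW a"], intro ext)
    fix x y
    have "map2 (@) (map (take q) M) (map (drop q) M) = M" for M :: "'a list list"
      by (induct M) auto
    then show "MSL s k (y # as) (G x) = MSL s k (xs @ y # as) (H x)"
      unfolding G_def MSL_MSL[OF s] l by simp
  qed
  \<comment> \<open>From here on only the first leg matters; \<open>R\<close> gathers the factors on
    the remaining ones.\<close>
  also have "\<dots> = SW a (\<lambda>x y. SWL xs (\<lambda>lx rx. SW y (\<lambda>v w. SWL as (\<lambda>la ra. P x (lx @ v # la) * R (rx @ w # ra)))))"
  proof (rule arg_cong[where f = "SW a"], intro ext)
    fix x y
    have "MSL s k (xs @ y # as) (H x) = SWL (xs @ y # as) (\<lambda>l r. P x l * R r)"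
      by (simp add: k H_def R_def MSL_hom[OF lin_mult_left])
    then show "MSL s k (xs @ y # as) (H x) = SWL xs (\<lambda>lx rx. SW y (\<lambda>v w. SWL as (\<lambda>la ra. P x (lx @ v # la) * R (rx @ w # ra))))"
      by (simp add: SWL_append)
  qed
  also have "\<dots> = SWL xs (\<lambda>lx rx. SW a (\<lambda>x y. SW y (\<lambda>v w. SWL as (\<lambda>la ra. P x (lx @ v # la) * R (rx @ w # ra)))))"
    by (rule SW_SWL_swap)
  \<comment> \<open>The decisive use of coassociativity: the extra leg, so far split off in front,
    is taken from the first leg of \<open>a\<close>.\<close>
  also have "\<dots> = SWL xs (\<lambda>lx rx. SW a (\<lambda>x w. SW x (\<lambda>u v. SWL as (\<lambda>la ra. P u (lx @ v # la) * R (rx @ w # ra)))))"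
  proof (rule SWL_cong, rule SW_coassoc[symmetric, OF s])
    fix lx rx :: "'a list" and y z assume lx: "length lx = length xs" "length rx = length xs"
    show "lin scale s (\<lambda>x. SWL as (\<lambda>la ra. P x (lx @ y # la) * R (rx @ z # ra)))"
      using lx l by (intro lin_SWL vs s lin_comp[OF P(1) lin_mult_right]) simp
    show "lin scale s (\<lambda>x. SWL as (\<lambda>la ra. P y (lx @ x # la) * R (rx @ z # ra)))"
      using lx l by (intro lin_SWL vs s lin_comp[OF multilinear_slot_lin[OF P(2)] lin_mult_right]) simp
    show "lin scale s (\<lambda>x. SWL as (\<lambda>la ra. P y (lx @ z # la) * R (rx @ x # ra)))"
      using lx l by (intro lin_SWL vs s lin_comp[OF multilinear_slot_lin[OF Rm] lin_mult_left]) simp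
  qed
  also have "\<dots> = SWL xs (\<lambda>lx rx. SW a (\<lambda>x w. SWL as (\<lambda>la ra. SW x (\<lambda>u v. P u (lx @ v # la)) * R (rx @ w # ra))))"
    by (simp add: SW_SWL_swap SW_additive[OF lin_additive[OF lin_mult_right]])
  also have "\<dots> = SWL (xs @ a # as) (\<lambda>l r. SW (l ! q) (\<lambda>u v. P u (l[q := v])) * R r)"
    unfolding SWL_append SWL.simps by (rule SWL_cong) (simp add: l nth_append list_update_append)
  also have "\<dots> = MSL s k (xs @ a # as) (\<lambda>M. prod_apply ((\<lambda>l. SW (l ! q) (\<lambda>u v. P u (l[q := v]))) # \<phi>s) M)"
    by (simp add: k R_def MSL_hom[OF lin_mult_left])
  finally show ?thesis .
qed

text \<open>The shape of \<open>\<d>\<close>: the letters \<open>as\<close> have one leg more than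
  \<open>xs\<close>, and their last two legs enter the same factor. \<open>MSL_merge_last\<close>
  makes them the coproduct of one leg.\<close>

lemma merge_sweedler:
  fixes s :: "'k \<Rightarrow> 'm::{comm_ring,comm_monoid_mult} \<Rightarrow> 'm"
  assumes alg: "k_algebra s" and \<phi>s: "\<forall>\<phi>\<in>set \<phi>s. multilinear scale s (q + p) \<phi>"
    and W: "\<And>u v. length u = p \<Longrightarrow> length v = p \<Longrightarrow> multilinear scale s q (\<lambda>x. W x u v)"
      "\<And>x v. length x = q \<Longrightarrow> length v = p \<Longrightarrow> multilinear scale s p (\<lambda>u. W x u v)"
      "\<And>x u. length x = q \<Longrightarrow> length u = p \<Longrightarrow> multilinear scale s p (\<lambda>v. W x u v)"
    and l: "length xs = q" "length as = p" and k: "k = length \<phi>s"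
  shows "sweedler s (map (Pair (Suc (Suc k))) as) (\<lambda>\<alpha>. sweedler s (map (Pair (Suc k)) xs) (\<lambda>\<xi>.
      prod_apply \<phi>s (map2 (@) (legs (Suc k) \<xi>) (legs (Suc (Suc k)) \<alpha>))
        * W (legs (Suc k) \<xi> ! k) (legs (Suc (Suc k)) \<alpha> ! k) (legs (Suc (Suc k)) \<alpha> ! Suc k)))
    = MSL s (Suc k) (xs @ as) (\<lambda>M. prod_apply (\<phi>s @ [\<lambda>l. SWL (drop q l) (\<lambda>u v. W (take q l) u v)]) M)"
proof -
  have s: "vector_space s" using alg by (simp add: k_algebra_def)
  note lin_mult_left = k_algebra.lin_mult_left[OF alg] and lin_mult_right = k_algebra.lin_mult_right[OF alg]
  define H where "H N X = prod_apply \<phi>s (map2 (@) X N) * W (X ! k) (N ! k) (N ! Suc k)" for N X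
  have N: "legwise_multilinear s (Suc (Suc k)) p (\<lambda>N. H N X)" if X: "length X = Suc k" "\<forall>l\<in>set X. length l = q" for X
  proof -
    have "legwise_multilinear s 2 p (\<lambda>D. W (X ! k) (D ! 0) (D ! 1))"
      unfolding legwise_multilinear_def
    proof (intro allI impI)
      fix L :: "'a list list" and i :: nat assume "length L = 2" "\<forall>l\<in>set L. length l = p" "i < 2"
      moreover obtain a b where "L = [a, b]" using \<open>length L = 2\<close> by (auto simp: numeral_2_eq_2 length_Suc_conv)
      ultimately show "multilinear scale s p (\<lambda>l. W (X ! k) (L[i := l] ! 0) (L[i := l] ! 1))"
        using W(2)[of "X ! k" b] W(3)[of "X ! k" a] X by (cases i) (auto simp: nth_mem)
    qed
    moreover have "\<forall>\<phi>\<in>set (map2 (\<lambda>\<phi> x l. \<phi> (x @ l)) \<phi>s X). multilinear scale s p \<phi>"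
      using \<phi>s X by (auto simp: multilinear_append set_zip all_set_conv_all_nth)
    moreover have "length (map2 (\<lambda>\<phi> x l. \<phi> (x @ l)) \<phi>s X) = k" using X k by simp
    ultimately have "legwise_multilinear s (k + 2) p (\<lambda>N. prod_apply (map2 (\<lambda>\<phi> x l. \<phi> (x @ l)) \<phi>s X) N * W (X ! k) (drop k N ! 0) (drop k N ! 1))"
      using legwise_prod_end[OF alg, of "map2 (\<lambda>\<phi> x l. \<phi> (x @ l)) \<phi>s X" p 2 "\<lambda>D. W (X ! k) (D ! 0) (D ! 1)"] by (simp only:)
    then show ?thesis
      by (rule legwise_multilinear_cong[rotated]) (simp_all add: H_def prod_map2_append(1))
  qed
  have X: "legwise_multilinear s (Suc k) q (H N)" if N: "length N = Suc (Suc k)" "\<forall>l\<in>set N. length l = p" for N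
  proof -
    have "legwise_multilinear s 1 q (\<lambda>D. W (D ! 0) (N ! k) (N ! Suc k))"
      using W(1)[of "N ! k" "N ! Suc k"] N by (auto simp: legwise_multilinear_def nth_mem)
    moreover have "\<forall>\<phi>\<in>set (map2 (\<lambda>\<phi> u l. \<phi> (l @ u)) \<phi>s N). multilinear scale s q \<phi>"
      using \<phi>s N by (auto simp: multilinear_append set_zip all_set_conv_all_nth)
    moreover have "length (map2 (\<lambda>\<phi> u l. \<phi> (l @ u)) \<phi>s N) = k" using N k by simp
    ultimately have "legwise_multilinear s (k + 1) q (\<lambda>X. prod_apply (map2 (\<lambda>\<phi> u l. \<phi> (l @ u)) \<phi>s N) X * W (drop k X ! 0) (N ! k) (N ! Suc k))"
      using legwise_prod_end[OF alg, of "map2 (\<lambda>\<phi> u l. \<phi> (l @ u)) \<phi>s N" q 1 "\<lambda>D. W (D ! 0) (N ! k) (N ! Suc k)"] by (simp only:)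
    then show ?thesis
      by (rule legwise_multilinear_cong[rotated]) (simp_all add: H_def prod_map2_append(2))
  qed
  have "sweedler s (map (Pair (Suc (Suc k))) as) (\<lambda>\<alpha>. sweedler s (map (Pair (Suc k)) xs) (\<lambda>\<xi>. H (legs (Suc (Suc k)) \<alpha>) (legs (Suc k) \<xi>)))
     = MSL s (Suc (Suc k)) as (\<lambda>N. MSL s (Suc k) xs (H N))"
    using N X l by (intro sweedler_sweedler_legs s) auto
  also have "\<dots> = MSL s (Suc k) as (\<lambda>L. SWL (last L) (\<lambda>u v. MSL s (Suc k) xs (H (butlast L @ [u, v]))))"
    using N l by (intro MSL_merge_last s legwise_MSL_param) auto
  also have "\<dots> = MSL s (Suc k) as (\<lambda>L. MSL s (Suc k) xs (\<lambda>X. SWL (last L) (\<lambda>u v. H (butlast L @ [u, v]) X)))"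
    by (simp only: MSL_SWL_swap[OF s])
  also have "\<dots> = MSL s (Suc k) (xs @ as) (\<lambda>M. SWL (last (map (drop q) M)) (\<lambda>u v. H (butlast (map (drop q) M) @ [u, v]) (map (take q) M)))"
    by (simp only: MSL_MSL[OF s] l)
  also have "\<dots> = MSL s (Suc k) (xs @ as) (\<lambda>M. prod_apply (\<phi>s @ [\<lambda>l. SWL (drop q l) (\<lambda>u v. W (take q l) u v)]) M)"
  proof (rule MSL_cong)
    fix M :: "'a list list" assume "length M = Suc k"
    then obtain M' m where M: "M = M' @ [m]" "length M' = k" by (cases M rule: rev_cases) auto
    have t: "map2 (@) (map (take q) M') (map (drop q) M') = M'" by (induct M') auto
    have "H (butlast (map (drop q) M) @ [u, v]) (map (take q) M) = prod_apply \<phi>s M' * W (take q m) u v" for u v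
      using M k by (simp add: H_def t nth_append zip_append2)
    then show "SWL (last (map (drop q) M)) (\<lambda>u v. H (butlast (map (drop q) M) @ [u, v]) (map (take q) M))
      = prod_apply (\<phi>s @ [\<lambda>l. SWL (drop q l) (\<lambda>u v. W (take q l) u v)]) M"
      using M k by (simp add: SWL_additive[OF lin_additive[OF lin_mult_left]])
  qed
  finally show ?thesis by (simp add: H_def)
qed

end

context commutative_bimodule_algebra
begin

lemma ad_tensor_eval:
  assumes F: "F \<in> Hom (q + p) scaleM" and l: "length xs = q" "length as = p"
  shows "\<Lambda> q p F (tens as) (ad_tensor a xs) = MS scaleM q a (\<lambda>c. F (tens (map2 ad c xs @ as)))"
proof -
  have m: "multilinear scaleA (fscale (*)) q (\<lambda>c. tens (map2 ad c xs))"
    by (rule multilinear_map2_left[OF lin_ad(1) multilinear_tensor[OF vs] l(1)])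
  have "ad_tensor a xs = MS (fscale (*)) q a (\<lambda>c. tens (map2 ad c xs))"
    unfolding ad_tensor_def l using MS_tens(3)[OF vector_space_tens2 m] by simp
  then have "\<Lambda> q p F (tens as) (ad_tensor a xs) = MS scaleM q a (\<lambda>c. \<Lambda> q p F (tens as) (tens (map2 ad c xs)))"
    using linear_maps_MS[OF \<Lambda>_Hom[OF F], of q "\<lambda>c. tens (map2 ad c xs)" "tens as" a] l by (simp add: tensor_in)
  also have "\<dots> = MS scaleM q a (\<lambda>c. F (tens (map2 ad c xs @ as)))"
    by (rule MS_cong) (simp add: \<Lambda>_tens l)
  finally show ?thesis .
qed

lemma contract_append:
  assumes "1 \<le> i" "Suc i \<le> length ys"
  shows "contract (length xs + i) (xs @ ys) = xs @ contract i ys" "contract i (ys @ zs) = contract i ys @ zs"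
  using assms by (auto simp: contract_def nth_append)

lemma face_multilinear:
  assumes "set Fs \<subseteq> carrier (Reg n)"
  shows "\<forall>\<phi>\<in>set (map (\<lambda>F l. F (tens l)) Fs). multilinear scaleA scaleM n \<phi>"
  using assms by (auto intro: Hom_multilinear[OF vsM Reg_Hom])

lemma Reg_foldr_MSL:
  assumes "set Fs \<subseteq> carrier (Reg n)" "length as = n"
  shows "foldr (\<otimes>\<^bsub>Reg n\<^esub>) Fs \<one>\<^bsub>Reg n\<^esub> (tens as)
    = MSL scaleM (length Fs) as (\<lambda>M. prod_apply (map (\<lambda>F l. F (tens l)) Fs) M)"
proof -
  have "prod_list (map2 (\<lambda>F l. F (tens l)) Fs L) = prod_apply (map (\<lambda>F l. F (tens l)) Fs) L" for L
    unfolding zip_map1 map_map by (rule arg_cong[where f = prod_list], rule map_cong) auto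
  then show ?thesis
    using MSL_conv[OF algM, of Fs n as] assms Reg_Hom by (auto simp: Reg_foldr subset_iff)
qed

text \<open>Brings \<open>\<Lambda>\<close> into the nested shape in which \<open>\<D>\<close> and
  \<open>\<d>\<close> are defined, so that these can be compared inside both lifts.\<close>

lemma \<Lambda>_lift:
  assumes G: "G \<in> Hom (p + q) scaleM"
  shows "\<Lambda> p q G = lift scaleA (fscale scaleM) q (\<lambda>as. lift scaleA scaleM p (\<lambda>xs. G (tens (xs @ as))))"
proof (rule lift_eq[OF vs vsW E_UNIV[OF \<Lambda>_in[OF G]], symmetric])
  fix as :: "'a list" assume "length as = q"
  then show "\<Lambda> p q G (tens as) = lift scaleA scaleM p (\<lambda>xs. G (tens (xs @ as)))"
    by (intro lift_eq[OF vs vsM \<Lambda>_Hom[OF G], symmetric] \<Lambda>_tens)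
qed

text \<open>Proved from right to left: the product of faces is written as a sum over legs, and
  \<open>split_sweedler\<close> recovers the extra leg of the first letter. The signed powers pass
  through \<open>\<Lambda>\<close> by \<open>\<Lambda>_pow\<close>.\<close>

lemma \<D>_tensor:
  assumes F: "F \<in> carrier (Reg (q + p))" and bs: "length bs = p + 1" and xs: "length xs = q"
  shows "sweedler scaleM ((p + 3, hd bs) # map (Pair (p + 2)) (tl bs)) (\<lambda>\<alpha>.
    sweedler scaleM (map (Pair (p + 2)) xs) (\<lambda>\<xi>.
      let \<beta> = tl (hd \<alpha>) # tl \<alpha> in
      (hd (hd \<alpha>) \<rightharpoonup> (\<Lambda> q p F [^]\<^bsub>C p q\<^esub> ((-1) ^ q :: int))
         (tens (tl (leg 1 \<beta>))) (ad_tensor (hd (leg 1 \<beta>)) (leg 1 \<xi>))) *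
      (\<Prod>i=1..p. (\<Lambda> q p F [^]\<^bsub>C p q\<^esub> ((-1) ^ (q + i) :: int))
         (tens (contract i (leg (i + 1) \<beta>))) (tens (leg (i + 1) \<xi>))) *
      ((\<Lambda> q p F [^]\<^bsub>C p q\<^esub> ((-1) ^ (q + p + 1) :: int))
         (tens (butlast (leg (p + 2) \<beta>))) (tens (leg (p + 2) \<xi>)) \<leftharpoonup> last (leg (p + 2) \<beta>)))) = DY q p F (tens (xs @ bs))"
    (is "sweedler _ _ (\<lambda>\<alpha>. sweedler _ _ (?I \<alpha>)) = _")
proof -
  obtain a as where a: "bs = a # as" and l: "length xs = q" "length as = p" using bs xs by (cases bs) auto
  let ?n = "q + Suc p" and ?m = "q + p"
  define F0 where "F0 = F [^]\<^bsub>Reg ?m\<^esub> ((-1) ^ q :: int)"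
  define Fi where "Fi i = F [^]\<^bsub>Reg ?m\<^esub> ((-1) ^ (q + i) :: int)" for i :: nat
  define F1 where "F1 = F [^]\<^bsub>Reg ?m\<^esub> ((-1) ^ (q + p + 1) :: int)"
  have FR: "F0 \<in> carrier (Reg ?m)" "Fi i \<in> carrier (Reg ?m)" "F1 \<in> carrier (Reg ?m)" for i
    unfolding F0_def Fi_def F1_def by (intro Reg_pow_in F)+
  define P where "P u l = u \<rightharpoonup> MS scaleM q (l ! q) (\<lambda>c. F0 (tens (map2 ad c (take q l) @ drop (Suc q) l)))" for u l
  define Bs where "Bs = map (\<lambda>i. faceM scaleM (q + i) ?m (Fi i)) [1..<Suc p] @ [faceR scaleM ractl ?m ?m F1]"
  let ?\<phi>s = "map (\<lambda>F l. F (tens l)) Bs"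
  have faces: "facesY q p F = faceL scaleM lact q ?m F0 # Bs"
    by (simp add: facesY_def Bs_def F0_def Fi_def F1_def del: upt_Suc)
  have k: "p + 2 = Suc (length ?\<phi>s)" by (simp add: Bs_def)
  have BR: "set Bs \<subseteq> carrier (Reg ?n)" using facesY_in[OF F] faces by simp
  have Pm: "multilinear scaleA scaleM ?n (P u)" for u
    using multilinear_left(2)[OF measuring_lact, of q p "\<lambda>l. F0 (tens l)"] Hom_multilinear[OF vsM Reg_Hom[OF FR(1)]]
    by (simp add: P_def[abs_def])
  have Pl: "lin scaleA scaleM (\<lambda>u. P u l)" for l
    unfolding P_def by (rule lact_linear_left)
  have P: "SW (l ! q) (\<lambda>u v. P u (l[q := v])) = faceL scaleM lact q ?m F0 (tens l)" if "length l = ?n" for l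
    using faceL(2)[OF measuring_lact Reg_Hom[OF FR(1)], of q l] that by (simp add: P_def)
  have Y: "set (facesY q p F) \<subseteq> carrier (Reg ?n)" "length (facesY q p F) = p + 2"
    using facesY_in[OF F] by (simp_all add: facesY_def)
  have "DY q p F (tens (xs @ a # as))
     = MSL scaleM (p + 2) (xs @ a # as) (\<lambda>M. prod_apply ((\<lambda>l. faceL scaleM lact q ?m F0 (tens l)) # ?\<phi>s) M)"
  proof -
    have "DY q p F (tens (xs @ a # as)) = foldr (\<otimes>\<^bsub>Reg ?n\<^esub>) (facesY q p F) \<one>\<^bsub>Reg ?n\<^esub> (tens (xs @ a # as))"
      by (simp add: DY_def)
    also have "\<dots> = MSL scaleM (length (facesY q p F)) (xs @ a # as) (\<lambda>M. prod_apply (map (\<lambda>F l. F (tens l)) (facesY q p F)) M)"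
      by (rule Reg_foldr_MSL[OF Y(1)]) (simp add: l)
    finally show ?thesis unfolding Y(2) unfolding faces list.map .
  qed
  also have "\<dots> = MSL scaleM (p + 2) (xs @ a # as) (\<lambda>M. prod_apply ((\<lambda>l. SW (l ! q) (\<lambda>u v. P u (l[q := v]))) # ?\<phi>s) M)"
  proof (rule MSL_cong)
    fix M :: "'a list list" assume "length M = p + 2" "\<forall>l\<in>set M. length l = length (xs @ a # as)"
    then obtain m M' where "M = m # M'" "length m = ?n" using l by (cases M) auto
    then show "prod_apply ((\<lambda>l. faceL scaleM lact q ?m F0 (tens l)) # ?\<phi>s) M
      = prod_apply ((\<lambda>l. SW (l ! q) (\<lambda>u v. P u (l[q := v]))) # ?\<phi>s) M"
      by (simp add: P)
  qed
  also have "\<dots> = sweedler scaleM ((Suc (p + 2), a) # map (Pair (p + 2)) as) (\<lambda>\<alpha>. sweedler scaleM (map (Pair (p + 2)) xs) (\<lambda>\<xi>.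
      prod_apply (P (hd (hd \<alpha>)) # ?\<phi>s) (map2 (@) (legs (p + 2) \<xi>) (legs (p + 2) (tl (hd \<alpha>) # tl \<alpha>)))))"
    by (rule split_sweedler[OF algM Pl Pm face_multilinear[OF BR] l k, symmetric])
  also have "\<dots> = sweedler scaleM ((p + 3, a) # map (Pair (p + 2)) as) (\<lambda>\<alpha>. sweedler scaleM (map (Pair (p + 2)) xs) (?I \<alpha>))"
  proof -
    have 3: "Suc (p + 2) = p + 3" by simp
    show ?thesis
      unfolding 3
    proof (intro sweedler_cong)
      fix \<alpha> \<xi> :: "'a list list"
      assume "map length \<alpha> = map fst ((p + 3, a) # map (Pair (p + 2)) as)" "map length \<xi> = map fst (map (Pair (p + 2)) xs)"
      then have "length \<alpha> = length ((p + 3, a) # map (Pair (p + 2)) as)" "length \<xi> = length xs" by (metis length_map)+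
      define \<beta> where "\<beta> = tl (hd \<alpha>) # tl \<alpha>"
      have \<beta>: "length \<beta> = Suc p" and \<xi>: "length \<xi> = q"
        using \<open>length \<alpha> = _\<close> \<open>length \<xi> = _\<close> l by (simp_all add: \<beta>_def)
      let ?M = "map2 (@) (legs (p + 2) \<xi>) (legs (p + 2) \<beta>)"
      have M: "length ?M = p + 2" "\<And>i. i < p + 2 \<Longrightarrow> ?M ! i = leg (Suc i) \<xi> @ leg (Suc i) \<beta>"
        by (simp_all add: legs_nth)
      have fs: "P u # ?\<phi>s = P u # map (\<lambda>i l. faceM scaleM (q + i) ?m (Fi i) (tens l)) [1..<Suc p] @ [\<lambda>l. faceR scaleM ractl ?m ?m F1 (tens l)]" for u
        by (simp add: Bs_def del: upt_Suc)
      have "prod_apply (P (hd (hd \<alpha>)) # ?\<phi>s) ?M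
        = P (hd (hd \<alpha>)) (?M ! 0) * (\<Prod>i=1..p. faceM scaleM (q + i) ?m (Fi i) (tens (?M ! i))) * faceR scaleM ractl ?m ?m F1 (tens (?M ! (p + 1)))"
        unfolding fs by (rule prod_list_ends[OF M(1)])
      also have "P (hd (hd \<alpha>)) (?M ! 0) = hd (hd \<alpha>) \<rightharpoonup> \<Lambda> q p F0 (tens (tl (leg 1 \<beta>))) (ad_tensor (hd (leg 1 \<beta>)) (leg 1 \<xi>))"
      proof -
        have "length (leg 1 \<beta>) = Suc p" using \<beta> by simp
        then obtain b bs where b: "leg 1 \<beta> = b # bs" "length bs = p" unfolding length_Suc_conv by blast
        show ?thesis
          using ad_tensor_eval[OF Reg_Hom[OF FR(1)], of "leg 1 \<xi>" bs b] M(2)[of 0] \<xi> b by (simp add: P_def nth_append)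
      qed
      also have "(\<Prod>i=1..p. faceM scaleM (q + i) ?m (Fi i) (tens (?M ! i)))
        = (\<Prod>i=1..p. \<Lambda> q p (Fi i) (tens (contract i (leg (i + 1) \<beta>))) (tens (leg (i + 1) \<xi>)))"
      proof (rule prod.cong[OF refl])
        fix i assume i: "i \<in> {1..p}"
        then have lc: "length (contract i (leg (i + 1) \<beta>)) = p" using \<beta> by (auto simp: contract_def)
        have "faceM scaleM (q + i) ?m (Fi i) (tens (?M ! i)) = Fi i (tens (contract (q + i) (?M ! i)))"
          using i \<beta> \<xi> M(2)[of i] by (intro face_values(3) FR) auto
        also have "contract (q + i) (?M ! i) = leg (i + 1) \<xi> @ contract i (leg (i + 1) \<beta>)"
          using i \<beta> \<xi> M(2)[of i] contract_append(1)[of i "leg (i + 1) \<beta>" "leg (i + 1) \<xi>"] by simp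
        finally show "faceM scaleM (q + i) ?m (Fi i) (tens (?M ! i))
          = \<Lambda> q p (Fi i) (tens (contract i (leg (i + 1) \<beta>))) (tens (leg (i + 1) \<xi>))"
          using \<Lambda>_tens[OF _ lc, of "leg (i + 1) \<xi>" q "Fi i"] \<xi> by simp
      qed
      also have "faceR scaleM ractl ?m ?m F1 (tens (?M ! (p + 1)))
        = \<Lambda> q p F1 (tens (butlast (leg (p + 2) \<beta>))) (tens (leg (p + 2) \<xi>)) \<leftharpoonup> last (leg (p + 2) \<beta>)"
      proof -
        have "leg (p + 2) \<beta> \<noteq> []" using \<beta> length_leg[of "p + 2" \<beta>] by (metis length_0_conv nat.distinct(1))
        moreover have e: "?M ! (p + 1) = leg (p + 2) \<xi> @ leg (p + 2) \<beta>" using M(2)[of "p + 1"] by simp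
        ultimately show ?thesis
          unfolding e using face_values(2)[OF FR(3), of "leg (p + 2) \<xi> @ leg (p + 2) \<beta>"] \<beta> \<xi>
          by (simp add: \<Lambda>_tens butlast_append)
      qed
      finally show "prod_apply (P (hd (hd \<alpha>)) # ?\<phi>s) (map2 (@) (legs (p + 2) \<xi>) (legs (p + 2) (tl (hd \<alpha>) # tl \<alpha>)))
        = ?I \<alpha> \<xi>"
        unfolding Let_def \<beta>_def[symmetric] \<Lambda>_pow[OF F] F0_def Fi_def F1_def .
    qed
  qed
  finally show ?thesis unfolding a list.sel by (rule sym)
qed

lemma \<D>_\<Lambda>:
  assumes F: "F \<in> carrier (Reg (q + p))"
  shows "\<D> p q (\<Lambda> q p F) = \<Lambda> q (p + 1) (DY q p F)"
proof -
  have DY: "DY q p F \<in> Hom (q + (p + 1)) scaleM" using Reg_Hom[OF DY_in[OF F]] by simp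
  show ?thesis
    unfolding \<D>_def \<Lambda>_lift[OF DY] by (rule lift_cong, rule lift_cong, rule \<D>_tensor[OF F])
qed

lemma \<d>_tensor:
  assumes F: "F \<in> carrier (Reg (q + p))" and as: "length as = p" and xs: "length xs = q + 1"
  shows "sweedler scaleM (map (Pair (q + 3)) as) (\<lambda>\<alpha>.
    sweedler scaleM (map (Pair (q + 2)) xs) (\<lambda>\<xi>.
      (hd (leg 1 \<xi>) \<rightharpoonup> \<Lambda> q p F (tens (leg 1 \<alpha>)) (tens (tl (leg 1 \<xi>)))) *
      (\<Prod>i=1..q. (\<Lambda> q p F [^]\<^bsub>C p q\<^esub> ((-1) ^ i :: int))
         (tens (leg (i + 1) \<alpha>)) (tens (contract i (leg (i + 1) \<xi>)))) *
      ((\<Lambda> q p F [^]\<^bsub>C p q\<^esub> ((-1) ^ (q + 1) :: int))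
         (tens (leg (q + 2) \<alpha>)) (tens (butlast (leg (q + 2) \<xi>)))
         \<leftharpoonup> ad (prod_list (leg (q + 3) \<alpha>)) (last (leg (q + 2) \<xi>))))) = DX q (q + p) F (tens (xs @ as))"
    (is "sweedler _ _ (\<lambda>\<alpha>. sweedler _ _ (?I \<alpha>)) = _")
proof -
  note l = xs as
  let ?m = "q + p" and ?n = "q + 1 + p"
  define Fi where "Fi i = F [^]\<^bsub>Reg ?m\<^esub> ((-1) ^ i :: int)" for i :: nat
  have FR: "Fi i \<in> carrier (Reg ?m)" for i
    unfolding Fi_def by (intro Reg_pow_in F)
  define Bs where "Bs = faceL scaleM lact 0 ?m F # map (\<lambda>i. faceM scaleM i ?m (Fi i)) [1..<Suc q]"
  let ?\<phi>s = "map (\<lambda>F l. F (tens l)) Bs"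
  \<comment> \<open>\<open>x\<close> is a leg of the enlarged first block: its first
    \<open>q\<close> letters are arguments, the last one acts. \<open>u\<close> and \<open>v\<close>
    are the two legs of the second block.\<close>
  define V where "V x u v = ractl (ad (prod_list v) (x ! q)) (Fi (q + 1) (tens (take q x @ u)))" for x u v
  have faces: "facesX q ?m F = Bs @ [faceR scaleM ractl q ?m (Fi (q + 1))]"
    by (simp add: facesX_def Bs_def Fi_def del: upt_Suc)
  have k: "q + 1 = length ?\<phi>s" by (simp add: Bs_def)
  have X: "set (facesX q ?m F) \<subseteq> carrier (Reg ?n)" "length (facesX q ?m F) = Suc (q + 1)"
    using facesX_in[OF F, of q] by (simp, simp add: facesX_def)
  have BR: "set Bs \<subseteq> carrier (Reg ?n)" using X faces by simp
  have Fm: "multilinear scaleA scaleM (q + p) (\<lambda>l. Fi (q + 1) (tens l))"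
    by (rule Hom_multilinear[OF vsM Reg_Hom[OF FR]])
  have V1: "multilinear scaleA scaleM (q + 1) (\<lambda>x. V x u v)" if "length u = p" "length v = p" for u v
    unfolding multilinear_append
  proof (intro conjI allI impI)
    fix ys :: "'a list" assume "length ys = 1"
    then obtain y where y: "ys = [y]" by (auto simp: length_Suc_conv)
    have "multilinear scaleA scaleM q (\<lambda>xs. ractl (ad (prod_list v) y) (Fi (q + 1) (tens (xs @ u))))"
      using Fm that by (intro multilinear_comp[OF ract_linear_left]) (simp add: multilinear_append)
    then show "multilinear scaleA scaleM q (\<lambda>xs. V (xs @ ys) u v)"
      by (rule multilinear_cong[THEN iffD1, rotated]) (simp add: V_def y nth_append)
  next
    fix xs :: "'a list" assume "length xs = q"
    then show "multilinear scaleA scaleM 1 (\<lambda>ys. V (xs @ ys) u v)"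
      by (simp add: V_def nth_append multilinear_Suc lin_comp[OF lin_ad(2) ract_linear_right])
  qed
  note bm = multilinear_right(2)[OF measuring_ract Fm]
  have V2: "multilinear scaleA scaleM p (\<lambda>u. V x u v)" if "length x = q + 1" "length v = p" for x v
    using bm[of "take q x" "x ! q"] that by (simp add: V_def bimultilinear_def)
  have V3: "multilinear scaleA scaleM p (\<lambda>v. V x u v)" if "length x = q + 1" "length u = p" for x u
    using bm[of "take q x" "x ! q"] that by (simp add: V_def bimultilinear_def)
  have V: "SWL (drop (q + 1) l) (\<lambda>u v. V (take (q + 1) l) u v) = faceR scaleM ractl q ?m (Fi (q + 1)) (tens l)" if "length l = ?n" for l
    using faceR(2)[OF measuring_ract Reg_Hom[OF FR], of q l "q + 1"] that by (simp add: V_def min_def)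
  have "DX q ?m F (tens (xs @ as)) = MSL scaleM (Suc (q + 1)) (xs @ as) (\<lambda>M. prod_apply (map (\<lambda>F l. F (tens l)) (facesX q ?m F)) M)"
  proof -
    have "DX q ?m F (tens (xs @ as)) = foldr (\<otimes>\<^bsub>Reg ?n\<^esub>) (facesX q ?m F) \<one>\<^bsub>Reg ?n\<^esub> (tens (xs @ as))"
      by (simp add: DX_def)
    also have "\<dots> = MSL scaleM (length (facesX q ?m F)) (xs @ as) (\<lambda>M. prod_apply (map (\<lambda>F l. F (tens l)) (facesX q ?m F)) M)"
      by (rule Reg_foldr_MSL[OF X(1)]) (simp add: l)
    finally show ?thesis unfolding X(2) .
  qed
  also have "\<dots> = MSL scaleM (Suc (q + 1)) (xs @ as) (\<lambda>M. prod_apply (?\<phi>s @ [\<lambda>l. SWL (drop (q + 1) l) (\<lambda>u v. V (take (q + 1) l) u v)]) M)"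
  proof (rule MSL_cong)
    fix M :: "'a list list" assume M: "length M = Suc (q + 1)" "\<forall>l\<in>set M. length l = length (xs @ as)"
    obtain M' m where m: "M = M' @ [m]" "length M' = length ?\<phi>s" using M(1) k by (cases M rule: rev_cases) auto
    have "length m = ?n" using M(2) l m by simp
    from V[OF this] show "prod_apply (map (\<lambda>F l. F (tens l)) (facesX q ?m F)) M
      = prod_apply (?\<phi>s @ [\<lambda>l. SWL (drop (q + 1) l) (\<lambda>u v. V (take (q + 1) l) u v)]) M"
      using m(2) by (simp add: faces m(1))
  qed
  also have "\<dots> = sweedler scaleM (map (Pair (Suc (Suc (q + 1)))) as) (\<lambda>\<alpha>. sweedler scaleM (map (Pair (Suc (q + 1))) xs) (\<lambda>\<xi>.
      prod_apply ?\<phi>s (map2 (@) (legs (Suc (q + 1)) \<xi>) (legs (Suc (Suc (q + 1))) \<alpha>))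
        * V (legs (Suc (q + 1)) \<xi> ! (q + 1)) (legs (Suc (Suc (q + 1))) \<alpha> ! (q + 1)) (legs (Suc (Suc (q + 1))) \<alpha> ! Suc (q + 1))))"
    by (rule merge_sweedler[OF algM face_multilinear[OF BR] V1 V2 V3 l k, symmetric])
  also have "\<dots> = sweedler scaleM (map (Pair (q + 3)) as) (\<lambda>\<alpha>. sweedler scaleM (map (Pair (q + 2)) xs) (?I \<alpha>))"
  proof -
    have 3: "Suc (q + 1) = q + 2" "Suc (q + 2) = q + 3" by simp_all
    show ?thesis
      unfolding 3
    proof (intro sweedler_cong)
      fix \<alpha> \<xi> :: "'a list list"
      assume "map length \<alpha> = map fst (map (Pair (q + 3)) as)" "map length \<xi> = map fst (map (Pair (q + 2)) xs)"
      then have "length \<alpha> = length as" "length \<xi> = length xs" by (metis length_map)+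
      then have \<alpha>: "length \<alpha> = p" and \<xi>: "length \<xi> = Suc q" using l by simp_all
      let ?M = "map2 (@) (legs (q + 2) \<xi>) (legs (q + 3) \<alpha>)"
      have M: "length ?M = q + 2" "\<And>i. i < q + 2 \<Longrightarrow> ?M ! i = leg (Suc i) \<xi> @ leg (Suc i) \<alpha>"
        by (simp_all add: legs_nth)
      \<comment> \<open>The right face has already been separated; a constant factor
        \<open>1\<close> in its place makes \<open>prod_list_ends\<close> applicable.\<close>
      have "prod_apply ?\<phi>s ?M = prod_apply ((\<lambda>l. faceL scaleM lact 0 ?m F (tens l)) # map (\<lambda>i l. faceM scaleM i ?m (Fi i) (tens l)) [1..<Suc q] @ [\<lambda>_. 1]) ?M"
      proof -
        have "length ?M = Suc (length ?\<phi>s)" unfolding M(1) k[symmetric] by simp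
        then obtain M' m where m: "?M = M' @ [m]" "length M' = length ?\<phi>s" unfolding length_Suc_conv_rev by blast
        have e: "(\<lambda>l. faceL scaleM lact 0 ?m F (tens l)) # map (\<lambda>i l. faceM scaleM i ?m (Fi i) (tens l)) [1..<Suc q] @ [\<lambda>_. 1] = ?\<phi>s @ [\<lambda>_. 1]"
          by (simp add: Bs_def del: upt_Suc)
        show ?thesis unfolding m(1) e using m(2) by (simp add: zip_append2)
      qed
      also have "\<dots> = faceL scaleM lact 0 ?m F (tens (?M ! 0)) * (\<Prod>i=1..q. faceM scaleM i ?m (Fi i) (tens (?M ! i)))"
        using prod_list_ends[OF M(1), of "\<lambda>\<phi> l. \<phi> l" "\<lambda>l. faceL scaleM lact 0 ?m F (tens l)" "\<lambda>i l. faceM scaleM i ?m (Fi i) (tens l)" "\<lambda>_. 1"] by simp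
      also have "faceL scaleM lact 0 ?m F (tens (?M ! 0)) = hd (leg 1 \<xi>) \<rightharpoonup> \<Lambda> q p F (tens (leg 1 \<alpha>)) (tens (tl (leg 1 \<xi>)))"
      proof -
        have "length (leg 1 \<xi>) = Suc q" using \<xi> by simp
        then obtain x x' where x: "leg 1 \<xi> = x # x'" "length x' = q" unfolding length_Suc_conv by blast
        have e: "?M ! 0 = leg 1 \<xi> @ leg 1 \<alpha>" using M(2)[of 0] by simp
        show ?thesis unfolding e using face_values(1)[OF F, of "leg 1 \<xi> @ leg 1 \<alpha>"] x \<alpha> \<xi> by (simp add: \<Lambda>_tens)
      qed
      also have "(\<Prod>i=1..q. faceM scaleM i ?m (Fi i) (tens (?M ! i)))
        = (\<Prod>i=1..q. \<Lambda> q p (Fi i) (tens (leg (i + 1) \<alpha>)) (tens (contract i (leg (i + 1) \<xi>))))"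
      proof (rule prod.cong[OF refl])
        fix i assume i: "i \<in> {1..q}"
        then have lc: "length (contract i (leg (i + 1) \<xi>)) = q" using \<xi> by (auto simp: contract_def)
        have "faceM scaleM i ?m (Fi i) (tens (?M ! i)) = Fi i (tens (contract i (?M ! i)))"
          using i \<alpha> \<xi> M(2)[of i] by (intro face_values(3) FR) auto
        also have "contract i (?M ! i) = contract i (leg (i + 1) \<xi>) @ leg (i + 1) \<alpha>"
          using i \<alpha> \<xi> M(2)[of i] contract_append(2)[of i "leg (i + 1) \<xi>" "leg (i + 1) \<alpha>"] by simp
        finally show "faceM scaleM i ?m (Fi i) (tens (?M ! i)) = \<Lambda> q p (Fi i) (tens (leg (i + 1) \<alpha>)) (tens (contract i (leg (i + 1) \<xi>)))"
          using \<Lambda>_tens[OF lc, of "leg (i + 1) \<alpha>" p "Fi i"] \<alpha> by simp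
      qed
      finally have 1: "prod_apply ?\<phi>s ?M = (hd (leg 1 \<xi>) \<rightharpoonup> \<Lambda> q p F (tens (leg 1 \<alpha>)) (tens (tl (leg 1 \<xi>)))) *
        (\<Prod>i=1..q. \<Lambda> q p (Fi i) (tens (leg (i + 1) \<alpha>)) (tens (contract i (leg (i + 1) \<xi>))))" .
      have 2: "V (legs (q + 2) \<xi> ! (q + 1)) (legs (q + 3) \<alpha> ! (q + 1)) (legs (q + 3) \<alpha> ! (q + 2))
        = \<Lambda> q p (Fi (q + 1)) (tens (leg (q + 2) \<alpha>)) (tens (butlast (leg (q + 2) \<xi>)))
         \<leftharpoonup> ad (prod_list (leg (q + 3) \<alpha>)) (last (leg (q + 2) \<xi>))"
      proof -
        have "length (leg (q + 2) \<xi>) = Suc q" using \<xi> by simp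
        then obtain x' x where x: "leg (q + 2) \<xi> = x' @ [x]" "length x' = q" unfolding length_Suc_conv_rev by blast
        have "legs (q + 2) \<xi> ! (q + 1) = leg (q + 2) \<xi>" "legs (q + 3) \<alpha> ! (q + 1) = leg (q + 2) \<alpha>"
          "legs (q + 3) \<alpha> ! (q + 2) = leg (q + 3) \<alpha>"
          using legs_nth[of "q + 1" "q + 2" \<xi>] legs_nth[of "q + 1" "q + 3" \<alpha>] legs_nth[of "q + 2" "q + 3" \<alpha>]
          by (simp_all add: numeral_3_eq_3)
        then show ?thesis using x \<alpha> by (simp add: V_def \<Lambda>_tens nth_append)
      qed
      show "prod_apply ?\<phi>s ?M * V (legs (q + 2) \<xi> ! (q + 1)) (legs (q + 3) \<alpha> ! (q + 1)) (legs (q + 3) \<alpha> ! (q + 2))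
        = ?I \<alpha> \<xi>"
        unfolding 1 2 \<Lambda>_pow[OF F] Fi_def ..
    qed
  qed
  finally show ?thesis by (rule sym)
qed

lemma \<d>_\<Lambda>:
  assumes F: "F \<in> carrier (Reg (q + p))"
  shows "\<d> p q (\<Lambda> q p F) = \<Lambda> (q + 1) p (DX q (q + p) F)"
proof -
  have DX: "DX q (q + p) F \<in> Hom (q + 1 + p) scaleM" using Reg_Hom[OF DX_in[OF F, of q]] by simp
  show ?thesis
    unfolding \<d>_def \<Lambda>_lift[OF DX] by (rule lift_cong, rule lift_cong, rule \<d>_tensor[OF F])
qed

end

subsection \<open>The total complexes\<close>

context bimodule_action
begin

lemma dtot_add: "dtot (\<lambda>xs bs. F xs bs + F' xs bs) xs bs = dtot F xs bs + dtot F' xs bs"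
  by (simp add: dtot_def dx_add dy_add sg_add algebra_simps)

lemma hoch_dx: "hoch f xs = dx (\<lambda>xs bs. f (xs @ bs)) xs []"
  by (simp add: hoch_def dx_def)

end

context commutative_bimodule_algebra
begin

lemma Tot_Reg2: "Tot_Reg2 n = product_group {..n} (\<lambda>_. Reg n)"
  unfolding Tot_Reg2_def product_group_def
  by (auto simp: Reg2_def fun_eq_iff restrict_def intro!: PiE_cong)

lemma Tot_carrier: "F \<in> carrier (Tot_Reg2 n) \<longleftrightarrow> F \<in> (\<Pi>\<^sub>E p\<in>{..n}. carrier (Reg n))"
  and Tot_mult: "F \<otimes>\<^bsub>Tot_Reg2 n\<^esub> G = (\<lambda>p\<in>{..n}. F p \<otimes>\<^bsub>Reg n\<^esub> G p)"
  and Tot_one: "\<one>\<^bsub>Tot_Reg2 n\<^esub> = (\<lambda>p\<in>{..n}. \<one>\<^bsub>Reg n\<^esub>)"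
  by (simp_all add: Tot_Reg2)

lemma Tot_component: "F \<in> carrier (Tot_Reg2 n) \<Longrightarrow> p \<le> n \<Longrightarrow> F p \<in> carrier (Reg n)"
  by (auto simp: Tot_carrier)

lemma Reg_mult_in: "f \<in> carrier (Reg n) \<Longrightarrow> g \<in> carrier (Reg n) \<Longrightarrow> f \<otimes>\<^bsub>Reg n\<^esub> g \<in> carrier (Reg n)"
  by (rule monoid.m_closed[OF group.is_monoid[OF group_Reg]])

lemma Reg_one_in: "\<one>\<^bsub>Reg n\<^esub> \<in> carrier (Reg n)"
  by (rule monoid.one_closed[OF group.is_monoid[OF group_Reg]])

lemma comm_group_Tot: "comm_group (Tot_Reg2 n)"
proof -
  interpret group "Tot_Reg2 n" unfolding Tot_Reg2 by (rule product_group) (rule group_Reg)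
  show ?thesis
  proof (rule group_comm_groupI)
    fix F G assume "F \<in> carrier (Tot_Reg2 n)" "G \<in> carrier (Tot_Reg2 n)"
    then show "F \<otimes>\<^bsub>Tot_Reg2 n\<^esub> G = G \<otimes>\<^bsub>Tot_Reg2 n\<^esub> F"
      using comm_monoid.m_comm[OF comm_group.axioms(1)[OF comm_group_Reg, of n]] Tot_component[of _ n]
      by (auto simp: Tot_mult fun_eq_iff restrict_def)
  qed
qed

text \<open>The length of the first block selects the summand, so a family becomes one function of
  two lists, to which \<open>dtot\<close> applies.\<close>

definition EvT :: "nat \<Rightarrow> (nat \<Rightarrow> ('a, 'k) tens \<Rightarrow> 'm) \<Rightarrow> (('a, 'k) tens \<Rightarrow> 'a) group_family list
    \<Rightarrow> (('a, 'k) tens \<Rightarrow> 'a) group_family list \<Rightarrow> (('a, 'k) tens \<Rightarrow> 'm) abelian_family"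
  where "EvT k F xs bs = Ev k (F (length xs)) (xs @ bs)"

lemma EvT_eqI:
  assumes F: "F \<in> carrier (Tot_Reg2 n)" "G \<in> carrier (Tot_Reg2 n)"
    and eq: "\<And>xs bs. length xs + length bs = n \<Longrightarrow> EvT n F xs bs = EvT n G xs bs"
  shows "F = G"
proof (rule PiE_ext[OF F[unfolded Tot_carrier]])
  fix p assume p: "p \<in> {..n}"
  show "F p = G p"
  proof (rule Ev_eqI)
    fix \<gamma>s :: "(('a, 'k) tens \<Rightarrow> 'a) group_family list" assume "length \<gamma>s = n"
    then have t: "length (take p \<gamma>s) = p" "length (drop p \<gamma>s) = n - p" using p by simp_all
    have "EvT n F (take p \<gamma>s) (drop p \<gamma>s) = EvT n G (take p \<gamma>s) (drop p \<gamma>s)"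
      by (rule eq) (use t p in simp)
    then show "Ev n (F p) \<gamma>s = Ev n (G p) \<gamma>s" by (simp only: EvT_def t append_take_drop_id)
  qed (use F p in \<open>auto intro: Tot_component\<close>)
qed

lemma EvT_mult:
  assumes "F \<in> carrier (Tot_Reg2 n)" "G \<in> carrier (Tot_Reg2 n)" "length xs + length bs = n"
  shows "EvT k (F \<otimes>\<^bsub>Tot_Reg2 n\<^esub> G) xs bs = EvT k F xs bs + EvT k G xs bs"
proof -
  have p: "length xs \<le> n" using assms(3) by simp
  show ?thesis
    using Ev_mult[OF Tot_component[OF assms(1) p] Tot_component[OF assms(2) p], of "xs @ bs" k] assms(3) p
    by (simp add: EvT_def Tot_mult)
qed

lemma EvT_one: "length xs + length bs = n \<Longrightarrow> EvT k \<one>\<^bsub>Tot_Reg2 n\<^esub> xs bs = 0"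
  by (simp add: EvT_def Tot_one Ev_one)

text \<open>
  The explicit form of \<open>\<rho>_Reg2\<close>.  Since \<open>\<Lambda>\<close> exchanges the two factors, \<open>\<D>\<close> becomes \<open>DY\<close>, which adds a variable on
  the right, and \<open>\<d>\<close> becomes \<open>DX\<close>.
\<close>

definition dTot :: "nat \<Rightarrow> (nat \<Rightarrow> ('a, 'k) tens \<Rightarrow> 'm) \<Rightarrow> nat \<Rightarrow> ('a, 'k) tens \<Rightarrow> 'm"
  where "dTot n F = (\<lambda>p\<in>{..n+1}. (if p = n + 1 then \<one>\<^bsub>Reg (n + 1)\<^esub> else DY p (n - p) (F p))
    \<otimes>\<^bsub>Reg (n + 1)\<^esub> (if p = 0 then \<one>\<^bsub>Reg (n + 1)\<^esub> else DX (p - 1) n (F (p - 1))))"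

lemma dTot_components:
  assumes F: "F \<in> carrier (Tot_Reg2 n)" and p: "p \<le> n + 1"
  shows "(if p = n + 1 then \<one>\<^bsub>Reg (n + 1)\<^esub> else DY p (n - p) (F p)) \<in> carrier (Reg (n + 1))"
    and "(if p = 0 then \<one>\<^bsub>Reg (n + 1)\<^esub> else DX (p - 1) n (F (p - 1))) \<in> carrier (Reg (n + 1))"
proof -
  show "(if p = n + 1 then \<one>\<^bsub>Reg (n + 1)\<^esub> else DY p (n - p) (F p)) \<in> carrier (Reg (n + 1))"
    using DY_in[of "F p" p "n - p"] Tot_component[OF F, of p] p Reg_one_in[of "n + 1"] by (auto simp: le_Suc_eq)
  show "(if p = 0 then \<one>\<^bsub>Reg (n + 1)\<^esub> else DX (p - 1) n (F (p - 1))) \<in> carrier (Reg (n + 1))"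
    using DX_in[of "F (p - 1)" n "p - 1"] Tot_component[OF F, of "p - 1"] p Reg_one_in[of "n + 1"]
    by (cases "p = 0") simp_all
qed

lemma dTot_in:
  assumes "F \<in> carrier (Tot_Reg2 n)"
  shows "dTot n F \<in> carrier (Tot_Reg2 (n + 1))"
  unfolding Tot_carrier dTot_def
  by (rule restrict_PiE_iff[THEN iffD2], intro ballI Reg_mult_in dTot_components[OF assms]) simp_all

lemma EvT_dTot:
  assumes F: "F \<in> carrier (Tot_Reg2 n)" and l: "length xs + length bs = n + 1"
  shows "EvT k (dTot n F) xs bs = bimodule_action.dtot (La k) (Ra k) (EvT k F) xs bs"
proof -
  interpret B: bimodule_action "La k" "Ra k" by (rule bimodule_action_Reg)
  let ?p = "length xs"
  let ?Y = "if ?p = n + 1 then \<one>\<^bsub>Reg (n + 1)\<^esub> else DY ?p (n - ?p) (F ?p)"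
  let ?X = "if ?p = 0 then \<one>\<^bsub>Reg (n + 1)\<^esub> else DX (?p - 1) n (F (?p - 1))"
  have p: "?p \<le> n + 1" and l': "length (xs @ bs) = n + 1" using l by simp_all
  have "EvT k (dTot n F) xs bs = Ev k (?Y \<otimes>\<^bsub>Reg (n + 1)\<^esub> ?X) (xs @ bs)"
    using p by (simp add: EvT_def dTot_def)
  also have "\<dots> = Ev k ?Y (xs @ bs) + Ev k ?X (xs @ bs)"
    by (rule Ev_mult[OF dTot_components[OF F p] l'])
  also have "Ev k ?Y (xs @ bs) = (if bs = [] then 0 else sg ?p (B.dy (EvT k F) xs bs))"
  proof (cases "bs = []")
    case True
    then show ?thesis using l by (simp add: Ev_one)
  next
    case False
    then have np: "?p \<le> n" using l by (cases bs) auto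
    have Fp: "F ?p \<in> carrier (Reg (?p + (n - ?p)))" using Tot_component[OF F np] np by simp
    have "Ev k ?Y (xs @ bs) = sg ?p (B.dy (\<lambda>xs bs. Ev k (F ?p) (xs @ bs)) xs bs)"
      using Ev_DY[OF Fp refl, of bs k] np l by simp
    also have "B.dy (\<lambda>xs bs. Ev k (F ?p) (xs @ bs)) xs bs = B.dy (EvT k F) xs bs"
      by (rule B.dy_cong) (simp_all add: EvT_def False)
    finally show ?thesis using False by simp
  qed
  also have "Ev k ?X (xs @ bs) = (if xs = [] then 0 else B.dx (EvT k F) xs bs)"
  proof (cases "xs = []")
    case True
    then show ?thesis using l by (simp add: Ev_one)
  next
    case False
    then have p1: "?p = Suc (?p - 1)" by (cases xs) auto
    then have p2: "?p - 1 \<le> n" and n: "n = ?p - 1 + length bs" using l by linarith+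
    have "Ev k ?X (xs @ bs) = B.dx (\<lambda>xs bs. Ev k (F (?p - 1)) (xs @ bs)) xs bs"
      using Ev_DX[OF Tot_component[OF F p2] n p1, of k] False by simp
    also have "\<dots> = B.dx (EvT k F) xs bs"
    proof (rule B.dx_cong)
      fix ks :: "(('a, 'k) tens \<Rightarrow> 'a) group_family list" assume "Suc (length ks) = ?p"
      then have "?p - 1 = length ks" by simp
      then show "Ev k (F (?p - 1)) (ks @ bs) = EvT k F ks bs" by (simp only: EvT_def)
    qed (rule False)
    finally show ?thesis using False by simp
  qed
  finally show ?thesis by (simp add: B.dtot_def add.commute)
qed

text \<open>\<open>\<Lambda>\<close> exchanges the blocks, so the summand \<open>q\<close> of
  \<open>\<rho>\<close> belongs to \<open>n + 1 - q\<close> letters in the first block. At both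
  ends, where one differential is absent, the units correspond.\<close>

lemma \<rho>_dTot:
  assumes F: "F \<in> carrier (Tot_Reg2 n)"
  shows "Tot_\<Lambda> (n + 1) (dTot n F) = \<rho> n (Tot_\<Lambda> n F)"
  unfolding Tot_\<Lambda>_def[of "n + 1"] \<rho>_def
proof (rule restrict_ext)
  fix q assume "q \<in> {..n + 1}"
  then have q: "q \<le> n + 1" by simp
  let ?p = "n + 1 - q"
  let ?Y = "if ?p = n + 1 then \<one>\<^bsub>Reg (n + 1)\<^esub> else DY ?p (n - ?p) (F ?p)"
  let ?X = "if ?p = 0 then \<one>\<^bsub>Reg (n + 1)\<^esub> else DX (?p - 1) n (F (?p - 1))"
  have n1: "?p + q = n + 1" using q by simp
  have hom: "\<Lambda> ?p q \<in> hom (Reg (n + 1)) (C q ?p)" using \<Lambda>_hom[of ?p q] unfolding n1 .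
  have one: "\<Lambda> ?p q \<one>\<^bsub>Reg (n + 1)\<^esub> = \<one>\<^bsub>C q ?p\<^esub>" by (rule hom_one[OF hom group_Reg group_C])
  have Y: "\<Lambda> ?p q ?Y = (if q = 0 then \<one>\<^bsub>C q ?p\<^esub> else \<D> (q - 1) ?p (Tot_\<Lambda> n F (q - 1)))"
  proof (cases q)
    case 0
    then show ?thesis using one by simp
  next
    case (Suc r)
    then have r: "r \<le> n" "?p = n - r" "n - ?p = r" "?p + r = n" "?p \<noteq> n + 1" using q by auto
    have "F ?p \<in> carrier (Reg (?p + r))" unfolding r(4) by (rule Tot_component[OF F]) (use r in simp)
    from \<D>_\<Lambda>[OF this] show ?thesis using r Suc by (simp add: Tot_\<Lambda>_def)
  qed
  have X: "\<Lambda> ?p q ?X = (if q = n + 1 then \<one>\<^bsub>C q ?p\<^esub> else \<d> q (n - q) (Tot_\<Lambda> n F q))"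
  proof (cases "q = n + 1")
    case True
    then show ?thesis using one by simp
  next
    case False
    then have r: "q \<le> n" "?p = n - q + 1" "?p - 1 = n - q" "n - q + q = n" "?p \<noteq> 0" using q by auto
    have "F (n - q) \<in> carrier (Reg (n - q + q))" unfolding r(4) by (rule Tot_component[OF F]) simp
    note d = \<d>_\<Lambda>[OF this]
    have t: "Tot_\<Lambda> n F q = \<Lambda> (n - q) q (F (n - q))" using r(1) by (simp add: Tot_\<Lambda>_def)
    show ?thesis unfolding t d r(4) using r(3,5) False r(2)[symmetric] by simp
  qed
  have "\<Lambda> ?p q (dTot n F ?p) = \<Lambda> ?p q (?Y \<otimes>\<^bsub>Reg (n + 1)\<^esub> ?X)"
    by (simp add: dTot_def)
  also have "\<dots> = \<Lambda> ?p q ?Y \<otimes>\<^bsub>C q ?p\<^esub> \<Lambda> ?p q ?X"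
    by (rule hom_mult[OF hom]) (rule dTot_components[OF F], simp)+
  finally show "\<Lambda> ?p q (dTot n F ?p) =
    (if q = 0 then \<one>\<^bsub>C q ?p\<^esub> else \<D> (q - 1) ?p (Tot_\<Lambda> n F (q - 1)))
      \<otimes>\<^bsub>C q ?p\<^esub> (if q = n + 1 then \<one>\<^bsub>C q ?p\<^esub> else \<d> q (n - q) (Tot_\<Lambda> n F q))"
    unfolding Y X .
qed

lemma inj_Tot_\<Lambda>: "inj_on (Tot_\<Lambda> n) (carrier (Tot_Reg2 n))"
proof (rule inj_onI)
  fix F G assume F: "F \<in> carrier (Tot_Reg2 n)" and G: "G \<in> carrier (Tot_Reg2 n)" and eq: "Tot_\<Lambda> n F = Tot_\<Lambda> n G"
  show "F = G"
  proof (rule PiE_ext[OF F[unfolded Tot_carrier] G[unfolded Tot_carrier]])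
    fix p assume p: "p \<in> {..n}"
    then have "\<Lambda> p (n - p) (F p) = \<Lambda> p (n - p) (G p)"
      using fun_cong[OF eq, of "n - p"] by (simp add: Tot_\<Lambda>_def)
    moreover have "F p \<in> carrier (Reg (p + (n - p)))" "G p \<in> carrier (Reg (p + (n - p)))"
      using p Tot_component[OF F, of p] Tot_component[OF G, of p] by simp_all
    ultimately show "F p = G p" using inj_onD[OF inj_\<Lambda>] by blast
  qed
qed

text \<open>\<open>inv_into\<close> returns \<open>dTot n F\<close> because this lies in the carrier
  and \<open>Tot_\<Lambda>\<close> is injective there.\<close>

lemma \<rho>_Reg2: "F \<in> carrier (Tot_Reg2 n) \<Longrightarrow> \<rho>_Reg2 n F = dTot n F"
  unfolding \<rho>_Reg2_def \<rho>_dTot[symmetric] by (rule inv_into_f_f[OF inj_Tot_\<Lambda> dTot_in])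

lemma Ev_\<delta>:
  assumes f: "f \<in> carrier (Reg n)" and xs: "length xs = n + 1"
  shows "Ev k (\<delta> n f) xs = bimodule_action.hoch (La k) (Ra k) (Ev k f) xs"
proof -
  interpret B: bimodule_action "La k" "Ra k" by (rule bimodule_action_Reg)
  show ?thesis using Ev_DX[OF f, of n "[]" xs k] xs by (simp add: \<delta>_DX[OF f] B.hoch_dx)
qed

lemma \<delta>_in: "f \<in> carrier (Reg n) \<Longrightarrow> \<delta> n f \<in> carrier (Reg (n + 1))"
  using DX_in[of f n n] by (simp add: \<delta>_DX)

text \<open>Each law is read off from group elements on the tensor power of the target degree: n + 1
  for the homomorphism property, n + 2 for the square.\<close>

lemma cochain_complex_Reg: "cochain_complex Reg \<delta>"
  unfolding cochain_complex_def
proof (intro allI conjI ballI)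
  fix n
  interpret B: bimodule_action "La (n + 1)" "Ra (n + 1)" by (rule bimodule_action_Reg)
  show "comm_group (Reg n)" by (rule comm_group_Reg)
  show "\<delta> n \<in> hom (Reg n) (Reg (n + 1))"
  proof (rule homI)
    fix f g assume f: "f \<in> carrier (Reg n)" and g: "g \<in> carrier (Reg n)"
    show "\<delta> n (f \<otimes>\<^bsub>Reg n\<^esub> g) = \<delta> n f \<otimes>\<^bsub>Reg (n + 1)\<^esub> \<delta> n g"
    proof (rule Ev_eqI[OF \<delta>_in[OF Reg_mult_in[OF f g]] Reg_mult_in[OF \<delta>_in[OF f] \<delta>_in[OF g]]])
      fix \<gamma>s :: "(('a, 'k) tens \<Rightarrow> 'a) group_family list" assume \<gamma>: "length \<gamma>s = n + 1"
      have "B.hoch (Ev (n + 1) (f \<otimes>\<^bsub>Reg n\<^esub> g)) \<gamma>s = B.hoch (\<lambda>l. Ev (n + 1) f l + Ev (n + 1) g l) \<gamma>s"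
        using \<gamma> by (intro B.hoch_cong Ev_mult f g) auto
      then show "Ev (n + 1) (\<delta> n (f \<otimes>\<^bsub>Reg n\<^esub> g)) \<gamma>s = Ev (n + 1) (\<delta> n f \<otimes>\<^bsub>Reg (n + 1)\<^esub> \<delta> n g) \<gamma>s"
        by (simp only: Ev_\<delta>[OF Reg_mult_in[OF f g] \<gamma>] Ev_mult[OF \<delta>_in[OF f] \<delta>_in[OF g] \<gamma>] Ev_\<delta>[OF f \<gamma>] Ev_\<delta>[OF g \<gamma>] B.hoch_add)
    qed
  qed (rule \<delta>_in)
next
  fix n f assume f: "f \<in> carrier (Reg n)"
  have f2: "\<delta> (n + 1) (\<delta> n f) \<in> carrier (Reg (n + 2))" using \<delta>_in[OF \<delta>_in[OF f]] by simp
  interpret B: bimodule_action "La (n + 2)" "Ra (n + 2)" by (rule bimodule_action_Reg)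
  show "\<delta> (n + 1) (\<delta> n f) = \<one>\<^bsub>Reg (n + 2)\<^esub>"
  proof (rule Ev_eqI[OF f2 Reg_one_in])
    fix \<gamma>s :: "(('a, 'k) tens \<Rightarrow> 'a) group_family list" assume \<gamma>: "length \<gamma>s = n + 2"
    then obtain x y l where l: "\<gamma>s = x # y # l" by (cases \<gamma>s; cases "tl \<gamma>s") auto
    have "Ev (n + 2) (\<delta> (n + 1) (\<delta> n f)) \<gamma>s = B.hoch (Ev (n + 2) (\<delta> n f)) \<gamma>s"
      by (rule Ev_\<delta>[OF \<delta>_in[OF f]]) (simp add: \<gamma>)
    also have "\<dots> = B.hoch (B.hoch (Ev (n + 2) f)) \<gamma>s"
      using \<gamma> by (intro B.hoch_cong Ev_\<delta> f) auto
    also have "\<dots> = 0" unfolding l by (rule B.hoch_hoch)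
    finally show "Ev (n + 2) (\<delta> (n + 1) (\<delta> n f)) \<gamma>s = Ev (n + 2) \<one>\<^bsub>Reg (n + 2)\<^esub> \<gamma>s"
      by (simp add: Ev_one \<gamma>)
  qed
qed

lemma Tot_mult_in: "F \<in> carrier (Tot_Reg2 n) \<Longrightarrow> G \<in> carrier (Tot_Reg2 n) \<Longrightarrow> F \<otimes>\<^bsub>Tot_Reg2 n\<^esub> G \<in> carrier (Tot_Reg2 n)"
  and Tot_one_in: "\<one>\<^bsub>Tot_Reg2 n\<^esub> \<in> carrier (Tot_Reg2 n)"
  using comm_group_Tot[of n] by (auto simp: comm_group_def group_def intro: monoid.m_closed monoid.one_closed)

lemma cochain_complex_Tot: "cochain_complex Tot_Reg2 \<rho>_Reg2"
  unfolding cochain_complex_def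
proof (intro allI conjI ballI)
  fix n
  interpret B: bimodule_action "La (n + 1)" "Ra (n + 1)" by (rule bimodule_action_Reg)
  show "comm_group (Tot_Reg2 n)" by (rule comm_group_Tot)
  show "\<rho>_Reg2 n \<in> hom (Tot_Reg2 n) (Tot_Reg2 (n + 1))"
  proof (rule homI)
    fix F G assume F: "F \<in> carrier (Tot_Reg2 n)" and G: "G \<in> carrier (Tot_Reg2 n)"
    show "\<rho>_Reg2 n (F \<otimes>\<^bsub>Tot_Reg2 n\<^esub> G) = \<rho>_Reg2 n F \<otimes>\<^bsub>Tot_Reg2 (n + 1)\<^esub> \<rho>_Reg2 n G"
      unfolding \<rho>_Reg2[OF F] \<rho>_Reg2[OF G] \<rho>_Reg2[OF Tot_mult_in[OF F G]]
    proof (rule EvT_eqI[OF dTot_in[OF Tot_mult_in[OF F G]] Tot_mult_in[OF dTot_in[OF F] dTot_in[OF G]]])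
      fix xs bs :: "(('a, 'k) tens \<Rightarrow> 'a) group_family list" assume l: "length xs + length bs = n + 1"
      have "B.dtot (EvT (n + 1) (F \<otimes>\<^bsub>Tot_Reg2 n\<^esub> G)) xs bs = B.dtot (\<lambda>xs bs. EvT (n + 1) F xs bs + EvT (n + 1) G xs bs) xs bs"
        using l by (intro B.dtot_cong EvT_mult F G) auto
      then show "EvT (n + 1) (dTot n (F \<otimes>\<^bsub>Tot_Reg2 n\<^esub> G)) xs bs = EvT (n + 1) (dTot n F \<otimes>\<^bsub>Tot_Reg2 (n + 1)\<^esub> dTot n G) xs bs"
        by (simp only: EvT_dTot[OF Tot_mult_in[OF F G] l] EvT_mult[OF dTot_in[OF F] dTot_in[OF G] l] EvT_dTot[OF F l] EvT_dTot[OF G l] B.dtot_add)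
    qed
  qed (simp only: \<rho>_Reg2 dTot_in)
next
  fix n F assume F: "F \<in> carrier (Tot_Reg2 n)"
  have F2: "dTot (n + 1) (dTot n F) \<in> carrier (Tot_Reg2 (n + 2))" using dTot_in[OF dTot_in[OF F]] by simp
  interpret B: bimodule_action "La (n + 2)" "Ra (n + 2)" by (rule bimodule_action_Reg)
  have "dTot (n + 1) (dTot n F) = \<one>\<^bsub>Tot_Reg2 (n + 2)\<^esub>"
  proof (rule EvT_eqI[OF F2 Tot_one_in])
    fix xs bs :: "(('a, 'k) tens \<Rightarrow> 'a) group_family list" assume l: "length xs + length bs = n + 2"
    have "EvT (n + 2) (dTot (n + 1) (dTot n F)) xs bs = B.dtot (EvT (n + 2) (dTot n F)) xs bs"
      by (rule EvT_dTot[OF dTot_in[OF F]]) (simp add: l)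
    also have "\<dots> = B.dtot (B.dtot (EvT (n + 2) F)) xs bs"
      using l by (intro B.dtot_cong EvT_dTot F) auto
    also have "\<dots> = 0" using l by (intro B.dtot_dtot) simp
    finally show "EvT (n + 2) (dTot (n + 1) (dTot n F)) xs bs = EvT (n + 2) \<one>\<^bsub>Tot_Reg2 (n + 2)\<^esub> xs bs"
      by (simp add: EvT_one l)
  qed
  then show "\<rho>_Reg2 (n + 1) (\<rho>_Reg2 n F) = \<one>\<^bsub>Tot_Reg2 (n + 2)\<^esub>"
    by (simp only: \<rho>_Reg2[OF F] \<rho>_Reg2[OF dTot_in[OF F]])
qed

lemma \<phi>\<^sub>\<sigma>_in: "f \<in> carrier (Reg n) \<Longrightarrow> \<phi>\<^sub>\<sigma> n f \<in> carrier (Tot_Reg2 n)"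
  unfolding Tot_carrier
proof (rule PiE_I)
  fix p assume f: "f \<in> carrier (Reg n)" and "p \<in> {..n}"
  then have p: "n = p + (n - p)" by simp
  show "\<phi>\<^sub>\<sigma> n f p \<in> carrier (Reg n)" using \<phi>\<^sub>\<sigma>(1)[of f p "n - p"] f p by simp
qed (simp add: \<phi>\<^sub>\<sigma>_def)

lemma EvT_\<phi>\<^sub>\<sigma>: "f \<in> carrier (Reg n) \<Longrightarrow> length as + length bs = n \<Longrightarrow> EvT k (\<phi>\<^sub>\<sigma> n f) as bs = Sh (Ev k f) as bs"
  using \<phi>\<^sub>\<sigma>(2)[of f "length as" "length bs" as bs k] by (auto simp: EvT_def)

text \<open>On two blocks of group elements the compatibility is \<open>Sh_hoch\<close>. The
  congruence rules restrict attention to lists of the right length, where the evaluation formulas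
  hold.\<close>

theorem morphism_\<phi>\<^sub>\<sigma>: "morphism_of_complexes Reg \<delta> Tot_Reg2 \<rho>_Reg2 \<phi>\<^sub>\<sigma>"
  unfolding morphism_of_complexes_def
proof (intro conjI allI ballI cochain_complex_Reg cochain_complex_Tot)
  fix n
  show "\<phi>\<^sub>\<sigma> n \<in> hom (Reg n) (Tot_Reg2 n)"
  proof (rule homI)
    fix f g assume f: "f \<in> carrier (Reg n)" and g: "g \<in> carrier (Reg n)"
    show "\<phi>\<^sub>\<sigma> n (f \<otimes>\<^bsub>Reg n\<^esub> g) = \<phi>\<^sub>\<sigma> n f \<otimes>\<^bsub>Tot_Reg2 n\<^esub> \<phi>\<^sub>\<sigma> n g"
    proof (rule EvT_eqI[OF \<phi>\<^sub>\<sigma>_in[OF Reg_mult_in[OF f g]] Tot_mult_in[OF \<phi>\<^sub>\<sigma>_in[OF f] \<phi>\<^sub>\<sigma>_in[OF g]]])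
      fix as bs :: "(('a, 'k) tens \<Rightarrow> 'a) group_family list" assume l: "length as + length bs = n"
      have "Sh (Ev n (f \<otimes>\<^bsub>Reg n\<^esub> g)) as bs = Sh (\<lambda>l. Ev n f l + Ev n g l) as bs"
        using l by (intro Sh_cong Ev_mult f g) simp
      then show "EvT n (\<phi>\<^sub>\<sigma> n (f \<otimes>\<^bsub>Reg n\<^esub> g)) as bs = EvT n (\<phi>\<^sub>\<sigma> n f \<otimes>\<^bsub>Tot_Reg2 n\<^esub> \<phi>\<^sub>\<sigma> n g) as bs"
        by (simp only: EvT_\<phi>\<^sub>\<sigma>[OF Reg_mult_in[OF f g] l] EvT_mult[OF \<phi>\<^sub>\<sigma>_in[OF f] \<phi>\<^sub>\<sigma>_in[OF g] l] EvT_\<phi>\<^sub>\<sigma>[OF f l] EvT_\<phi>\<^sub>\<sigma>[OF g l] Sh_add)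
    qed
  qed (rule \<phi>\<^sub>\<sigma>_in)
  fix f assume f: "f \<in> carrier (Reg n)"
  interpret B: bimodule_action "La (n + 1)" "Ra (n + 1)" by (rule bimodule_action_Reg)
  show "\<phi>\<^sub>\<sigma> (n + 1) (\<delta> n f) = \<rho>_Reg2 n (\<phi>\<^sub>\<sigma> n f)"
    unfolding \<rho>_Reg2[OF \<phi>\<^sub>\<sigma>_in[OF f]]
  proof (rule EvT_eqI[OF \<phi>\<^sub>\<sigma>_in[OF \<delta>_in[OF f]] dTot_in[OF \<phi>\<^sub>\<sigma>_in[OF f]]])
    fix as bs :: "(('a, 'k) tens \<Rightarrow> 'a) group_family list" assume l: "length as + length bs = n + 1"
    have "EvT (n + 1) (\<phi>\<^sub>\<sigma> (n + 1) (\<delta> n f)) as bs = Sh (Ev (n + 1) (\<delta> n f)) as bs"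
      by (rule EvT_\<phi>\<^sub>\<sigma>[OF \<delta>_in[OF f] l])
    also have "\<dots> = Sh (B.hoch (Ev (n + 1) f)) as bs"
      using l by (intro Sh_cong Ev_\<delta> f) simp
    also have "\<dots> = B.dtot (Sh (Ev (n + 1) f)) as bs"
      using l by (intro B.Sh_hoch) auto
    also have "\<dots> = B.dtot (EvT (n + 1) (\<phi>\<^sub>\<sigma> n f)) as bs"
      using l by (intro B.dtot_cong EvT_\<phi>\<^sub>\<sigma>[symmetric] f) auto
    also have "\<dots> = EvT (n + 1) (dTot n (\<phi>\<^sub>\<sigma> n f)) as bs"
      by (rule EvT_dTot[OF \<phi>\<^sub>\<sigma>_in[OF f] l, symmetric])
    finally show "EvT (n + 1) (\<phi>\<^sub>\<sigma> (n + 1) (\<delta> n f)) as bs = EvT (n + 1) (dTot n (\<phi>\<^sub>\<sigma> n f)) as bs" .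
  qed
qed

end

theorem theorem3p2:
  fixes scaleA :: "'k::field \<Rightarrow> 'a::{ring,monoid_mult} \<Rightarrow> 'a"
    and comult :: "'a \<Rightarrow> ('a, 'k) tens" and counit :: "'a \<Rightarrow> 'k" and antipode :: "'a \<Rightarrow> 'a"
    and scaleM :: "'k \<Rightarrow> 'm::{comm_ring,comm_monoid_mult} \<Rightarrow> 'm"
    and lact :: "'a \<Rightarrow> 'm \<Rightarrow> 'm" and ract :: "'m \<Rightarrow> 'a \<Rightarrow> 'm"
  assumes "commutative_bimodule_algebra scaleA comult counit antipode scaleM lact ract"
  shows "morphism_of_complexes
    (commutative_bimodule_algebra.Reg scaleA comult counit scaleM)
    (commutative_bimodule_algebra.\<delta> scaleA comult counit scaleM lact ract)
    (commutative_bimodule_algebra.Tot_Reg2 scaleA comult counit scaleM)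
    (commutative_bimodule_algebra.\<rho>_Reg2 scaleA comult counit antipode scaleM lact ract)
    (commutative_bimodule_algebra.\<phi>\<^sub>\<sigma> scaleA comult counit antipode scaleM)"
  by (rule commutative_bimodule_algebra.morphism_\<phi>\<^sub>\<sigma>[OF assms])

end
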